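(* Let $\Lambda$ and $\Lambda'$ be finite-dimensional elementary $k$-algebras of rank $2$ with complete sets of primitive orthogonal idempotents $1=e_1+e_2\in\Lambda$ and $1=e'_1+e'_2\in\Lambda'$ such that $e_2\Lambda e_1=0$, $e'_2\Lambda'e'_1=0$, $\sigma:=\operatorname{cone}\{(0,-1),(1,-1)\}\in\Sigma(\Lambda)$ and $\sigma':=\operatorname{cone}\{(1,-1),(1,0)\}\in\Sigma(\Lambda')$. Then there exists a finite-dimensional elementary $k$-algebra $\Gamma$ of rank $2$ (with a complete set of primitive orthogonal idempotents) such that the set of $2$-dimensional cones of $\Sigma(\Gamma)$ equals $(\Sigma(\Lambda)_2\setminus\{\sigma\})\cup(\Sigma(\Lambda')_2\setminus\{\sigma'\})$, where $\Sigma_2$ denotes the set of $2$-dimensional cones of a fan $\Sigma$.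
   Context: $k$ is a field; elementary means $\Lambda/J_\Lambda$ is a product of copies of $k$. The $g$-fan $\Sigma(\Lambda)$ consists of the cones $\operatorname{cone}\{[T_1],\dots,[T_m]\}$ for basic 2-term presilting complexes $T=\bigoplus T_i$ (indecomposable $T_i$) in $K^b(\operatorname{proj}\Lambda)$ (2-term: concentrated in degrees $-1,0$; presilting: $\operatorname{Hom}(T,T[\ell])=0$ for all $\ell>0$; $[T]=[T^0]-[T^{-1}]$), viewed in $\mathbb{R}^2$ via $[e_1\Lambda]\mapsto(1,0)$, $[e_2\Lambda]\mapsto(0,1)$; similarly for $\Lambda'$ and $\Gamma$. *)

theory Defs
  imports "HOL-Analysis.Analysis" "HOL-Algebra.Ring" "HOL-Algebra.AbelCoset"
begin

definition is_fd_kalg :: "'a ring \<Rightarrow> ('k::field \<Rightarrow> 'a \<Rightarrow> 'a) \<Rightarrow> bool" where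
  "is_fd_kalg R sm \<longleftrightarrow> ring R
     \<and> (\<forall>c x. x \<in> carrier R \<longrightarrow> sm c x \<in> carrier R)
     \<and> (\<forall>c x y. x \<in> carrier R \<longrightarrow> y \<in> carrier R \<longrightarrow> sm c (x \<oplus>\<^bsub>R\<^esub> y) = sm c x \<oplus>\<^bsub>R\<^esub> sm c y)
     \<and> (\<forall>c d x. x \<in> carrier R \<longrightarrow> sm (c + d) x = sm c x \<oplus>\<^bsub>R\<^esub> sm d x)
     \<and> (\<forall>c d x. x \<in> carrier R \<longrightarrow> sm (c * d) x = sm c (sm d x))
     \<and> (\<forall>x. x \<in> carrier R \<longrightarrow> sm 1 x = x)
     \<and> (\<forall>c x y. x \<in> carrier R \<longrightarrow> y \<in> carrier R \<longrightarrow>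
           sm c (x \<otimes>\<^bsub>R\<^esub> y) = sm c x \<otimes>\<^bsub>R\<^esub> y \<and> sm c (x \<otimes>\<^bsub>R\<^esub> y) = x \<otimes>\<^bsub>R\<^esub> sm c y)
     \<and> (\<exists>B. finite B \<and> B \<subseteq> carrier R \<and>
           (\<forall>x\<in>carrier R. \<exists>c. x = finsum R (\<lambda>b. sm (c b) b) B))"

definition right_ideal :: "'a ring \<Rightarrow> 'a set \<Rightarrow> bool" where
  "right_ideal R I \<longleftrightarrow> additive_subgroup I R \<and>
     (\<forall>x\<in>I. \<forall>a\<in>carrier R. x \<otimes>\<^bsub>R\<^esub> a \<in> I)"

definition maximal_right_ideal :: "'a ring \<Rightarrow> 'a set \<Rightarrow> bool" where
  "maximal_right_ideal R I \<longleftrightarrow> right_ideal R I \<and> I \<noteq> carrier R \<and>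
     (\<forall>I'. right_ideal R I' \<and> I \<subseteq> I' \<and> I' \<noteq> carrier R \<longrightarrow> I' = I)"

definition jacobson_radical :: "'a ring \<Rightarrow> 'a set" where
  "jacobson_radical R = {x \<in> carrier R. \<forall>I. maximal_right_ideal R I \<longrightarrow> x \<in> I}"

text \<open>Elementary of rank 2: Lambda/J is isomorphic, as a k-algebra, to k x k.
  Equivalently there is a surjective k-algebra homomorphism Lambda -> k x k with kernel J.\<close>

definition elementary_rank2 :: "'a ring \<Rightarrow> ('k::field \<Rightarrow> 'a \<Rightarrow> 'a) \<Rightarrow> bool" where
  "elementary_rank2 R sm \<longleftrightarrow> (\<exists>\<phi> :: 'a \<Rightarrow> 'k \<times> 'k.
      \<phi> ` carrier R = UNIV
    \<and> (\<forall>x\<in>carrier R. \<forall>y\<in>carrier R. \<phi> (x \<oplus>\<^bsub>R\<^esub> y) = (fst (\<phi> x) + fst (\<phi> y), snd (\<phi> x) + snd (\<phi> y)))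
    \<and> (\<forall>x\<in>carrier R. \<forall>y\<in>carrier R. \<phi> (x \<otimes>\<^bsub>R\<^esub> y) = (fst (\<phi> x) * fst (\<phi> y), snd (\<phi> x) * snd (\<phi> y)))
    \<and> \<phi> \<one>\<^bsub>R\<^esub> = (1, 1)
    \<and> (\<forall>c. \<forall>x\<in>carrier R. \<phi> (sm c x) = (c * fst (\<phi> x), c * snd (\<phi> x)))
    \<and> {x \<in> carrier R. \<phi> x = (0, 0)} = jacobson_radical R)"

definition idempotent_el :: "'a ring \<Rightarrow> 'a \<Rightarrow> bool" where
  "idempotent_el R e \<longleftrightarrow> e \<in> carrier R \<and> e \<otimes>\<^bsub>R\<^esub> e = e"

definition primitive_idem :: "'a ring \<Rightarrow> 'a \<Rightarrow> bool" where
  "primitive_idem R e \<longleftrightarrow> idempotent_el R e \<and> e \<noteq> \<zero>\<^bsub>R\<^esub> \<and>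
     (\<forall>f g. idempotent_el R f \<and> idempotent_el R g \<and> f \<otimes>\<^bsub>R\<^esub> g = \<zero>\<^bsub>R\<^esub> \<and> g \<otimes>\<^bsub>R\<^esub> f = \<zero>\<^bsub>R\<^esub>
        \<and> f \<oplus>\<^bsub>R\<^esub> g = e \<longrightarrow> f = \<zero>\<^bsub>R\<^esub> \<or> g = \<zero>\<^bsub>R\<^esub>)"

definition complete_prim_orth2 :: "'a ring \<Rightarrow> 'a \<Rightarrow> 'a \<Rightarrow> bool" where
  "complete_prim_orth2 R e1 e2 \<longleftrightarrow> primitive_idem R e1 \<and> primitive_idem R e2
     \<and> e1 \<otimes>\<^bsub>R\<^esub> e2 = \<zero>\<^bsub>R\<^esub> \<and> e2 \<otimes>\<^bsub>R\<^esub> e1 = \<zero>\<^bsub>R\<^esub> \<and> e1 \<oplus>\<^bsub>R\<^esub> e2 = \<one>\<^bsub>R\<^esub>"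

text \<open>An object of add(e1 Lambda + e2 Lambda) is a list of labels in {1,2}; label i stands for
  the summand e_i Lambda. A morphism from (labels ls) to (labels ms) is a matrix M with
  M j i in e_(ms!j) Lambda e_(ls!i) (= Hom(e_(ls!i) Lambda, e_(ms!j) Lambda) via left multiplication),
  and zero outside the index range. Composition is matrix multiplication.\<close>

definition idm :: "'a \<Rightarrow> 'a \<Rightarrow> nat \<Rightarrow> 'a" where
  "idm e1 e2 i = (if i = 1 then e1 else e2)"

definition is_mor :: "'a ring \<Rightarrow> 'a \<Rightarrow> 'a \<Rightarrow> nat list \<Rightarrow> nat list \<Rightarrow> (nat \<Rightarrow> nat \<Rightarrow> 'a) \<Rightarrow> bool" where
  "is_mor R e1 e2 ls ms M \<longleftrightarrow> (\<forall>j i. if j < length ms \<and> i < length ls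
      then M j i \<in> carrier R \<and> idm e1 e2 (ms ! j) \<otimes>\<^bsub>R\<^esub> M j i \<otimes>\<^bsub>R\<^esub> idm e1 e2 (ls ! i) = M j i
      else M j i = \<zero>\<^bsub>R\<^esub>)"

definition mcomp :: "'a ring \<Rightarrow> nat \<Rightarrow> (nat \<Rightarrow> nat \<Rightarrow> 'a) \<Rightarrow> (nat \<Rightarrow> nat \<Rightarrow> 'a) \<Rightarrow> (nat \<Rightarrow> nat \<Rightarrow> 'a)" where
  "mcomp R n N M = (\<lambda>k i. finsum R (\<lambda>j. N k j \<otimes>\<^bsub>R\<^esub> M j i) {..<n})"

definition madd :: "'a ring \<Rightarrow> (nat \<Rightarrow> nat \<Rightarrow> 'a) \<Rightarrow> (nat \<Rightarrow> nat \<Rightarrow> 'a) \<Rightarrow> (nat \<Rightarrow> nat \<Rightarrow> 'a)" where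
  "madd R M N = (\<lambda>j i. M j i \<oplus>\<^bsub>R\<^esub> N j i)"

definition msub :: "'a ring \<Rightarrow> (nat \<Rightarrow> nat \<Rightarrow> 'a) \<Rightarrow> (nat \<Rightarrow> nat \<Rightarrow> 'a) \<Rightarrow> (nat \<Rightarrow> nat \<Rightarrow> 'a)" where
  "msub R M N = (\<lambda>j i. M j i \<ominus>\<^bsub>R\<^esub> N j i)"

definition mid :: "'a ring \<Rightarrow> 'a \<Rightarrow> 'a \<Rightarrow> nat list \<Rightarrow> (nat \<Rightarrow> nat \<Rightarrow> 'a)" where
  "mid R e1 e2 ls = (\<lambda>j i. if j < length ls \<and> i = j then idm e1 e2 (ls ! j) else \<zero>\<^bsub>R\<^esub>)"

text \<open>A 2-term complex T = (T^{-1} labels, T^0 labels, differential T^{-1} -> T^0).\<close>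

type_synonym 'a cpx = "nat list \<times> nat list \<times> (nat \<Rightarrow> nat \<Rightarrow> 'a)"

definition tm1 :: "'a cpx \<Rightarrow> nat list" where "tm1 T = fst T"
definition t0 :: "'a cpx \<Rightarrow> nat list" where "t0 T = fst (snd T)"
definition dd :: "'a cpx \<Rightarrow> (nat \<Rightarrow> nat \<Rightarrow> 'a)" where "dd T = snd (snd T)"

definition is_cpx :: "'a ring \<Rightarrow> 'a \<Rightarrow> 'a \<Rightarrow> 'a cpx \<Rightarrow> bool" where
  "is_cpx R e1 e2 T \<longleftrightarrow> set (tm1 T) \<subseteq> {1, 2} \<and> set (t0 T) \<subseteq> {1, 2}
     \<and> is_mor R e1 e2 (tm1 T) (t0 T) (dd T)"

definition chain_map :: "'a ring \<Rightarrow> 'a \<Rightarrow> 'a \<Rightarrow> 'a cpx \<Rightarrow> 'a cpx \<Rightarrow>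
    (nat \<Rightarrow> nat \<Rightarrow> 'a) \<Rightarrow> (nat \<Rightarrow> nat \<Rightarrow> 'a) \<Rightarrow> bool" where
  "chain_map R e1 e2 T U f1 f0 \<longleftrightarrow> is_mor R e1 e2 (tm1 T) (tm1 U) f1 \<and> is_mor R e1 e2 (t0 T) (t0 U) f0
     \<and> mcomp R (length (tm1 U)) (dd U) f1 = mcomp R (length (t0 T)) f0 (dd T)"

text \<open>Null-homotopic chain maps between 2-term complexes: the only homotopy component is h : T^0 -> U^{-1}.\<close>

definition nullhtp :: "'a ring \<Rightarrow> 'a \<Rightarrow> 'a \<Rightarrow> 'a cpx \<Rightarrow> 'a cpx \<Rightarrow>
    (nat \<Rightarrow> nat \<Rightarrow> 'a) \<Rightarrow> (nat \<Rightarrow> nat \<Rightarrow> 'a) \<Rightarrow> bool" where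
  "nullhtp R e1 e2 T U f1 f0 \<longleftrightarrow> (\<exists>h. is_mor R e1 e2 (t0 T) (tm1 U) h
     \<and> f1 = mcomp R (length (t0 T)) h (dd T) \<and> f0 = mcomp R (length (tm1 U)) (dd U) h)"

definition cpx_iso :: "'a ring \<Rightarrow> 'a \<Rightarrow> 'a \<Rightarrow> 'a cpx \<Rightarrow> 'a cpx \<Rightarrow> bool" where
  "cpx_iso R e1 e2 T U \<longleftrightarrow> (\<exists>f1 f0 g1 g0.
      chain_map R e1 e2 T U f1 f0 \<and> chain_map R e1 e2 U T g1 g0
    \<and> nullhtp R e1 e2 T T (msub R (mcomp R (length (tm1 U)) g1 f1) (mid R e1 e2 (tm1 T)))
                          (msub R (mcomp R (length (t0 U)) g0 f0) (mid R e1 e2 (t0 T)))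
    \<and> nullhtp R e1 e2 U U (msub R (mcomp R (length (tm1 T)) f1 g1) (mid R e1 e2 (tm1 U)))
                          (msub R (mcomp R (length (t0 T)) f0 g0) (mid R e1 e2 (t0 U))))"

definition zero_cpx :: "'a ring \<Rightarrow> 'a cpx" where
  "zero_cpx R = ([], [], (\<lambda>_ _. \<zero>\<^bsub>R\<^esub>))"

definition dsum :: "'a ring \<Rightarrow> 'a cpx \<Rightarrow> 'a cpx \<Rightarrow> 'a cpx" where
  "dsum R T U = (tm1 T @ tm1 U, t0 T @ t0 U,
     (\<lambda>j i. if j < length (t0 T) then (if i < length (tm1 T) then dd T j i else \<zero>\<^bsub>R\<^esub>)
            else if i < length (tm1 T) then \<zero>\<^bsub>R\<^esub>
            else dd U (j - length (t0 T)) (i - length (tm1 T))))"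

definition dsum_list :: "'a ring \<Rightarrow> 'a cpx list \<Rightarrow> 'a cpx" where
  "dsum_list R Ts = foldr (dsum R) Ts (zero_cpx R)"

definition indec :: "'a ring \<Rightarrow> 'a \<Rightarrow> 'a \<Rightarrow> 'a cpx \<Rightarrow> bool" where
  "indec R e1 e2 T \<longleftrightarrow> is_cpx R e1 e2 T \<and> \<not> cpx_iso R e1 e2 T (zero_cpx R) \<and>
     (\<forall>U V. is_cpx R e1 e2 U \<and> is_cpx R e1 e2 V \<and> cpx_iso R e1 e2 T (dsum R U V)
        \<longrightarrow> cpx_iso R e1 e2 U (zero_cpx R) \<or> cpx_iso R e1 e2 V (zero_cpx R))"

text \<open>Presilting for a 2-term complex: Hom(T,T[1]) = 0 (Hom(T,T[l]) = 0 for l >= 2 is automatic).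
  A morphism T -> T[1] is any g : T^{-1} -> T^0; it is null-homotopic iff g = d a + b d
  for endomorphisms a of T^{-1} and b of T^0.\<close>

definition presilting :: "'a ring \<Rightarrow> 'a \<Rightarrow> 'a \<Rightarrow> 'a cpx \<Rightarrow> bool" where
  "presilting R e1 e2 T \<longleftrightarrow> is_cpx R e1 e2 T \<and>
     (\<forall>g. is_mor R e1 e2 (tm1 T) (t0 T) g \<longrightarrow>
        (\<exists>a b. is_mor R e1 e2 (tm1 T) (tm1 T) a \<and> is_mor R e1 e2 (t0 T) (t0 T) b \<and>
           g = madd R (mcomp R (length (tm1 T)) (dd T) a) (mcomp R (length (t0 T)) b (dd T))))"

definition gvec :: "'a cpx \<Rightarrow> real \<times> real" where
  "gvec T = (real (count_list (t0 T) 1) - real (count_list (tm1 T) 1),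
             real (count_list (t0 T) 2) - real (count_list (tm1 T) 2))"

definition gcone :: "(real \<times> real) set \<Rightarrow> (real \<times> real) set" where
  "gcone S = {(\<Sum>v\<in>S. c v *\<^sub>R v) | c. \<forall>v\<in>S. 0 \<le> c v}"

definition gfan :: "'a ring \<Rightarrow> 'a \<Rightarrow> 'a \<Rightarrow> (real \<times> real) set set" where
  "gfan R e1 e2 = {gcone (set (map gvec Ts)) | Ts.
      (\<forall>T\<in>set Ts. indec R e1 e2 T)
    \<and> (\<forall>i<length Ts. \<forall>j<length Ts. i \<noteq> j \<longrightarrow> \<not> cpx_iso R e1 e2 (Ts ! i) (Ts ! j))
    \<and> presilting R e1 e2 (dsum_list R Ts)}"

definition cones2 :: "(real \<times> real) set set \<Rightarrow> (real \<times> real) set set" where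
  "cones2 F = {C \<in> F. aff_dim C = 2}"

end

theory Submission
  imports Defs "Jordan_Normal_Form.Determinant"
begin

text \<open>
  Let \<open>X = e\<^sub>1 \<Lambda> e\<^sub>2\<close>. That \<open>\<sigma>\<close> is a cone of \<open>\<Sigma>(\<Lambda>)\<close> forces \<open>X = x (e\<^sub>2 \<Lambda> e\<^sub>2)\<close> for some \<open>x \<noteq> 0\<close>, which yields
  an algebra map \<open>\<tau> = (\<phi>\<^sub>1, \<phi>\<^sub>2, \<psi>)\<close> from \<open>\<Lambda>\<close> onto the path algebra of the quiver \<open>A\<^sub>2\<close>; dually for \<open>\<Lambda>'\<close>.
  The glued algebra is the fibre product \<open>\<Gamma>\<close> of \<open>\<Lambda>\<close> and \<open>\<Lambda>'\<close> over this path algebra.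

  In the fourth quadrant a minimal presilting complex is a matrix \<open>d\<close> over \<open>X\<close>, and presilting forces the scalar
  matrix \<open>\<psi>(d)\<close> to have a left or a right inverse. In the first case the complex is isomorphic to one in the image of
  the section \<open>\<Lambda> \<rightarrow> \<Gamma>\<close> (the kernel part of \<open>d\<close> is absorbed by an automorphism of the degree \<open>0\<close> term), so the
  corresponding cones are those of \<open>\<Lambda>\<close>; over \<open>\<Lambda>\<close> itself the second case only produces \<open>\<sigma>\<close>. Passing to
  opposite algebras exchanges the two cases and the roles of \<open>\<Lambda>\<close> and \<open>\<Lambda>'\<close>.

  Computations take place in the ring of finitely supported matrices over a ring: a list of labels becomes a diagonal
  idempotent, and a morphism \<open>f\<close> of projectives is a matrix fixed by the two idempotents.
\<close>

section \<open>Finitely supported matrices\<close>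

text \<open>Why presilting yields a one-sided inverse: each \<open>g = d a + b d\<close> satisfies
  \<open>w \<psi>(g) v = 0\<close> for a kernel vector \<open>v\<close> and a cokernel vector
  \<open>w\<close> of \<open>\<psi>(d)\<close>, whereas \<psi> attains every scalar matrix of that
  size. Why a left inverse suits the projection to \<Lambda>: the part of
  \<open>e\<^sub>1 \<Gamma> e\<^sub>2\<close> that it kills consists of products \<open>n y\<close>,
  and such an \<open>n\<close> times a lifted element of \<open>X\<close> sees only the value of
  \<psi>, so removing the kernel part is linear algebra over the field. Complexes outside the fourth
  quadrant belong to both cases, which is harmless because the two sets of cones are united. Two
  choices shape the setting. All matrix sizes live in one ring without unit, so composition is the
  class multiplication and size conditions are equations with idempotents. The given algebras are
  first replaced by matrix algebras over \<open>k\<close>, since transposition then realises the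
  opposite algebra as another subset of the same type.\<close>

typedef (overloaded) 'a fsm = "{f :: nat \<Rightarrow> nat \<Rightarrow> 'a::zero. \<exists>n. \<forall>i j. n \<le> i \<or> n \<le> j \<longrightarrow> f i j = 0}"
  morphisms ent Fsm
  by (rule exI[of _ "\<lambda>_ _. 0"]) simp

lemma ent_bounded: "\<exists>n. \<forall>i j. n \<le> i \<or> n \<le> j \<longrightarrow> ent A i j = 0"
  using ent[of A] by simp

lemma ent_Fsm: "(\<And>i j. n \<le> i \<or> n \<le> j \<Longrightarrow> f i j = 0) \<Longrightarrow> ent (Fsm f) = f"
  by (rule Fsm_inverse) blast

lemma fsm_eqI: "(\<And>i j. ent A i j = ent B i j) \<Longrightarrow> A = B"
  by (metis ent_inject ext)

instantiation fsm :: (ab_group_add) ab_group_add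
begin
definition "0 = Fsm (\<lambda>_ _. 0)"
definition "A + B = Fsm (\<lambda>i j. ent A i j + ent B i j)"
definition "A - B = Fsm (\<lambda>i j. ent A i j - ent B i j)"
definition "- A = Fsm (\<lambda>i j. - ent A i j)"

lemma ent_zero [simp]: "ent 0 i j = 0"
  unfolding zero_fsm_def by (subst ent_Fsm[of 0]) auto

lemma ent_add [simp]: "ent (A + B) i j = ent A i j + ent B i j"
proof -
  obtain n m where "\<forall>i j. n \<le> i \<or> n \<le> j \<longrightarrow> ent A i j = 0" "\<forall>i j. m \<le> i \<or> m \<le> j \<longrightarrow> ent B i j = 0"
    using ent_bounded by meson
  then show ?thesis unfolding plus_fsm_def by (subst ent_Fsm[of "max n m"]) auto
qed

lemma ent_diff [simp]: "ent (A - B) i j = ent A i j - ent B i j"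
proof -
  obtain n m where "\<forall>i j. n \<le> i \<or> n \<le> j \<longrightarrow> ent A i j = 0" "\<forall>i j. m \<le> i \<or> m \<le> j \<longrightarrow> ent B i j = 0"
    using ent_bounded by meson
  then show ?thesis unfolding minus_fsm_def by (subst ent_Fsm[of "max n m"]) auto
qed

lemma ent_uminus [simp]: "ent (- A) i j = - ent A i j"
proof -
  obtain n where "\<forall>i j. n \<le> i \<or> n \<le> j \<longrightarrow> ent A i j = 0"
    using ent_bounded by meson
  then show ?thesis unfolding uminus_fsm_def by (subst ent_Fsm[of n]) auto
qed

instance
  by standard (auto intro!: fsm_eqI simp: algebra_simps)
end

instantiation fsm :: (ring) ring
begin
definition "A * B = Fsm (\<lambda>i k. \<Sum>j\<in>{j. ent A i j \<noteq> 0}. ent A i j * ent B j k)"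

text \<open>The definition sums over the support of row \<open>i\<close>; any initial segment
  containing the nonzero products gives the same sum. Each use picks the bound that suits it: a
  length, the successor of an index, a common bound.\<close>

lemma ent_times:
  assumes "\<And>j. n \<le> j \<Longrightarrow> ent A i j * ent B j k = 0"
  shows "ent (A * B) i k = (\<Sum>j<n. ent A i j * ent B j k)"
proof -
  obtain n1 n2 where n: "\<forall>i j. n1 \<le> i \<or> n1 \<le> j \<longrightarrow> ent A i j = 0" "\<forall>i j. n2 \<le> i \<or> n2 \<le> j \<longrightarrow> ent B i j = 0"
    using ent_bounded by meson
  have fin: "finite {j. ent A i j \<noteq> 0}" for i
  proof (rule finite_subset)
    show "{j. ent A i j \<noteq> 0} \<subseteq> {..<n1}" using n(1) by (metis (mono_tags, lifting) lessThan_iff linorder_not_le mem_Collect_eq subsetI)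
  qed simp
  have "ent (A * B) i k = (\<Sum>j\<in>{j. ent A i j \<noteq> 0}. ent A i j * ent B j k)"
    unfolding times_fsm_def by (subst ent_Fsm[of "max n1 n2"]) (use n in auto)
  also have "\<dots> = (\<Sum>j\<in>{j. ent A i j \<noteq> 0} \<inter> {..<n}. ent A i j * ent B j k)"
    by (rule sum.mono_neutral_right) (use fin[of i] assms in \<open>auto, meson linorder_not_less\<close>)
  also have "\<dots> = (\<Sum>j<n. ent A i j * ent B j k)"
    by (rule sum.mono_neutral_left) auto
  finally show ?thesis .
qed

lemma common_bound:
  "\<exists>n. (\<forall>i j. n \<le> i \<or> n \<le> j \<longrightarrow> ent A i j = 0) \<and> (\<forall>i j. n \<le> i \<or> n \<le> j \<longrightarrow> ent B i j = 0)
     \<and> (\<forall>i j. n \<le> i \<or> n \<le> j \<longrightarrow> ent C i j = 0)"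
proof -
  obtain n1 where "\<forall>i j. n1 \<le> i \<or> n1 \<le> j \<longrightarrow> ent A i j = 0" using ent_bounded[of A] by blast
  moreover obtain n2 where "\<forall>i j. n2 \<le> i \<or> n2 \<le> j \<longrightarrow> ent B i j = 0" using ent_bounded[of B] by blast
  moreover obtain n3 where "\<forall>i j. n3 \<le> i \<or> n3 \<le> j \<longrightarrow> ent C i j = 0" using ent_bounded[of C] by blast
  ultimately show ?thesis by (intro exI[of _ "max n1 (max n2 n3)"]) auto
qed

instance
proof
  fix A B C :: "'a fsm"
  obtain n where n: "\<forall>i j. n \<le> i \<or> n \<le> j \<longrightarrow> ent A i j = 0" "\<forall>i j. n \<le> i \<or> n \<le> j \<longrightarrow> ent B i j = 0"
     "\<forall>i j. n \<le> i \<or> n \<le> j \<longrightarrow> ent C i j = 0"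
    using common_bound[of A B C] by blast
  show "A * B * C = A * (B * C)"
  proof (rule fsm_eqI)
    fix i k
    have "ent (A * B * C) i k = (\<Sum>j<n. \<Sum>l<n. ent A i l * ent B l j * ent C j k)"
      using n by (simp add: ent_times[of n] sum_distrib_right)
    also have "\<dots> = (\<Sum>l<n. \<Sum>j<n. ent A i l * ent B l j * ent C j k)"
      by (rule sum.swap)
    also have "\<dots> = ent (A * (B * C)) i k"
      using n by (simp add: ent_times[of n] sum_distrib_left mult.assoc)
    finally show "ent (A * B * C) i k = ent (A * (B * C)) i k" .
  qed
  show "(A + B) * C = A * C + B * C" "A * (B + C) = A * B + A * C"
    using n by (auto intro!: fsm_eqI simp: ent_times[of n] sum.distrib distrib_left distrib_right)
qed
end

definition fmap :: "('a::zero \<Rightarrow> 'b::zero) \<Rightarrow> 'a fsm \<Rightarrow> 'b fsm" where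
  "fmap f A = Fsm (\<lambda>i j. f (ent A i j))"

lemma ent_fmap: "f 0 = 0 \<Longrightarrow> ent (fmap f A) i j = f (ent A i j)"
proof -
  assume "f 0 = 0"
  moreover obtain n where "\<forall>i j. n \<le> i \<or> n \<le> j \<longrightarrow> ent A i j = 0"
    using ent_bounded by meson
  ultimately show ?thesis unfolding fmap_def by (subst ent_Fsm[of n]) auto
qed

definition tpose :: "'a::zero fsm \<Rightarrow> 'a fsm" where
  "tpose A = Fsm (\<lambda>i j. ent A j i)"

lemma ent_tpose [simp]: "ent (tpose A) i j = ent A j i"
proof -
  obtain n where "\<forall>i j. n \<le> i \<or> n \<le> j \<longrightarrow> ent A i j = 0"
    using ent_bounded by meson
  then show ?thesis unfolding tpose_def by (subst ent_Fsm[of n]) auto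
qed

definition single :: "nat \<Rightarrow> nat \<Rightarrow> 'a \<Rightarrow> 'a::zero fsm" where
  "single i j a = Fsm (\<lambda>k l. if k = i \<and> l = j then a else 0)"

lemma ent_single: "ent (single i j a) k l = (if k = i \<and> l = j then a else 0)"
  unfolding single_def by (subst ent_Fsm[of "Suc (max i j)"]) auto

definition diag :: "'a list \<Rightarrow> 'a::zero fsm" where
  "diag xs = Fsm (\<lambda>i j. if i = j \<and> j < length xs then xs ! j else 0)"

lemma ent_diag: "ent (diag xs) i j = (if i = j \<and> j < length xs then xs ! j else 0)"
  unfolding diag_def by (subst ent_Fsm[of "length xs"]) auto

lemma ent_diag_times: "ent (diag xs * A) i j = (if i < length xs then xs ! i * ent A i j else 0)"
  for A :: "'a::ring fsm"
proof (cases "i < length xs")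
  case True
  have "ent (diag xs * A) i j = (\<Sum>k<length xs. ent (diag xs) i k * ent A k j)"
    by (rule ent_times) (auto simp: ent_diag)
  also have "\<dots> = (\<Sum>k<length xs. if k = i then xs ! i * ent A i j else 0)"
    by (rule sum.cong) (auto simp: ent_diag)
  finally show ?thesis using True by simp
next
  case False
  then have "ent (diag xs * A) i j = (\<Sum>k<0. ent (diag xs) i k * ent A k j)"
    by (intro ent_times) (auto simp: ent_diag)
  then show ?thesis using False by simp
qed

lemma ent_times_diag: "ent (A * diag xs) i j = (if j < length xs then ent A i j * xs ! j else 0)"
  for A :: "'a::ring fsm"
proof -
  have "ent (A * diag xs) i j = (\<Sum>k<length xs. ent A i k * ent (diag xs) k j)"
    by (rule ent_times) (auto simp: ent_diag)
  also have "\<dots> = (\<Sum>k<length xs. if k = j then (if j < length xs then ent A i j * xs ! j else 0) else 0)"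
    by (rule sum.cong) (auto simp: ent_diag)
  finally show ?thesis by auto
qed

lemma ent_single_times: "ent (single p q a * A) i j = (if i = p then a * ent A q j else 0)"
  for A :: "'a::ring fsm"
proof -
  have "ent (single p q a * A) i j = (\<Sum>k<Suc q. ent (single p q a) i k * ent A k j)"
    by (rule ent_times) (auto simp: ent_single)
  also have "\<dots> = (\<Sum>k<Suc q. if k = q then (if i = p then a * ent A q j else 0) else 0)"
    by (rule sum.cong) (auto simp: ent_single)
  finally show ?thesis by (simp del: sum.lessThan_Suc)
qed

lemma ent_times_single: "ent (A * single p q a) i j = (if j = q then ent A i p * a else 0)"
  for A :: "'a::ring fsm"
proof -
  have "ent (A * single p q a) i j = (\<Sum>k<Suc p. ent A i k * ent (single p q a) k j)"
    by (rule ent_times) (auto simp: ent_single)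
  also have "\<dots> = (\<Sum>k<Suc p. if k = p then (if j = q then ent A i p * a else 0) else 0)"
    by (rule sum.cong) (auto simp: ent_single)
  finally show ?thesis by (simp del: sum.lessThan_Suc)
qed

definition mats :: "'a set \<Rightarrow> 'a::zero fsm set" where
  "mats S = {A. \<forall>i j. ent A i j \<in> S}"

lemma matsI: "(\<And>i j. ent A i j \<in> S) \<Longrightarrow> A \<in> mats S"
  by (simp add: mats_def)

lemma matsD: "A \<in> mats S \<Longrightarrow> ent A i j \<in> S"
  by (simp add: mats_def)

text \<open>The two-term shape covers algebra homomorphisms (\<open>h' = 0\<close>) as well as the derivations
  \<open>\<psi> (r s) = \<phi>1 r \<psi> s + \<psi> r \<phi>2 s\<close>.\<close>
lemma fmap_times_derivation:
  fixes f g h g' h' :: "'a::ring \<Rightarrow> 'b::ring"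
  assumes f0: "f 0 = 0" "g 0 = 0" "h 0 = 0" "g' 0 = 0" "h' 0 = 0"
    and add: "\<And>x y. x \<in> S \<Longrightarrow> y \<in> S \<Longrightarrow> f (x + y) = f x + f y"
    and closed: "0 \<in> S" "\<And>x y. x \<in> S \<Longrightarrow> y \<in> S \<Longrightarrow> x + y \<in> S" "\<And>x y. x \<in> S \<Longrightarrow> y \<in> S \<Longrightarrow> x * y \<in> S"
    and mul: "\<And>x y. x \<in> S \<Longrightarrow> y \<in> S \<Longrightarrow> f (x * y) = g x * h y + g' x * h' y"
    and A: "A \<in> mats S" and B: "B \<in> mats S"
  shows "fmap f (A * B) = fmap g A * fmap h B + fmap g' A * fmap h' B"
proof (rule fsm_eqI)
  fix i k
  obtain n where n: "\<forall>i j. n \<le> i \<or> n \<le> j \<longrightarrow> ent A i j = 0" "\<forall>i j. n \<le> i \<or> n \<le> j \<longrightarrow> ent B i j = 0"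
    using common_bound[of A B B] by blast
  have S: "(\<Sum>j\<in>I. u j) \<in> S \<and> f (\<Sum>j\<in>I. u j) = (\<Sum>j\<in>I. f (u j))" if "finite I" "\<And>j. u j \<in> S" for I :: "nat set" and u
    using that(1) by (induction I) (simp_all add: f0 closed add that(2))
  have m: "ent A i j * ent B j k \<in> S" for j using A B closed by (simp add: mats_def)
  have "ent (fmap f (A * B)) i k = f (\<Sum>j<n. ent A i j * ent B j k)"
    using n by (simp add: ent_fmap f0 ent_times[of n])
  also have "\<dots> = (\<Sum>j<n. f (ent A i j * ent B j k))"
    using S[of "{..<n}" "\<lambda>j. ent A i j * ent B j k"] m by simp
  also have "\<dots> = (\<Sum>j<n. g (ent A i j) * h (ent B j k)) + (\<Sum>j<n. g' (ent A i j) * h' (ent B j k))"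
    using A B by (simp add: mul mats_def sum.distrib)
  also have "\<dots> = ent (fmap g A * fmap h B + fmap g' A * fmap h' B) i k"
    using n by (simp add: ent_fmap f0 ent_times[of n])
  finally show "ent (fmap f (A * B)) i k = ent (fmap g A * fmap h B + fmap g' A * fmap h' B) i k" .
qed

lemma fmap_times:
  fixes f :: "'a::ring \<Rightarrow> 'b::ring"
  assumes "f 0 = 0"
    and "\<And>x y. x \<in> S \<Longrightarrow> y \<in> S \<Longrightarrow> f (x + y) = f x + f y"
    and "0 \<in> S" "\<And>x y. x \<in> S \<Longrightarrow> y \<in> S \<Longrightarrow> x + y \<in> S" "\<And>x y. x \<in> S \<Longrightarrow> y \<in> S \<Longrightarrow> x * y \<in> S"
    and "\<And>x y. x \<in> S \<Longrightarrow> y \<in> S \<Longrightarrow> f (x * y) = f x * f y"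
    and "A \<in> mats S" "B \<in> mats S"
  shows "fmap f (A * B) = fmap f A * fmap f B"
proof -
  have "fmap f (A * B) = fmap f A * fmap f B + fmap (\<lambda>_. 0) A * fmap (\<lambda>_. 0 :: 'b) B"
    by (rule fmap_times_derivation[of f f f "\<lambda>_. 0" "\<lambda>_. 0" S]) (use assms in auto)
  moreover have "fmap (\<lambda>_. 0) A = (0 :: 'b fsm)" by (rule fsm_eqI) (simp add: ent_fmap)
  ultimately show ?thesis by simp
qed

lemma fmap_add:
  fixes f :: "'a::ring \<Rightarrow> 'b::ring"
  assumes "f 0 = 0" "\<And>x y. x \<in> S \<Longrightarrow> y \<in> S \<Longrightarrow> f (x + y) = f x + f y" "A \<in> mats S" "B \<in> mats S"
  shows "fmap f (A + B) = fmap f A + fmap f B"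
  by (rule fsm_eqI) (use assms in \<open>simp add: ent_fmap mats_def\<close>)

lemma fmap_zero:
  fixes f :: "'a::ring \<Rightarrow> 'b::ring"
  shows "f 0 = 0 \<Longrightarrow> fmap f 0 = 0"
  by (rule fsm_eqI) (simp add: ent_fmap)

lemma fmap_diag: "f 0 = 0 \<Longrightarrow> fmap f (diag xs) = diag (map f xs)"
  by (rule fsm_eqI) (auto simp: ent_fmap ent_diag)

section \<open>Matrices over a field\<close>

text \<open>The identity block of size \<open>n\<close>. The pair \<open>un m * N = N\<close>,
  \<open>N * un n = N\<close> is the way to say that \<open>N\<close> is an m by n matrix.\<close>

definition un :: "nat \<Rightarrow> 'k::field fsm" where
  "un n = diag (replicate n 1)"

lemma ent_un: "ent (un n) i j = (if i = j \<and> j < n then 1 else 0)"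
  by (auto simp: un_def ent_diag)

lemma ent_un_times: "ent (un m * A) i j = (if i < m then ent A i j else 0)"
  by (simp add: un_def ent_diag_times)

lemma ent_times_un: "ent (A * un m) i j = (if j < m then ent A i j else 0)"
  by (simp add: un_def ent_times_diag)

lemma un_times_iff: "un m * A = A \<longleftrightarrow> (\<forall>i j. m \<le> i \<longrightarrow> ent A i j = 0)"
proof
  assume "un m * A = A"
  then have *: "ent (un m * A) i j = ent A i j" for i j by simp
  show "\<forall>i j. m \<le> i \<longrightarrow> ent A i j = 0"
  proof (intro allI impI)
    fix i j assume "m \<le> i" then show "ent A i j = 0" using *[of i j] by (simp add: ent_un_times)
  qed
next
  assume "\<forall>i j. m \<le> i \<longrightarrow> ent A i j = 0"
  then show "un m * A = A" by (intro fsm_eqI) (simp add: ent_un_times)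
qed

lemma times_un_iff: "A * un n = A \<longleftrightarrow> (\<forall>i j. n \<le> j \<longrightarrow> ent A i j = 0)"
proof
  assume "A * un n = A"
  then have *: "ent (A * un n) i j = ent A i j" for i j by simp
  show "\<forall>i j. n \<le> j \<longrightarrow> ent A i j = 0"
  proof (intro allI impI)
    fix i j assume "n \<le> j" then show "ent A i j = 0" using *[of i j] by (simp add: ent_times_un)
  qed
next
  assume "\<forall>i j. n \<le> j \<longrightarrow> ent A i j = 0"
  then show "A * un n = A" by (intro fsm_eqI) (simp add: ent_times_un)
qed

lemma tpose_times: "tpose (A * B) = tpose B * tpose (A :: 'a::comm_ring fsm)"
proof (rule fsm_eqI)
  fix i k
  obtain n where n: "\<forall>i j. n \<le> i \<or> n \<le> j \<longrightarrow> ent A i j = 0" "\<forall>i j. n \<le> i \<or> n \<le> j \<longrightarrow> ent B i j = 0"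
    using common_bound[of A B B] by blast
  show "ent (tpose (A * B)) i k = ent (tpose B * tpose A) i k"
    using n by (simp add: ent_times[of n] mult.commute)
qed

lemma tpose_tpose [simp]: "tpose (tpose A) = A"
  by (rule fsm_eqI) simp

lemma tpose_un [simp]: "tpose (un n) = un n"
  by (rule fsm_eqI) (auto simp: ent_un)

text \<open>Elimination one column at a time: a left inverse for the first \<open>n\<close> columns
  either extends over the next column or shows that this column is a combination of the earlier
  ones, which is a kernel vector.\<close>

lemma left_inverse_or_kernel:
  fixes N :: "'k::field fsm"
  assumes "un m * N = N" "N * un n = N"
  shows "(\<exists>P. P * N = un n \<and> P * un m = P \<and> un n * P = P) \<or>
    (\<exists>v. v \<noteq> 0 \<and> un n * v = v \<and> v * un (Suc 0) = v \<and> N * v = 0)"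
  using assms
proof (induction n arbitrary: N)
  case 0
  then have "N = 0" by (intro fsm_eqI) (simp add: times_un_iff)
  moreover have "un 0 = (0 :: 'k fsm)" by (rule fsm_eqI) (simp add: ent_un)
  ultimately show ?case by (intro disjI1 exI[of _ 0]) simp
next
  case (Suc n)
  \<comment> \<open>\<open>single n 0 1\<close> is the last unit column and
    \<open>single 0 n 1\<close> its transpose, so \<open>c\<close> is the last column of
    \<open>N\<close> moved to column 0.\<close>
  define N' where "N' = N * un n"
  define c where "c = N * single n 0 1"
  have un: "un (Suc n) = un n + single n 0 1 * (single 0 n 1 :: 'k fsm)"
    by (rule fsm_eqI) (auto simp: ent_un ent_single_times ent_single)
  have N: "N = N' + c * single 0 n 1"
    using Suc.prems(2) unfolding N'_def c_def by (metis un distrib_left mult.assoc)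
  have uu: "un n * un n = (un n :: 'k fsm)" for n by (rule fsm_eqI) (auto simp: ent_un_times ent_un)
  have N': "un m * N' = N'" "N' * un n = N'" "un m * c = c"
    using Suc.prems uu by (auto simp: N'_def c_def mult.assoc[symmetric]) (simp add: mult.assoc uu)
  have e1: "single n 0 1 * un (Suc 0) = (single n 0 1 :: 'k fsm)"
    "un n * single n 0 1 = (0 :: 'k fsm)" "single 0 n 1 * un n = (0 :: 'k fsm)"
    "single 0 n 1 * single n 0 1 = (un (Suc 0) :: 'k fsm)"
    by (rule fsm_eqI, auto simp: ent_times_un ent_un_times ent_single ent_single_times ent_un)+
  have e2: "un (Suc n) * un n = (un n :: 'k fsm)" "un (Suc n) * single n 0 1 = (single n 0 1 :: 'k fsm)"
    by (rule fsm_eqI, auto simp: ent_un_times ent_single ent_un)+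
  have Nn: "N * un n = N'" by (simp add: N'_def)
  from Suc.IH[OF N'(1,2)] show ?case
  proof (elim disjE exE conjE)
    fix v assume v: "v \<noteq> 0" "un n * v = v" "v * un (Suc 0) = v" "N' * v = 0"
    have "un (Suc n) * v = v" using v(2) by (metis e2(1) mult.assoc)
    moreover have "N * v = 0" using v by (metis N'_def mult.assoc)
    ultimately show ?thesis using v by blast
  next
    fix P assume P: "P * N' = un n" "P * un m = P" "un n * P = P"
    have c1: "c * un (Suc 0) = c" by (simp add: c_def mult.assoc e1)
    \<comment> \<open>\<open>P * c\<close> holds the only possible coefficients of \<open>c\<close>
      in the columns of \<open>N'\<close>; \<open>r\<close> is what they fail to reach.\<close>
    define r where "r = c - N' * (P * c)"
    show ?thesis
    proof (cases "r = 0")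
      case True
      define v where "v = single n 0 1 - P * c"
      have "un n * (P * c) = P * c" using P(3) by (metis mult.assoc)
      then have "ent (P * c) n 0 = 0" by (simp add: un_times_iff)
      then have "ent v n 0 = 1" by (simp add: v_def ent_single)
      then have "v \<noteq> 0" by auto
      moreover have "un (Suc n) * v = v"
        unfolding v_def using P(3) e2 by (metis mult.assoc right_diff_distrib)
      moreover have "v * un (Suc 0) = v"
        using e1(1) c1 by (simp add: v_def left_diff_distrib mult.assoc)
      moreover have "N * v = 0"
      proof -
        have "N * (P * c) = N' * (P * c)" using P(3) by (metis Nn mult.assoc)
        then show ?thesis using True by (simp add: v_def right_diff_distrib c_def[symmetric] r_def)
      qed
      ultimately show ?thesis by blast
    next
      case False
      then obtain i j where ij: "ent r i j \<noteq> 0" by (metis ent_zero fsm_eqI)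
      have "r * un (Suc 0) = r" using c1 by (simp add: r_def left_diff_distrib mult.assoc)
      then have j: "j = 0" using ij by (metis Suc_leI not_gr_zero times_un_iff)
      have "un m * r = r" using N' by (simp add: r_def right_diff_distrib mult.assoc[symmetric])
      then have i: "i < m" using ij by (meson linorder_not_le un_times_iff)
      \<comment> \<open>\<open>q\<close> is 1 on \<open>r\<close> through one nonzero entry.
        Subtracting \<open>q * N' * P\<close> makes it vanish on the columns of \<open>N'\<close>
        while its value on \<open>c\<close> becomes 1.\<close>
      define q where "q = single 0 i (1 / ent r i 0)"
      define \<rho> where "\<rho> = q - q * N' * P"
      have qm: "q * un m = q" unfolding times_un_iff using i by (auto simp: q_def ent_single)
      have "\<rho> * N' = 0" using P(1) N'(2) by (simp add: \<rho>_def left_diff_distrib mult.assoc)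
      have "\<rho> * c = q * r" by (simp add: \<rho>_def r_def left_diff_distrib right_diff_distrib mult.assoc)
      also have "\<dots> = un (Suc 0)"
        using ij j \<open>r * un (Suc 0) = r\<close> by (intro fsm_eqI) (auto simp: q_def ent_single_times ent_un times_un_iff)
      finally have \<rho>c: "\<rho> * c = un (Suc 0)" .
      have \<rho>m: "\<rho> * un m = \<rho>" using qm P(2) by (simp add: \<rho>_def left_diff_distrib mult.assoc)
      \<comment> \<open>The value of \<open>P\<close> on \<open>c\<close> is replaced by the new
        unit vector. Both corrections factor through \<open>\<rho>\<close>, so \<open>P * N'\<close>
        does not change.\<close>
      define P' where "P' = P - P * c * \<rho> + single n 0 1 * \<rho>"
      have "P' * N = (P' * N') + (P' * c) * single 0 n 1"
        by (subst N) (simp add: distrib_left mult.assoc)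
      also have "P' * N' = un n"
        using \<open>\<rho> * N' = 0\<close> P(1) by (simp add: P'_def distrib_right left_diff_distrib mult.assoc)
      also have "P' * c = single n 0 1"
      proof -
        have "P' * c = P * c - P * (c * un (Suc 0)) + single n 0 1 * un (Suc 0)"
          unfolding P'_def using \<rho>c by (simp add: distrib_right left_diff_distrib mult.assoc)
        then show ?thesis by (simp add: c1 e1(1))
      qed
      finally have "P' * N = un (Suc n)" by (simp add: un)
      moreover have "P' * un m = P'" using P \<rho>m by (simp add: P'_def distrib_right left_diff_distrib mult.assoc)
      moreover have "un (Suc n) * P' = P'"
      proof -
        have "un (Suc n) * P = P" using P(3) e2 by (metis mult.assoc)
        then show ?thesis using e2(2) by (simp add: P'_def distrib_left right_diff_distrib mult.assoc[symmetric])
      qed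
      ultimately show ?thesis by blast
    qed
  qed
qed

lemma right_inverse_or_cokernel:
  fixes N :: "'k::field fsm"
  assumes "un m * N = N" "N * un n = N"
  shows "(\<exists>P. N * P = un m \<and> P * un m = P \<and> un n * P = P) \<or>
    (\<exists>w. w \<noteq> 0 \<and> w * un m = w \<and> un (Suc 0) * w = w \<and> w * N = 0)"
proof -
  have "un n * tpose N = tpose N" "tpose N * un m = tpose N"
    using assms by (metis tpose_times tpose_un)+
  then consider P where "P * tpose N = un m" "P * un n = P" "un m * P = P"
    | v where "v \<noteq> 0" "un m * v = v" "v * un (Suc 0) = v" "tpose N * v = 0"
    using left_inverse_or_kernel[of n "tpose N" m] by blast
  then show ?thesis
  proof cases
    case 1
    then have "N * tpose P = un m" "tpose P * un m = tpose P" "un n * tpose P = tpose P"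
      by (metis tpose_times tpose_un tpose_tpose)+
    then show ?thesis by blast
  next
    case 2
    have "tpose 0 = (0 :: 'k fsm)" by (rule fsm_eqI) simp
    with 2 have "tpose v \<noteq> 0" "tpose v * un m = tpose v" "un (Suc 0) * tpose v = tpose v" "tpose v * N = 0"
      by (metis tpose_times tpose_un tpose_tpose)+
    then show ?thesis by blast
  qed
qed

text \<open>Taken over from matrices of fixed dimension: on n by n blocks, \<open>M\<close> is
  multiplicative and sends \<open>un n\<close> to the identity matrix.\<close>

lemma square_left_right_inverse:
  fixes A B :: "'k::field fsm"
  assumes A: "un n * A = A" "A * un n = A" and B: "un n * B = B" "B * un n = B" and AB: "A * B = un n"
  shows "B * A = un n"
proof -
  define M where "M C = mat n n (\<lambda>(i, j). ent C i j)" for C :: "'k fsm"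
  have M: "M C \<in> carrier_mat n n" for C by (simp add: M_def)
  have mult: "M C * M D = M (C * D)" if "C * un n = C" for C D
  proof (rule eq_matI)
    fix i j assume "i < dim_row (M (C * D))" "j < dim_col (M (C * D))"
    then have ij: "i < n" "j < n" by (auto simp: M_def)
    have "ent (C * D) i j = (\<Sum>k<n. ent C i k * ent D k j)"
      using that by (intro ent_times) (simp add: times_un_iff)
    then show "(M C * M D) $$ (i, j) = M (C * D) $$ (i, j)"
      using ij by (simp add: M_def scalar_prod_def lessThan_atLeast0)
  qed (auto simp: M_def)
  have M1: "M (un n) = 1\<^sub>m n" by (rule eq_matI) (auto simp: M_def ent_un)
  have "M B * M A = 1\<^sub>m n"
    by (rule mat_mult_left_right_inverse[OF M M]) (simp add: mult A AB M1)
  then have *: "M (B * A) = M (un n)" by (simp add: mult B M1)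
  show ?thesis
  proof (rule fsm_eqI)
    fix i j
    show "ent (B * A) i j = ent (un n) i j"
    proof (cases "i < n \<and> j < n")
      case True
      with * have "M (B * A) $$ (i, j) = M (un n) $$ (i, j)" by simp
      with True show ?thesis by (simp add: M_def)
    next
      case False
      have "un n * (B * A) = B * A" "B * A * un n = B * A" using A B by (metis mult.assoc)+
      with False show ?thesis by (auto simp: un_times_iff times_un_iff ent_un not_less)
    qed
  qed
qed

text \<open>If \<open>m < n\<close>, padding by zeros makes both matrices n by n, so
  \<open>N * P\<close> would be the identity although its row \<open>m\<close> is zero.\<close>

lemma left_inverse_imp_le:
  fixes N P :: "'k::field fsm"
  assumes N: "un m * N = N" "N * un n = N" and P: "P * un m = P" "un n * P = P" and "P * N = un n"
  shows "n \<le> m"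
proof (rule ccontr)
  assume "\<not> n \<le> m"
  then have le: "m \<le> n" "m < n" by auto
  have "un n * N = N" "P * un n = P" using N P le unfolding un_times_iff times_un_iff by auto
  then have "N * P = un n" using square_left_right_inverse[of n P N] N P assms(5) by simp
  then have "ent (N * P) m m = 1" using le by (simp add: ent_un)
  moreover have "un m * (N * P) = N * P" using N by (metis mult.assoc)
  ultimately show False by (simp add: un_times_iff)
qed

section \<open>Two-term complexes over a subring with idempotents\<close>

text \<open>The inclusion of a summand whose \<open>j\<close>-th label sits at position
  \<open>\<sigma> j\<close> of a larger list: the idempotents \<open>xs\<close> are placed along the
  graph of \<open>\<sigma>\<close>. \<open>rowm\<close> is the matching projection.\<close>

definition colm :: "(nat \<Rightarrow> nat) \<Rightarrow> 'a list \<Rightarrow> 'a::zero fsm" where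
  "colm \<sigma> xs = Fsm (\<lambda>i j. if j < length xs \<and> i = \<sigma> j then xs ! j else 0)"

definition rowm :: "(nat \<Rightarrow> nat) \<Rightarrow> 'a list \<Rightarrow> 'a::zero fsm" where
  "rowm \<sigma> xs = tpose (colm \<sigma> xs)"

lemma ent_colm: "ent (colm \<sigma> xs) i j = (if j < length xs \<and> i = \<sigma> j then xs ! j else 0)"
proof -
  have "finite (\<sigma> ` {..<length xs})" by simp
  then obtain n where "\<forall>k\<in>\<sigma> ` {..<length xs}. k \<le> n" using finite_nat_set_iff_bounded_le by blast
  then show ?thesis
    unfolding colm_def by (subst ent_Fsm[of "max (Suc n) (length xs)"]) force+
qed

lemma ent_rowm: "ent (rowm \<sigma> xs) i j = (if i < length xs \<and> j = \<sigma> i then xs ! i else 0)"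
  by (simp add: rowm_def ent_colm)

lemma ent_times_colm: "ent (A * colm \<sigma> xs) i j = (if j < length xs then ent A i (\<sigma> j) * xs ! j else 0)"
  for A :: "'a::ring fsm"
proof -
  have "ent (A * colm \<sigma> xs) i j = (\<Sum>k<Suc (\<sigma> j). ent A i k * ent (colm \<sigma> xs) k j)"
    by (rule ent_times) (auto simp: ent_colm)
  also have "\<dots> = (\<Sum>k<Suc (\<sigma> j). if k = \<sigma> j then (if j < length xs then ent A i (\<sigma> j) * xs ! j else 0) else 0)"
    by (rule sum.cong) (auto simp: ent_colm)
  finally show ?thesis by (simp del: sum.lessThan_Suc)
qed

lemma ent_colm_times:
  fixes A :: "'a::ring fsm"
  assumes inj: "inj_on \<sigma> {..<length xs}" and q: "q < length xs"
  shows "ent (colm \<sigma> xs * A) (\<sigma> q) j = xs ! q * ent A q j"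
proof -
  have "ent (colm \<sigma> xs * A) (\<sigma> q) j = (\<Sum>k<length xs. ent (colm \<sigma> xs) (\<sigma> q) k * ent A k j)"
    by (rule ent_times) (auto simp: ent_colm)
  also have "\<dots> = (\<Sum>k<length xs. if k = q then xs ! q * ent A q j else 0)"
    by (rule sum.cong) (use inj q in \<open>auto simp: ent_colm inj_on_def\<close>)
  finally show ?thesis using q by simp
qed

lemma ent_colm_times_other:
  fixes A :: "'a::ring fsm"
  assumes "i \<notin> \<sigma> ` {..<length xs}"
  shows "ent (colm \<sigma> xs * A) i j = 0"
proof -
  have "ent (colm \<sigma> xs * A) i j = (\<Sum>k<length xs. ent (colm \<sigma> xs) i k * ent A k j)"
    by (rule ent_times) (auto simp: ent_colm)
  also have "\<dots> = 0" by (rule sum.neutral) (use assms in \<open>auto simp: ent_colm\<close>)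
  finally show ?thesis .
qed

type_synonym 'r cx = "nat list \<times> nat list \<times> 'r fsm"

definition src :: "'r cx \<Rightarrow> nat list" where "src T = fst T"
definition tgt :: "'r cx \<Rightarrow> nat list" where "tgt T = fst (snd T)"
definition dif :: "'r cx \<Rightarrow> 'r fsm" where "dif T = snd (snd T)"

abbreviation Cx :: "nat list \<Rightarrow> nat list \<Rightarrow> 'r fsm \<Rightarrow> 'r cx" where "Cx l m d \<equiv> (l, m, d)"

lemma cx_eqI: "src T = src U \<Longrightarrow> tgt T = tgt U \<Longrightarrow> dif T = dif U \<Longrightarrow> T = U"
  by (simp add: src_def tgt_def dif_def prod_eq_iff)

definition obj :: "(nat \<Rightarrow> 'r::ring) \<Rightarrow> nat list \<Rightarrow> 'r fsm" where
  "obj e ls = diag (map e ls)"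

definition hom :: "'r::ring set \<Rightarrow> (nat \<Rightarrow> 'r) \<Rightarrow> nat list \<Rightarrow> nat list \<Rightarrow> 'r fsm set" where
  "hom S e ls ms = {f \<in> mats S. f * obj e ls = f \<and> obj e ms * f = f}"

definition iscx :: "'r::ring set \<Rightarrow> (nat \<Rightarrow> 'r) \<Rightarrow> 'r cx \<Rightarrow> bool" where
  "iscx S e T \<longleftrightarrow> set (src T) \<subseteq> {1, 2} \<and> set (tgt T) \<subseteq> {1, 2} \<and> dif T \<in> hom S e (src T) (tgt T)"

text \<open>Isomorphism in the homotopy category. The homotopies \<open>h\<close> and
  \<open>k\<close> have a single component, from degree 0 to degree -1.\<close>

definition iso :: "'r::ring set \<Rightarrow> (nat \<Rightarrow> 'r) \<Rightarrow> 'r cx \<Rightarrow> 'r cx \<Rightarrow> bool" where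
  "iso S e T U \<longleftrightarrow> (\<exists>f1 f0 g1 g0 h k.
     f1 \<in> hom S e (src T) (src U) \<and> f0 \<in> hom S e (tgt T) (tgt U) \<and>
     g1 \<in> hom S e (src U) (src T) \<and> g0 \<in> hom S e (tgt U) (tgt T) \<and>
     h \<in> hom S e (tgt T) (src T) \<and> k \<in> hom S e (tgt U) (src U) \<and>
     dif U * f1 = f0 * dif T \<and> dif T * g1 = g0 * dif U \<and>
     g1 * f1 = obj e (src T) + h * dif T \<and> g0 * f0 = obj e (tgt T) + dif T * h \<and>
     f1 * g1 = obj e (src U) + k * dif U \<and> f0 * g0 = obj e (tgt U) + dif U * k)"

definition sft :: "(nat \<Rightarrow> 'r::ring) \<Rightarrow> nat \<Rightarrow> nat list \<Rightarrow> 'r fsm" where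
  "sft e n ms = colm (\<lambda>j. j + n) (map e ms)"

definition sft' :: "(nat \<Rightarrow> 'r::ring) \<Rightarrow> nat \<Rightarrow> nat list \<Rightarrow> 'r fsm" where
  "sft' e n ms = rowm (\<lambda>j. j + n) (map e ms)"

definition dsm :: "(nat \<Rightarrow> 'r::ring) \<Rightarrow> 'r cx \<Rightarrow> 'r cx \<Rightarrow> 'r cx" where
  "dsm e T U = Cx (src T @ src U) (tgt T @ tgt U)
     (dif T + sft e (length (tgt T)) (tgt U) * dif U * sft' e (length (src T)) (src U))"

definition zcx :: "'r::ring cx" where "zcx = Cx [] [] 0"

definition dsms :: "(nat \<Rightarrow> 'r::ring) \<Rightarrow> 'r cx list \<Rightarrow> 'r cx" where
  "dsms e Ts = foldr (dsm e) Ts zcx"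

definition ind :: "'r::ring set \<Rightarrow> (nat \<Rightarrow> 'r) \<Rightarrow> 'r cx \<Rightarrow> bool" where
  "ind S e T \<longleftrightarrow> iscx S e T \<and> \<not> iso S e T zcx \<and>
     (\<forall>U V. iscx S e U \<and> iscx S e V \<and> iso S e T (dsm e U V) \<longrightarrow> iso S e U zcx \<or> iso S e V zcx)"

definition presil :: "'r::ring set \<Rightarrow> (nat \<Rightarrow> 'r) \<Rightarrow> 'r cx \<Rightarrow> bool" where
  "presil S e T \<longleftrightarrow> (\<forall>g\<in>hom S e (src T) (tgt T). \<exists>a\<in>hom S e (src T) (src T). \<exists>b\<in>hom S e (tgt T) (tgt T).
     g = dif T * a + b * dif T)"

definition gv :: "'r cx \<Rightarrow> real \<times> real" where
  "gv T = (real (count_list (tgt T) 1) - real (count_list (src T) 1),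
           real (count_list (tgt T) 2) - real (count_list (src T) 2))"

definition family :: "'r::ring set \<Rightarrow> (nat \<Rightarrow> 'r) \<Rightarrow> 'r cx list \<Rightarrow> bool" where
  "family S e Ts \<longleftrightarrow> (\<forall>T\<in>set Ts. ind S e T)
     \<and> (\<forall>i<length Ts. \<forall>j<length Ts. i \<noteq> j \<longrightarrow> \<not> iso S e (Ts ! i) (Ts ! j))
     \<and> presil S e (dsms e Ts)"

definition fan :: "'r::ring set \<Rightarrow> (nat \<Rightarrow> 'r) \<Rightarrow> (real \<times> real) set set" where
  "fan S e = {gcone (set (map gv Ts)) | Ts. family S e Ts}"

text \<open>A biproduct decomposition of the object \<open>ls\<close>. Beside concatenation it
  covers deleting one label from the middle of a list and changing the embedding of a
  summand.\<close>

definition bip :: "'r::ring set \<Rightarrow> (nat \<Rightarrow> 'r) \<Rightarrow> nat list \<Rightarrow> nat list \<Rightarrow> nat list \<Rightarrow>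
    'r fsm \<Rightarrow> 'r fsm \<Rightarrow> 'r fsm \<Rightarrow> 'r fsm \<Rightarrow> bool" where
  "bip S e ls ms ns a a' c c' \<longleftrightarrow> a \<in> hom S e ms ls \<and> a' \<in> hom S e ls ms \<and> c \<in> hom S e ns ls \<and> c' \<in> hom S e ls ns \<and>
     a' * a = obj e ms \<and> c' * c = obj e ns \<and> a' * c = 0 \<and> c' * a = 0 \<and> obj e ls = a * a' + c * c'"

definition isum :: "'r::ring set \<Rightarrow> (nat \<Rightarrow> 'r) \<Rightarrow> 'r cx \<Rightarrow> 'r cx \<Rightarrow> 'r cx \<Rightarrow> bool" where
  "isum S e W T U \<longleftrightarrow> (\<exists>a a' c c' b b' g g'. bip S e (src W) (src T) (src U) a a' c c' \<and>
     bip S e (tgt W) (tgt T) (tgt U) b b' g g' \<and> dif W = b * dif T * a' + g * dif U * c')"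

text \<open>A strict retract: \<open>i, j\<close> and \<open>p, q\<close> are chain maps whose
  composites are the identity in each degree, with no homotopy.\<close>

definition summand :: "'r::ring set \<Rightarrow> (nat \<Rightarrow> 'r) \<Rightarrow> 'r cx \<Rightarrow> 'r cx \<Rightarrow> bool" where
  "summand S e T D \<longleftrightarrow> (\<exists>i p j q. i \<in> hom S e (src T) (src D) \<and> p \<in> hom S e (src D) (src T) \<and>
     j \<in> hom S e (tgt T) (tgt D) \<and> q \<in> hom S e (tgt D) (tgt T) \<and> p * i = obj e (src T) \<and> q * j = obj e (tgt T) \<and>
     dif D * i = j * dif T \<and> q * dif D = dif T * p)"

text \<open>Lets the simplifier use an equation for a product of two factors inside a longer product
  associated to the right.\<close>

lemma assoc2: "a * b = c \<Longrightarrow> a * (b * y) = c * (y :: 'a::semigroup_mult)"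
  by (simp add: mult.assoc[symmetric])

lemma cx_sel [simp]: "src (Cx l m d) = l" "tgt (Cx l m d) = m" "dif (Cx l m d) = d"
  by (simp_all add: src_def tgt_def dif_def)

text \<open>An algebra inside a ring type without unit; its own unit appears later as
  \<open>e 1 + e 2\<close>.\<close>

locale idem_ring =
  fixes S :: "'r::ring set" and e :: "nat \<Rightarrow> 'r"
  assumes S0: "0 \<in> S" and Sadd: "x \<in> S \<Longrightarrow> y \<in> S \<Longrightarrow> x + y \<in> S"
    and Sneg: "x \<in> S \<Longrightarrow> - x \<in> S" and Smul: "x \<in> S \<Longrightarrow> y \<in> S \<Longrightarrow> x * y \<in> S"
    and eS: "e i \<in> S" and ee: "e i * e i = e i"
begin

abbreviation "ob \<equiv> obj e"
abbreviation "Hom \<equiv> hom S e"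

lemma Sdiff: "x \<in> S \<Longrightarrow> y \<in> S \<Longrightarrow> x - y \<in> S"
  using Sadd[of x "- y"] Sneg[of y] by simp

lemma Ssum: "(\<And>i. i \<in> I \<Longrightarrow> f i \<in> S) \<Longrightarrow> sum f I \<in> S"
  by (induction I rule: infinite_finite_induct) (auto intro: S0 Sadd)

lemma mats_mul: "A \<in> mats S \<Longrightarrow> B \<in> mats S \<Longrightarrow> A * B \<in> mats S"
proof (rule matsI)
  fix i j assume AB: "A \<in> mats S" "B \<in> mats S"
  obtain n where n: "\<forall>i j. n \<le> i \<or> n \<le> j \<longrightarrow> ent A i j = 0" "\<forall>i j. n \<le> i \<or> n \<le> j \<longrightarrow> ent B i j = 0"
    using common_bound[of A B B] by blast
  have "ent (A * B) i j = (\<Sum>k<n. ent A i k * ent B k j)" by (rule ent_times) (use n in simp)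
  then show "ent (A * B) i j \<in> S" using AB by (auto intro!: Ssum Smul simp: matsD)
qed

lemma mats_lin: "A \<in> mats S \<Longrightarrow> B \<in> mats S \<Longrightarrow> A + B \<in> mats S" "A \<in> mats S \<Longrightarrow> B \<in> mats S \<Longrightarrow> A - B \<in> mats S"
   "A \<in> mats S \<Longrightarrow> - A \<in> mats S" "0 \<in> mats S"
  by (auto simp: mats_def Sadd Sdiff Sneg S0)

lemma ob_mats: "ob ls \<in> mats S"
  by (rule matsI) (simp add: obj_def ent_diag eS S0)

lemma ob_idem: "ob ls * ob ls = ob ls"
  by (rule fsm_eqI) (auto simp: obj_def ent_diag_times ent_diag ee)

lemma hom_mats: "f \<in> Hom ls ms \<Longrightarrow> f \<in> mats S"
  and hom_r: "f \<in> Hom ls ms \<Longrightarrow> f * ob ls = f"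
  and hom_l: "f \<in> Hom ls ms \<Longrightarrow> ob ms * f = f"
  by (auto simp: hom_def)

lemma hom_r2: "f \<in> Hom ls ms \<Longrightarrow> f * (ob ls * y) = f * y"
  and hom_l2: "f \<in> Hom ls ms \<Longrightarrow> ob ms * (f * y) = f * y"
  by (simp_all add: mult.assoc[symmetric] hom_r hom_l)

lemmas hom_simps = hom_r hom_l hom_r2 hom_l2

lemma hom_ob [intro, simp]: "ob ls \<in> Hom ls ls"
  by (simp add: hom_def ob_mats ob_idem)

lemma hom_mul [intro]: "g \<in> Hom ms ns \<Longrightarrow> f \<in> Hom ls ms \<Longrightarrow> g * f \<in> Hom ls ns"
  by (auto simp: hom_def mats_mul mult.assoc) (simp add: mult.assoc[symmetric])

lemma hom_add [intro]: "f \<in> Hom ls ms \<Longrightarrow> g \<in> Hom ls ms \<Longrightarrow> f + g \<in> Hom ls ms"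
  and hom_diff [intro]: "f \<in> Hom ls ms \<Longrightarrow> g \<in> Hom ls ms \<Longrightarrow> f - g \<in> Hom ls ms"
  and hom_neg [intro]: "f \<in> Hom ls ms \<Longrightarrow> - f \<in> Hom ls ms"
  and hom_zero [intro, simp]: "0 \<in> Hom ls ms"
  by (auto simp: hom_def mats_lin algebra_simps)

section \<open>Homotopy equivalence of two-term complexes\<close>

lemma isoI:
  assumes "f1 \<in> Hom (src T) (src U)" "f0 \<in> Hom (tgt T) (tgt U)" "g1 \<in> Hom (src U) (src T)" "g0 \<in> Hom (tgt U) (tgt T)"
    "h \<in> Hom (tgt T) (src T)" "k \<in> Hom (tgt U) (src U)" "dif U * f1 = f0 * dif T" "dif T * g1 = g0 * dif U"
    "g1 * f1 = ob (src T) + h * dif T" "g0 * f0 = ob (tgt T) + dif T * h"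
    "f1 * g1 = ob (src U) + k * dif U" "f0 * g0 = ob (tgt U) + dif U * k"
  shows "iso S e T U"
  unfolding iso_def by (rule exI[of _ f1], rule exI[of _ f0], rule exI[of _ g1], rule exI[of _ g0],
      rule exI[of _ h], rule exI[of _ k]) (use assms in blast)

lemma isoE:
  assumes "iso S e T U"
  obtains f1 f0 g1 g0 h k where
    "f1 \<in> Hom (src T) (src U)" "f0 \<in> Hom (tgt T) (tgt U)" "g1 \<in> Hom (src U) (src T)" "g0 \<in> Hom (tgt U) (tgt T)"
    "h \<in> Hom (tgt T) (src T)" "k \<in> Hom (tgt U) (src U)" "dif U * f1 = f0 * dif T" "dif T * g1 = g0 * dif U"
    "g1 * f1 = ob (src T) + h * dif T" "g0 * f0 = ob (tgt T) + dif T * h"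
    "f1 * g1 = ob (src U) + k * dif U" "f0 * g0 = ob (tgt U) + dif U * k"
  using assms unfolding iso_def by (elim exE conjE)

lemma iscx_dif: "iscx S e T \<Longrightarrow> dif T \<in> Hom (src T) (tgt T)"
  by (simp add: iscx_def)

lemma iso_refl: "iscx S e T \<Longrightarrow> iso S e T T"
  by (rule isoI[of "ob (src T)" _ _ "ob (tgt T)" "ob (src T)" "ob (tgt T)" 0 0])
     (auto simp: hom_r[OF iscx_dif] hom_l[OF iscx_dif] ob_idem)

lemma iso_sym: "iso S e T U \<Longrightarrow> iso S e U T"
  unfolding iso_def by metis

lemma iso_trans:
  assumes "iso S e T U" "iso S e U V"
  shows "iso S e T V"
proof -
  from assms(1) obtain f1 f0 g1 g0 h k where 1:
    "f1 \<in> Hom (src T) (src U)" "f0 \<in> Hom (tgt T) (tgt U)" "g1 \<in> Hom (src U) (src T)" "g0 \<in> Hom (tgt U) (tgt T)"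
    "h \<in> Hom (tgt T) (src T)" "k \<in> Hom (tgt U) (src U)" and eq1: "dif U * f1 = f0 * dif T" "dif T * g1 = g0 * dif U"
    "g1 * f1 = ob (src T) + h * dif T" "g0 * f0 = ob (tgt T) + dif T * h"
    "f1 * g1 = ob (src U) + k * dif U" "f0 * g0 = ob (tgt U) + dif U * k" by (rule isoE)
  from assms(2) obtain p1 p0 q1 q0 l m where 2:
    "p1 \<in> Hom (src U) (src V)" "p0 \<in> Hom (tgt U) (tgt V)" "q1 \<in> Hom (src V) (src U)" "q0 \<in> Hom (tgt V) (tgt U)"
    "l \<in> Hom (tgt U) (src U)" "m \<in> Hom (tgt V) (src V)" and eq2: "dif V * p1 = p0 * dif U" "dif U * q1 = q0 * dif V"
    "q1 * p1 = ob (src U) + l * dif U" "q0 * p0 = ob (tgt U) + dif U * l"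
    "p1 * q1 = ob (src V) + m * dif V" "p0 * q0 = ob (tgt V) + dif V * m" by (rule isoE)
  note H = 1[THEN hom_r] 1[THEN hom_r2] 1[THEN hom_l] 1[THEN hom_l2] 2[THEN hom_r] 2[THEN hom_r2] 2[THEN hom_l] 2[THEN hom_l2]
  note R = H eq1 eq2 eq1[THEN assoc2] eq2[THEN assoc2] mult.assoc distrib_left distrib_right
  \<comment> \<open>The homotopy \<open>l\<close> is carried to \<open>T\<close> by the chain maps,
    since \<open>g1 * l * dif U * f1 = g1 * l * f0 * dif T\<close>; likewise \<open>k\<close> is
    carried to \<open>V\<close>.\<close>
  show ?thesis
    by (rule isoI[of "p1 * f1" _ _ "p0 * f0" "g1 * q1" "g0 * q0" "h + g1 * l * f0" "m + p1 * k * q0"])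
       (use 1 2 in \<open>auto simp: R\<close>)
qed

text \<open>Two disjoint injections that cover the positions of \<open>ls\<close> and respect labels
  split it. The identity is verified row by row, according to the injection that hits the
  row.\<close>

lemma bipI_index:
  assumes inj: "inj_on \<sigma> {..<length ms}" "inj_on \<tau> {..<length ns}"
    and disj: "\<And>p q. p < length ms \<Longrightarrow> q < length ns \<Longrightarrow> \<sigma> p \<noteq> \<tau> q"
    and un: "\<And>i. i < length ls \<longleftrightarrow> (\<exists>p<length ms. i = \<sigma> p) \<or> (\<exists>q<length ns. i = \<tau> q)"
    and lab: "\<And>p. p < length ms \<Longrightarrow> ls ! \<sigma> p = ms ! p" "\<And>q. q < length ns \<Longrightarrow> ls ! \<tau> q = ns ! q"
  shows "bip S e ls ms ns (colm \<sigma> (map e ms)) (rowm \<sigma> (map e ms)) (colm \<tau> (map e ns)) (rowm \<tau> (map e ns))"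
proof -
  have m: "colm \<sigma> (map e ms) \<in> mats S" "rowm \<sigma> (map e ms) \<in> mats S" for \<sigma> ms
    by (auto intro!: matsI simp: ent_colm ent_rowm eS S0)
  have lt: "\<And>p. p < length ms \<Longrightarrow> \<sigma> p < length ls" "\<And>q. q < length ns \<Longrightarrow> \<tau> q < length ls"
    using un by blast+
  have hc: "colm \<sigma> (map e ms) \<in> Hom ms ls" "rowm \<sigma> (map e ms) \<in> Hom ls ms"
    unfolding hom_def obj_def using m lt lab(1)
    by (auto intro!: fsm_eqI simp: ent_times_diag ent_diag_times ent_colm ent_rowm ee)
  have hd: "colm \<tau> (map e ns) \<in> Hom ns ls" "rowm \<tau> (map e ns) \<in> Hom ls ns"
    unfolding hom_def obj_def using m lt lab(2)
    by (auto intro!: fsm_eqI simp: ent_times_diag ent_diag_times ent_colm ent_rowm ee)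
  have comp: "rowm \<sigma> (map e ms) * colm \<sigma> (map e ms) = obj e ms" if "inj_on \<sigma> {..<length ms}" for \<sigma> ms
    using that by (intro fsm_eqI) (auto simp: ent_times_colm ent_rowm obj_def ent_diag ee inj_on_def)
  have z: "rowm \<sigma> (map e ms) * colm \<tau> (map e ns) = 0" "rowm \<tau> (map e ns) * colm \<sigma> (map e ms) = 0"
    by (intro fsm_eqI, use disj in \<open>fastforce simp: ent_times_colm ent_rowm\<close>)+
  have "obj e ls = colm \<sigma> (map e ms) * rowm \<sigma> (map e ms) + colm \<tau> (map e ns) * rowm \<tau> (map e ns)"
  proof (rule fsm_eqI)
    fix i j
    consider p where "p < length ms" "i = \<sigma> p" | q where "q < length ns" "i = \<tau> q" | "\<not> i < length ls"
      using un by blast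
    then show "ent (obj e ls) i j =
      ent (colm \<sigma> (map e ms) * rowm \<sigma> (map e ms) + colm \<tau> (map e ns) * rowm \<tau> (map e ns)) i j"
    proof cases
      case 1
      then have o: "i \<notin> \<tau> ` {..<length (map e ns)}" using disj by auto
      then show ?thesis
        using 1 inj ent_colm_times[of \<sigma> "map e ms" p] ent_colm_times_other[OF o] lt lab
        by (auto simp: obj_def ent_diag ent_rowm ee)
    next
      case 2
      then have o: "i \<notin> \<sigma> ` {..<length (map e ms)}" using disj by fastforce
      then show ?thesis
        using 2 inj ent_colm_times[of \<tau> "map e ns" q] ent_colm_times_other[OF o] lt lab
        by (auto simp: obj_def ent_diag ent_rowm ee)
    next
      case 3
      then have "i \<notin> \<sigma> ` {..<length (map e ms)}" "i \<notin> \<tau> ` {..<length (map e ns)}" using lt by auto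
      then show ?thesis using 3 by (auto simp: obj_def ent_diag ent_colm_times_other)
    qed
  qed
  then show ?thesis unfolding bip_def using hc hd comp inj z by simp
qed

lemma obj_colm: "obj e ls = colm (\<lambda>j. j) (map e ls)" "obj e ls = rowm (\<lambda>j. j) (map e ls)"
  by (rule fsm_eqI, auto simp: obj_def ent_diag ent_colm ent_rowm)+

lemma bip_append: "bip S e (ls @ ms) ls ms (ob ls) (ob ls) (sft e (length ls) ms) (sft' e (length ls) ms)"
  unfolding sft_def sft'_def
  apply (subst obj_colm(1), subst obj_colm(2), rule bipI_index)
  apply (auto simp: inj_on_def nth_append)
  by (metis add.commute add_diff_inverse_nat nat_add_left_cancel_less)

lemma bip_nth:
  assumes i: "i < length ls"
  shows "\<exists>c c'. bip S e ls [ls ! i] (take i ls @ drop (Suc i) ls) (single i 0 (e (ls ! i))) (single 0 i (e (ls ! i))) c c'"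
proof -
  have s: "colm (\<lambda>_. i) (map e [ls ! i]) = single i 0 (e (ls ! i))" "rowm (\<lambda>_. i) (map e [ls ! i]) = single 0 i (e (ls ! i))"
    by (rule fsm_eqI, auto simp: ent_colm ent_rowm ent_single)+
  \<comment> \<open>The second index map enumerates the positions other than \<open>i\<close> in
    increasing order.\<close>
  have "bip S e ls [ls ! i] (take i ls @ drop (Suc i) ls) (colm (\<lambda>_. i) (map e [ls ! i])) (rowm (\<lambda>_. i) (map e [ls ! i]))
    (colm (\<lambda>q. if q < i then q else Suc q) (map e (take i ls @ drop (Suc i) ls)))
    (rowm (\<lambda>q. if q < i then q else Suc q) (map e (take i ls @ drop (Suc i) ls)))"
  proof (rule bipI_index)
    fix k
    show "k < length ls \<longleftrightarrow> (\<exists>p<length [ls ! i]. k = i) \<or>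
       (\<exists>q<length (take i ls @ drop (Suc i) ls). k = (if q < i then q else Suc q))" (is "_ \<longleftrightarrow> _ \<or> (\<exists>q<?n. ?P q)")
    proof
      assume k: "k < length ls"
      show "(\<exists>p<length [ls ! i]. k = i) \<or> (\<exists>q<?n. ?P q)"
      proof (cases k i rule: linorder_cases)
        case less then show ?thesis using i by (intro disjI2 exI[of _ k]) auto
      next
        case equal then show ?thesis by simp
      next
        case greater then show ?thesis using i k by (intro disjI2 exI[of _ "k - 1"]) auto
      qed
    qed (use i in \<open>auto split: if_splits\<close>)
  next
    fix q assume "q < length (take i ls @ drop (Suc i) ls)"
    then show "ls ! (if q < i then q else Suc q) = (take i ls @ drop (Suc i) ls) ! q"
      using i by (auto simp: nth_append)
  qed (use i in \<open>auto simp: inj_on_def split: if_splits\<close>)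
  then show ?thesis unfolding s by blast
qed

lemma bip_sym: "bip S e ls ms ns a a' c c' \<Longrightarrow> bip S e ls ns ms c c' a a'"
  by (auto simp: bip_def add.commute)

lemma isum_sym: "isum S e W T U \<Longrightarrow> isum S e W U T"
  unfolding isum_def by (metis bip_sym add.commute)

lemma isum_dsm: "iscx S e T \<Longrightarrow> isum S e (dsm e T U) T U"
  unfolding isum_def
  apply (rule exI[of _ "ob (src T)"], rule exI[of _ "ob (src T)"],
      rule exI[of _ "sft e (length (src T)) (src U)"], rule exI[of _ "sft' e (length (src T)) (src U)"],
      rule exI[of _ "ob (tgt T)"], rule exI[of _ "ob (tgt T)"],
      rule exI[of _ "sft e (length (tgt T)) (tgt U)"], rule exI[of _ "sft' e (length (tgt T)) (tgt U)"])
  using bip_append by (simp add: dsm_def hom_r[OF iscx_dif] hom_l[OF iscx_dif] mult.assoc)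

text \<open>Homotopy equivalences of the summands, moved by the inclusions and projections, add up
  to one of the sums. With identities on the summands it compares two presentations of the same
  sum.\<close>

lemma isum_iso:
  assumes WTU: "isum S e W T U" and W'TU: "isum S e W' T' U'" and T: "iso S e T T'" and U: "iso S e U U'"
    and cx: "iscx S e T" "iscx S e T'" "iscx S e U" "iscx S e U'"
  shows "iso S e W W'"
proof -
  from WTU obtain a a' c c' b b' g g' where 
    1: "bip S e (src W) (src T) (src U) a a' c c'" and 2: "bip S e (tgt W) (tgt T) (tgt U) b b' g g'"
    and d: "dif W = b * dif T * a' + g * dif U * c'" unfolding isum_def by auto
  from W'TU obtain A A' C C' B B' G G' where 
    3: "bip S e (src W') (src T') (src U') A A' C C'" and 4: "bip S e (tgt W') (tgt T') (tgt U') B B' G G'"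
    and d': "dif W' = B * dif T' * A' + G * dif U' * C'" unfolding isum_def by auto
  from T obtain f1 f0 g1 g0 h k where 5:
    "f1 \<in> Hom (src T) (src T')" "f0 \<in> Hom (tgt T) (tgt T')" "g1 \<in> Hom (src T') (src T)" "g0 \<in> Hom (tgt T') (tgt T)"
    "h \<in> Hom (tgt T) (src T)" "k \<in> Hom (tgt T') (src T')" and eq5: "dif T' * f1 = f0 * dif T" "dif T * g1 = g0 * dif T'"
    "g1 * f1 = ob (src T) + h * dif T" "g0 * f0 = ob (tgt T) + dif T * h"
    "f1 * g1 = ob (src T') + k * dif T'" "f0 * g0 = ob (tgt T') + dif T' * k" by (rule isoE)
  from U obtain p1 p0 q1 q0 l m where 6:
    "p1 \<in> Hom (src U) (src U')" "p0 \<in> Hom (tgt U) (tgt U')" "q1 \<in> Hom (src U') (src U)" "q0 \<in> Hom (tgt U') (tgt U)"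
    "l \<in> Hom (tgt U) (src U)" "m \<in> Hom (tgt U') (src U')" and eq6: "dif U' * p1 = p0 * dif U" "dif U * q1 = q0 * dif U'"
    "q1 * p1 = ob (src U) + l * dif U" "q0 * p0 = ob (tgt U) + dif U * l"
    "p1 * q1 = ob (src U') + m * dif U'" "p0 * q0 = ob (tgt U') + dif U' * m" by (rule isoE)
  note D = cx[THEN iscx_dif]
  have h1: "a \<in> Hom (src T) (src W)" "a' \<in> Hom (src W) (src T)" "c \<in> Hom (src U) (src W)" "c' \<in> Hom (src W) (src U)"
    and e1: "a' * a = ob (src T)" "c' * c = ob (src U)" "a' * c = 0" "c' * a = 0" and o1: "ob (src W) = a * a' + c * c'"
    using 1 unfolding bip_def by auto
  have h2: "b \<in> Hom (tgt T) (tgt W)" "b' \<in> Hom (tgt W) (tgt T)" "g \<in> Hom (tgt U) (tgt W)" "g' \<in> Hom (tgt W) (tgt U)"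
    and e2: "b' * b = ob (tgt T)" "g' * g = ob (tgt U)" "b' * g = 0" "g' * b = 0" and o2: "ob (tgt W) = b * b' + g * g'"
    using 2 unfolding bip_def by auto
  have h3: "A \<in> Hom (src T') (src W')" "A' \<in> Hom (src W') (src T')" "C \<in> Hom (src U') (src W')" "C' \<in> Hom (src W') (src U')"
    and e3: "A' * A = ob (src T')" "C' * C = ob (src U')" "A' * C = 0" "C' * A = 0" and o3: "ob (src W') = A * A' + C * C'"
    using 3 unfolding bip_def by auto
  have h4: "B \<in> Hom (tgt T') (tgt W')" "B' \<in> Hom (tgt W') (tgt T')" "G \<in> Hom (tgt U') (tgt W')" "G' \<in> Hom (tgt W') (tgt U')"
    and e4: "B' * B = ob (tgt T')" "G' * G = ob (tgt U')" "B' * G = 0" "G' * B = 0" and o4: "ob (tgt W') = B * B' + G * G'"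
    using 4 unfolding bip_def by auto
  note HH = 5 6 D h1 h2 h3 h4
  note E = eq5 eq6 e1 e2 e3 e4
  note R = E E[THEN assoc2] HH[THEN hom_r] HH[THEN hom_r2] HH[THEN hom_l] HH[THEN hom_l2] mult.assoc distrib_left distrib_right
  have m: "X * f * Y \<in> Hom l1 l4" if "f \<in> Hom l2 l3" "Y \<in> Hom l1 l2" "X \<in> Hom l3 l4" for X Y f l1 l2 l3 l4
    using that by blast
  show ?thesis
    apply (rule isoI[of "A * f1 * a' + C * p1 * c'" _ _ "B * f0 * b' + G * p0 * g'" "a * g1 * A' + c * q1 * C'"
       "b * g0 * B' + g * q0 * G'" "a * h * b' + c * l * g'" "A * k * B' + C * m * G'"])
    using HH apply (blast intro: m)+
    by (simp_all add: d d' R o1 o2 o3 o4)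
qed

text \<open>Gaussian elimination: when the component \<open>b' * dif W * a\<close> between two equal
  labels is invertible, both labels cancel and the rest of the differential becomes its Schur
  complement.\<close>

lemma pivot_iso:
  assumes cx: "dif W \<in> Hom (src W) (tgt W)"
    and 1: "bip S e (src W) [x] ls a a' c c'" and 2: "bip S e (tgt W) [x] ms b b' g g'"
    and v: "v \<in> Hom [x] [x]" "v * (b' * dif W * a) = ob [x]" "b' * dif W * a * v = ob [x]"
  shows "iso S e W (Cx ls ms (g' * dif W * c - g' * dif W * a * v * b' * dif W * c))"
    "g' * dif W * c - g' * dif W * a * v * b' * dif W * c \<in> Hom ls ms"
proof -
  have h1: "a \<in> Hom [x] (src W)" "a' \<in> Hom (src W) [x]" "c \<in> Hom ls (src W)" "c' \<in> Hom (src W) ls"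
    and e1: "a' * a = ob [x]" "c' * c = ob ls" "a' * c = 0" "c' * a = 0" and o1: "ob (src W) = a * a' + c * c'"
    using 1 unfolding bip_def by auto
  have h2: "b \<in> Hom [x] (tgt W)" "b' \<in> Hom (tgt W) [x]" "g \<in> Hom ms (tgt W)" "g' \<in> Hom (tgt W) ms"
    and e2: "b' * b = ob [x]" "g' * g = ob ms" "b' * g = 0" "g' * b = 0" and o2: "ob (tgt W) = b * b' + g * g'"
    using 2 unfolding bip_def by auto
  define d where "d = dif W"
  have d: "d \<in> Hom (src W) (tgt W)" using cx by (simp add: d_def)
  have v2: "v * (b' * (d * a)) = ob [x]" "b' * (d * (a * v)) = ob [x]" using v by (simp_all add: d_def mult.assoc)
  have v3: "v * (b' * (d * (a * y))) = ob [x] * y" "b' * (d * (a * (v * y))) = ob [x] * y" for y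
    using arg_cong[OF v2(1), of "\<lambda>z. z * y"] arg_cong[OF v2(2), of "\<lambda>z. z * y"] by (simp_all add: mult.assoc)
  note HH = h1 h2 d v(1)
  have cc: "c * (c' * y) = ob (src W) * y - a * (a' * y)" for y by (simp add: o1 distrib_right mult.assoc)
  have gg: "g * (g' * y) = ob (tgt W) * y - b * (b' * y)" for y by (simp add: o2 distrib_right mult.assoc)
  have cc': "c * c' = ob (src W) - a * a'" by (simp add: o1)
  have gg': "g * g' = ob (tgt W) - b * b'" by (simp add: o2)
  note E = e1 e2
  note R = E E[THEN assoc2] HH[THEN hom_r] HH[THEN hom_r2] HH[THEN hom_l] HH[THEN hom_l2] mult.assoc distrib_left distrib_right
    left_diff_distrib right_diff_distrib cc gg cc' gg' v2 v3
  show H: "g' * dif W * c - g' * dif W * a * v * b' * dif W * c \<in> Hom ls ms"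
    unfolding d_def[symmetric] using HH by (intro hom_diff hom_mul) auto
  have avb: "a * v * b' \<in> Hom (tgt W) (src W)" using HH by blast
  \<comment> \<open>Only the large complex needs a homotopy, namely minus the inverse pivot; the
    composite on the reduced complex is strictly the identity.\<close>
  show "iso S e W (Cx ls ms (g' * dif W * c - g' * dif W * a * v * b' * dif W * c))"
    unfolding d_def[symmetric]
    apply (rule isoI[of "c'" _ _ "g' - g' * d * a * v * b'" "c - a * v * b' * d * c" g "- (a * v * b')" 0])
    using HH avb apply (simp_all add: d_def[symmetric])
    apply ((intro hom_diff hom_mul hom_neg; simp)+)[2]
    by (simp_all add: R hom_neg avb)
qed

section \<open>Retracts, sums of families and presilting\<close>

lemma summand_isum:
  assumes "isum S e W T U" "iscx S e T" "iscx S e U"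
  shows "summand S e T W"
proof -
  from assms(1) obtain a a' c c' b b' g g' where 
    1: "bip S e (src W) (src T) (src U) a a' c c'" and 2: "bip S e (tgt W) (tgt T) (tgt U) b b' g g'"
    and d: "dif W = b * dif T * a' + g * dif U * c'" unfolding isum_def by auto
  note D = assms(2,3)[THEN iscx_dif]
  have h1: "a \<in> Hom (src T) (src W)" "a' \<in> Hom (src W) (src T)"
    and e1: "a' * a = ob (src T)" "c' * a = 0" using 1 unfolding bip_def by auto
  have h2: "b \<in> Hom (tgt T) (tgt W)" "b' \<in> Hom (tgt W) (tgt T)"
    and e2: "b' * b = ob (tgt T)" "b' * g = 0" using 2 unfolding bip_def by auto
  have "dif W * a = b * dif T" "b' * dif W = dif T * a'"
    unfolding d using e1 e2 e1[THEN assoc2] e2[THEN assoc2] D h1 h2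
    by (simp_all add: distrib_left distrib_right mult.assoc hom_simps)
  then show ?thesis using e1 e2 h1 h2 unfolding summand_def
    by (intro exI[of _ a] exI[of _ a'] exI[of _ b] exI[of _ b'] conjI)
qed

lemma summand_trans:
  assumes "summand S e T U" "summand S e U D" shows "summand S e T D"
proof -
  from assms(1) obtain i p j q where 1: "i \<in> Hom (src T) (src U)" "p \<in> Hom (src U) (src T)"
     "j \<in> Hom (tgt T) (tgt U)" "q \<in> Hom (tgt U) (tgt T)" and eq1: "p * i = ob (src T)" "q * j = ob (tgt T)"
     "dif U * i = j * dif T" "q * dif U = dif T * p" unfolding summand_def by blast
  from assms(2) obtain i' p' j' q' where 2: "i' \<in> Hom (src U) (src D)" "p' \<in> Hom (src D) (src U)"
     "j' \<in> Hom (tgt U) (tgt D)" "q' \<in> Hom (tgt D) (tgt U)" and eq2: "p' * i' = ob (src U)" "q' * j' = ob (tgt U)"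
     "dif D * i' = j' * dif U" "q' * dif D = dif U * p'" unfolding summand_def by blast
  note E = eq1 eq2
  note R = E E[THEN assoc2] 1[THEN hom_r] 1[THEN hom_l] 2[THEN hom_r] 2[THEN hom_l] 1[THEN hom_r2] 1[THEN hom_l2] mult.assoc
  show ?thesis unfolding summand_def
    by (rule exI[of _ "i' * i"], rule exI[of _ "p * p'"], rule exI[of _ "j' * j"], rule exI[of _ "q * q'"])
       (use 1 2 in \<open>auto simp: R\<close>)
qed

lemma iscx_zcx: "iscx S e zcx"
  by (simp add: iscx_def zcx_def)

lemma iscx_dsm: "iscx S e T \<Longrightarrow> iscx S e U \<Longrightarrow> iscx S e (dsm e T U)"
proof -
  assume T: "iscx S e T" and U: "iscx S e U"
  from isum_dsm[OF T, of U] obtain a a' c c' b b' g g' where 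
    "bip S e (src (dsm e T U)) (src T) (src U) a a' c c'" "bip S e (tgt (dsm e T U)) (tgt T) (tgt U) b b' g g'"
    and d: "dif (dsm e T U) = b * dif T * a' + g * dif U * c'" unfolding isum_def by auto
  then have "dif (dsm e T U) \<in> Hom (src (dsm e T U)) (tgt (dsm e T U))"
    unfolding d bip_def using iscx_dif[OF T] iscx_dif[OF U] by (intro hom_add hom_mul) blast+
  then show ?thesis using T U by (auto simp: iscx_def dsm_def)
qed

lemma dsms_simps [simp]: "dsms e [] = zcx" "dsms e (T # Ts) = dsm e T (dsms e Ts)"
  by (simp_all add: dsms_def)

lemma iscx_dsms: "(\<And>T. T \<in> set Ts \<Longrightarrow> iscx S e T) \<Longrightarrow> iscx S e (dsms e Ts)"
  by (induction Ts) (auto intro: iscx_zcx iscx_dsm)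

lemma iso_dsms:
  assumes "\<And>T. T \<in> set Ts \<Longrightarrow> iscx S e T \<and> iscx S e (f T) \<and> iso S e T (f T)"
  shows "iso S e (dsms e Ts) (dsms e (map f Ts))"
  using assms
proof (induction Ts)
  case Nil then show ?case by (simp add: iso_refl iscx_zcx)
next
  case (Cons T Ts)
  have "iscx S e U" if "U \<in> set Ts" for U using Cons.prems[of U] that by simp
  then have "iscx S e (dsms e Ts)" by (rule iscx_dsms)
  moreover have "iscx S e U" if "U \<in> set (map f Ts)" for U
    using Cons.prems that by auto
  then have "iscx S e (dsms e (map f Ts))" by (rule iscx_dsms)
  moreover have "iso S e (dsms e Ts) (dsms e (map f Ts))" using Cons by simp
  ultimately show ?case using Cons.prems[of T]
    by (simp add: isum_iso[OF isum_dsm isum_dsm])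
qed

lemma summand_dsms: "(\<And>T. T \<in> set Ts \<Longrightarrow> iscx S e T) \<Longrightarrow> T \<in> set Ts \<Longrightarrow> summand S e T (dsms e Ts)"
proof (induction Ts)
  case (Cons U Ts)
  have cx: "iscx S e U" "iscx S e (dsms e Ts)" using Cons.prems(1) by (auto intro: iscx_dsms)
  show ?case
  proof (cases "T = U")
    case True then show ?thesis using summand_isum[OF isum_dsm] cx by simp
  next
    case False
    then have "summand S e T (dsms e Ts)" using Cons by simp
    moreover have "summand S e (dsms e Ts) (dsm e U (dsms e Ts))"
      using summand_isum[OF isum_sym[OF isum_dsm]] cx by simp
    ultimately show ?thesis using summand_trans by simp
  qed
qed simp

lemma src_tgt_dsms: "T \<in> set Ts \<Longrightarrow> set (src T) \<subseteq> set (src (dsms e Ts))" "T \<in> set Ts \<Longrightarrow> set (tgt T) \<subseteq> set (tgt (dsms e Ts))"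
  by (induction Ts) (auto simp: dsm_def)

text \<open>Vanishing of maps to the shift passes from \<open>D\<close> to pairs of retracts:
  \<open>g\<close> is extended to \<open>D\<close> as \<open>j' * g * p\<close>, and the solution
  found there is compressed back.\<close>

lemma presil_summands:
  assumes D: "presil S e D" and T: "summand S e T D" and U: "summand S e U D" and g: "g \<in> Hom (src T) (tgt U)"
  shows "\<exists>a\<in>Hom (src T) (src U). \<exists>b\<in>Hom (tgt T) (tgt U). g = dif U * a + b * dif T"
proof -
  from T obtain i p j q where 1: "i \<in> Hom (src T) (src D)" "p \<in> Hom (src D) (src T)"
     "j \<in> Hom (tgt T) (tgt D)" "q \<in> Hom (tgt D) (tgt T)" and eq1: "p * i = ob (src T)" "q * j = ob (tgt T)"
     "dif D * i = j * dif T" "q * dif D = dif T * p" unfolding summand_def by blast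
  from U obtain i' p' j' q' where 2: "i' \<in> Hom (src U) (src D)" "p' \<in> Hom (src D) (src U)"
     "j' \<in> Hom (tgt U) (tgt D)" "q' \<in> Hom (tgt D) (tgt U)" and eq2: "p' * i' = ob (src U)" "q' * j' = ob (tgt U)"
     "dif D * i' = j' * dif U" "q' * dif D = dif U * p'" unfolding summand_def by blast
  have "j' * g * p \<in> Hom (src D) (tgt D)" using 1 2 g by blast
  with D obtain a b where a: "a \<in> Hom (src D) (src D)" and b: "b \<in> Hom (tgt D) (tgt D)" and ab: "j' * g * p = dif D * a + b * dif D"
    unfolding presil_def by blast
  have "g = q' * (j' * g * p) * i"
    using g eq1 eq2 eq1[THEN assoc2] eq2[THEN assoc2] by (simp add: mult.assoc hom_simps)
  also have "\<dots> = dif U * (p' * a * i) + (q' * b * j) * dif T"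
    unfolding ab using eq1 eq2 eq1[THEN assoc2] eq2[THEN assoc2]
    by (simp add: distrib_left distrib_right mult.assoc)
  finally have "g = dif U * (p' * a * i) + (q' * b * j) * dif T" .
  moreover have "p' * a * i \<in> Hom (src T) (src U)" "q' * b * j \<in> Hom (tgt T) (tgt U)"
    using 1 2 a b by (blast intro: hom_mul)+
  ultimately show ?thesis by blast
qed

lemma presil_iso:
  assumes T: "presil S e T" and i: "iso S e T U" and cx: "iscx S e T" "iscx S e U" shows "presil S e U"
  unfolding presil_def
proof
  fix g assume g: "g \<in> Hom (src U) (tgt U)"
  from i obtain f1 f0 g1 g0 h k where 1:
    "f1 \<in> Hom (src T) (src U)" "f0 \<in> Hom (tgt T) (tgt U)" "g1 \<in> Hom (src U) (src T)" "g0 \<in> Hom (tgt U) (tgt T)"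
    "h \<in> Hom (tgt T) (src T)" "k \<in> Hom (tgt U) (src U)" and eq1: "dif U * f1 = f0 * dif T" "dif T * g1 = g0 * dif U"
    "g1 * f1 = ob (src T) + h * dif T" "g0 * f0 = ob (tgt T) + dif T * h"
    "f1 * g1 = ob (src U) + k * dif U" "f0 * g0 = ob (tgt U) + dif U * k" by (rule isoE)
  have "g0 * g * f1 \<in> Hom (src T) (tgt T)" using 1 g by blast
  with T obtain a b where a: "a \<in> Hom (src T) (src T)" and b: "b \<in> Hom (tgt T) (tgt T)" and ab: "g0 * g * f1 = dif T * a + b * dif T"
    unfolding presil_def by blast
  note d = cx[THEN iscx_dif]
  \<comment> \<open>This is \<open>(1 + d k) g (1 + k d)\<close> expanded, \<open>d\<close> being
    the differential of \<open>U\<close>. All terms other than \<open>g\<close> are themselves of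
    the form \<open>d a + b d\<close> and move to the other side.\<close>
  have "f0 * (g0 * g * f1) * g1 = g + dif U * (k * g) + dif U * (k * (g * (k * dif U))) + g * (k * dif U)"
    using g eq1(5,6) eq1(5,6)[THEN assoc2] 1 by (simp add: mult.assoc hom_simps distrib_left distrib_right)
  moreover have "f0 * (g0 * g * f1) * g1 = dif U * (f1 * a * g1) + (f0 * b * g0) * dif U"
    unfolding ab using eq1(1,2) eq1(1,2)[THEN assoc2] by (simp add: distrib_left distrib_right mult.assoc)
  ultimately have "g = dif U * (f1 * a * g1 - k * g - k * g * k * dif U) + (f0 * b * g0 - g * k) * dif U"
    by (simp add: algebra_simps)
  moreover have "f1 * a * g1 - k * g - k * g * k * dif U \<in> Hom (src U) (src U)" "f0 * b * g0 - g * k \<in> Hom (tgt U) (tgt U)"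
    using 1 a b g d by (blast intro: hom_diff hom_mul)+
  ultimately show "\<exists>a\<in>Hom (src U) (src U). \<exists>b\<in>Hom (tgt U) (tgt U). g = dif U * a + b * dif U" by blast
qed

lemma ind_iso: "ind S e T \<Longrightarrow> iso S e T U \<Longrightarrow> iscx S e U \<Longrightarrow> ind S e U"
  unfolding ind_def by (meson iso_sym iso_trans)

lemma family_map:
  assumes F: "family S e Ts" and f: "\<And>T. T \<in> set Ts \<Longrightarrow> iscx S e (f T) \<and> iso S e T (f T)"
  shows "family S e (map f Ts)"
proof -
  have cx: "iscx S e T" if "T \<in> set Ts" for T using F that by (simp add: family_def ind_def)
  have "presil S e (dsms e (map f Ts))"
    by (rule presil_iso[of "dsms e Ts"]) (use F f cx in \<open>auto simp: family_def intro!: iso_dsms iscx_dsms\<close>)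
  moreover have "\<not> iso S e (map f Ts ! i) (map f Ts ! j)" if "i < length Ts" "j < length Ts" "i \<noteq> j" for i j
  proof
    assume "iso S e (map f Ts ! i) (map f Ts ! j)"
    then have "iso S e (f (Ts ! i)) (f (Ts ! j))" using that by simp
    then have "iso S e (Ts ! i) (Ts ! j)" using f that by (meson iso_sym iso_trans nth_mem)
    then show False using F that by (simp add: family_def)
  qed
  moreover have "ind S e (f T)" if "T \<in> set Ts" for T
    using ind_iso[of T "f T"] f[OF that] F that by (simp add: family_def)
  ultimately show ?thesis unfolding family_def by simp
qed

end

section \<open>Minimal complexes over an elementary algebra of rank two\<close>

text \<open>Products of \<open>n\<close> elements of \<open>J\<close> closed off by
  \<open>u\<close>, which stands for the unit of the algebra. These are single products, not the
  ideal they generate; nilpotency of \<open>J\<close> reads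
  \<open>pw J u m \<subseteq> {0}\<close>.\<close>

primrec pw :: "'r::ring set \<Rightarrow> 'r \<Rightarrow> nat \<Rightarrow> 'r set" where
  "pw J u 0 = {u}"
| "pw J u (Suc n) = {j * y | j y. j \<in> J \<and> y \<in> pw J u n}"

definition radl :: "'r set \<Rightarrow> (nat \<Rightarrow> 'r \<Rightarrow> 'k::zero) \<Rightarrow> 'r set" where
  "radl S \<phi> = {s \<in> S. \<phi> 1 s = 0 \<and> \<phi> 2 s = 0}"

locale elem2 = idem_ring S e + vector_space sc
  for S :: "'r::ring set" and e and sc :: "'k::field \<Rightarrow> 'r \<Rightarrow> 'r" +
  fixes \<phi> :: "nat \<Rightarrow> 'r \<Rightarrow> 'k"
  assumes sc_l: "sc c (x * y) = sc c x * y" and sc_r: "sc c (x * y) = x * sc c y"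
    and Ssc: "x \<in> S \<Longrightarrow> sc c x \<in> S"
    and unit_l: "x \<in> S \<Longrightarrow> (e 1 + e 2) * x = x" and unit_r: "x \<in> S \<Longrightarrow> x * (e 1 + e 2) = x"
    and orth: "e 1 * e 2 = 0" "e 2 * e 1 = 0"
    and phi_add: "i \<in> {1, 2} \<Longrightarrow> x \<in> S \<Longrightarrow> y \<in> S \<Longrightarrow> \<phi> i (x + y) = \<phi> i x + \<phi> i y"
    and phi_mul: "i \<in> {1, 2} \<Longrightarrow> x \<in> S \<Longrightarrow> y \<in> S \<Longrightarrow> \<phi> i (x * y) = \<phi> i x * \<phi> i y"
    and phi_sc: "i \<in> {1, 2} \<Longrightarrow> x \<in> S \<Longrightarrow> \<phi> i (sc c x) = c * \<phi> i x"
    and phi_e: "i \<in> {1, 2} \<Longrightarrow> j \<in> {1, 2} \<Longrightarrow> \<phi> i (e j) = (if i = j then 1 else 0)"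
    and nil: "\<exists>m. pw (radl S \<phi>) (e 1 + e 2) m \<subseteq> {0}"
begin

abbreviation "J \<equiv> radl S \<phi>"
abbreviation "\<Phi> i \<equiv> fmap (\<phi> i)"

lemma phi_0: "i \<in> {1, 2} \<Longrightarrow> \<phi> i 0 = 0"
proof -
  assume "i \<in> {1, 2}"
  then have "\<phi> i 0 + \<phi> i 0 = \<phi> i 0 + 0" using phi_add[of i 0 0] S0 by simp
  then show ?thesis by (rule add_left_imp_eq)
qed

lemma phi_uminus: "i \<in> {1, 2} \<Longrightarrow> x \<in> S \<Longrightarrow> \<phi> i (- x) = - \<phi> i x"
  using phi_add[of i x "- x"] Sneg[of x] phi_0[of i] by (simp add: eq_neg_iff_add_eq_0 add.commute)

lemma phi_diff: "i \<in> {1, 2} \<Longrightarrow> x \<in> S \<Longrightarrow> y \<in> S \<Longrightarrow> \<phi> i (x - y) = \<phi> i x - \<phi> i y"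
  using phi_add[of i x "- y"] phi_uminus[of i y] Sneg[of y] by simp

lemma J_S: "j \<in> J \<Longrightarrow> j \<in> S"
  by (simp add: radl_def)

lemma J_ideal: "j \<in> J \<Longrightarrow> s \<in> S \<Longrightarrow> s * j \<in> J" "j \<in> J \<Longrightarrow> s \<in> S \<Longrightarrow> j * s \<in> J"
  by (auto simp: radl_def Smul phi_mul)

text \<open>A chain of right ideals from \<open>S\<close> to zero along which right multiplication
  by \<open>J\<close> gains one step. It is what makes the approximation arguments for inverses and
  for Nakayama's lemma terminate.\<close>

definition filt :: "(nat \<Rightarrow> 'r set) \<Rightarrow> nat \<Rightarrow> bool" where
  "filt F m \<longleftrightarrow> F 0 = S \<and> F m = {0} \<and> (\<forall>n. F n \<subseteq> S) \<and> (\<forall>n. subspace (F n)) \<and>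
    (\<forall>n. \<forall>x\<in>F n. \<forall>s\<in>S. x * s \<in> F n) \<and> (\<forall>n. \<forall>x\<in>F n. \<forall>j\<in>J. x * j \<in> F (Suc n))"

lemma filtD:
  assumes "filt F m"
  shows "F 0 = S" "F m = {0}" "F n \<subseteq> S" "subspace (F n)"
    "x \<in> F n \<Longrightarrow> s \<in> S \<Longrightarrow> x * s \<in> F n" "x \<in> F n \<Longrightarrow> j \<in> J \<Longrightarrow> x * j \<in> F (Suc n)"
  using assms unfolding filt_def by auto

text \<open>\<open>F n\<close> is the left annihilator of the products of \<open>m - n\<close>
  radical elements. Annihilators are subspaces at once, while the sets \<open>pw\<close> are not
  closed under sums.\<close>

lemma filtration: "\<exists>F m. filt F m"
proof -
  obtain m where m: "pw J (e 1 + e 2) m \<subseteq> {0}" using nil by blast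
  define F where "F n = {x \<in> S. \<forall>y\<in>pw J (e 1 + e 2) (m - n). x * y = 0}" for n
  have z: "F n = {0}" if "m \<le> n" for n
    using that unit_r S0 by (auto simp: F_def)
  have F0: "F 0 = S" using m by (auto simp: F_def)
  have sub: "subspace (F n)" for n
    by (rule subspaceI) (auto simp: F_def S0 Sadd Ssc distrib_right sc_l[symmetric])
  have r: "x * s \<in> F n" if x: "x \<in> F n" and s: "s \<in> S" for n x s
  proof (cases "m \<le> n")
    case True then show ?thesis using x z by simp
  next
    case False
    then have "m - n = Suc (m - n - 1)" by simp
    then obtain k where k: "m - n = Suc k" by blast
    have "x * s * y = 0" if y: "y \<in> pw J (e 1 + e 2) (m - n)" for y
    proof -
      obtain j y' where "y = j * y'" "j \<in> J" "y' \<in> pw J (e 1 + e 2) k" using y k by auto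
      \<comment> \<open>The factor \<open>s\<close> is absorbed by the first radical factor of
        \<open>y\<close>.\<close>
      then have "s * y \<in> pw J (e 1 + e 2) (m - n)" using J_ideal(1)[OF _ s] k by (auto simp: mult.assoc[symmetric])
      then show ?thesis using x by (simp add: F_def mult.assoc)
    qed
    then show ?thesis using x s by (simp add: F_def Smul)
  qed
  have j: "x * j \<in> F (Suc n)" if x: "x \<in> F n" and j: "j \<in> J" for n x j
  proof (cases "m \<le> n")
    case True then show ?thesis using x z by simp
  next
    case False
    then have k: "m - n = Suc (m - Suc n)" by simp
    have "x * j * y = 0" if "y \<in> pw J (e 1 + e 2) (m - Suc n)" for y
    proof -
      have "j * y \<in> pw J (e 1 + e 2) (m - n)" unfolding k using j that by auto
      then show ?thesis using x by (simp add: F_def mult.assoc)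
    qed
    then show ?thesis using x j by (simp add: F_def Smul J_S)
  qed
  have "filt F m" unfolding filt_def
  proof (intro conjI allI ballI)
    show "F m = {0}" by (simp add: z)
    show "F n \<subseteq> S" for n by (auto simp: F_def)
  qed (simp_all add: F0 sub r j)
  then show ?thesis by blast
qed

lemma idem_J: "f \<in> J \<Longrightarrow> f * f = f \<Longrightarrow> f = 0"
proof -
  assume f: "f \<in> J" "f * f = f"
  obtain F m where F: "filt F m"
    using filtration by blast
  have "f \<in> F n" for n
  proof (induction n)
    case 0 then show ?case using f(1) filtD(1)[OF F] J_S by simp
  next
    case (Suc n)
    from filtD(6)[OF F this f(1)] show ?case by (simp add: f(2))
  qed
  then show "f = 0" using filtD(2)[OF F] by blast
qed

lemma J_0: "0 \<in> J"
  by (simp add: radl_def S0 phi_0)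

lemma J_uminus: "j \<in> J \<Longrightarrow> - j \<in> J"
  by (simp add: radl_def Sneg phi_uminus)

lemma J_add: "j \<in> J \<Longrightarrow> j' \<in> J \<Longrightarrow> j + j' \<in> J"
  by (simp add: radl_def Sadd phi_add)

lemma mats_prod:
  assumes "A \<in> mats X" "B \<in> mats Y" and "0 \<in> Z" "\<And>x y. x \<in> Z \<Longrightarrow> y \<in> Z \<Longrightarrow> x + y \<in> Z"
    "\<And>x y. x \<in> X \<Longrightarrow> y \<in> Y \<Longrightarrow> x * y \<in> Z"
  shows "A * B \<in> mats Z"
proof (rule matsI)
  fix i j
  obtain n where n: "\<forall>i j. n \<le> i \<or> n \<le> j \<longrightarrow> ent A i j = 0" "\<forall>i j. n \<le> i \<or> n \<le> j \<longrightarrow> ent B i j = 0"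
    using common_bound[of A B B] by blast
  have s: "(\<Sum>k<l. ent A i k * ent B k j) \<in> Z" for l
    by (induction l) (use assms in \<open>auto simp: matsD\<close>)
  have "ent (A * B) i j = (\<Sum>k<n. ent A i k * ent B k j)" by (rule ent_times) (use n in simp)
  then show "ent (A * B) i j \<in> Z" using s by simp
qed

text \<open>Successive approximation: if \<open>E\<close> is the error of \<open>W\<close>, then
  \<open>W - E\<close> has error \<open>- (E * N)\<close>, which lies one step deeper in the
  filtration.\<close>

lemma one_plus_J_left_inverse:
  assumes N: "N \<in> Hom ls ls" "N \<in> mats J"
  shows "\<exists>W\<in>Hom ls ls. W * (ob ls + N) = ob ls"
proof -
  obtain F m where F: "filt F m"
    using filtration by blast
  have "\<exists>W\<in>Hom ls ls. W * (ob ls + N) - ob ls \<in> mats (F n)" for n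
  proof (induction n)
    case 0
    show ?case by (rule bexI[of _ 0]) (simp_all add: filtD(1)[OF F] mats_lin ob_mats)
  next
    case (Suc n)
    then obtain W where W: "W \<in> Hom ls ls" "W * (ob ls + N) - ob ls \<in> mats (F n)" by blast
    define E where "E = W * (ob ls + N) - ob ls"
    have E: "E \<in> Hom ls ls" unfolding E_def using W N by (intro hom_diff hom_mul hom_add) auto
    have "E * N \<in> mats (F (Suc n))"
      using W(2) unfolding E_def[symmetric]
      by (rule mats_prod[OF _ N(2)]) (use filtD(4)[OF F] filtD(6)[OF F] in \<open>auto simp: subspace_0 subspace_add\<close>)
    moreover have "(W - E) * (ob ls + N) - ob ls = - (E * N)"
      using E by (simp add: left_diff_distrib distrib_left hom_r E_def[symmetric])
         (simp add: E_def algebra_simps)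
    ultimately have "(W - E) * (ob ls + N) - ob ls \<in> mats (F (Suc n))"
      using subspace_neg[OF filtD(4)[OF F]] by (simp add: mats_def)
    then show ?case using W(1) E by blast
  qed
  then obtain W where "W \<in> Hom ls ls" "W * (ob ls + N) - ob ls \<in> mats {0}" using filtD(2)[OF F] by metis
  moreover from this(2) have "W * (ob ls + N) - ob ls = 0" by (intro fsm_eqI) (simp add: mats_def)
  ultimately show ?thesis by auto
qed

text \<open>A left inverse \<open>W\<close> equals the identity minus \<open>W * N\<close>, so it
  has the same shape and a left inverse of its own, which must be the given matrix.\<close>

lemma one_plus_J_inverse:
  assumes N: "N \<in> Hom ls ls" "N \<in> mats J"
  shows "\<exists>W\<in>Hom ls ls. W * (ob ls + N) = ob ls \<and> (ob ls + N) * W = ob ls"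
proof -
  obtain W where W: "W \<in> Hom ls ls" "W * (ob ls + N) = ob ls"
    using one_plus_J_left_inverse[OF N] by blast
  have WN: "W * N \<in> mats J"
    by (rule mats_prod[OF hom_mats[OF W(1)] N(2)]) (auto intro: J_0 J_add J_ideal)
  have W': "W = ob ls + - (W * N)" using W by (simp add: distrib_left hom_r algebra_simps)
  have "- (W * N) \<in> Hom ls ls" "- (W * N) \<in> mats J"
    using W(1) N WN J_uminus by (auto simp: mats_def intro: hom_neg hom_mul)
  from one_plus_J_left_inverse[OF this] W' obtain V where V: "V \<in> Hom ls ls" "V * W = ob ls" by auto
  have oN: "ob ls + N \<in> Hom ls ls" using N by blast
  have "V = V * (W * (ob ls + N))" using W V by (simp add: hom_r)
  also have "\<dots> = ob ls + N" using V(2) oN by (simp add: mult.assoc[symmetric] hom_l)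
  finally show ?thesis using V(2) W by blast
qed

lemma Phi_mul: "i \<in> {1, 2} \<Longrightarrow> A \<in> mats S \<Longrightarrow> B \<in> mats S \<Longrightarrow> \<Phi> i (A * B) = \<Phi> i A * \<Phi> i B"
  by (rule fmap_times[of _ S]) (simp_all add: phi_0 phi_add phi_mul S0 Sadd Smul)

lemma Phi_add: "i \<in> {1, 2} \<Longrightarrow> A \<in> mats S \<Longrightarrow> B \<in> mats S \<Longrightarrow> \<Phi> i (A + B) = \<Phi> i A + \<Phi> i B"
  by (rule fmap_add[of _ S]) (simp_all add: phi_0 phi_add)

lemma Phi_ob: "i \<in> {1, 2} \<Longrightarrow> set ls \<subseteq> {1, 2} \<Longrightarrow> \<Phi> i (ob ls) = diag (map (\<lambda>l. if l = i then 1 else 0) ls)"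
  unfolding obj_def by (subst fmap_diag) (auto simp: phi_0 phi_e subset_iff intro!: arg_cong[of _ _ diag])

lemma Phi_ob_un: "i \<in> {1, 2} \<Longrightarrow> set ls \<subseteq> {i} \<Longrightarrow> \<Phi> i (ob ls) = un (length ls)"
  by (subst Phi_ob) (auto simp: un_def subset_iff intro!: arg_cong[of _ _ diag] nth_equalityI dest: nth_mem)

lemma mats_J_iff: "A \<in> mats J \<longleftrightarrow> A \<in> mats S \<and> \<Phi> 1 A = 0 \<and> \<Phi> 2 A = 0"
proof
  assume "A \<in> mats J"
  then show "A \<in> mats S \<and> \<Phi> 1 A = 0 \<and> \<Phi> 2 A = 0"
    by (auto simp: mats_def radl_def ent_fmap phi_0 intro!: fsm_eqI)
next
  assume A: "A \<in> mats S \<and> \<Phi> 1 A = 0 \<and> \<Phi> 2 A = 0"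
  then have "ent (\<Phi> 1 A) i j = 0" "ent (\<Phi> 2 A) i j = 0" for i j by simp_all
  then have "\<phi> 1 (ent A i j) = 0" "\<phi> 2 (ent A i j) = 0" for i j by (simp_all add: ent_fmap phi_0)
  then show "A \<in> mats J" using A by (simp add: mats_def radl_def)
qed

lemma hom_ent:
  assumes f: "f \<in> Hom ls ms"
  shows "ent f p q \<in> S" "p < length ms \<Longrightarrow> e (ms ! p) * ent f p q = ent f p q"
    "q < length ls \<Longrightarrow> ent f p q * e (ls ! q) = ent f p q"
    "\<not> p < length ms \<Longrightarrow> ent f p q = 0" "\<not> q < length ls \<Longrightarrow> ent f p q = 0"
proof -
  show "ent f p q \<in> S" using hom_mats[OF f] by (rule matsD)
  have 1: "ent (ob ms * f) p q = ent f p q" "ent (f * ob ls) p q = ent f p q" using f by (simp_all add: hom_simps)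
  show "p < length ms \<Longrightarrow> e (ms ! p) * ent f p q = ent f p q" "\<not> p < length ms \<Longrightarrow> ent f p q = 0"
    using 1(1) by (simp_all add: obj_def ent_diag_times)
  show "q < length ls \<Longrightarrow> ent f p q * e (ls ! q) = ent f p q" "\<not> q < length ls \<Longrightarrow> ent f p q = 0"
    using 1(2) by (simp_all add: obj_def ent_times_diag)
qed

lemma homI_ent:
  assumes "\<And>p q. ent f p q \<in> S" "\<And>p q. p < length ms \<Longrightarrow> e (ms ! p) * ent f p q = ent f p q"
    "\<And>p q. q < length ls \<Longrightarrow> ent f p q * e (ls ! q) = ent f p q"
    "\<And>p q. length ms \<le> p \<Longrightarrow> ent f p q = 0" "\<And>p q. length ls \<le> q \<Longrightarrow> ent f p q = 0"
  shows "f \<in> Hom ls ms"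
  unfolding hom_def obj_def using assms
  by (auto intro!: matsI fsm_eqI simp: ent_diag_times ent_times_diag not_less)

lemma single_mul: "single p q a * single q r b = single p r (a * b :: 'r)"
  by (rule fsm_eqI) (auto simp: ent_single_times ent_single)

lemma ob_single: "ob [i] = single 0 0 (e i)"
  by (rule fsm_eqI) (auto simp: obj_def ent_diag ent_single)

lemma single_hom: "s \<in> S \<Longrightarrow> e j * s = s \<Longrightarrow> s * e i = s \<Longrightarrow> p < length ms \<Longrightarrow> ms ! p = j \<Longrightarrow>
    q < length ls \<Longrightarrow> ls ! q = i \<Longrightarrow> single p q s \<in> Hom ls ms"
  by (rule homI_ent) (auto simp: ent_single S0)

text \<open>The corner at \<open>e i\<close> is local: after division by \<open>\<phi> i s\<close>
  the element differs from \<open>e i\<close> by a radical element. It is treated as a 1 by 1 matrix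
  so that the inversion of matrices applies.\<close>

lemma unit1:
  assumes i: "i \<in> {1, 2}" and s: "s \<in> S" "e i * s = s" "s * e i = s" "\<phi> i s \<noteq> 0"
  shows "\<exists>v\<in>Hom [i] [i]. v * single 0 0 s = ob [i] \<and> single 0 0 s * v = ob [i]"
proof -
  define c where "c = 1 / \<phi> i s"
  define N where "N = single 0 0 (sc c s - e i)"
  define \<gamma> where "\<gamma> = single 0 0 (sc c (e i))"
  have es: "e i * sc c s = sc c s" "sc c s * e i = sc c s" using s by (metis sc_r, metis sc_l)
  have ec: "e i * sc c (e i) = sc c (e i)" "sc c (e i) * e i = sc c (e i)" using ee by (metis sc_r, metis sc_l)
  have N1: "N \<in> Hom [i] [i]" unfolding N_def
    by (rule single_hom[where i = i and j = i]) (use s es in \<open>auto simp: Sdiff Ssc eS ee left_diff_distrib right_diff_distrib\<close>)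
  have "\<phi> j (sc c s - e i) = 0" if j: "j \<in> {1, 2}" for j
  proof (cases "j = i")
    case True then show ?thesis using s j by (simp add: phi_diff Ssc eS phi_sc phi_e c_def)
  next
    case False
    have "\<phi> j s = \<phi> j (e i * s)" using s by simp
    also have "\<dots> = 0" using j i False s(1) phi_mul[OF j eS s(1), of i] phi_e[OF j i] by simp
    finally show ?thesis using s j i False by (simp add: phi_diff Ssc eS phi_sc phi_e)
  qed
  then have "sc c s - e i \<in> J" using s by (auto simp: radl_def Sdiff Ssc eS)
  then have N2: "N \<in> mats J" by (auto simp: N_def mats_def ent_single J_0)
  have oN: "ob [i] + N = single 0 0 (sc c s)" unfolding N_def ob_single by (rule fsm_eqI) (simp add: ent_single)
  have comm: "\<gamma> * single 0 0 s = single 0 0 (sc c s)" "single 0 0 s * \<gamma> = single 0 0 (sc c s)"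
    using s by (simp_all add: \<gamma>_def single_mul sc_l[symmetric] sc_r[symmetric])
  obtain W where W: "W \<in> Hom [i] [i]" "W * single 0 0 (sc c s) = ob [i]" "single 0 0 (sc c s) * W = ob [i]"
    using one_plus_J_inverse[OF N1 N2] unfolding oN by blast
  have g: "\<gamma> \<in> Hom [i] [i]" unfolding \<gamma>_def
    by (rule single_hom[where i = i and j = i]) (use ec in \<open>auto simp: Ssc eS\<close>)
  have l: "W * \<gamma> * single 0 0 s = ob [i]" using W comm by (simp add: mult.assoc)
  have r: "single 0 0 s * (\<gamma> * W) = ob [i]" using W comm by (simp add: mult.assoc[symmetric])
  have h: "W * \<gamma> \<in> Hom [i] [i]" "\<gamma> * W \<in> Hom [i] [i]" using W g by blast+
  have "W * \<gamma> = W * \<gamma> * (single 0 0 s * (\<gamma> * W))" using r h by (simp add: hom_r)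
  also have "\<dots> = \<gamma> * W" using arg_cong[OF l, of "\<lambda>z. z * (\<gamma> * W)"] h(2) by (simp only: mult.assoc hom_l)
  finally show ?thesis using l r h by metis
qed

lemma unit_elem:
  assumes i: "i \<in> {1, 2}" and s: "s \<in> S" "e i * s = s" "s * e i = s" "\<phi> i s \<noteq> 0"
  shows "\<exists>t\<in>S. e i * t = t \<and> t * e i = t \<and> t * s = e i \<and> s * t = e i"
proof -
  obtain v where v: "v \<in> Hom [i] [i]" "v * single 0 0 s = ob [i]" "single 0 0 s * v = ob [i]"
    using unit1[OF assms] by blast
  have "ent (v * single 0 0 s) 0 0 = e i" "ent (single 0 0 s * v) 0 0 = e i"
    using v(2,3) by (simp_all add: ob_single ent_single)
  then show ?thesis using hom_ent[OF v(1), of 0 0]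
    by (intro bexI[of _ "ent v 0 0"]) (simp_all add: ent_times_single ent_single_times)
qed

section \<open>Minimal complexes and their labels\<close>

definition minl :: "'r cx \<Rightarrow> bool" where
  "minl T \<longleftrightarrow> iscx S e T \<and> dif T \<in> mats J"

text \<open>The character \<open>\<phi> i\<close> kills the other idempotent, so it detects only
  entries from a label \<open>i\<close> to a label \<open>i\<close>.\<close>

lemma phi_label:
  assumes f: "f \<in> Hom ls ms" and i: "i \<in> {1, 2}" and ls: "set ls \<subseteq> {1, 2}" "set ms \<subseteq> {1, 2}" and nz: "\<phi> i (ent f p q) \<noteq> 0"
  shows "p < length ms" "q < length ls" "ms ! p = i" "ls ! q = i"
proof -
  show p: "p < length ms" and q: "q < length ls" using nz hom_ent(4,5)[OF f] phi_0[OF i] by metis+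
  have l: "ms ! p \<in> {1, 2}" "ls ! q \<in> {1, 2}" using p q ls nth_mem by blast+
  have "\<phi> i (ent f p q) = \<phi> i (e (ms ! p)) * \<phi> i (ent f p q)"
    "\<phi> i (ent f p q) = \<phi> i (ent f p q) * \<phi> i (e (ls ! q))"
    using hom_ent[OF f] p q i by (metis phi_mul eS)+
  then show "ms ! p = i" "ls ! q = i" using nz i l by (simp_all add: phi_e split: if_splits)
qed

lemma nth_split_counts:
  assumes "i < length ls"
  shows "set (take i ls @ drop (Suc i) ls) \<subseteq> set ls"
    "count_list ls x = count_list (take i ls @ drop (Suc i) ls) x + (if x = ls ! i then 1 else 0)"
    "length ls = Suc (length (take i ls @ drop (Suc i) ls))"
proof -
  have "ls = take i ls @ ls ! i # drop (Suc i) ls" using assms by (rule id_take_nth_drop)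
  then have "count_list ls x = count_list (take i ls @ ls ! i # drop (Suc i) ls) x" by simp
  then show "count_list ls x = count_list (take i ls @ drop (Suc i) ls) x + (if x = ls ! i then 1 else 0)"
    by (simp del: append_take_drop_id)
  show "set (take i ls @ drop (Suc i) ls) \<subseteq> set ls" by (auto dest: in_set_takeD in_set_dropD)
qed (use assms in simp)

text \<open>An entry of the differential outside the radical joins two equal labels and is
  invertible there, so a pivot cancels the pair. The g-vector loses the same label in both degrees
  and does not change.\<close>

lemma minimize:
  "iscx S e T \<Longrightarrow> \<exists>T'. minl T' \<and> iso S e T T' \<and> gv T' = gv T"
proof (induction "length (src T)" arbitrary: T rule: less_induct)
  case less
  show ?case
  proof (cases "dif T \<in> mats J")
    case True
    then have "minl T \<and> iso S e T T \<and> gv T = gv T" using less.prems iso_refl by (simp add: minl_def)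
    then show ?thesis by blast
  next
    case False
    have d: "dif T \<in> Hom (src T) (tgt T)" and lab: "set (src T) \<subseteq> {1, 2}" "set (tgt T) \<subseteq> {1, 2}"
      using less.prems by (auto simp: iscx_def)
    from False obtain p q where "ent (dif T) p q \<notin> J" by (auto simp: mats_def)
    then obtain i where i: "i \<in> {1, 2}" and nz: "\<phi> i (ent (dif T) p q) \<noteq> 0"
      using hom_ent(1)[OF d] by (auto simp: radl_def)
    note L = phi_label[OF d i lab nz]
    obtain c c' where 1: "bip S e (src T) [i] (take q (src T) @ drop (Suc q) (src T)) (single q 0 (e i)) (single 0 q (e i)) c c'"
      using bip_nth[of q "src T"] L by auto
    obtain g g' where 2: "bip S e (tgt T) [i] (take p (tgt T) @ drop (Suc p) (tgt T)) (single p 0 (e i)) (single 0 p (e i)) g g'"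
      using bip_nth[of p "tgt T"] L by auto
    have en: "e i * ent (dif T) p q = ent (dif T) p q" "ent (dif T) p q * e i = ent (dif T) p q"
      using hom_ent(2)[OF d, of p q] hom_ent(3)[OF d, of q p] L by auto
    have s: "single 0 p (e i) * dif T * single q 0 (e i) = single 0 0 (ent (dif T) p q)"
      by (rule fsm_eqI) (auto simp: ent_times_single ent_single_times ent_single en)
    obtain v where v: "v \<in> Hom [i] [i]" "v * single 0 0 (ent (dif T) p q) = ob [i]" "single 0 0 (ent (dif T) p q) * v = ob [i]"
      using unit1[OF i hom_ent(1)[OF d] en nz] by blast
    define T' where "T' = Cx (take q (src T) @ drop (Suc q) (src T)) (take p (tgt T) @ drop (Suc p) (tgt T))
       (g' * dif T * c - g' * dif T * single q 0 (e i) * v * single 0 p (e i) * dif T * c)"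
    note P = pivot_iso[OF d 1 2 v(1), unfolded s, OF v(2,3)]
    note cq = nth_split_counts[OF L(2)] and cp = nth_split_counts[OF L(1)]
    have cx': "iscx S e T'" using P(2) lab cq(1) cp(1) unfolding T'_def iscx_def cx_sel by blast
    have "length (src T') < length (src T)" using cq(3) by (simp add: T'_def del: append_take_drop_id)
    from less.hyps[OF this cx'] obtain T'' where T'': "minl T''" "iso S e T' T''" "gv T'' = gv T'" by blast
    have "gv T' = gv T"
      using cq(2)[of 1] cq(2)[of 2] cp(2)[of 1] cp(2)[of 2] L(3,4)
      by (simp add: gv_def T'_def del: append_take_drop_id)
    moreover have "iso S e T T'" using P(1) unfolding T'_def .
    ultimately have "minl T'' \<and> iso S e T T'' \<and> gv T'' = gv T" using T'' iso_trans[of T T' T''] by simp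
    then show ?thesis by blast
  qed
qed

lemma Phi_ob_eq_0:
  assumes "\<Phi> 1 (ob ls) = 0" "\<Phi> 2 (ob ls) = 0" "set ls \<subseteq> {1, 2}"
  shows "ls = []"
proof (rule ccontr)
  assume "ls \<noteq> []"
  then have l: "0 < length ls" by simp
  then have "ls ! 0 \<in> set ls" by (rule nth_mem)
  then have l: "0 < length ls" "ls ! 0 \<in> {1, 2}" using assms(3) l by blast+
  then have "ent (\<Phi> (ls ! 0) (ob ls)) 0 0 = 1" using assms(3) by (simp add: Phi_ob ent_diag)
  moreover have "\<Phi> (ls ! 0) (ob ls) = 0" using l assms by auto
  ultimately show False by simp
qed

lemma Phi_mul_0: "i \<in> {1, 2} \<Longrightarrow> A \<in> mats J \<Longrightarrow> B \<in> mats S \<Longrightarrow> \<Phi> i (A * B) = 0"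
   "i \<in> {1, 2} \<Longrightarrow> A \<in> mats J \<Longrightarrow> B \<in> mats S \<Longrightarrow> \<Phi> i (B * A) = 0"
  by (auto simp: Phi_mul mats_J_iff)

text \<open>A contraction writes the identities as \<open>- h * d\<close> and
  \<open>d * (- h)\<close>, which vanish modulo the radical when \<open>d\<close> does; the identity
  of a nonempty list does not.\<close>

lemma minl_iso_zero:
  assumes "minl T" "iso S e T zcx"
  shows "src T = []" "tgt T = []"
proof -
  have lab: "set (src T) \<subseteq> {1, 2}" "set (tgt T) \<subseteq> {1, 2}" and d: "dif T \<in> mats J"
    using assms(1) by (auto simp: minl_def iscx_def)
  from assms(2) obtain f1 f0 g1 g0 h k where
    f: "f1 \<in> Hom (src T) []" "f0 \<in> Hom (tgt T) []" and h: "h \<in> Hom (tgt T) (src T)" and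
    E: "g1 * f1 = ob (src T) + h * dif T" "g0 * f0 = ob (tgt T) + dif T * h"
    by (elim isoE) (auto simp: zcx_def)
  have "ob [] = 0" by (rule fsm_eqI) (simp add: obj_def ent_diag)
  then have "f1 = 0" "f0 = 0" using f[THEN hom_l] by simp_all
  with E have e: "ob (src T) = - h * dif T" "ob (tgt T) = dif T * (- h)"
    by (simp_all add: eq_neg_iff_add_eq_0)
  have h': "- h \<in> mats S" using h hom_mats hom_neg by blast
  show "src T = []" by (rule Phi_ob_eq_0) (use e(1) Phi_mul_0(2)[OF _ d h'] lab in auto)
  show "tgt T = []" by (rule Phi_ob_eq_0) (use e(2) Phi_mul_0(1)[OF _ d h'] lab in auto)
qed

text \<open>If a label occurs in both degrees, the map that is \<open>e i\<close> between two
  occurrences does not vanish modulo the radical, whereas every \<open>d a + b d\<close>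
  does.\<close>

lemma presil_disjoint:
  assumes D: "minl D" "presil S e D"
  shows "set (src D) \<inter> set (tgt D) = {}"
proof (rule ccontr)
  assume "set (src D) \<inter> set (tgt D) \<noteq> {}"
  then obtain q p where qp: "q < length (src D)" "p < length (tgt D)" "src D ! q = tgt D ! p"
    by (metis disjoint_iff in_set_conv_nth)
  define i where "i = tgt D ! p"
  have lab: "set (src D) \<subseteq> {1, 2}" "set (tgt D) \<subseteq> {1, 2}" and d: "dif D \<in> mats J"
    using D(1) by (auto simp: minl_def iscx_def)
  then have i: "i \<in> {1, 2}" using qp i_def nth_mem by blast
  have "single p q (e i) \<in> Hom (src D) (tgt D)"
    by (rule single_hom[where i = i and j = i]) (use qp in \<open>auto simp: eS ee i_def\<close>)
  with D(2) obtain a b where a: "a \<in> Hom (src D) (src D)" and b: "b \<in> Hom (tgt D) (tgt D)"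
    and ab: "single p q (e i) = dif D * a + b * dif D" unfolding presil_def by blast
  have "\<Phi> i (single p q (e i)) = 0"
    unfolding ab using Phi_mul_0[OF i d] a b d i
    by (subst Phi_add) (auto simp: hom_mats mats_J_iff intro!: mats_mul)
  moreover have "ent (\<Phi> i (single p q (e i))) p q = 1"
    using i by (simp add: ent_fmap phi_0 ent_single phi_e)
  ultimately show False by simp
qed

text \<open>Lifts a scalar matrix to one between copies of a single label; \<open>\<Phi> l\<close>
  takes it back.\<close>

definition lft :: "nat \<Rightarrow> 'k fsm \<Rightarrow> 'r fsm" where
  "lft l P = fmap (\<lambda>c. sc c (e l)) P"

lemma lft_hom:
  assumes "set ls \<subseteq> {l}" "set ms \<subseteq> {l}" "un (length ms) * P = P" "P * un (length ls) = P"
  shows "lft l P \<in> Hom ls ms"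
proof -
  have "ms ! p = l" if "p < length ms" for p using that assms nth_mem by blast
  moreover have "ls ! p = l" if "p < length ls" for p using that assms nth_mem by blast
  ultimately show ?thesis
    using assms(3,4)
    by (intro homI_ent) (auto simp: lft_def ent_fmap Ssc eS sc_l[symmetric] sc_r[symmetric] ee un_times_iff times_un_iff)
qed

lemma Phi_lft: "l \<in> {1, 2} \<Longrightarrow> \<Phi> l (lft l P) = P"
  by (rule fsm_eqI) (simp add: lft_def ent_fmap phi_0 phi_sc eS phi_e)

text \<open>Exchange step of Krull-Schmidt type: some entry of \<open>i\<close> is a unit, at a
  position \<open>q\<close>, so the image of \<open>i\<close> can replace the summand at
  \<open>q\<close>. The remaining labels then form a complement for the prescribed embedding
  \<open>i\<close> and retraction \<open>\<pi>\<close>.\<close>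

lemma exchange:
  assumes x: "x \<in> {1, 2}" and ls: "set ls \<subseteq> {1, 2}"
    and i: "i \<in> Hom [x] ls" and \<pi>: "\<pi> \<in> Hom ls [x]" and pi: "\<pi> * i = ob [x]"
  shows "\<exists>ns C C'. bip S e ls [x] ns i \<pi> C C' \<and> set ns \<subseteq> set ls \<and> length ls = Suc (length ns)"
proof -
  have "\<exists>q. \<phi> x (ent i q 0) \<noteq> 0"
  proof (rule ccontr)
    assume "\<not> ?thesis"
    then have "ent (\<Phi> x i) q 0 = 0" for q using x by (simp add: ent_fmap phi_0)
    moreover have "ent (\<Phi> x i) q r = 0" if "r \<noteq> 0" for q r
      using that x hom_ent(5)[OF i, of r q] by (simp add: ent_fmap phi_0)
    ultimately have "\<Phi> x i = 0" by (intro fsm_eqI) (metis ent_zero)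
    then have "\<Phi> x (\<pi> * i) = 0" using x i \<pi> by (simp add: Phi_mul hom_mats)
    moreover have "ent (\<Phi> x (ob [x])) 0 0 = 1" using x by (subst Phi_ob) (auto simp: ent_diag)
    ultimately show False using pi by simp
  qed
  then obtain q where nz: "\<phi> x (ent i q 0) \<noteq> 0" by blast
  note L = phi_label[OF i x _ ls nz]
  have q: "q < length ls" "ls ! q = x" using L(1,3) x by auto
  obtain c c' where B: "bip S e ls [x] (take q ls @ drop (Suc q) ls) (single q 0 (e x)) (single 0 q (e x)) c c'"
    using bip_nth[OF q(1)] q by auto
  define ns where "ns = take q ls @ drop (Suc q) ls"
  define a where "a = single q 0 (e x)"
  define a' where "a' = single 0 q (e x)"
  have en: "e x * ent i q 0 = ent i q 0" "ent i q 0 * e x = ent i q 0"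
    using hom_ent(2)[OF i, of q 0] hom_ent(3)[OF i, of 0 q] q by auto
  have ai: "a' * i = single 0 0 (ent i q 0)"
    unfolding a'_def by (rule fsm_eqI) (use hom_ent(5)[OF i] in \<open>auto simp: ent_single_times ent_single en\<close>)
  obtain w where w: "w \<in> Hom [x] [x]" "w * (a' * i) = ob [x]" "a' * i * w = ob [x]"
    using unit1[OF x hom_ent(1)[OF i] en nz] unfolding ai by blast
  have h: "a \<in> Hom [x] ls" "a' \<in> Hom ls [x]" "c \<in> Hom ns ls" "c' \<in> Hom ls ns"
    and E: "a' * a = ob [x]" "c' * c = ob ns" "a' * c = 0" "c' * a = 0" and o: "ob ls = a * a' + c * c'"
    using B unfolding bip_def a_def a'_def ns_def by auto
  have w2: "a' * (i * w) = ob [x]" using w(3) by (simp add: mult.assoc)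
  have w3: "w * (a' * (i * y)) = ob [x] * y" "a' * (i * (w * y)) = ob [x] * y" for y
    using arg_cong[OF w(2), of "\<lambda>z. z * y"] arg_cong[OF w2, of "\<lambda>z. z * y"] by (simp_all add: mult.assoc)
  have cc: "c * (c' * y) = ob ls * y - a * (a' * y)" for y by (simp add: o distrib_right mult.assoc)
  have cc': "c * c' = ob ls - a * a'" by (simp add: o)
  note HH = h i \<pi> w(1)
  note R = E E[THEN assoc2] HH[THEN hom_r] HH[THEN hom_r2] HH[THEN hom_l] HH[THEN hom_l2] mult.assoc distrib_left distrib_right
    left_diff_distrib right_diff_distrib cc cc' w(2) w2 w3 pi pi[THEN assoc2]
  \<comment> \<open>The old complement is corrected so that \<open>\<pi>\<close> kills its inclusion
    and its projection kills \<open>i\<close>; \<open>w\<close> inverts the unit entry.\<close>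
  have "bip S e ls [x] ns i \<pi> (c - i * \<pi> * c) (c' - c' * i * w * a')"
    unfolding bip_def
  proof (intro conjI)
    show "c - i * \<pi> * c \<in> Hom ns ls" "c' - c' * i * w * a' \<in> Hom ls ns" using HH by (intro hom_diff hom_mul; blast)+
    show "ob ls = i * \<pi> + (c - i * \<pi> * c) * (c' - c' * i * w * a')" by (simp add: R)
  qed (use HH in \<open>simp_all add: R\<close>)
  moreover have "set ns \<subseteq> set ls" "length ls = Suc (length ns)"
    unfolding ns_def using nth_split_counts[OF q(1)] by blast+
  ultimately show ?thesis by blast
qed

end

section \<open>Triangular algebras\<close>

locale tri2 = elem2 S e sc \<phi>
  for S :: "'r::ring set" and e and sc :: "'k::field \<Rightarrow> 'r \<Rightarrow> 'r" and \<phi> +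
  assumes tri: "s \<in> S \<Longrightarrow> e 2 * s * e 1 = 0"
begin

definition X :: "'r set" where "X = {s \<in> S. e 1 * s = s \<and> s * e 2 = s}"
definition B :: "'r set" where "B = {s \<in> S. e 2 * s = s \<and> s * e 2 = s}"

lemma hom_J: "f \<in> Hom ls ms \<Longrightarrow> set ls \<subseteq> {1, 2} \<Longrightarrow> set ms \<subseteq> {1, 2} \<Longrightarrow> set ls \<inter> set ms = {} \<Longrightarrow> f \<in> mats J"
proof (rule matsI)
  fix p q assume f: "f \<in> Hom ls ms" and l: "set ls \<subseteq> {1, 2}" "set ms \<subseteq> {1, 2}" and d: "set ls \<inter> set ms = {}"
  have "\<phi> i (ent f p q) = 0" if i: "i \<in> {1, 2}" for i
  proof (rule ccontr)
    assume "\<phi> i (ent f p q) \<noteq> 0"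
    from phi_label[OF f i l this] have "i \<in> set ls" "i \<in> set ms" by (metis nth_mem)+
    then show False using d by blast
  qed
  then show "ent f p q \<in> J" using hom_ent(1)[OF f] by (simp add: radl_def)
qed

text \<open>Between different labels only maps from label 2 to label 1 survive triangularity, with
  entries in \<open>X\<close>. A complex with disjoint labels and nonzero differential therefore has
  all its labels fixed, and its g-vector lies in the fourth quadrant.\<close>

lemma hom_eq_0: "f \<in> Hom ls ms \<Longrightarrow> set ls \<subseteq> {1, 2} \<Longrightarrow> set ms \<subseteq> {1, 2} \<Longrightarrow> set ls \<inter> set ms = {} \<Longrightarrow>
    2 \<notin> set ls \<or> 1 \<notin> set ms \<Longrightarrow> f = 0"
proof (rule fsm_eqI)
  fix p q assume f: "f \<in> Hom ls ms" and l: "set ls \<subseteq> {1, 2}" "set ms \<subseteq> {1, 2}" and d: "set ls \<inter> set ms = {}"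
    and n: "2 \<notin> set ls \<or> 1 \<notin> set ms"
  show "ent f p q = ent 0 p q"
  proof (cases "p < length ms \<and> q < length ls")
    case True
    then have m: "ms ! p \<in> set ms" "ls ! q \<in> set ls" by auto
    then have "ms ! p \<in> {1, 2}" "ls ! q \<in> {1, 2}" using l by (simp_all add: subset_iff)
    moreover have "ms ! p \<noteq> ls ! q" using m d by (metis IntI empty_iff)
    moreover have "\<not> (ls ! q = 2 \<and> ms ! p = 1)" using m n by metis
    ultimately have "ms ! p = 2 \<and> ls ! q = 1" by auto
    then have "e 2 * ent f p q = ent f p q" "ent f p q * e 1 = ent f p q"
      using hom_ent(2)[OF f, of p q] hom_ent(3)[OF f, of q p] True by auto
    then show ?thesis using tri[OF hom_ent(1)[OF f, of p q]] by simp
  next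
    case False
    then show ?thesis using hom_ent(4,5)[OF f] by auto
  qed
qed

lemma eqpart: "s \<in> S \<Longrightarrow> e 1 * s * e 2 \<in> X" "s \<in> S \<Longrightarrow> e 2 * s * e 2 \<in> B"
  using ee by (auto simp: X_def B_def Smul eS mult.assoc) (metis mult.assoc)+

lemma B_decomp: "b \<in> B \<Longrightarrow> \<exists>j\<in>J. j \<in> B \<and> b = sc (\<phi> 2 b) (e 2) + j"
proof -
  assume b: "b \<in> B"
  define j where "j = b - sc (\<phi> 2 b) (e 2)"
  have ec: "e 2 * sc c (e 2) = sc c (e 2)" "sc c (e 2) * e 2 = sc c (e 2)" for c
    using ee by (metis sc_r, metis sc_l)
  have jB: "j \<in> B" using b ec by (auto simp: j_def B_def Sdiff Ssc eS right_diff_distrib left_diff_distrib)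
  have "\<phi> 2 j = 0" using b by (simp add: j_def B_def phi_diff Ssc eS phi_sc phi_e)
  moreover have "\<phi> 1 j = \<phi> 1 (e 2) * \<phi> 1 j" using jB phi_mul[of 1 "e 2" j] eS by (simp add: B_def)
  then have "\<phi> 1 j = 0" by (simp add: phi_e)
  ultimately have "j \<in> J" using jB by (simp add: radl_def B_def)
  then show ?thesis using jB by (intro bexI[of _ j]) (simp_all add: j_def)
qed

lemma B_add: "x \<in> B \<Longrightarrow> y \<in> B \<Longrightarrow> x + y \<in> B"
  by (simp add: B_def Sadd distrib_left distrib_right)

lemma B_sc: "x \<in> B \<Longrightarrow> sc c x \<in> B"
  by (simp add: B_def Ssc sc_l[symmetric] sc_r[symmetric])

lemma B_mul: "x \<in> B \<Longrightarrow> y \<in> B \<Longrightarrow> x * y \<in> B"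
  by (simp add: B_def Smul mult.assoc) (simp add: mult.assoc[symmetric])

lemma B_e2: "e 2 \<in> B" by (simp add: B_def eS ee)

lemma B_0: "0 \<in> B" by (simp add: B_def S0)

text \<open>Its span is the radical of \<open>X\<close> as a right module over the corner
  \<open>B\<close>; the generators are kept as bare products.\<close>

definition XJ :: "'r set" where "XJ = {x * j | x j. x \<in> X \<and> j \<in> J \<and> j \<in> B}"

text \<open>Nakayama: a generator of \<open>X\<close> modulo \<open>XJ\<close> generates \<open>X\<close>; the case \<open>x = 0\<close> says that \<open>X = XJ\<close> forces \<open>X = 0\<close>.\<close>
lemma nakayama:
  assumes x: "x \<in> X" and gen: "X \<subseteq> span (insert x XJ)" and z: "z \<in> X"
  shows "\<exists>b\<in>B. z = x * b"
proof -
  obtain F m where F: "filt F m" using filtration by blast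
  \<comment> \<open>Multiples of \<open>x\<close> reach every \<open>z\<close> up to an error in
    \<open>F n\<close>. A generator \<open>w * j\<close> of the radical gains a step because the
    error of \<open>w\<close> is multiplied by \<open>j\<close>.\<close>
  have "\<forall>z\<in>X. \<exists>b\<in>B. z - x * b \<in> F n" for n
  proof (induction n)
    case 0
    show ?case
    proof
      fix z assume "z \<in> X"
      then show "\<exists>b\<in>B. z - x * b \<in> F 0" using B_0 by (intro bexI[of _ 0]) (auto simp: filtD(1)[OF F] X_def)
    qed
  next
    case (Suc n)
    show ?case
    proof
      fix z assume "z \<in> X"
      then have "z \<in> span (insert x XJ)" using gen by blast
      then show "\<exists>b\<in>B. z - x * b \<in> F (Suc n)"
      proof (induction rule: span_induct_alt)
        case base
        show ?case using B_0 subspace_0[OF filtD(4)[OF F]] by (intro bexI[of _ 0]) auto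
      next
        case (step c u y)
        then obtain b where b: "b \<in> B" "y - x * b \<in> F (Suc n)" by blast
        have "\<exists>b'\<in>B. u - x * b' \<in> F (Suc n)"
        proof (cases "u = x")
          case True
          then show ?thesis using B_e2 x subspace_0[OF filtD(4)[OF F]]
            by (intro bexI[of _ "e 2"]) (auto simp: X_def)
        next
          case False
          then obtain w j where w: "u = w * j" "w \<in> X" "j \<in> J" "j \<in> B" using step by (auto simp: XJ_def)
          obtain b' where b': "b' \<in> B" "w - x * b' \<in> F n" using Suc w by blast
          have "(w - x * b') * j \<in> F (Suc n)" using filtD(6)[OF F b'(2) w(3)] .
          then show ?thesis using b' w by (intro bexI[of _ "b' * j"]) (auto simp: B_mul left_diff_distrib mult.assoc)
        qed
        then obtain b' where b': "b' \<in> B" "u - x * b' \<in> F (Suc n)" by blast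
        have "sc c u + y - x * (sc c b' + b) = sc c (u - x * b') + (y - x * b)"
          by (simp add: distrib_left scale_right_diff_distrib sc_r)
        moreover have "\<dots> \<in> F (Suc n)"
          using b b' filtD(4)[OF F] by (intro subspace_add subspace_scale)
        ultimately have "sc c u + y - x * (sc c b' + b) \<in> F (Suc n)" by (simp only:)
        moreover have "sc c b' + b \<in> B" using b b' by (simp add: B_add B_sc)
        ultimately show ?case by blast
      qed
    qed
  qed
  from this[of m] z filtD(2)[OF F] show ?thesis by auto
qed

lemma not_subset_XJ:
  assumes "z \<in> X" "z \<noteq> 0"
  shows "\<exists>x\<in>X. x \<notin> span XJ"
proof (rule ccontr)
  assume "\<not> ?thesis"
  then have "X \<subseteq> span XJ" by blast
  then have "X \<subseteq> span (insert 0 XJ)" by simp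
  then obtain b where "z = 0 * b" using nakayama[of 0 z] assms S0 by (auto simp: X_def)
  then show False using assms by simp
qed

lemma functional:
  assumes "independent B0" "v \<in> B0"
  shows "\<exists>f. (\<forall>a b. f (a + b) = f a + f b) \<and> (\<forall>c a. f (sc c a) = c * f a) \<and> f v = (1 :: 'k) \<and> (\<forall>b\<in>B0. b \<noteq> v \<longrightarrow> f b = 0)"
proof -
  interpret k: vector_space "(*) :: 'k \<Rightarrow> 'k \<Rightarrow> 'k" by unfold_locales (auto simp: algebra_simps)
  interpret P: vector_space_pair sc "(*) :: 'k \<Rightarrow> 'k \<Rightarrow> 'k" ..
  from P.linear_independent_extend[OF assms(1), of "\<lambda>b. if b = v then 1 else 0"]
  obtain g where g: "Vector_Spaces.linear sc (*) g" "\<forall>b\<in>B0. g b = (if b = v then 1 else 0)" by blast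
  interpret g: Vector_Spaces.linear sc "(*)" g by (rule g(1))
  show ?thesis using g(2) assms(2) g.add g.scale by (intro exI[of _ g]) auto
qed

text \<open>A functional that kills \<open>XJ\<close> satisfies
  \<open>f (x * b) = f x * \<phi> 2 b\<close> on \<open>X\<close>, so applied entrywise it turns a
  factorisation through \<open>d\<close> into a product of scalar matrices.\<close>

lemma functional_mul:
  assumes f: "\<forall>a b. f (a + b) = f a + f b" "\<forall>c a. f (sc c a) = c * f a" "\<forall>b\<in>XJ. f b = (0 :: 'k)"
    and d: "d \<in> Hom ls ms" and a: "\<alpha> \<in> Hom [2] ls" and ls: "set ls \<subseteq> {2}" and ms: "set ms \<subseteq> {1}"
  shows "fmap f (d * \<alpha>) = fmap f d * \<Phi> 2 \<alpha>"
proof (rule fsm_eqI)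
  fix p r
  have xb: "f (x * b) = f x * \<phi> 2 b" if x: "x \<in> X" and b: "b \<in> B" for x b
  proof -
    obtain j where j: "j \<in> J" "j \<in> B" "b = sc (\<phi> 2 b) (e 2) + j" using B_decomp[OF b] by blast
    have "x * b = x * (sc (\<phi> 2 b) (e 2) + j)" by (subst j(3)) simp
    also have "\<dots> = sc (\<phi> 2 b) x + x * j" using x by (simp add: distrib_left sc_r[symmetric] X_def)
    finally have "f (x * b) = \<phi> 2 b * f x + f (x * j)" using f(1,2) by simp
    moreover have "x * j \<in> XJ" using x j by (auto simp: XJ_def)
    ultimately show ?thesis using f(3) by simp
  qed
  have f0: "f 0 = 0" using f(2)[rule_format, of 0 0] by simp
  have fs: "f (sum u I) = (\<Sum>i\<in>I. f (u i))" for u and I :: "nat set"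
    by (induction I rule: infinite_finite_induct) (simp_all add: f0 f(1))
  have m: "f (ent d p k * ent \<alpha> k r) = f (ent d p k) * \<phi> 2 (ent \<alpha> k r)" for k
  proof (cases "p < length ms \<and> k < length ls \<and> r < 1")
    case True
    then have l: "ms ! p = 1" "ls ! k = 2" using ls ms nth_mem by blast+
    have "ent d p k \<in> X" using hom_ent(1)[OF d, of p k] hom_ent(2)[OF d, of p k] hom_ent(3)[OF d, of k p] True l by (simp add: X_def)
    moreover have "ent \<alpha> k r \<in> B" using hom_ent(1)[OF a, of k r] hom_ent(2)[OF a, of k r] hom_ent(3)[OF a, of r k] True l by (simp add: B_def)
    ultimately show ?thesis by (rule xb)
  next
    case False
    then consider "\<not> p < length ms" | "\<not> k < length ls" | "\<not> r < length [2::nat]" by fastforce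
    then show ?thesis using hom_ent(4,5)[OF d] hom_ent(4,5)[OF a] f0 phi_0[of 2] by cases auto
  qed
  obtain n where n: "\<forall>i j. n \<le> i \<or> n \<le> j \<longrightarrow> ent d i j = 0" "\<forall>i j. n \<le> i \<or> n \<le> j \<longrightarrow> ent \<alpha> i j = 0"
    using common_bound[of d \<alpha> \<alpha>] by blast
  have "ent (fmap f (d * \<alpha>)) p r = f (\<Sum>k<n. ent d p k * ent \<alpha> k r)"
    using n by (simp add: ent_fmap f0 ent_times[of n])
  also have "\<dots> = (\<Sum>k<n. f (ent d p k) * \<phi> 2 (ent \<alpha> k r))" by (simp add: fs m)
  also have "\<dots> = ent (fmap f d * \<Phi> 2 \<alpha>) p r"
    using n by (subst ent_times[of n]) (simp_all add: ent_fmap f0 phi_0)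
  finally show "ent (fmap f (d * \<alpha>)) p r = ent (fmap f d * \<Phi> 2 \<alpha>) p r" .
qed

text \<open>If \<open>a\<close> columns generate \<open>X\<^sup>a\<close>, then \<open>X / XJ\<close> is at most one-dimensional: two independent functionals on it
  would make a \<open>2a \<times> a\<close> matrix over the field surjective.\<close>
lemma one_generator:
  assumes d: "d \<in> Hom ls ms" and ls: "set ls \<subseteq> {2}" and ms: "set ms \<subseteq> {1}" and len: "length ls = length ms" "0 < length ms"
    and surj: "\<And>c. c \<in> Hom [2] ms \<Longrightarrow> \<exists>\<alpha>\<in>Hom [2] ls. c = d * \<alpha>"
    and z: "z \<in> X" "z \<noteq> 0"
  shows "\<exists>x\<in>X. x \<noteq> 0 \<and> (\<forall>s\<in>X. \<exists>b\<in>B. s = x * b)"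
proof -
  obtain x where x: "x \<in> X" "x \<notin> span XJ" using not_subset_XJ[OF z] by blast
  have x0: "x \<noteq> 0" using x(2) span_zero by blast
  have "X \<subseteq> span (insert x XJ)"
  proof (rule ccontr)
    assume "\<not> ?thesis"
    then obtain y where y: "y \<in> X" "y \<notin> span (insert x XJ)" by blast
    obtain B0 where B0: "B0 \<subseteq> XJ" "independent B0" "XJ \<subseteq> span B0"
      using maximal_independent_subset[of XJ] by blast
    have sp: "span B0 = span XJ" using B0 by (metis span_mono span_span subset_antisym)
    have i1: "independent (insert x B0)" using x sp B0 by (simp add: independent_insertI)
    have "span (insert x B0) = span (insert x XJ)" using sp by (simp add: span_insert)
    then have i2: "independent (insert y (insert x B0))" using y i1 by (simp add: independent_insertI)
    have xy: "x \<noteq> y" "x \<notin> B0" "y \<notin> B0" using x y sp span_base[of _ B0] span_base[of x "insert x XJ"] span_mono[of XJ "insert x XJ"] by auto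
    \<comment> \<open>\<open>f\<close> and \<open>g\<close> are the coordinates of \<open>x\<close>
      and \<open>y\<close> in an independent set that also contains a basis of the span of
      \<open>XJ\<close>.\<close>
    obtain f where f: "\<forall>a b. f (a + b) = f a + f b" "\<forall>c a. f (sc c a) = c * f a" "f x = 1"
      "\<forall>b\<in>insert y (insert x B0). b \<noteq> x \<longrightarrow> f b = (0 :: 'k)" using functional[OF i2, of x] by auto
    obtain g where g: "\<forall>a b. g (a + b) = g a + g b" "\<forall>c a. g (sc c a) = c * g a" "g y = 1"
      "\<forall>b\<in>insert y (insert x B0). b \<noteq> y \<longrightarrow> g b = (0 :: 'k)" using functional[OF i2, of y] by auto
    have vanish: "\<forall>b\<in>XJ. h b = 0" if h: "\<forall>a b. h (a + b) = h a + h b" "\<forall>c a. h (sc c a) = c * h a"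
      "\<forall>b\<in>B0. h b = (0 :: 'k)" for h
    proof
      fix b assume "b \<in> XJ"
      then have "b \<in> span B0" using B0 by blast
      then show "h b = 0"
      proof (induction rule: span_induct_alt)
        case base show ?case using h(2)[rule_format, of 0 0] by simp
      qed (use h in simp)
    qed
    have fJ: "\<forall>b\<in>XJ. f b = 0" by (rule vanish) (use f xy in auto)
    have gJ: "\<forall>b\<in>XJ. g b = 0" by (rule vanish) (use g xy in auto)
    have f0: "f 0 = 0" "g 0 = 0" using f(2)[rule_format, of 0 0] g(2)[rule_format, of 0 0] by simp_all
    have col: "\<exists>\<alpha>\<in>Hom [2] ls. single q 0 v = d * \<alpha>" if "q < length ms" "v \<in> X" for q v
    proof (rule surj, rule single_hom[where j = 1 and i = 2])
      show "ms ! q = 1" using that ms nth_mem by blast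
    qed (use that in \<open>auto simp: X_def\<close>)
    define n where "n = length ms"
    have "\<forall>q. \<exists>\<alpha>. q < n \<longrightarrow> \<alpha> \<in> Hom [2] ls \<and> single q 0 x = d * \<alpha>" using col[OF _ x(1)] unfolding n_def by blast
    then obtain \<alpha> where \<alpha>: "\<And>q. q < n \<Longrightarrow> \<alpha> q \<in> Hom [2] ls \<and> single q 0 x = d * \<alpha> q" by metis
    \<comment> \<open>The columns of \<open>Q\<close> are the residues of the factors through which
      \<open>x\<close> in position \<open>q\<close> is obtained. Under \<open>f\<close> the matrix
      \<open>d\<close> times \<open>Q\<close> becomes the identity, under \<open>g\<close> it
      becomes zero.\<close>
    define Q where "Q = Fsm (\<lambda>k q. if k < n \<and> q < n then ent (\<Phi> 2 (\<alpha> q)) k 0 else 0)"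
    have Q: "ent Q k q = (if k < n \<and> q < n then ent (\<Phi> 2 (\<alpha> q)) k 0 else 0)" for k q
      unfolding Q_def by (subst ent_Fsm[of n]) auto
    have a0: "ent (\<Phi> 2 (\<alpha> q)) k 0 = 0" if "q < n" "\<not> k < n" for k q
      using hom_ent(4)[of "\<alpha> q" "[2]" ls k 0] \<alpha>[OF that(1)] that(2) len by (simp add: n_def ent_fmap phi_0)
    have hQ: "ent (M * Q) p q = (if q < n then ent (M * \<Phi> 2 (\<alpha> q)) p 0 else 0)" for M p q
    proof -
      have "ent (M * Q) p q = (\<Sum>k<n. ent M p k * ent Q k q)" by (rule ent_times) (simp add: Q)
      also have "\<dots> = (if q < n then (\<Sum>k<n. ent M p k * ent (\<Phi> 2 (\<alpha> q)) k 0) else 0)" by (simp add: Q)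
      also have "\<dots> = (if q < n then ent (M * \<Phi> 2 (\<alpha> q)) p 0 else 0)"
      proof (cases "q < n")
        case True
        then have "ent (M * \<Phi> 2 (\<alpha> q)) p 0 = (\<Sum>k<n. ent M p k * ent (\<Phi> 2 (\<alpha> q)) k 0)"
          by (intro ent_times) (simp add: a0)
        then show ?thesis by simp
      qed simp
      finally show ?thesis .
    qed
    have fa: "fmap f d * \<Phi> 2 (\<alpha> q) = fmap f (single q 0 x)" "fmap g d * \<Phi> 2 (\<alpha> q) = fmap g (single q 0 x)"
      if "q < n" for q
      using functional_mul[OF f(1,2) fJ d _ ls ms, of "\<alpha> q"] functional_mul[OF g(1,2) gJ d _ ls ms, of "\<alpha> q"] \<alpha>[OF that]
      by simp_all
    have fQ: "fmap f d * Q = un n"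
      by (rule fsm_eqI) (auto simp: hQ fa ent_un ent_fmap f0 ent_single f(3))
    have gQ: "fmap g d * Q = 0"
      by (rule fsm_eqI) (use g(4) xy in \<open>auto simp: hQ fa ent_fmap f0 ent_single\<close>)
    have un: "un n * fmap h d = fmap h d" "fmap h d * un n = fmap h d" if "h 0 = (0 :: 'k)" for h
      using hom_ent(4,5)[OF d] len that by (simp_all add: un_times_iff times_un_iff ent_fmap n_def)
    \<comment> \<open>Since \<open>d\<close> is square, \<open>Q\<close> is invertible, so
      \<open>g\<close> kills all entries of \<open>d\<close>. But \<open>y\<close> in position 0
      factors through \<open>d\<close>, and \<open>g y = 1\<close>.\<close>
    have "Q * fmap f d = un n"
      by (rule square_left_right_inverse) (use un f0 fQ in \<open>auto simp: un_times_iff times_un_iff Q\<close>)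
    then have g0: "fmap g d = 0" using gQ un(2)[of g] f0 by (metis mult.assoc mult_zero_left)
    obtain \<beta> where "\<beta> \<in> Hom [2] ls" "single 0 0 y = d * \<beta>" using col[OF len(2) y(1)] by blast
    then have "fmap g (single 0 0 y) = 0" using functional_mul[OF g(1,2) gJ d _ ls ms, of \<beta>] g0 by simp
    then have "ent (fmap g (single 0 0 y)) 0 0 = 0" by simp
    then show False using g(3) f0 by (simp add: ent_fmap ent_single)
  qed
  then show ?thesis using nakayama[OF x(1)] x x0 by blast
qed

end

text \<open>\<open>psi_mul\<close> is the rule for the off-diagonal entry of a product of upper
  triangular 2 by 2 matrices with diagonal entries \<open>\<phi> 1\<close> and
  \<open>\<phi> 2\<close>.\<close>

locale tri_alg = tri2 S e sc \<phi>
  for S :: "'r::ring set" and e and sc :: "'k::field \<Rightarrow> 'r \<Rightarrow> 'r" and \<phi> +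
  fixes x :: 'r and \<psi> :: "'r \<Rightarrow> 'k"
  assumes xX: "x \<in> S" "e 1 * x = x" "x * e 2 = x"
    and psi_add: "r \<in> S \<Longrightarrow> s \<in> S \<Longrightarrow> \<psi> (r + s) = \<psi> r + \<psi> s"
    and psi_mul: "r \<in> S \<Longrightarrow> s \<in> S \<Longrightarrow> \<psi> (r * s) = \<phi> 1 r * \<psi> s + \<psi> r * \<phi> 2 s"
    and psi_sc: "r \<in> S \<Longrightarrow> \<psi> (sc c r) = c * \<psi> r"
    and psi_e: "i \<in> {1, 2} \<Longrightarrow> \<psi> (e i) = 0"
    and psi_x: "\<psi> x = 1"

section \<open>The residue map attached to a generator of \<open>X\<close>\<close>

context tri2
begin

text \<open>Iterating the equation gives \<open>x = u * x * w\<close> with \<open>u\<close>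
  arbitrarily deep in the filtration.\<close>

lemma nilpotent_left:
  assumes x: "x \<in> X" and a: "a \<in> J" and c: "c \<in> S" and eq: "x = a * x * c"
  shows "x = 0"
proof -
  obtain F m where F: "filt F m" using filtration by blast
  have "\<exists>u\<in>F n. \<exists>w\<in>S. x = u * x * w" for n
  proof (induction n)
    case 0
    show ?case using x by (intro bexI[of _ "e 1"] bexI[of _ "e 2"]) (auto simp: X_def eS filtD(1)[OF F])
  next
    case (Suc n)
    then obtain u w where u: "u \<in> F n" "w \<in> S" "x = u * x * w" by blast
    have "x = u * (a * x * c) * w" using u(3) eq by simp
    then have "x = u * a * x * (c * w)" by (simp add: mult.assoc)
    then show ?case using filtD(6)[OF F u(1) a] Smul[OF c u(2)] by blast
  qed
  from this[of m] filtD(2)[OF F] show ?thesis by auto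
qed

text \<open>\<open>\<psi> s\<close> is the residue of a coefficient \<open>b\<close> with
  \<open>e 1 * s * e 2 = x * b\<close>. This residue does not depend on \<open>b\<close>, and left
  multiplication by the corner at \<open>e 1\<close> acts on it through \<open>\<phi> 1\<close>;
  both facts rest on the nilpotency of the radical.\<close>

lemma tri_alg_of_generator:
  assumes x: "x \<in> X" "x \<noteq> 0" and gen: "\<And>s. s \<in> X \<Longrightarrow> \<exists>b\<in>B. s = x * b"
  shows "\<exists>\<psi>. tri_alg S e sc \<phi> x \<psi>"
proof -
  define q where "q s = (SOME b. b \<in> B \<and> e 1 * s * e 2 = x * b)" for s
  have q: "q s \<in> B \<and> e 1 * s * e 2 = x * q s" if "s \<in> S" for s
    unfolding q_def by (rule someI_ex) (use gen[OF eqpart(1)[OF that]] in blast)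
  have BS: "b \<in> S" if "b \<in> B" for b using that by (simp add: B_def)
  \<comment> \<open>If \<open>b\<close> had nonzero residue it would be invertible, and then
    \<open>x = a * x * t\<close> with \<open>a\<close> radical, which forces
    \<open>x = 0\<close>.\<close>
  have kill: "\<phi> 2 b = 0" if b: "b \<in> B" and a: "a \<in> J" and eq: "a * x = x * b" for a b
  proof (rule ccontr)
    assume "\<phi> 2 b \<noteq> 0"
    then obtain t where t: "t \<in> S" "b * t = e 2" using unit_elem[of 2 b] b by (auto simp: B_def)
    have "x = a * x * t" using x(1) t(2) by (simp add: eq mult.assoc X_def)
    from nilpotent_left[OF x(1) a t(1) this] x(2) show False by simp
  qed
  have uniq: "\<phi> 2 b = \<phi> 2 b'" if "b \<in> B" "b' \<in> B" "x * b = x * b'" for b b'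
  proof -
    have "b - b' \<in> B" using that by (simp add: B_def Sdiff left_diff_distrib right_diff_distrib)
    then have "\<phi> 2 (b - b') = 0" using that by (intro kill[OF _ J_0]) (simp_all add: right_diff_distrib)
    then show ?thesis using that BS by (simp add: phi_diff)
  qed
  \<comment> \<open>Subtracting the scalar \<open>\<phi> 1 a\<close> on both sides leaves a radical
    element on the left, the case settled by \<open>kill\<close>.\<close>
  have swap: "\<phi> 2 b = \<phi> 1 a" if a: "a \<in> S" "e 1 * a * e 1 = a" and b: "b \<in> B" and eq: "a * x = x * b" for a b
  proof -
    have a1: "e 1 * a = a" "a * e 1 = a" using a(2) ee[of 1] by (metis mult.assoc)+
    have "\<phi> 2 a = \<phi> 2 (e 1) * \<phi> 2 a" using phi_mul[of 2 "e 1" a] a a1 eS by simp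
    then have "\<phi> 2 a = 0" by (simp add: phi_e)
    then have "a - sc (\<phi> 1 a) (e 1) \<in> J" using a by (simp add: radl_def Sdiff Ssc eS phi_diff phi_sc phi_e)
    moreover have "b - sc (\<phi> 1 a) (e 2) \<in> B"
      using b by (simp add: B_def Sdiff Ssc eS left_diff_distrib right_diff_distrib sc_l[symmetric] sc_r[symmetric] ee)
    moreover have "(a - sc (\<phi> 1 a) (e 1)) * x = x * (b - sc (\<phi> 1 a) (e 2))"
      using x(1) eq by (simp add: left_diff_distrib right_diff_distrib sc_l[symmetric] sc_r[symmetric] X_def)
    ultimately have "\<phi> 2 (b - sc (\<phi> 1 a) (e 2)) = 0" using kill by blast
    then show ?thesis using b by (simp add: BS phi_diff Ssc eS phi_sc phi_e)
  qed
  define \<psi> where "\<psi> s = \<phi> 2 (q s)" for s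
  have psi: "\<psi> s = \<phi> 2 b" if "s \<in> S" "b \<in> B" "e 1 * s * e 2 = x * b" for s b
    unfolding \<psi>_def using uniq q that by metis
  have "tri_alg S e sc \<phi> x \<psi>"
  proof
    show "x \<in> S" "e 1 * x = x" "x * e 2 = x" using x by (simp_all add: X_def)
    fix r s assume r: "r \<in> S" and s: "s \<in> S"
    have qq: "q r \<in> B" "q s \<in> B" "q r \<in> S" "q s \<in> S" "e 1 * r * e 2 = x * q r" "e 1 * s * e 2 = x * q s"
      using q r s BS by auto
    show "\<psi> (r + s) = \<psi> r + \<psi> s"
      using qq by (subst psi[OF Sadd[OF r s] B_add[OF qq(1,2)]]) (simp_all add: distrib_left distrib_right \<psi>_def phi_add)
    show "\<psi> (r * s) = \<phi> 1 r * \<psi> s + \<psi> r * \<phi> 2 s"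
    proof -
      define a where "a = e 1 * r * e 1"
      define b where "b = e 2 * s * e 2"
      have a: "a \<in> S" "e 1 * a * e 1 = a" using r ee by (simp_all add: a_def Smul eS mult.assoc) (metis ee mult.assoc)+
      have b: "b \<in> B" unfolding b_def by (rule eqpart(2)[OF s])
      have "e 1 * a = a" using a(2) ee[of 1] by (metis mult.assoc)
      then have xq: "a * x \<in> X" using x(1) a(1) unfolding X_def by (simp add: Smul mult.assoc[symmetric]) (simp add: mult.assoc)
      then obtain b' where b': "b' \<in> B" "a * x = x * b'" using gen by blast
      have "e 1 * (r * s) * e 2 = e 1 * (r * ((e 1 + e 2) * s)) * e 2" using unit_l[OF s] by simp
      also have "\<dots> = (e 1 * r * e 1) * (e 1 * s * e 2) + (e 1 * r * e 2) * (e 2 * s * e 2)"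
      proof -
        have "e i * (s * e 2) = e i * (e i * (s * e 2))" for i using ee[of i] by (metis mult.assoc)
        then show ?thesis by (simp add: distrib_left distrib_right mult.assoc)
      qed
      also have "\<dots> = a * (x * q s) + (x * q r) * b" using qq by (simp add: a_def b_def)
      also have "\<dots> = x * (b' * q s + q r * b)" using b' by (simp add: distrib_left mult.assoc[symmetric])
      finally have "\<psi> (r * s) = \<phi> 2 (b' * q s + q r * b)"
        using b' b qq by (intro psi) (auto simp: Smul r s B_add B_mul)
      also have "\<dots> = \<phi> 2 b' * \<phi> 2 (q s) + \<phi> 2 (q r) * \<phi> 2 b"
        using b' b qq BS by (simp add: phi_add phi_mul Smul)
      also have "\<phi> 2 b' = \<phi> 1 r" using swap[OF a b'] r by (simp add: a_def phi_mul Smul eS phi_e)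
      also have "\<phi> 2 b = \<phi> 2 s" using s by (simp add: b_def phi_mul Smul eS phi_e)
      finally show ?thesis by (simp add: \<psi>_def)
    qed
  next
    fix r c assume r: "r \<in> S"
    have qq: "q r \<in> B" "q r \<in> S" "e 1 * r * e 2 = x * q r" using q r BS by auto
    show "\<psi> (sc c r) = c * \<psi> r"
      using qq by (subst psi[OF Ssc[OF r, of c] B_sc[OF qq(1), of c]])
        (simp_all add: sc_l[symmetric] sc_r[symmetric] \<psi>_def phi_sc)
  next
    show "\<psi> (e i) = 0" if "i \<in> {1, 2}" for i
      using psi[OF eS B_0, of i] that orth ee by (auto simp: phi_0)
    show "\<psi> x = 1"
      using psi[OF _ B_e2, of x] x(1) by (simp add: X_def phi_e)
  qed
  then show ?thesis by blast
qed

end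

section \<open>Presilting families over a triangular algebra\<close>

lemma gcone_base: "finite G \<Longrightarrow> v \<in> G \<Longrightarrow> v \<in> gcone G"
  unfolding gcone_def
  by (intro CollectI exI[of _ "\<lambda>u. if u = v then 1 else 0"]) (auto simp: if_distrib[of "\<lambda>c. c *\<^sub>R _"] cong: if_cong)

lemma gconeE:
  assumes "u \<in> gcone G"
  obtains c where "\<forall>v\<in>G. 0 \<le> c v" "fst u = (\<Sum>v\<in>G. c v * fst v)" "snd u = (\<Sum>v\<in>G. c v * snd v)"
  using assms by (auto simp: gcone_def fst_sum snd_sum)

lemma finite_gvs [simp]: "finite (set (map gv Ts))"
  by simp

context idem_ring
begin

lemma family_cx: "family S e Ts \<Longrightarrow> T \<in> set Ts \<Longrightarrow> iscx S e T"
  by (simp add: family_def ind_def)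

end

context elem2
begin

lemma minl_cx: "minl T \<Longrightarrow> iscx S e T"
  by (simp add: minl_def)

lemma minl_dsm: "minl T \<Longrightarrow> minl U \<Longrightarrow> minl (dsm e T U)"
proof -
  assume T: "minl T" and U: "minl U"
  have "sft e (length (tgt T)) (tgt U) \<in> mats S" "sft' e (length (src T)) (src U) \<in> mats S"
    using bip_append[of "tgt T" "tgt U"] bip_append[of "src T" "src U"] hom_mats unfolding bip_def by blast+
  then have "sft e (length (tgt T)) (tgt U) * dif U * sft' e (length (src T)) (src U) \<in> mats J"
    using U unfolding minl_def
    by (intro mats_prod[where X = J and Y = S] mats_prod[where X = S and Y = J]) (auto intro: J_0 J_add J_ideal)
  then have "dif (dsm e T U) \<in> mats J"
    using T unfolding minl_def dsm_def by (auto simp: mats_def intro: J_add)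
  then show ?thesis using T U iscx_dsm by (simp add: minl_def)
qed

lemma minl_dsms: "(\<And>T. T \<in> set Ts \<Longrightarrow> minl T) \<Longrightarrow> minl (dsms e Ts)"
proof (induction Ts)
  case Nil
  show ?case using iscx_zcx J_0 by (simp add: minl_def) (simp add: zcx_def mats_def)
qed (auto intro: minl_dsm)

text \<open>Replacing the members of a family by minimal models changes neither the g-vectors nor
  the isomorphism class of the sum.\<close>

lemma fan_minl: "fan S e = {gcone (set (map gv Ts)) | Ts. family S e Ts \<and> (\<forall>T\<in>set Ts. minl T)}"
proof -
  have "\<exists>Ts'. gcone (set (map gv Ts)) = gcone (set (map gv Ts')) \<and> family S e Ts' \<and> (\<forall>T\<in>set Ts'. minl T)"
    if F: "family S e Ts" for Ts
  proof -
    define f where "f T = (SOME T'. minl T' \<and> iso S e T T' \<and> gv T' = gv T)" for T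
    have f: "minl (f T) \<and> iso S e T (f T) \<and> gv (f T) = gv T" if "T \<in> set Ts" for T
      unfolding f_def by (rule someI_ex) (use minimize family_cx[OF F that] in blast)
    have "family S e (map f Ts)" by (rule family_map[OF F]) (use f minl_cx in blast)
    moreover have "map gv (map f Ts) = map gv Ts" using f by simp
    ultimately show ?thesis using f by (intro exI[of _ "map f Ts"]) auto
  qed
  then show ?thesis unfolding fan_def by blast
qed

lemma family_minl_presil:
  assumes "family S e Ts" "\<forall>T\<in>set Ts. minl T"
  shows "minl (dsms e Ts)" "presil S e (dsms e Ts)" "set (src (dsms e Ts)) \<inter> set (tgt (dsms e Ts)) = {}"
  using assms minl_dsms presil_disjoint by (auto simp: family_def)

text \<open>A complex with zero differential is the sum of its two terms, so an indecomposable one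
  has at most one nonempty term.\<close>

lemma dif_0_split:
  assumes U: "ind S e U" and d: "dif U = 0"
  shows "src U = [] \<or> tgt U = []"
proof -
  have l: "set (src U) \<subseteq> {1, 2}" "set (tgt U) \<subseteq> {1, 2}" using U by (auto simp: ind_def iscx_def)
  have m: "minl (Cx (src U) [] 0)" "minl (Cx [] (tgt U) 0)"
    using l by (auto simp: minl_def iscx_def mats_def J_0)
  have "U = dsm e (Cx (src U) [] 0) (Cx [] (tgt U) 0)"
    by (rule cx_eqI) (simp_all add: dsm_def d)
  moreover have "iso S e U U" using U iso_refl by (simp add: ind_def)
  ultimately have "iso S e U (dsm e (Cx (src U) [] 0) (Cx [] (tgt U) 0))" by simp
  with U m have "iso S e (Cx (src U) [] 0) zcx \<or> iso S e (Cx [] (tgt U) 0) zcx"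
    unfolding ind_def minl_def by blast
  then show ?thesis using minl_iso_zero(1)[OF m(1)] minl_iso_zero(2)[OF m(2)] by auto
qed

end

lemma count_list_all: "set ls \<subseteq> {l} \<Longrightarrow> count_list ls m = (if m = l then length ls else 0)"
  by (induction ls) auto

lemma gv_quadrant: "set (src T) \<subseteq> {2} \<Longrightarrow> set (tgt T) \<subseteq> {1} \<Longrightarrow> gv T = (real (length (tgt T)), - real (length (src T)))"
  by (simp add: gv_def count_list_all)

context tri2
begin

text \<open>To generate \<open>(1, -1)\<close> some member must have label 1 in degree 0 and some
  member label 2 in degree -1. A minimal presilting complex has no label in both degrees, so all
  labels are determined.\<close>

lemma sigma_quadrant:
  assumes F: "family S e Ts" "\<forall>T\<in>set Ts. minl T" and mem: "(1, -1) \<in> gcone (set (map gv Ts))"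
  shows "set (src (dsms e Ts)) \<subseteq> {2}" "set (tgt (dsms e Ts)) \<subseteq> {1}"
    "\<And>T. T \<in> set Ts \<Longrightarrow> set (src T) \<subseteq> {2}" "\<And>T. T \<in> set Ts \<Longrightarrow> set (tgt T) \<subseteq> {1}"
proof -
  let ?D = "dsms e Ts"
  from mem obtain c where c: "\<forall>v\<in>set (map gv Ts). 0 \<le> c v" "1 = (\<Sum>v\<in>set (map gv Ts). c v * fst v)"
    "- 1 = (\<Sum>v\<in>set (map gv Ts). c v * snd v)" by (auto elim: gconeE)
  have "\<exists>T\<in>set Ts. fst (gv T) > 0"
  proof (rule ccontr)
    assume "\<not> ?thesis"
    then have "(\<Sum>v\<in>set (map gv Ts). c v * fst v) \<le> 0"
      using c(1) by (intro sum_nonpos) (auto simp: mult_le_0_iff not_less)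
    then show False using c(2) by simp
  qed
  then obtain T where T: "T \<in> set Ts" "count_list (tgt T) 1 \<noteq> 0" by (auto simp: gv_def)
  have "\<exists>T\<in>set Ts. snd (gv T) < 0"
  proof (rule ccontr)
    assume "\<not> ?thesis"
    then have "(\<Sum>v\<in>set (map gv Ts). c v * snd v) \<ge> 0"
      using c(1) by (intro sum_nonneg) (auto simp: not_less)
    then show False using c(3) by simp
  qed
  then obtain U where U: "U \<in> set Ts" "count_list (src U) 2 \<noteq> 0" by (auto simp: gv_def)
  have "1 \<in> set (tgt ?D)" "2 \<in> set (src ?D)"
    using T U src_tgt_dsms[of T Ts] src_tgt_dsms[of U Ts] by (auto simp: count_list_0_iff)
  moreover have "set (src ?D) \<subseteq> {1, 2}" "set (tgt ?D) \<subseteq> {1, 2}"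
    using family_minl_presil(1)[OF F] by (auto simp: minl_def iscx_def)
  moreover have "set (src ?D) \<inter> set (tgt ?D) = {}" by (rule family_minl_presil(3)[OF F])
  ultimately show D: "set (src ?D) \<subseteq> {2}" "set (tgt ?D) \<subseteq> {1}" by auto
  show "\<And>T. T \<in> set Ts \<Longrightarrow> set (src T) \<subseteq> {2}" "\<And>T. T \<in> set Ts \<Longrightarrow> set (tgt T) \<subseteq> {1}"
    using D src_tgt_dsms(1)[of _ Ts] src_tgt_dsms(2)[of _ Ts] by (meson subset_trans)+
qed

text \<open>The family spanning \<sigma> has a member \<open>V\<close> on the ray of
  \<open>(0, -1)\<close>, a shifted projective, and a member \<open>U\<close> on the ray of
  \<open>(1, -1)\<close>, whose differential is square. Presilting for \<open>V\<close> and
  \<open>U\<close> says that every map from label 2 to the degree 0 term of \<open>U\<close> factors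
  through that differential.\<close>

lemma sigma_generator:
  assumes sig: "gcone {(0, -1), (1, -1)} \<in> fan S e"
  shows "\<exists>x\<in>X. x \<noteq> 0 \<and> (\<forall>s\<in>X. \<exists>b\<in>B. s = x * b)"
proof -
  let ?\<sigma> = "gcone {(0, -1), (1, -1)} :: (real \<times> real) set"
  obtain Ts where Ts: "?\<sigma> = gcone (set (map gv Ts))" and F: "family S e Ts" "\<forall>T\<in>set Ts. minl T"
    using sig unfolding fan_minl by auto
  let ?G = "set (map gv Ts)"
  have m: "(1, -1) \<in> gcone ?G" "(0, -1) \<in> gcone ?G"
    unfolding Ts[symmetric] by (rule gcone_base; simp)+
  note Q = sigma_quadrant[OF F m(1)]
  \<comment> \<open>The two inequalities that cut out \<sigma>. Equality in one of them describes
    each boundary ray, so a boundary vector forces a generator on its ray.\<close>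
  have sub: "0 \<le> fst v \<and> fst v + snd v \<le> 0" if "v \<in> ?G" for v
  proof -
    have "v \<in> ?\<sigma>" unfolding Ts using that by (intro gcone_base) simp_all
    then show ?thesis by (elim gconeE) auto
  qed
  have V: "\<exists>V\<in>set Ts. tgt V = [] \<and> src V \<noteq> []"
  proof -
    from m(2) obtain c where c: "\<forall>v\<in>?G. 0 \<le> c v" "0 = (\<Sum>v\<in>?G. c v * fst v)" "- 1 = (\<Sum>v\<in>?G. c v * snd v)"
      by (auto elim: gconeE)
    have z: "\<forall>v\<in>?G. c v * fst v = 0" using c(1,2) sub
      by (subst sum_nonneg_eq_0_iff[symmetric]) (auto simp del: set_map)
    have "\<not> (\<forall>v\<in>?G. c v * snd v = 0)"
    proof
      assume "\<forall>v\<in>?G. c v * snd v = 0"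
      then have "(\<Sum>v\<in>?G. c v * snd v) = 0" by (rule sum.neutral)
      with c(3) show False by simp
    qed
    then obtain v where v: "v \<in> ?G" "c v * snd v \<noteq> 0" by blast
    then have "fst v = 0" "snd v \<noteq> 0" using z by auto
    moreover obtain V where "V \<in> set Ts" "v = gv V" using v by auto
    ultimately show ?thesis using gv_quadrant[OF Q(3,4), of V] by auto
  qed
  have U: "\<exists>U\<in>set Ts. length (tgt U) = length (src U) \<and> src U \<noteq> []"
  proof -
    from m(1) obtain c where c: "\<forall>v\<in>?G. 0 \<le> c v" "1 = (\<Sum>v\<in>?G. c v * fst v)" "- 1 = (\<Sum>v\<in>?G. c v * snd v)"
      by (auto elim: gconeE)
    have "(\<Sum>v\<in>?G. c v * - (fst v + snd v)) = 0"
      using c(2,3) by (simp add: distrib_left sum_negf sum.distrib right_diff_distrib sum_subtractf del: set_map)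
    moreover have nn: "0 \<le> c v * - (fst v + snd v)" if "v \<in> ?G" for v
      by (rule mult_nonneg_nonneg) (use c(1) sub[OF that] that in auto)
    ultimately have z: "\<forall>v\<in>?G. c v * - (fst v + snd v) = 0" using sum_nonneg_eq_0_iff[of ?G "\<lambda>v. c v * - (fst v + snd v)"] nn by blast
    have "\<not> (\<forall>v\<in>?G. c v * fst v = 0)"
    proof
      assume "\<forall>v\<in>?G. c v * fst v = 0"
      then have "(\<Sum>v\<in>?G. c v * fst v) = 0" by (rule sum.neutral)
      with c(2) show False by simp
    qed
    then obtain v where v: "v \<in> ?G" "c v * fst v \<noteq> 0" by blast
    then have "fst v + snd v = 0" "fst v \<noteq> 0" using z by force+
    moreover obtain U where "U \<in> set Ts" "v = gv U" using v by auto
    ultimately show ?thesis using gv_quadrant[OF Q(3,4), of U] by auto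
  qed
  from U obtain U where U: "U \<in> set Ts" "length (tgt U) = length (src U)" "src U \<noteq> []" by blast
  from V obtain V where V: "V \<in> set Ts" "tgt V = []" "src V \<noteq> []" by blast
  have cx: "iscx S e T" if "T \<in> set Ts" for T using family_cx[OF F(1) that] .
  have sV: "src V ! 0 = 2" "0 < length (src V)"
    using V(3) subsetD[OF Q(3)[OF V(1)] nth_mem[of 0 "src V"]] by auto
  have dV: "dif V = 0" using hom_l[OF iscx_dif[OF cx[OF V(1)]]] V(2) by (simp add: obj_def diag_def zero_fsm_def[symmetric])
  have surj: "\<exists>\<alpha>\<in>Hom [2] (src U). c = dif U * \<alpha>" if c: "c \<in> Hom [2] (tgt U)" for c
  proof -
    have a: "single 0 0 (e 2) \<in> Hom (src V) [2]" "single 0 0 (e 2) \<in> Hom [2] (src V)"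
      by (rule single_hom[where i = 2 and j = 2]; use sV in \<open>simp add: eS ee\<close>)+
    have "c * single 0 0 (e 2) \<in> Hom (src V) (tgt U)" using a c by blast
    from presil_summands[OF family_minl_presil(2)[OF F] summand_dsms[OF cx V(1)] summand_dsms[OF cx U(1)] this]
    obtain a where a': "a \<in> Hom (src V) (src U)" "c * single 0 0 (e 2) = dif U * a" by (auto simp: dV)
    have "c = c * single 0 0 (e 2) * single 0 0 (e 2)"
      using hom_r[OF c] by (simp add: mult.assoc single_mul ee ob_single)
    then have "c = dif U * (a * single 0 0 (e 2))" by (simp add: a'(2) mult.assoc)
    moreover have "a * single 0 0 (e 2) \<in> Hom [2] (src U)" using a a' by blast
    ultimately show ?thesis by blast
  qed
  have dU: "dif U \<in> Hom (src U) (tgt U)" using iscx_dif[OF cx[OF U(1)]] .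
  \<comment> \<open>A zero differential would split \<open>U\<close>, both of whose terms are
    nonempty.\<close>
  have "dif U \<noteq> 0" using dif_0_split[of U] U F(1) by (auto simp: family_def)
  then obtain p q where nz: "ent (dif U) p q \<noteq> 0" by (metis ent_zero fsm_eqI)
  then have pq: "p < length (tgt U)" "q < length (src U)" using hom_ent(4,5)[OF dU] by blast+
  then have "tgt U ! p = 1" "src U ! q = 2" using Q(3,4)[OF U(1)] nth_mem by blast+
  then have "ent (dif U) p q \<in> X"
    using hom_ent(1)[OF dU, of p q] hom_ent(2)[OF dU, of p q] hom_ent(3)[OF dU, of q p] pq by (simp add: X_def)
  from one_generator[OF dU Q(3,4)[OF U(1)] _ _ surj this nz] U show ?thesis by auto
qed

end

section \<open>Left and right invertible residues\<close>

context tri_alg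
begin

abbreviation "\<Psi> \<equiv> fmap \<psi>"

lemma psi_0: "\<psi> 0 = 0"
  using psi_e[of 1] psi_sc[OF S0, of 0] by simp

lemma Psi_mul: "M \<in> mats S \<Longrightarrow> N \<in> mats S \<Longrightarrow> \<Psi> (M * N) = \<Phi> 1 M * \<Psi> N + \<Psi> M * \<Phi> 2 N"
  by (rule fmap_times_derivation[of _ _ _ _ _ S]) (simp_all add: psi_0 phi_0 psi_add psi_mul S0 Sadd Smul)

lemma Psi_add: "M \<in> mats S \<Longrightarrow> N \<in> mats S \<Longrightarrow> \<Psi> (M + N) = \<Psi> M + \<Psi> N"
  by (rule fmap_add[of _ S]) (simp_all add: psi_0 psi_add)

definition linv :: "'r cx \<Rightarrow> bool" where
  "linv T \<longleftrightarrow> (\<exists>P. P * \<Psi> (dif T) = un (length (src T)) \<and> P * un (length (tgt T)) = P \<and> un (length (src T)) * P = P)"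

definition rinv :: "'r cx \<Rightarrow> bool" where
  "rinv T \<longleftrightarrow> (\<exists>P. \<Psi> (dif T) * P = un (length (tgt T)) \<and> P * un (length (tgt T)) = P \<and> un (length (src T)) * P = P)"

definition quad :: "'r cx \<Rightarrow> bool" where
  "quad T \<longleftrightarrow> set (src T) \<subseteq> {2} \<and> set (tgt T) \<subseteq> {1}"

text \<open>Complexes without label 2 in degree -1 or without label 1 in degree 0 belong to both
  \<open>LFT\<close> and \<open>RGT\<close>; only those that use both labels are sorted by the side
  of the inverse.\<close>

definition LFT :: "'r cx \<Rightarrow> bool" where
  "LFT D \<longleftrightarrow> 2 \<notin> set (src D) \<or> 1 \<notin> set (tgt D) \<or> quad D \<and> linv D"

definition RGT :: "'r cx \<Rightarrow> bool" where
  "RGT D \<longleftrightarrow> 2 \<notin> set (src D) \<or> 1 \<notin> set (tgt D) \<or> quad D \<and> rinv D"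

lemma Psi_un:
  assumes "f \<in> Hom ls ms"
  shows "un (length ms) * \<Psi> f = \<Psi> f" "\<Psi> f * un (length ls) = \<Psi> f"
  using hom_ent(4,5)[OF assms] by (simp_all add: un_times_iff times_un_iff ent_fmap psi_0)

lemma dichotomy:
  assumes D: "minl D" "presil S e D" and q: "quad D"
  shows "linv D \<or> rinv D"
proof (rule ccontr)
  assume no: "\<not> ?thesis"
  have d: "dif D \<in> Hom (src D) (tgt D)" and dJ: "dif D \<in> mats J" using D(1) iscx_dif by (auto simp: minl_def)
  obtain v where v: "v \<noteq> 0" "un (length (src D)) * v = v" "v * un (Suc 0) = v" "\<Psi> (dif D) * v = 0"
    using left_inverse_or_kernel[OF Psi_un[OF d]] no unfolding linv_def by blast
  obtain w where w: "w \<noteq> 0" "w * un (length (tgt D)) = w" "un (Suc 0) * w = w" "w * \<Psi> (dif D) = 0"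
    using right_inverse_or_cokernel[OF Psi_un[OF d]] no unfolding rinv_def by blast
  obtain i i' where i: "ent v i i' \<noteq> 0" using v(1) by (metis ent_zero fsm_eqI)
  then have i: "ent v i 0 \<noteq> 0" "i < length (src D)"
    using v(2,3) by (auto simp: un_times_iff times_un_iff) (metis Suc_leI not_gr_zero, meson linorder_not_le)
  obtain j j' where j: "ent w j' j \<noteq> 0" using w(1) by (metis ent_zero fsm_eqI)
  then have j: "ent w 0 j \<noteq> 0" "j < length (tgt D)"
    using w(2,3) by (auto simp: un_times_iff times_un_iff) (metis Suc_leI not_gr_zero, meson linorder_not_le)
  have lab: "src D ! i = 2" "tgt D ! j = 1" using q i(2) j(2) nth_mem unfolding quad_def by blast+
  \<comment> \<open>The test map puts \<open>x\<close> at a position where the entries of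
    \<open>w\<close> and \<open>v\<close> are both nonzero.\<close>
  have g: "single j i x \<in> Hom (src D) (tgt D)"
    by (rule single_hom[where i = 2 and j = 1]) (use lab i j xX in auto)
  with D(2) obtain a b where a: "a \<in> Hom (src D) (src D)" and b: "b \<in> Hom (tgt D) (tgt D)"
    and ab: "single j i x = dif D * a + b * dif D" unfolding presil_def by blast
  have m: "a \<in> mats S" "b \<in> mats S" "dif D \<in> mats S" using a b d hom_mats by blast+
  \<comment> \<open>Both characters vanish on the differential, so of the two terms of
    \<open>Psi_mul\<close> only the one containing \<open>\<Psi> (dif D)\<close> remains in each
    product.\<close>
  have "\<Psi> (single j i x) = \<Psi> (dif D) * \<Phi> 2 a + \<Phi> 1 b * \<Psi> (dif D)"
    unfolding ab using m dJ by (simp add: Psi_add mats_mul Psi_mul mats_J_iff)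
  then have "w * \<Psi> (single j i x) * v = 0"
    using v(4) w(4) by (simp add: distrib_left distrib_right mult.assoc) (simp add: mult.assoc[symmetric])
  moreover have "\<Psi> (single j i x) = single j i 1"
    by (rule fsm_eqI) (simp add: ent_fmap psi_0 ent_single psi_x)
  ultimately have "ent (w * (single j i 1 * v)) 0 0 = 0" by (simp add: mult.assoc)
  moreover have "ent (w * (single j i 1 * v)) 0 0 = (\<Sum>k<Suc j. if k = j then ent w 0 j * ent v i 0 else 0)"
    by (subst ent_times[of "Suc j"], simp add: ent_single_times)
      (rule sum.cong, simp_all add: ent_single_times)
  ultimately show False using i j by (simp del: sum.lessThan_Suc)
qed

lemma LFT_or_RGT:
  assumes "minl D" "presil S e D"
  shows "LFT D \<or> RGT D"
proof -
  have "set (src D) \<subseteq> {1, 2}" "set (tgt D) \<subseteq> {1, 2}" using assms(1) by (auto simp: minl_def iscx_def)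
  then have "quad D" if "2 \<in> set (src D)" "1 \<in> set (tgt D)"
    using presil_disjoint[OF assms] that by (auto simp: quad_def)
  then show ?thesis using dichotomy[OF assms] by (auto simp: LFT_def RGT_def)
qed

end

locale tri_gen = tri_alg +
  assumes gen: "s \<in> X \<Longrightarrow> \<exists>b\<in>B. s = x * b"
begin

text \<open>Since \<open>X = x B\<close>, the differential is \<open>x\<close> times a matrix
  \<open>N\<close> over \<open>B\<close>, and the right inverse of its residue lifts to one of
  \<open>N\<close>. The first row of \<open>N\<close> is then a split projection onto a label 2,
  compatible with the differential, so the complex given by \<open>x\<close> from label 2 to label 1
  splits off. If degree 0 is empty, indecomposability leaves a single label 2.\<close>

lemma rinv_gv:
  assumes U: "ind S e U" "minl U" "quad U" "rinv U"
  shows "gv U \<in> {(0, -1), (1, -1)}"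
proof (cases "tgt U = []")
  case True
  have cx: "iscx S e U" using U(1) by (simp add: ind_def)
  have dU: "dif U = 0" using hom_l[OF iscx_dif[OF cx]] True by (simp add: obj_def diag_def zero_fsm_def[symmetric])
  have "src U \<noteq> []"
  proof
    assume "src U = []"
    then have "U = zcx" using True dU by (intro cx_eqI) (simp_all add: zcx_def)
    then show False using U(1) iso_refl[OF iscx_zcx] by (simp add: ind_def)
  qed
  then obtain y ls where s: "src U = y # ls" by (cases "src U") auto
  have m: "minl (Cx [y] [] 0)" "minl (Cx ls [] 0)"
    using cx s by (auto simp: minl_def iscx_def mats_def J_0)
  have "U = dsm e (Cx [y] [] 0) (Cx ls [] 0)"
    by (rule cx_eqI) (simp_all add: dsm_def dU s True)
  then have "iso S e U (dsm e (Cx [y] [] 0) (Cx ls [] 0))" using iso_refl[OF cx] by simp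
  with U(1) m have "iso S e (Cx [y] [] 0) zcx \<or> iso S e (Cx ls [] 0) zcx"
    unfolding ind_def minl_def by blast
  then have "ls = []" using minl_iso_zero(1)[OF m(1)] minl_iso_zero(1)[OF m(2)] by auto
  then show ?thesis using gv_quadrant[of U] U(3) s True by (simp add: quad_def)
next
  case False
  let ?ls = "src U" and ?ms = "tgt U" and ?d = "dif U"
  define n where "n = length ?ms"
  define rs where "rs = replicate n (2::nat)"
  have cx: "iscx S e U" using U(1) by (simp add: ind_def)
  have d: "?d \<in> Hom ?ls ?ms" using iscx_dif[OF cx] .
  have lab: "set ?ls \<subseteq> {2}" "set ?ms \<subseteq> {1}" "set rs \<subseteq> {2}" using U(3) by (auto simp: quad_def rs_def)
  have lab12: "set ?ls \<subseteq> {1, 2}" "set ?ms \<subseteq> {1, 2}" "set rs \<subseteq> {1, 2}" using lab by auto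
  have ln: "?ms ! p = 1" if "p < n" for p using that lab(2) nth_mem unfolding n_def by blast
  have ll: "?ls ! p = 2" if "p < length ?ls" for p using that lab(1) nth_mem by blast
  have rn: "length rs = n" "rs ! p = 2" if "p < n" for p using that by (auto simp: rs_def)
  have n0: "0 < n" using False by (simp add: n_def)
  have ex: "\<exists>b\<in>B. ent ?d p q = x * b" if "p < n" "q < length ?ls" for p q
    by (rule gen) (use hom_ent(1)[OF d, of p q] hom_ent(2)[OF d, of p q] hom_ent(3)[OF d, of q p] that ln ll in \<open>simp add: X_def n_def\<close>)
  define \<beta> where "\<beta> p q = (SOME b. b \<in> B \<and> ent ?d p q = x * b)" for p q
  have \<beta>: "\<beta> p q \<in> B \<and> ent ?d p q = x * \<beta> p q" if "p < n" "q < length ?ls" for p q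
    unfolding \<beta>_def by (rule someI_ex) (use ex[OF that] in blast)
  define N where "N = Fsm (\<lambda>p q. if p < n \<and> q < length ?ls then \<beta> p q else 0)"
  have Ne: "ent N p q = (if p < n \<and> q < length ?ls then \<beta> p q else 0)" for p q
    unfolding N_def by (subst ent_Fsm[of "max n (length ?ls)"]) auto
  have N: "N \<in> Hom ?ls rs"
    by (rule homI_ent) (use \<beta> ll in \<open>auto simp: Ne S0 B_def rs_def\<close>)
  define xh where "xh = diag (replicate n x)"
  have xh: "xh \<in> Hom rs ?ms"
    by (rule homI_ent) (use ln xX in \<open>auto simp: xh_def ent_diag S0 rs_def n_def\<close>)
  have dN: "?d = xh * N"
    by (rule fsm_eqI) (use \<beta> hom_ent(4,5)[OF d] in \<open>auto simp: xh_def ent_diag_times Ne n_def\<close>)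
  have P1: "\<Phi> 1 f = 0" if f: "f \<in> Hom ks ks'" and ks: "set ks \<subseteq> {2}" "set ks' \<subseteq> {1, 2}" for f ks ks'
  proof (rule fsm_eqI)
    fix p q
    show "ent (\<Phi> 1 f) p q = ent 0 p q"
    proof (rule ccontr)
      assume "\<not> ?thesis"
      then have "\<phi> 1 (ent f p q) \<noteq> 0" by (simp add: ent_fmap phi_0)
      from phi_label(2,4)[OF f _ _ _ this] ks have "q < length ks" "ks ! q = 1" by auto
      then show False using ks(1) nth_mem[of q ks] by auto
    qed
  qed
  have Pd: "\<Psi> ?d = \<Phi> 2 N"
  proof -
    have "\<Psi> xh = un n" by (rule fsm_eqI) (simp add: xh_def ent_fmap psi_0 ent_diag ent_un psi_x)
    then have "\<Psi> ?d = un n * \<Phi> 2 N"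
      unfolding dN using P1[OF xh lab(3) lab12(2)] by (simp add: Psi_mul hom_mats[OF xh] hom_mats[OF N])
    also have "\<dots> = \<Phi> 2 N" by (simp add: un_times_iff ent_fmap phi_0 Ne)
    finally show ?thesis .
  qed
  obtain P where P: "\<Phi> 2 N * P = un n" "P * un n = P" "un (length ?ls) * P = P"
    using U(4) unfolding rinv_def Pd n_def by blast
  have lP: "lft 2 P \<in> Hom rs ?ls" by (rule lft_hom) (use lab P rn n0 in auto)
  \<comment> \<open>The lifted inverse is exact only modulo the radical; \<open>M\<close> is its
    error, which \<open>W\<close> repairs.\<close>
  define M where "M = N * lft 2 P - ob rs"
  have M: "M \<in> Hom rs rs" unfolding M_def using N lP by blast
  have "\<Phi> 2 (M + ob rs) = un n"
    using P Phi_lft[of 2 P] N lP by (simp add: M_def Phi_mul hom_mats)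
  moreover have "\<Phi> 2 (ob rs) = un n" using Phi_ob_un[of 2 rs] lab(3) rn n0 by simp
  ultimately have "\<Phi> 2 M = 0" using Phi_add[of 2 M "ob rs"] hom_mats[OF M] ob_mats by simp
  then have "M \<in> mats J" using P1[OF M lab(3) lab12(3)] hom_mats[OF M] by (simp add: mats_J_iff)
  from one_plus_J_inverse[OF M this] obtain W where W: "W \<in> Hom rs rs" "(ob rs + M) * W = ob rs" by blast
  define R where "R = lft 2 P * W"
  have R: "R \<in> Hom rs ?ls" unfolding R_def using lP W by blast
  have NR: "N * R = ob rs" using W(2) by (simp add: R_def M_def mult.assoc)
  \<comment> \<open>\<open>\<epsilon>\<close> selects the first of the \<open>n\<close> copies, so
    \<open>p1\<close> is the first row of \<open>N\<close> and \<open>i1\<close> the first column of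
    its right inverse.\<close>
  define \<epsilon> where "\<epsilon> = single 0 0 (e 2)"
  have \<epsilon>: "\<epsilon> \<in> Hom [2] rs" "\<epsilon> \<in> Hom rs [2]"
    unfolding \<epsilon>_def by (rule single_hom[where i = 2 and j = 2]; use n0 rn in \<open>simp add: eS ee\<close>)+
  define i1 where "i1 = R * \<epsilon>"
  define p1 where "p1 = \<epsilon> * N"
  have ip: "i1 \<in> Hom [2] ?ls" "p1 \<in> Hom ?ls [2]" unfolding i1_def p1_def using R N \<epsilon> by blast+
  have "p1 * i1 = \<epsilon> * (N * R) * \<epsilon>" by (simp add: p1_def i1_def mult.assoc)
  also have "\<dots> = ob [2]" using \<epsilon> by (simp add: NR hom_simps) (simp add: \<epsilon>_def single_mul ee ob_single)
  finally have pi: "p1 * i1 = ob [2]" .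
  obtain ns C C' where C: "bip S e ?ls [2] ns i1 p1 C C'" "set ns \<subseteq> set ?ls" "length ?ls = Suc (length ns)"
    using exchange[OF _ lab12(1) ip pi] by auto
  define b where "b = single 0 0 (e 1)"
  define ks where "ks = take 0 ?ms @ drop (Suc 0) ?ms"
  obtain g g' where G: "bip S e ?ms [1] ks b b g g'"
    using bip_nth[of 0 ?ms] n0 ln[of 0] unfolding b_def ks_def n_def by auto
  have t0: "single 0 0 x \<in> Hom [2] [1]" by (rule single_hom[where i = 2 and j = 1]) (use xX in simp_all)
  have h1: "C \<in> Hom ns ?ls" "C' \<in> Hom ?ls ns" and E1: "p1 * C = 0" and o1: "ob ?ls = i1 * p1 + C * C'"
    using C(1) unfolding bip_def by auto
  have h2: "b \<in> Hom [1] ?ms" "b \<in> Hom ?ms [1]" "g \<in> Hom ks ?ms" "g' \<in> Hom ?ms ks" and o2: "ob ?ms = b * b + g * g'"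
    using G unfolding bip_def by auto
  have bx: "b * xh = single 0 0 x * \<epsilon>" "xh * \<epsilon> = b * single 0 0 x"
    by (rule fsm_eqI, use n0 xX in \<open>auto simp: b_def \<epsilon>_def xh_def ent_single_times ent_times_single ent_times_diag ent_diag_times ent_single ent_diag single_mul\<close>)+
  have bd: "b * ?d = single 0 0 x * p1" by (simp add: dN p1_def mult.assoc[symmetric] bx)
  have di: "?d * i1 = b * single 0 0 x"
  proof -
    have "?d * i1 = xh * (N * R) * \<epsilon>" by (simp add: dN i1_def mult.assoc)
    then show ?thesis using \<epsilon> xh by (simp add: NR hom_simps bx)
  qed
  \<comment> \<open>By \<open>bd\<close> and \<open>di\<close> the differential has no components
    between the split part and its complement, which is therefore a complex by itself.\<close>
  define V where "V = Cx ns ks (g' * ?d * C)"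
  have "?d = ?d * i1 * p1 + ?d * C * C'"
    using hom_r[OF d] unfolding o1 by (simp add: distrib_left mult.assoc)
  also have "?d * C = (b * b + g * g') * (?d * C)" using h1 d by (simp add: o2[symmetric] hom_simps)
  also have "\<dots> = b * (b * ?d) * C + g * (g' * ?d * C)" by (simp add: distrib_right mult.assoc)
  also have "\<dots> = g * (g' * ?d * C)" using E1 by (simp add: bd mult.assoc)
  finally have dd: "?d = b * single 0 0 x * p1 + g * (g' * ?d * C) * C'" by (simp only: di)
  have sum: "isum S e U (Cx [2] [1] (single 0 0 x)) V"
    unfolding isum_def V_def cx_sel using C(1) G dd by blast
  have sk: "set ks \<subseteq> set ?ms" unfolding ks_def by (auto dest: in_set_dropD)
  have cT: "iscx S e (Cx [2] [1] (single 0 0 x))" using t0 by (simp add: iscx_def)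
  have cV: "iscx S e V" unfolding iscx_def V_def cx_sel
    using h1 h2 d C(2) sk lab12 by (intro conjI hom_mul[of g' ?ms] hom_mul) (auto intro: hom_mul)
  have mT: "minl (Cx [2] [1] (single 0 0 x))" using cT hom_J[OF t0] by (simp add: minl_def)
  have mV: "minl V" using cV hom_J[OF iscx_dif[OF cV]] C(2) sk lab by (force simp: minl_def iscx_def V_def)
  have "iso S e U (dsm e (Cx [2] [1] (single 0 0 x)) V)"
    using isum_iso[OF sum isum_dsm[OF cT] iso_refl[OF cT] iso_refl[OF cV] cT cT cV cV] .
  \<comment> \<open>The split part is minimal with labels and so not contractible; hence
    \<open>V\<close> is contractible, and being minimal it is empty.\<close>
  then have "iso S e (Cx [2] [1] (single 0 0 x)) zcx \<or> iso S e V zcx" using U(1) cT cV unfolding ind_def by blast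
  then have "ns = []" "ks = []" using minl_iso_zero[OF mT] minl_iso_zero[OF mV] by (auto simp: V_def)
  then have "length ?ls = 1" "length ?ms = 1" using C(3) n0 by (auto simp: ks_def n_def le_Suc_eq)
  then show ?thesis using gv_quadrant[of U] lab by simp
qed

end

section \<open>Functoriality\<close>

locale rhom = dom: idem_ring S e + cod: idem_ring S' e'
  for S :: "'r::ring set" and e and S' :: "'s::ring set" and e' +
  fixes f :: "'r \<Rightarrow> 's"
  assumes f_S: "x \<in> S \<Longrightarrow> f x \<in> S'" and f_add: "x \<in> S \<Longrightarrow> y \<in> S \<Longrightarrow> f (x + y) = f x + f y"
    and f_mul: "x \<in> S \<Longrightarrow> y \<in> S \<Longrightarrow> f (x * y) = f x * f y" and f_e: "f (e i) = e' i"
begin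

lemma f_0: "f 0 = 0"
proof -
  have "f 0 + f 0 = f 0 + 0" using f_add[of 0 0] dom.S0 by simp
  then show ?thesis by (rule add_left_imp_eq)
qed

abbreviation "F \<equiv> fmap f"

lemma F_mats: "A \<in> mats S \<Longrightarrow> F A \<in> mats S'"
  by (simp add: mats_def ent_fmap f_0 f_S)

lemma F_mul: "A \<in> mats S \<Longrightarrow> B \<in> mats S \<Longrightarrow> F (A * B) = F A * F B"
  by (rule fmap_times[of _ S]) (simp_all add: f_0 f_add f_mul dom.S0 dom.Sadd dom.Smul)

lemma F_add: "A \<in> mats S \<Longrightarrow> B \<in> mats S \<Longrightarrow> F (A + B) = F A + F B"
  by (rule fmap_add[of _ S]) (simp_all add: f_0 f_add)

lemma F_diff: "A \<in> mats S \<Longrightarrow> B \<in> mats S \<Longrightarrow> F (A - B) = F A - F B"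
  using F_add[of "A - B" B] dom.mats_lin(2)[of A B] by simp

lemma F_ob: "F (obj e ls) = obj e' ls"
  by (rule fsm_eqI) (simp add: obj_def ent_fmap ent_diag f_0 f_e)

lemma F_hom: "A \<in> hom S e ls ms \<Longrightarrow> F A \<in> hom S' e' ls ms"
proof -
  assume A: "A \<in> hom S e ls ms"
  have "F (A * obj e ls) = F A * obj e' ls" "F (obj e ms * A) = obj e' ms * F A"
    using dom.hom_mats[OF A] dom.ob_mats by (simp_all add: F_mul F_ob)
  then show ?thesis using A F_mats[OF dom.hom_mats[OF A]] by (simp add: hom_def)
qed

lemma F_hom_mul: "A \<in> hom S e ls ms \<Longrightarrow> B \<in> hom S e ks ls \<Longrightarrow> F (A * B) = F A * F B"
  using F_mul dom.hom_mats by blast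

definition cmap :: "'r cx \<Rightarrow> 's cx" where
  "cmap T = Cx (src T) (tgt T) (F (dif T))"

lemma cmap_sel [simp]: "src (cmap T) = src T" "tgt (cmap T) = tgt T" "dif (cmap T) = F (dif T)"
  by (simp_all add: cmap_def)

lemma cmap_gv [simp]: "gv (cmap T) = gv T"
  by (simp add: gv_def)

lemma cmap_cx: "iscx S e T \<Longrightarrow> iscx S' e' (cmap T)"
  by (simp add: iscx_def F_hom)

lemma cmap_iso:
  assumes i: "iso S e T U" and cx: "iscx S e T" "iscx S e U"
  shows "iso S' e' (cmap T) (cmap U)"
proof -
  note d = cx[THEN dom.iscx_dif]
  from i obtain f1 f0 g1 g0 h k where 1:
    "f1 \<in> hom S e (src T) (src U)" "f0 \<in> hom S e (tgt T) (tgt U)" "g1 \<in> hom S e (src U) (src T)" "g0 \<in> hom S e (tgt U) (tgt T)"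
    "h \<in> hom S e (tgt T) (src T)" "k \<in> hom S e (tgt U) (src U)" and eq1: "dif U * f1 = f0 * dif T" "dif T * g1 = g0 * dif U"
    "g1 * f1 = obj e (src T) + h * dif T" "g0 * f0 = obj e (tgt T) + dif T * h"
    "f1 * g1 = obj e (src U) + k * dif U" "f0 * g0 = obj e (tgt U) + dif U * k" by (rule dom.isoE)
  note m = 1[THEN dom.hom_mats] d[THEN dom.hom_mats] dom.ob_mats
  have "F (g1 * f1) = F (obj e (src T) + h * dif T)" "F (g0 * f0) = F (obj e (tgt T) + dif T * h)"
    "F (f1 * g1) = F (obj e (src U) + k * dif U)" "F (f0 * g0) = F (obj e (tgt U) + dif U * k)"
    "F (dif U * f1) = F (f0 * dif T)" "F (dif T * g1) = F (g0 * dif U)"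
    using eq1 by simp_all
  then show ?thesis
    by (intro cod.isoI[of "F f1" _ _ "F f0" "F g1" "F g0" "F h" "F k"])
       (use 1 in \<open>simp_all add: F_hom\<close>, simp_all add: m F_mul F_add F_ob dom.mats_mul)
qed

lemma cmap_dsm: "iscx S e T \<Longrightarrow> iscx S e U \<Longrightarrow> cmap (dsm e T U) = dsm e' (cmap T) (cmap U)"
proof -
  assume cx: "iscx S e T" "iscx S e U"
  have s: "F (sft e n ls) = sft e' n ls" "F (sft' e n ls) = sft' e' n ls" for n ls
    by (rule fsm_eqI, simp add: sft_def sft'_def ent_colm ent_rowm ent_fmap f_0 f_e)+
  have m: "sft e n ls \<in> mats S" "sft' e n ls \<in> mats S" for n ls
    by (auto simp: mats_def sft_def sft'_def ent_colm ent_rowm dom.S0 dom.eS)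
  have d: "dif T \<in> mats S" "dif U \<in> mats S" using cx dom.iscx_dif dom.hom_mats by blast+
  show ?thesis by (rule cx_eqI) (simp_all add: dsm_def F_add F_mul m d s dom.mats_mul)
qed

lemma cmap_zcx [simp]: "cmap zcx = zcx"
  by (rule cx_eqI) (simp_all add: zcx_def fmap_zero f_0)

lemma cmap_dsms: "(\<And>T. T \<in> set Ts \<Longrightarrow> iscx S e T) \<Longrightarrow> cmap (dsms e Ts) = dsms e' (map cmap Ts)"
  by (induction Ts) (simp_all add: cmap_dsm dom.iscx_dsms)

end

section \<open>Left and right cones\<close>

context tri_alg
begin

text \<open>The chain map equations become scalar equations under \<open>\<Psi>\<close>, because the
  differentials vanish under both characters; the inverse for \<open>D\<close> is then compressed by
  the retraction.\<close>

lemma inv_summand: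
  assumes D: "minl D" and T: "minl T" and s: "summand S e T D"
  shows "linv D \<Longrightarrow> quad T \<Longrightarrow> linv T" "rinv D \<Longrightarrow> quad T \<Longrightarrow> rinv T"
proof -
  from s obtain i p j q where 1: "i \<in> Hom (src T) (src D)" "p \<in> Hom (src D) (src T)"
     "j \<in> Hom (tgt T) (tgt D)" "q \<in> Hom (tgt D) (tgt T)" and eq1: "p * i = ob (src T)" "q * j = ob (tgt T)"
     "dif D * i = j * dif T" "q * dif D = dif T * p" unfolding summand_def by blast
  note m = 1[THEN hom_mats]
  have dD: "dif D \<in> mats S" "\<Phi> 1 (dif D) = 0" "\<Phi> 2 (dif D) = 0" and dT: "dif T \<in> mats S" "\<Phi> 1 (dif T) = 0" "\<Phi> 2 (dif T) = 0"
    using D T by (simp_all add: minl_def mats_J_iff)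
  have "\<Psi> (dif D * i) = \<Psi> (j * dif T)" "\<Psi> (q * dif D) = \<Psi> (dif T * p)" using eq1 by simp_all
  then have P: "\<Psi> (dif D) * \<Phi> 2 i = \<Phi> 1 j * \<Psi> (dif T)" "\<Phi> 1 q * \<Psi> (dif D) = \<Psi> (dif T) * \<Phi> 2 p"
    using m dD dT by (simp_all add: Psi_mul)
  have ph: "un (length ms) * \<Phi> r f = \<Phi> r f" "\<Phi> r f * un (length ls) = \<Phi> r f" if "f \<in> Hom ls ms" "r \<in> {1, 2}" for f ls ms r
    using hom_ent(4,5)[OF that(1)] phi_0[OF that(2)] by (simp_all add: un_times_iff times_un_iff ent_fmap)
  show "linv T" if lD: "linv D" and qT: "quad T"
  proof -
    obtain Q where Q: "Q * \<Psi> (dif D) = un (length (src D))" "Q * un (length (tgt D)) = Q" "un (length (src D)) * Q = Q"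
      using lD unfolding linv_def by blast
    have "\<Phi> 2 p * Q * \<Phi> 1 j * \<Psi> (dif T) = \<Phi> 2 p * (Q * \<Psi> (dif D)) * \<Phi> 2 i"
      by (simp add: mult.assoc P)
    also have "\<dots> = \<Phi> 2 (p * i)" using ph(2)[OF 1(2), of 2] by (simp add: Q Phi_mul m)
    also have "\<dots> = un (length (src T))" unfolding eq1 using qT by (simp add: quad_def Phi_ob_un)
    finally show ?thesis unfolding linv_def
      using ph(1)[OF 1(2), of 2] ph(2)[OF 1(3), of 1]
      by (intro exI[of _ "\<Phi> 2 p * Q * \<Phi> 1 j"]) (simp add: mult.assoc[symmetric], simp add: mult.assoc)
  qed
  show "rinv T" if rD: "rinv D" and qT: "quad T"
  proof -
    obtain Q where Q: "\<Psi> (dif D) * Q = un (length (tgt D))" "Q * un (length (tgt D)) = Q" "un (length (src D)) * Q = Q"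
      using rD unfolding rinv_def by blast
    have "\<Psi> (dif T) * (\<Phi> 2 p * Q * \<Phi> 1 j) = \<Phi> 1 q * (\<Psi> (dif D) * Q) * \<Phi> 1 j"
      by (simp only: mult.assoc[symmetric] P(2))
    also have "\<dots> = \<Phi> 1 (q * j)" using ph(2)[OF 1(4), of 1] by (simp add: Q Phi_mul m)
    also have "\<dots> = un (length (tgt T))" unfolding eq1 using qT by (simp add: quad_def Phi_ob_un)
    finally show ?thesis unfolding rinv_def
      using ph(1)[OF 1(2), of 2] ph(2)[OF 1(3), of 1]
      by (intro exI[of _ "\<Phi> 2 p * Q * \<Phi> 1 j"]) (simp add: mult.assoc[symmetric], simp add: mult.assoc)
  qed
qed

lemma LFT_member:
  assumes "family S e Ts" "\<forall>T\<in>set Ts. minl T" "T \<in> set Ts" "LFT (dsms e Ts)"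
  shows "LFT T" "set (src T) \<inter> set (tgt T) = {}"
proof -
  have sub: "set (src T) \<subseteq> set (src (dsms e Ts))" "set (tgt T) \<subseteq> set (tgt (dsms e Ts))"
    using src_tgt_dsms assms(3) by blast+
  have sm: "summand S e T (dsms e Ts)" using summand_dsms family_cx[OF assms(1)] assms(3) by blast
  have "linv T" if "quad (dsms e Ts)" "linv (dsms e Ts)"
    by (rule inv_summand(1)[OF family_minl_presil(1)[OF assms(1,2)] _ sm])
       (use assms sub that in \<open>auto simp: quad_def\<close>)
  moreover have "quad T" if "quad (dsms e Ts)" using that sub by (auto simp: quad_def)
  ultimately show "LFT T" using assms(4) sub unfolding LFT_def by blast
  show "set (src T) \<inter> set (tgt T) = {}" using family_minl_presil(3)[OF assms(1,2)] sub by blast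
qed

definition LC :: "(real \<times> real) set set" where
  "LC = {gcone (set (map gv Ts)) | Ts. family S e Ts \<and> (\<forall>T\<in>set Ts. minl T) \<and> LFT (dsms e Ts)}"

definition RC :: "(real \<times> real) set set" where
  "RC = {gcone (set (map gv Ts)) | Ts. family S e Ts \<and> (\<forall>T\<in>set Ts. minl T) \<and> RGT (dsms e Ts)}"

lemma fan_LC_RC: "fan S e = LC \<union> RC"
  unfolding fan_minl LC_def RC_def using LFT_or_RGT family_minl_presil(1,2) by blast

text \<open>A left inverse of \<open>\<Psi> (dif T)\<close> forces at least as many labels in degree
  0 as in degree -1, so all g-vectors satisfy \<open>0 \<le> fst v + snd v\<close>. But \<sigma>
  contains \<open>(0, -1)\<close>.\<close>

lemma sigma_notin_LC: "gcone {(0, -1), (1, -1)} \<notin> LC"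
proof
  assume "gcone {(0, -1), (1, -1)} \<in> LC"
  then obtain Ts where Ts: "gcone {(0, -1), (1, -1)} = gcone (set (map gv Ts))" and F: "family S e Ts" "\<forall>T\<in>set Ts. minl T"
    and L: "LFT (dsms e Ts)" unfolding LC_def by auto
  have m: "(1, -1) \<in> gcone (set (map gv Ts))" "(0, -1) \<in> gcone (set (map gv Ts))"
    unfolding Ts[symmetric] by (rule gcone_base; simp)+
  note Q = sigma_quadrant[OF F m(1)]
  \<comment> \<open>Both labels have to occur, for otherwise \<open>LFT\<close> would hold without a
    left inverse.\<close>
  have ne: "src (dsms e Ts) \<noteq> []" "tgt (dsms e Ts) \<noteq> []"
  proof -
    have "\<exists>T\<in>set Ts. src T \<noteq> []" "\<exists>T\<in>set Ts. tgt T \<noteq> []"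
    proof -
      obtain c where c: "1 = (\<Sum>v\<in>set (map gv Ts). c v * fst v)" "- 1 = (\<Sum>v\<in>set (map gv Ts). c v * snd v)"
        using m(1) by (auto elim: gconeE)
      show "\<exists>T\<in>set Ts. src T \<noteq> []"
      proof (rule ccontr)
        assume "\<not> ?thesis"
        then have "(\<Sum>v\<in>set (map gv Ts). c v * snd v) = 0"
          using gv_quadrant[OF Q(3,4)] by (intro sum.neutral) auto
        then show False using c by simp
      qed
      show "\<exists>T\<in>set Ts. tgt T \<noteq> []"
      proof (rule ccontr)
        assume "\<not> ?thesis"
        then have "(\<Sum>v\<in>set (map gv Ts). c v * fst v) = 0"
          using gv_quadrant[OF Q(3,4)] by (intro sum.neutral) auto
        then show False using c by simp
      qed
    qed
    then show "src (dsms e Ts) \<noteq> []" "tgt (dsms e Ts) \<noteq> []" using src_tgt_dsms[of _ Ts] by fastforce+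
  qed
  then have "2 \<in> set (src (dsms e Ts))" "1 \<in> set (tgt (dsms e Ts))"
    using Q(1,2) by (metis list.set_sel(1) singletonD subset_iff)+
  have le: "0 \<le> fst v + snd v" if "v \<in> set (map gv Ts)" for v
  proof -
    obtain T where T: "T \<in> set Ts" "v = gv T" using \<open>v \<in> _\<close> by auto
    have sm: "summand S e T (dsms e Ts)" using summand_dsms family_cx[OF F(1)] T(1) by blast
    have "linv (dsms e Ts)" using L \<open>2 \<in> _\<close> \<open>1 \<in> _\<close> by (simp add: LFT_def)
    then have "linv T"
      by (rule inv_summand(1)[OF family_minl_presil(1)[OF F] _ sm, rotated])
         (use F Q(1,2) Q(3,4)[OF T(1)] T(1) in \<open>auto simp: quad_def\<close>)
    then obtain P where P: "P * \<Psi> (dif T) = un (length (src T))" "P * un (length (tgt T)) = P" "un (length (src T)) * P = P"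
      unfolding linv_def by blast
    have "length (src T) \<le> length (tgt T)"
      using left_inverse_imp_le[OF Psi_un P(2,3,1)] iscx_dif[OF family_cx[OF F(1) T(1)]] by blast
    then show ?thesis using gv_quadrant[OF Q(3,4)[OF T(1)]] T by simp
  qed
  obtain c where c: "\<forall>v\<in>set (map gv Ts). 0 \<le> c v" "0 = (\<Sum>v\<in>set (map gv Ts). c v * fst v)" "- 1 = (\<Sum>v\<in>set (map gv Ts). c v * snd v)"
    using m(2) by (auto elim: gconeE)
  have "0 \<le> (\<Sum>v\<in>set (map gv Ts). c v * (fst v + snd v))"
    by (rule sum_nonneg, rule mult_nonneg_nonneg) (use c(1) le in blast)+
  also have "\<dots> = -1" using c(2,3) by (simp add: distrib_left sum.distrib del: set_map)
  finally show False by simp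
qed

end

lemma aff_dim_gcone_single: "aff_dim (gcone {v}) \<le> 1" "aff_dim (gcone {} :: (real \<times> real) set) \<le> 1"
proof -
  have "gcone {v} \<subseteq> span {v}"
    by (auto simp: gcone_def span_singleton)
  then have "aff_dim (gcone {v}) \<le> aff_dim (span {v})" by (rule aff_dim_subset)
  also have "\<dots> = int (dim (span {v}))" by (rule aff_dim_subspace) simp
  also have "\<dots> \<le> 1" using dim_le_card[of "{v}" "{v}"] by (simp add: span_base)
  finally show "aff_dim (gcone {v}) \<le> 1" .
  have "gcone {} = ({0} :: (real \<times> real) set)" by (auto simp: gcone_def)
  then show "aff_dim (gcone {} :: (real \<times> real) set) \<le> 1" by simp
qed

lemma subset_pairD: "A \<subseteq> {a, b} \<Longrightarrow> A = {} \<or> A = {a} \<or> A = {b} \<or> A = {a, b}"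
  by blast

lemma cones2_iff: "C \<in> cones2 K \<longleftrightarrow> C \<in> K \<and> aff_dim C = 2"
  by (simp add: cones2_def)

context tri_gen
begin

text \<open>In a family giving a cone outside \<open>LC\<close> every member is right invertible, so
  its g-vector is one of the two generators of \<sigma>; dimension two requires both of
  them.\<close>

lemma cones2_RC: "C \<in> cones2 RC \<Longrightarrow> C \<notin> LC \<Longrightarrow> C = gcone {(0, -1), (1, -1)}"
proof -
  assume "C \<in> cones2 RC" and nL: "C \<notin> LC"
  then obtain Ts where Ts: "C = gcone (set (map gv Ts))" and F: "family S e Ts" "\<forall>T\<in>set Ts. minl T"
    and R: "RGT (dsms e Ts)" and dim: "aff_dim C = 2" unfolding cones2_iff RC_def by auto
  have "\<not> LFT (dsms e Ts)" using nL Ts F unfolding LC_def by blast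
  then have q: "quad (dsms e Ts)" "rinv (dsms e Ts)" using R unfolding LFT_def RGT_def by blast+
  have gvT: "gv T \<in> {(0, -1), (1, -1)}" if T: "T \<in> set Ts" for T
  proof (rule rinv_gv)
    show qT: "quad T" using q src_tgt_dsms T unfolding quad_def by (meson subset_trans)
    have sm: "summand S e T (dsms e Ts)" using summand_dsms family_cx[OF F(1)] T by blast
    show "rinv T"
      by (rule inv_summand(2)[OF family_minl_presil(1)[OF F] _ sm]) (use F T q qT in auto)
  qed (use F T in \<open>auto simp: family_def\<close>)
  have sub: "set (map gv Ts) \<subseteq> {(0, -1), (1, -1)}"
    unfolding set_map by (rule image_subsetI) (rule gvT)
  consider "set (map gv Ts) = {}" | "set (map gv Ts) = {(0, -1)}" | "set (map gv Ts) = {(1, -1)}"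
    | "set (map gv Ts) = {(0, -1), (1, -1)}"
    using subset_pairD[OF sub] by blast
  then show ?thesis
  proof cases
    case 1
    then show ?thesis using aff_dim_gcone_single(2) dim unfolding Ts by (simp del: set_map)
  next
    case 2
    have "aff_dim C \<le> 1" unfolding Ts 2 by (rule aff_dim_gcone_single(1))
    then show ?thesis using dim by simp
  next
    case 3
    have "aff_dim C \<le> 1" unfolding Ts 3 by (rule aff_dim_gcone_single(1))
    then show ?thesis using dim by simp
  qed (simp add: Ts del: set_map)
qed

lemma cones2_LC: "cones2 LC = cones2 (fan S e) - {gcone {(0, -1), (1, -1)}}"
  using sigma_notin_LC cones2_RC by (auto simp: fan_LC_RC cones2_iff)

end

text \<open>The projection \<open>p\<close> of a fibre product to a factor, with section
  \<open>s\<close>. \<open>ker\<close> says that the elements from label 2 to label 1 killed by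
  \<open>p\<close> are left multiples of \<open>y\<close> with coefficients killed by
  \<open>p\<close>; \<open>ker_mul\<close> says that such a coefficient times a lifted element
  depends only on the value of \<open>\<psi>\<close>.\<close>

locale fib = G: tri_alg SG eG scG \<phi>G y \<psi>G + L: tri_alg S e sc \<phi> x \<psi>
    + p: rhom SG eG S e p + s: rhom S e SG eG s
  for SG :: "'g::ring set" and eG and scG :: "'k::field \<Rightarrow> 'g \<Rightarrow> 'g" and \<phi>G and y and \<psi>G
    and S :: "'r::ring set" and e and sc :: "'k \<Rightarrow> 'r \<Rightarrow> 'r" and \<phi> and x and \<psi> and p and s +
  assumes ps: "r \<in> S \<Longrightarrow> p (s r) = r"
    and phi_p: "i \<in> {1, 2} \<Longrightarrow> g \<in> SG \<Longrightarrow> \<phi>G i g = \<phi> i (p g)" and psi_p: "g \<in> SG \<Longrightarrow> \<psi>G g = \<psi> (p g)"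
    and ker: "\<kappa> \<in> SG \<Longrightarrow> eG 1 * \<kappa> = \<kappa> \<Longrightarrow> \<kappa> * eG 2 = \<kappa> \<Longrightarrow> p \<kappa> = 0 \<Longrightarrow>
       \<exists>n\<in>SG. eG 1 * n = n \<and> n * eG 1 = n \<and> p n = 0 \<and> \<kappa> = n * y"
    and ker_mul: "n \<in> SG \<Longrightarrow> eG 1 * n = n \<Longrightarrow> n * eG 1 = n \<Longrightarrow> p n = 0 \<Longrightarrow>
       m \<in> S \<Longrightarrow> e 1 * m = m \<Longrightarrow> m * e 2 = m \<Longrightarrow> n * s m = scG (\<psi> m) (n * y)"
begin

lemma p_J: "M \<in> mats SG \<Longrightarrow> fmap p M \<in> mats L.J \<longleftrightarrow> M \<in> mats G.J"
  by (auto simp: mats_def radl_def ent_fmap p.f_0 phi_p p.f_S)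

lemma p_s: "M \<in> mats S \<Longrightarrow> fmap p (fmap s M) = M"
  by (rule fsm_eqI) (simp add: ent_fmap p.f_0 s.f_0 mats_def ps)

lemma minl_p: "G.minl T \<Longrightarrow> L.minl (p.cmap T)"
  using p_J[of "dif T"] by (simp add: G.minl_def L.minl_def p.cmap_cx G.mats_J_iff)

lemma minl_s: "L.minl T \<Longrightarrow> G.minl (s.cmap T)"
proof -
  assume T: "L.minl T"
  then have m: "dif T \<in> mats S" by (simp add: L.minl_def L.mats_J_iff)
  then have "fmap s (dif T) \<in> mats G.J" using p_J[OF s.F_mats[OF m]] T by (simp add: p_s L.minl_def)
  then show ?thesis using T by (simp add: G.minl_def L.minl_def s.cmap_cx)
qed

lemma Psi_p: "M \<in> mats SG \<Longrightarrow> G.\<Psi> M = L.\<Psi> (fmap p M)"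
  by (rule fsm_eqI) (simp add: ent_fmap G.psi_0 L.psi_0 p.f_0 mats_def psi_p)

lemma LFT_p: "iscx SG eG T \<Longrightarrow> G.LFT T \<longleftrightarrow> L.LFT (p.cmap T)"
  using G.hom_mats[OF G.iscx_dif] by (simp add: G.LFT_def L.LFT_def G.quad_def L.quad_def G.linv_def L.linv_def Psi_p)

lemma p_s_cx: "iscx S e T \<Longrightarrow> p.cmap (s.cmap T) = T"
  by (rule cx_eqI) (simp_all add: p_s L.hom_mats[OF L.iscx_dif])

text \<open>Here \<open>K\<close> equals \<open>n y\<close> for a matrix \<open>n\<close> over the kernel of \<open>p\<close>, and \<open>n y = (n P) s(d)\<close> since \<open>P\<close> inverts \<open>\<psi>(d)\<close>.\<close>
lemma kernel_factor:
  assumes K: "K \<in> hom SG eG ls ms" "fmap p K = 0" and ls: "set ls \<subseteq> {2}" and ms: "set ms \<subseteq> {1}"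
    and d: "d \<in> hom S e ls ms" and P: "P * L.\<Psi> d = un (length ls)" "P * un (length ms) = P" "un (length ls) * P = P"
  shows "\<exists>Q\<in>hom SG eG ms ms. fmap p Q = 0 \<and> Q * fmap s d = K"
proof -
  define b where "b = length ls"
  define rs where "rs = replicate b (1::nat)"
  have rs: "length rs = b" "set rs \<subseteq> {1}" "\<And>q. q < b \<Longrightarrow> rs ! q = 1" by (auto simp: rs_def)
  have lm: "ms ! i = 1" if "i < length ms" for i using that ms nth_mem by blast
  have ll: "ls ! i = 2" if "i < b" for i using that ls nth_mem unfolding b_def by blast
  have ex: "\<exists>n\<in>SG. eG 1 * n = n \<and> n * eG 1 = n \<and> p n = 0 \<and> ent K i j = n * y"
    if "i < length ms" "j < b" for i j
  proof (rule ker)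
    have "ent (fmap p K) i j = 0" using K(2) by simp
    then show "p (ent K i j) = 0" by (simp add: ent_fmap p.f_0)
  qed (use G.hom_ent(1)[OF K(1), of i j] G.hom_ent(2)[OF K(1), of i j] G.hom_ent(3)[OF K(1), of j i] that lm ll in \<open>auto simp: b_def\<close>)
  define \<nu> where "\<nu> i j = (SOME n. n \<in> SG \<and> eG 1 * n = n \<and> n * eG 1 = n \<and> p n = 0 \<and> ent K i j = n * y)" for i j
  have \<nu>: "\<nu> i j \<in> SG \<and> eG 1 * \<nu> i j = \<nu> i j \<and> \<nu> i j * eG 1 = \<nu> i j \<and> p (\<nu> i j) = 0 \<and> ent K i j = \<nu> i j * y"
    if "i < length ms" "j < b" for i j
    unfolding \<nu>_def by (rule someI_ex) (use ex[OF that] in blast)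
  define N where "N = Fsm (\<lambda>i j. if i < length ms \<and> j < b then \<nu> i j else 0)"
  have Ne: "ent N i j = (if i < length ms \<and> j < b then \<nu> i j else 0)" for i j
    unfolding N_def by (subst ent_Fsm[of "max (length ms) b"]) auto
  have N: "N \<in> hom SG eG rs ms"
    by (rule G.homI_ent) (use \<nu> lm rs in \<open>auto simp: Ne G.S0\<close>)
  have pN: "fmap p N = 0"
    by (rule fsm_eqI) (use \<nu> in \<open>auto simp: ent_fmap p.f_0 Ne\<close>)
  \<comment> \<open>\<open>P\<close> is lifted so that \<open>D\<close> has \<open>b\<close> rows
    and the identity as residue; by \<open>ker_mul\<close> the product of \<open>N\<close> with the
    lift of \<open>D\<close> is then computed as if \<open>D\<close> were the identity.\<close>
  define D where "D = L.lft 1 P * d"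
  have lP: "L.lft 1 P \<in> hom S e ms rs" by (rule L.lft_hom) (use ms rs P in \<open>auto simp: b_def\<close>)
  have D: "D \<in> hom S e ls rs" unfolding D_def using L.hom_mul[OF lP d] .
  have "L.\<Psi> (L.lft 1 P) = 0"
    by (rule fsm_eqI) (simp add: ent_fmap L.psi_0 L.lft_def L.psi_sc L.eS L.psi_e)
  then have PD: "L.\<Psi> D = un b"
    unfolding D_def using L.Phi_lft[of 1 P] P(1) L.hom_mats[OF lP] L.hom_mats[OF d] by (simp add: L.Psi_mul b_def)
  have psiD: "\<psi> (ent D j k) = (if j = k \<and> k < b then 1 else 0)" for j k
    using arg_cong[OF PD, of "\<lambda>M. ent M j k"] by (simp add: ent_fmap L.psi_0 ent_un)
  have "N * fmap s D = K"
  proof (rule fsm_eqI)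
    fix i k
    show "ent (N * fmap s D) i k = ent K i k"
    proof (cases "i < length ms \<and> k < b")
      case True
      have t: "ent N i j * ent (fmap s D) j k = (if j = k then ent K i k else 0)" if j: "j < b" for j
      proof -
        have "\<nu> i j * s (ent D j k) = scG (\<psi> (ent D j k)) (\<nu> i j * y)"
          by (rule ker_mul) (use \<nu>[of i j] True j L.hom_ent(1)[OF D, of j k] L.hom_ent(2)[OF D, of j k] L.hom_ent(3)[OF D, of k j] rs ll
            in \<open>auto simp: b_def\<close>)
        then show ?thesis using True j \<nu>[of i k] by (simp add: Ne ent_fmap s.f_0 psiD)
      qed
      have "ent (N * fmap s D) i k = (\<Sum>j<b. ent N i j * ent (fmap s D) j k)"
        by (rule ent_times) (simp add: Ne)
      also have "\<dots> = (\<Sum>j<b. if j = k then ent K i k else 0)" by (rule sum.cong) (simp_all add: t)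
      finally show ?thesis using True by simp
    next
      case False
      have "N * fmap s D \<in> hom SG eG ls ms" using G.hom_mul[OF N s.F_hom[OF D]] .
      then have "ent (N * fmap s D) i k = 0" using False G.hom_ent(4,5) unfolding b_def by blast
      moreover have "ent K i k = 0" using False G.hom_ent(4,5)[OF K(1)] unfolding b_def by blast
      ultimately show ?thesis by simp
    qed
  qed
  moreover have "fmap s D = fmap s (L.lft 1 P) * fmap s d"
    unfolding D_def by (rule s.F_hom_mul[OF lP d])
  moreover have sP: "fmap s (L.lft 1 P) \<in> hom SG eG ms rs" by (rule s.F_hom[OF lP])
  moreover have "fmap p (N * fmap s (L.lft 1 P)) = 0" using p.F_hom_mul[OF N sP] pN by simp
  ultimately show ?thesis using G.hom_mul[OF N sP]
    by (intro bexI[of _ "N * fmap s (L.lft 1 P)"]) (simp_all add: mult.assoc)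
qed

lemma LFT_iso_section:
  assumes T: "G.minl T" "G.LFT T" "set (src T) \<inter> set (tgt T) = {}"
  shows "iso SG eG T (s.cmap (p.cmap T))"
proof -
  have cx: "iscx SG eG T" using T(1) by (rule G.minl_cx)
  have d: "dif T \<in> hom SG eG (src T) (tgt T)" using G.iscx_dif[OF cx] .
  have lab: "set (src T) \<subseteq> {1, 2}" "set (tgt T) \<subseteq> {1, 2}" using cx by (auto simp: iscx_def)
  have pd: "fmap p (dif T) \<in> hom S e (src T) (tgt T)" using p.F_hom[OF d] .
  have spd: "fmap s (fmap p (dif T)) \<in> hom SG eG (src T) (tgt T)" using s.F_hom[OF pd] .
  show ?thesis
  proof (cases "2 \<notin> set (src T) \<or> 1 \<notin> set (tgt T)")
    case True
    then have "dif T = 0" "fmap s (fmap p (dif T)) = 0" using G.hom_eq_0[OF _ lab T(3)] d spd by blast+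
    then have "s.cmap (p.cmap T) = T" by (intro cx_eqI) simp_all
    then show ?thesis using G.iso_refl[OF cx] by simp
  next
    case False
    then have q: "G.quad T" "G.linv T" using T(2) by (auto simp: G.LFT_def)
    obtain P where P: "P * L.\<Psi> (fmap p (dif T)) = un (length (src T))" "P * un (length (tgt T)) = P" "un (length (src T)) * P = P"
      using q(2) unfolding G.linv_def by (auto simp: Psi_p G.hom_mats[OF d])
    define K where "K = dif T - fmap s (fmap p (dif T))"
    have K: "K \<in> hom SG eG (src T) (tgt T)" unfolding K_def using d spd by (rule G.hom_diff)
    have "fmap p K = 0"
      unfolding K_def by (simp add: p.F_diff G.hom_mats[OF d] G.hom_mats[OF spd] p_s L.hom_mats[OF pd])
    from kernel_factor[OF K this _ _ pd P] q(1) obtain Q where Q: "Q \<in> hom SG eG (tgt T) (tgt T)" "fmap p Q = 0"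
      "Q * fmap s (fmap p (dif T)) = K" by (auto simp: G.quad_def)
    \<comment> \<open>The characters factor through \<open>p\<close>, so a matrix killed by
      \<open>p\<close> is radical and the identity plus \<open>Q\<close> is an automorphism.\<close>
    have "Q \<in> mats G.J" using p_J[OF G.hom_mats[OF Q(1)]] Q(2) by (simp add: mats_def L.J_0)
    from G.one_plus_J_inverse[OF Q(1) this] obtain W where W: "W \<in> hom SG eG (tgt T) (tgt T)"
      "W * (G.ob (tgt T) + Q) = G.ob (tgt T)" "(G.ob (tgt T) + Q) * W = G.ob (tgt T)" by blast
    have eq: "dif T = (G.ob (tgt T) + Q) * fmap s (fmap p (dif T))"
      using spd by (simp add: distrib_right Q(3) G.hom_simps K_def)
    have eqW: "W * dif T = fmap s (fmap p (dif T))"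
      using spd by (subst eq, subst mult.assoc[symmetric], subst W(2)) (simp add: G.hom_simps)
    have oQ: "G.ob (tgt T) + Q \<in> hom SG eG (tgt T) (tgt T)" using Q(1) by blast
    show ?thesis
      by (rule G.isoI[of "G.ob (src T)" _ _ W "G.ob (src T)" "G.ob (tgt T) + Q" 0 0])
         (use W oQ d spd eqW eq[symmetric] in \<open>simp_all add: G.hom_simps G.ob_idem\<close>)
  qed
qed

text \<open>A map over the factor is lifted by the section, solved upstairs and projected
  back.\<close>

lemma presil_p:
  assumes cx: "iscx SG eG D" and D: "presil SG eG D"
  shows "presil S e (p.cmap D)"
  unfolding presil_def
proof
  fix g assume "g \<in> hom S e (src (p.cmap D)) (tgt (p.cmap D))"
  then have g: "g \<in> hom S e (src D) (tgt D)" by simp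
  obtain a b where a: "a \<in> hom SG eG (src D) (src D)" and b: "b \<in> hom SG eG (tgt D) (tgt D)"
    and ab: "fmap s g = dif D * a + b * dif D" using D s.F_hom[OF g] unfolding presil_def by blast
  note m = G.hom_mats[OF a] G.hom_mats[OF b] G.hom_mats[OF G.iscx_dif[OF cx]]
  have "fmap p (fmap s g) = fmap p (dif D) * fmap p a + fmap p b * fmap p (dif D)"
    unfolding ab by (simp add: p.F_add p.F_mul m G.mats_mul)
  then have "g = dif (p.cmap D) * fmap p a + fmap p b * dif (p.cmap D)" by (simp add: p_s L.hom_mats[OF g])
  then show "\<exists>a\<in>hom S e (src (p.cmap D)) (src (p.cmap D)). \<exists>b\<in>hom S e (tgt (p.cmap D)) (tgt (p.cmap D)).
      g = dif (p.cmap D) * a + b * dif (p.cmap D)"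
    using p.F_hom[OF a] p.F_hom[OF b] by auto
qed

text \<open>Over the factor the projection of \<open>g\<close> already has the form
  \<open>d a + b d\<close>. What is left of \<open>g\<close> after lifting this solution lies in the
  kernel, equals \<open>Q\<close> times the lifted differential, and is absorbed into
  \<open>b\<close>.\<close>

lemma presil_s:
  assumes D: "L.minl D" "presil S e D" "L.LFT D"
  shows "presil SG eG (s.cmap D)"
  unfolding presil_def
proof
  fix g assume "g \<in> hom SG eG (src (s.cmap D)) (tgt (s.cmap D))"
  then have g: "g \<in> hom SG eG (src D) (tgt D)" by simp
  have cx: "iscx S e D" using L.minl_cx[OF D(1)] .
  have d: "dif D \<in> hom S e (src D) (tgt D)" using L.iscx_dif[OF cx] .
  have lab: "set (src D) \<subseteq> {1, 2}" "set (tgt D) \<subseteq> {1, 2}" using cx by (auto simp: iscx_def)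
  have "\<exists>a\<in>hom SG eG (src D) (src D). \<exists>b\<in>hom SG eG (tgt D) (tgt D). g = fmap s (dif D) * a + b * fmap s (dif D)"
  proof (cases "2 \<notin> set (src D) \<or> 1 \<notin> set (tgt D)")
    case True
    then have "g = 0" using G.hom_eq_0[OF g lab L.presil_disjoint[OF D(1,2)]] by blast
    then show ?thesis by (intro bexI[of _ 0]) simp_all
  next
    case False
    then have q: "L.quad D" "L.linv D" using D(3) by (auto simp: L.LFT_def)
    have pg: "fmap p g \<in> hom S e (src D) (tgt D)" using p.F_hom[OF g] .
    then obtain a b where a: "a \<in> hom S e (src D) (src D)" and b: "b \<in> hom S e (tgt D) (tgt D)"
      and ab: "fmap p g = dif D * a + b * dif D" using D(2) unfolding presil_def by blast
    obtain P where P: "P * L.\<Psi> (dif D) = un (length (src D))" "P * un (length (tgt D)) = P" "un (length (src D)) * P = P"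
      using q(2) unfolding L.linv_def by blast
    define K where "K = g - fmap s (fmap p g)"
    have K: "K \<in> hom SG eG (src D) (tgt D)" unfolding K_def using g s.F_hom[OF pg] by (rule G.hom_diff)
    have "fmap p K = 0"
      unfolding K_def by (simp add: p.F_diff G.hom_mats[OF g] G.hom_mats[OF s.F_hom[OF pg]] p_s L.hom_mats[OF pg])
    from kernel_factor[OF K this _ _ d P] q(1) obtain Q where Q: "Q \<in> hom SG eG (tgt D) (tgt D)"
      "Q * fmap s (dif D) = K" by (auto simp: L.quad_def)
    note m = L.hom_mats[OF a] L.hom_mats[OF b] L.hom_mats[OF d]
    have "g = fmap s (fmap p g) + K" by (simp add: K_def)
    also have "\<dots> = fmap s (dif D) * fmap s a + (fmap s b + Q) * fmap s (dif D)"
      unfolding ab by (simp add: s.F_add s.F_mul m L.mats_mul Q(2) distrib_right)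
    finally show ?thesis using s.F_hom[OF a] s.F_hom[OF b] Q(1) by blast
  qed
  then show "\<exists>a\<in>hom SG eG (src (s.cmap D)) (src (s.cmap D)). \<exists>b\<in>hom SG eG (tgt (s.cmap D)) (tgt (s.cmap D)).
      g = dif (s.cmap D) * a + b * dif (s.cmap D)" by simp
qed

text \<open>The projection keeps labels, and a contractible minimal complex has none. This carries
  indecomposability from the factor up to the fibre product.\<close>

lemma p_iso_zero:
  assumes U: "iscx SG eG U" and z: "iso S e (p.cmap U) zcx"
  shows "iso SG eG U zcx"
proof -
  obtain U' where U': "G.minl U'" "iso SG eG U U'" using G.minimize[OF U] by blast
  have cx: "iscx SG eG U'" using G.minl_cx[OF U'(1)] .
  have "iso S e (p.cmap U') zcx"
    using L.iso_trans[OF L.iso_sym[OF p.cmap_iso[OF U'(2) U cx]] z] .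
  then have e: "src U' = []" "tgt U' = []" using L.minl_iso_zero[OF minl_p[OF U'(1)]] by simp_all
  have "dif U' = 0" using G.hom_l[OF G.iscx_dif[OF cx]] e by (simp add: obj_def diag_def zero_fsm_def[symmetric])
  then have "U' = zcx" using e by (intro cx_eqI) (simp_all add: zcx_def)
  then show ?thesis using U'(2) by simp
qed

text \<open>\<open>p.cmap\<close> and \<open>s.cmap\<close> carry left families to left families,
  inverse to each other up to isomorphism, and keep the g-vectors.\<close>

lemma LC_eq: "G.LC = L.LC"
proof
  show "G.LC \<subseteq> L.LC"
  proof
    fix C assume "C \<in> G.LC"
    then obtain Ts where Ts: "C = gcone (set (map gv Ts))" and F: "family SG eG Ts" "\<forall>T\<in>set Ts. G.minl T"
      and lft: "G.LFT (dsms eG Ts)" unfolding G.LC_def by blast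
    have cx: "iscx SG eG T" if "T \<in> set Ts" for T using G.family_cx[OF F(1) that] .
    have sec: "iso SG eG T (s.cmap (p.cmap T))" if "T \<in> set Ts" for T
      by (rule LFT_iso_section) (use F(2) G.LFT_member[OF F that lft] that in auto)
    have cp: "iscx S e (p.cmap T)" if "T \<in> set Ts" for T using p.cmap_cx[OF cx[OF that]] .
    have sz: "iso SG eG (s.cmap V) zcx" if "iso S e V zcx" "iscx S e V" for V
      using s.cmap_iso[OF that L.iscx_zcx] by simp
    have ind: "ind S e (p.cmap T)" if T: "T \<in> set Ts" for T
      unfolding ind_def
    proof (intro conjI allI impI)
      have iT: "ind SG eG T" using F(1) T by (simp add: family_def)
      show "iscx S e (p.cmap T)" using cp[OF T] .
      show "\<not> iso S e (p.cmap T) zcx" using p_iso_zero[OF cx[OF T]] iT by (auto simp: ind_def)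
      fix U V assume UV: "iscx S e U \<and> iscx S e V \<and> iso S e (p.cmap T) (dsm e U V)"
      then have "iso SG eG (s.cmap (p.cmap T)) (s.cmap (dsm e U V))"
        using s.cmap_iso[OF _ cp[OF T]] L.iscx_dsm by blast
      then have "iso SG eG T (dsm eG (s.cmap U) (s.cmap V))"
        using G.iso_trans[OF sec[OF T]] UV by (simp add: s.cmap_dsm)
      then have "iso SG eG (s.cmap U) zcx \<or> iso SG eG (s.cmap V) zcx"
        using iT UV s.cmap_cx unfolding ind_def by blast
      moreover have "iso S e W zcx" if "iso SG eG (s.cmap W) zcx" "iscx S e W" for W
        using p.cmap_iso[OF that(1) s.cmap_cx[OF that(2)] G.iscx_zcx] by (simp add: p_s_cx that(2))
      ultimately show "iso S e U zcx \<or> iso S e V zcx" using UV by blast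
    qed
    have "\<not> iso S e (p.cmap (Ts ! i)) (p.cmap (Ts ! j))" if ij: "i < length Ts" "j < length Ts" "i \<noteq> j" for i j
    proof
      assume "iso S e (p.cmap (Ts ! i)) (p.cmap (Ts ! j))"
      then have "iso SG eG (s.cmap (p.cmap (Ts ! i))) (s.cmap (p.cmap (Ts ! j)))"
        using s.cmap_iso cp ij by simp
      then have "iso SG eG (Ts ! i) (Ts ! j)"
        using sec[of "Ts ! i"] sec[of "Ts ! j"] ij by (meson G.iso_sym G.iso_trans nth_mem)
      then show False using F(1) ij by (simp add: family_def)
    qed
    moreover have D: "dsms e (map p.cmap Ts) = p.cmap (dsms eG Ts)" using p.cmap_dsms cx by simp
    have cD: "iscx SG eG (dsms eG Ts)" using G.iscx_dsms cx by blast
    then have "presil S e (dsms e (map p.cmap Ts))" unfolding D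
      by (rule presil_p) (use F in \<open>simp add: family_def\<close>)
    ultimately have "family S e (map p.cmap Ts)" using ind unfolding family_def by simp
    moreover have "\<forall>T\<in>set (map p.cmap Ts). L.minl T" using F(2) minl_p by auto
    moreover have "L.LFT (dsms e (map p.cmap Ts))" using lft LFT_p[OF cD] D by simp
    moreover have "map gv (map p.cmap Ts) = map gv Ts" by simp
    ultimately show "C \<in> L.LC" unfolding L.LC_def Ts mem_Collect_eq by (intro exI[of _ "map p.cmap Ts"]) (simp only: conj_assoc simp_thms)
  qed
  show "L.LC \<subseteq> G.LC"
  proof
    fix C assume "C \<in> L.LC"
    then obtain Ts where Ts: "C = gcone (set (map gv Ts))" and F: "family S e Ts" "\<forall>T\<in>set Ts. L.minl T"
      and lft: "L.LFT (dsms e Ts)" unfolding L.LC_def by blast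
    have cx: "iscx S e T" if "T \<in> set Ts" for T using L.family_cx[OF F(1) that] .
    have ind: "ind SG eG (s.cmap T)" if T: "T \<in> set Ts" for T
      unfolding ind_def
    proof (intro conjI allI impI)
      have iT: "ind S e T" using F(1) T by (simp add: family_def)
      show cs: "iscx SG eG (s.cmap T)" using s.cmap_cx[OF cx[OF T]] .
      show "\<not> iso SG eG (s.cmap T) zcx"
      proof
        assume "iso SG eG (s.cmap T) zcx"
        from p.cmap_iso[OF this cs G.iscx_zcx] show False using iT cx[OF T] by (simp add: p_s_cx ind_def)
      qed
      fix U V assume UV: "iscx SG eG U \<and> iscx SG eG V \<and> iso SG eG (s.cmap T) (dsm eG U V)"
      then have "iso S e (p.cmap (s.cmap T)) (p.cmap (dsm eG U V))"
        using p.cmap_iso[OF _ cs] G.iscx_dsm by blast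
      then have "iso S e T (dsm e (p.cmap U) (p.cmap V))"
        using UV cx[OF T] by (simp add: p.cmap_dsm p_s_cx)
      then have "iso S e (p.cmap U) zcx \<or> iso S e (p.cmap V) zcx"
        using iT UV p.cmap_cx unfolding ind_def by blast
      then show "iso SG eG U zcx \<or> iso SG eG V zcx" using p_iso_zero UV by blast
    qed
    have "\<not> iso SG eG (s.cmap (Ts ! i)) (s.cmap (Ts ! j))" if ij: "i < length Ts" "j < length Ts" "i \<noteq> j" for i j
    proof
      assume "iso SG eG (s.cmap (Ts ! i)) (s.cmap (Ts ! j))"
      then have "iso S e (p.cmap (s.cmap (Ts ! i))) (p.cmap (s.cmap (Ts ! j)))"
        using p.cmap_iso s.cmap_cx cx ij by simp
      then show False using F(1) ij cx by (simp add: family_def p_s_cx)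
    qed
    moreover have D: "dsms eG (map s.cmap Ts) = s.cmap (dsms e Ts)" using s.cmap_dsms cx by simp
    have cD: "iscx S e (dsms e Ts)" using L.iscx_dsms cx by blast
    have "presil SG eG (dsms eG (map s.cmap Ts))" unfolding D
      by (rule presil_s) (use L.family_minl_presil[OF F] lft in auto)
    ultimately have "family SG eG (map s.cmap Ts)" using ind unfolding family_def by simp
    moreover have "\<forall>T\<in>set (map s.cmap Ts). G.minl T" using F(2) minl_s by auto
    moreover have "G.LFT (dsms eG (map s.cmap Ts))" using lft LFT_p[OF s.cmap_cx[OF cD]] D by (simp add: p_s_cx cD)
    moreover have "map gv (map s.cmap Ts) = map gv Ts" by simp
    ultimately show "C \<in> G.LC" unfolding G.LC_def Ts mem_Collect_eq by (intro exI[of _ "map s.cmap Ts"]) (simp only: conj_assoc simp_thms)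
  qed
qed

end

section \<open>Duality\<close>

text \<open>Every label other than 1 is treated as 2, in agreement with \<open>idm\<close>.\<close>

definition sw :: "nat \<Rightarrow> nat" where "sw i = (if i = 1 then 2 else 1)"

lemma sw_simps [simp]: "sw 1 = 2" "sw (Suc 0) = 2" "sw 2 = 1"
  by (simp_all add: sw_def)

lemma sw_12 [simp]: "sw i \<in> {1, 2}"
  by (simp add: sw_def)

lemma map_sw_sw: "set ls \<subseteq> {1, 2} \<Longrightarrow> map sw (map sw ls) = ls"
  by (induction ls) (auto simp: sw_def)

lemma count_sw: "set ls \<subseteq> {1, 2} \<Longrightarrow> i \<in> {1, 2} \<Longrightarrow> count_list (map sw ls) i = count_list ls (sw i)"
  by (induction ls) (auto simp: sw_def)

text \<open>The effect of duality on g-vectors: the reflection that fixes \<open>(1, -1)\<close>,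
  preserves the fourth quadrant and exchanges the rays of \<open>(0, -1)\<close> and
  \<open>(1, 0)\<close>.\<close>

definition dlt :: "real \<times> real \<Rightarrow> real \<times> real" where "dlt v = (- snd v, - fst v)"

lemma dlt_dlt [simp]: "dlt (dlt v) = v"
  by (simp add: dlt_def)

lemma linear_dlt: "linear dlt"
  by (rule linearI) (auto simp: dlt_def)

lemma inj_dlt: "inj dlt"
  by (metis dlt_dlt injI)

lemma gcone_dlt: "gcone (dlt ` K) = dlt ` gcone K"
proof -
  have *: "dlt ` gcone K \<subseteq> gcone (dlt ` K)" for K
  proof
    fix u assume "u \<in> dlt ` gcone K"
    then obtain c where c: "u = dlt (\<Sum>v\<in>K. c v *\<^sub>R v)" "\<forall>v\<in>K. 0 \<le> c v" by (auto simp: gcone_def)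
    have "u = (\<Sum>v\<in>K. c v *\<^sub>R dlt v)" unfolding c(1)
      by (simp add: linear_sum[OF linear_dlt] linear_scale[OF linear_dlt])
    also have "\<dots> = (\<Sum>v\<in>dlt ` K. c (dlt v) *\<^sub>R v)"
      by (subst sum.reindex) (auto intro: inj_on_subset[OF inj_dlt])
    finally show "u \<in> gcone (dlt ` K)" using c(2) unfolding gcone_def
      by (intro CollectI exI[of _ "\<lambda>v. c (dlt v)"]) auto
  qed
  have "dlt ` gcone (dlt ` K) \<subseteq> gcone K" using *[of "dlt ` K"] by (simp add: image_image)
  then have "gcone (dlt ` K) \<subseteq> dlt ` gcone K" by (metis dlt_dlt image_subset_iff rev_image_eqI subsetI)
  with * show ?thesis by blast
qed

lemma cones2_dlt: "cones2 ((`) dlt ` K) = (`) dlt ` cones2 K"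
  using aff_dim_injective_linear_image[OF linear_dlt inj_dlt] by (auto simp: cones2_def)

text \<open>\<open>\<theta>\<close> is an anti-automorphism of order at most two of the ambient
  ring, transposition in the applications, so the opposite algebra is the image of \<open>S\<close>
  in the same type. \<open>conv\<close> lets \<open>sw\<close> be undone on every index.\<close>

locale dual = idem_ring S e for S :: "'r::ring set" and e +
  fixes \<theta> :: "'r \<Rightarrow> 'r"
  assumes th_add: "\<theta> (a + b) = \<theta> a + \<theta> b" and th_mul: "\<theta> (a * b) = \<theta> b * \<theta> a" and th_th: "\<theta> (\<theta> a) = a"
    and conv: "i \<noteq> 1 \<Longrightarrow> e i = e 2"
begin

definition Sd :: "'r set" where "Sd = \<theta> ` S"
text \<open>Swapping the labels keeps the opposite algebra triangular in the same direction.\<close>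

definition ed :: "nat \<Rightarrow> 'r" where "ed i = \<theta> (e (sw i))"
definition Th :: "'r fsm \<Rightarrow> 'r fsm" where "Th M = tpose (fmap \<theta> M)"
text \<open>The duality of projectives: maps are reversed, so the two terms change places.\<close>

definition dcx :: "'r cx \<Rightarrow> 'r cx" where "dcx T = Cx (map sw (tgt T)) (map sw (src T)) (Th (dif T))"

lemma th_0 [simp]: "\<theta> 0 = 0"
proof -
  have "\<theta> 0 + \<theta> 0 = \<theta> 0 + 0" using th_add[of 0 0] by simp
  then show ?thesis by (rule add_left_imp_eq)
qed

lemma th_neg: "\<theta> (- a) = - \<theta> a"
  using th_add[of a "- a"] by (simp add: eq_neg_iff_add_eq_0 add.commute)

lemma th_S: "\<theta> s \<in> Sd \<longleftrightarrow> s \<in> S"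
  unfolding Sd_def by (metis image_iff th_th)

lemma Sd_iff: "s \<in> Sd \<longleftrightarrow> \<theta> s \<in> S"
  unfolding Sd_def by (metis image_iff th_th)

lemma dual_idem_ring: "idem_ring Sd ed"
proof
  show "ed i * ed i = ed i" for i by (simp add: ed_def th_mul[symmetric] ee)
qed (auto simp: Sd_iff th_add th_neg th_mul S0 Sadd Sneg Smul eS ed_def th_th)

lemma ent_Th: "ent (Th M) i j = \<theta> (ent M j i)"
  by (simp add: Th_def ent_fmap)

lemma Th_mul: "Th (A * B) = Th B * Th A"
proof (rule fsm_eqI)
  fix i k
  obtain n where n: "\<forall>i j. n \<le> i \<or> n \<le> j \<longrightarrow> ent A i j = 0" "\<forall>i j. n \<le> i \<or> n \<le> j \<longrightarrow> ent B i j = 0"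
    using common_bound[of A B B] by blast
  have s: "\<theta> (sum u I) = (\<Sum>i\<in>I. \<theta> (u i))" for u and I :: "nat set"
    by (induction I rule: infinite_finite_induct) (simp_all add: th_add)
  show "ent (Th (A * B)) i k = ent (Th B * Th A) i k"
    using n by (simp add: ent_Th ent_times[of n] s th_mul)
qed

lemma Th_add: "Th (A + B) = Th A + Th B"
  by (rule fsm_eqI) (simp add: ent_Th th_add)

lemma Th_0 [simp]: "Th 0 = 0"
  by (rule fsm_eqI) (simp add: ent_Th)

lemma Th_Th: "Th (Th A) = A"
  by (rule fsm_eqI) (simp add: ent_Th th_th)

lemma ed_sw: "ed (sw i) = \<theta> (e i)"
  using conv[of i] by (auto simp: ed_def sw_def)

lemma Th_ob: "Th (obj e ls) = obj ed (map sw ls)"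
  by (rule fsm_eqI) (auto simp: ent_Th obj_def ent_diag ed_sw)

lemma Th_hom: "f \<in> hom S e ls ms \<Longrightarrow> Th f \<in> hom Sd ed (map sw ms) (map sw ls)"
  by (simp add: hom_def mats_def ent_Th th_S Th_mul[symmetric] Th_ob[symmetric])

lemma Th_homD: "f \<in> hom Sd ed (map sw ms) (map sw ls) \<Longrightarrow> Th f \<in> hom S e ls ms"
proof -
  assume f: "f \<in> hom Sd ed (map sw ms) (map sw ls)"
  then have "Th (f * obj ed (map sw ms)) = Th f" "Th (obj ed (map sw ls) * f) = Th f" by (simp_all add: hom_def)
  then have "Th f * obj e ls = Th f" "obj e ms * Th f = Th f"
    by (simp_all add: Th_mul Th_ob[symmetric] Th_Th)
  moreover have "Th f \<in> mats S" using f by (simp add: hom_def mats_def ent_Th Sd_iff)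
  ultimately show ?thesis by (simp add: hom_def)
qed

lemma dcx_sel [simp]: "src (dcx T) = map sw (tgt T)" "tgt (dcx T) = map sw (src T)" "dif (dcx T) = Th (dif T)"
  by (simp_all add: dcx_def)

lemma dcx_cx: "iscx S e T \<Longrightarrow> iscx Sd ed (dcx T)"
  by (auto simp: iscx_def Th_hom sw_def)

lemma dcx_iso:
  assumes i: "iso S e T U" shows "iso Sd ed (dcx T) (dcx U)"
proof -
  interpret D: idem_ring Sd ed by (rule dual_idem_ring)
  from i obtain f1 f0 g1 g0 h k where 1:
    "f1 \<in> hom S e (src T) (src U)" "f0 \<in> hom S e (tgt T) (tgt U)" "g1 \<in> hom S e (src U) (src T)" "g0 \<in> hom S e (tgt U) (tgt T)"
    "h \<in> hom S e (tgt T) (src T)" "k \<in> hom S e (tgt U) (src U)" and eq1: "dif U * f1 = f0 * dif T" "dif T * g1 = g0 * dif U"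
    "g1 * f1 = obj e (src T) + h * dif T" "g0 * f0 = obj e (tgt T) + dif T * h"
    "f1 * g1 = obj e (src U) + k * dif U" "f0 * g0 = obj e (tgt U) + dif U * k" by (rule isoE)
  show ?thesis
    by (rule D.isoI[of "Th g0" _ _ "Th g1" "Th f0" "Th f1" "Th h" "Th k"])
       (use 1 in \<open>simp_all add: Th_hom Th_mul[symmetric] eq1 Th_add Th_ob\<close>)
qed

lemma dcx_dsm: "dcx (dsm e T U) = dsm ed (dcx T) (dcx U)"
proof -
  have s: "Th (sft e n ls) = sft' ed n (map sw ls)" "Th (sft' e n ls) = sft ed n (map sw ls)" for n ls
    by (rule fsm_eqI, simp add: sft_def sft'_def ent_colm ent_rowm ent_Th ed_sw)+
  show ?thesis by (rule cx_eqI) (simp_all add: dsm_def Th_add Th_mul s mult.assoc)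
qed

lemma dcx_zcx [simp]: "dcx zcx = zcx"
  by (rule cx_eqI) (simp_all add: zcx_def)

lemma dcx_dsms: "dcx (dsms e Ts) = dsms ed (map dcx Ts)"
  by (induction Ts) (simp_all add: dsms_def dcx_dsm)

lemma dcx_gv: "iscx S e T \<Longrightarrow> gv (dcx T) = dlt (gv T)"
  by (simp add: gv_def dlt_def iscx_def count_sw)

lemma undual_cx: "iscx Sd ed T \<Longrightarrow> \<exists>U. iscx S e U \<and> T = dcx U"
proof -
  assume T: "iscx Sd ed T"
  define U where "U = Cx (map sw (tgt T)) (map sw (src T)) (Th (dif T))"
  have l: "map sw (map sw (src T)) = src T" "map sw (map sw (tgt T)) = tgt T"
    using T map_sw_sw by (auto simp: iscx_def)
  have "Th (dif T) \<in> hom S e (map sw (tgt T)) (map sw (src T))"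
    by (rule Th_homD) (use T l in \<open>simp add: iscx_def\<close>)
  then have "iscx S e U" by (auto simp: iscx_def U_def sw_def)
  moreover have "T = dcx U" by (rule cx_eqI) (use l in \<open>simp_all add: U_def Th_Th\<close>)
  ultimately show ?thesis by blast
qed

lemma undual_iso:
  assumes "iso Sd ed (dcx T) (dcx U)" and cx: "iscx S e T" "iscx S e U"
  shows "iso S e T U"
proof -
  interpret D: idem_ring Sd ed by (rule dual_idem_ring)
  have l: "map sw (map sw (src V)) = src V" "map sw (map sw (tgt V)) = tgt V" if "iscx S e V" for V
    using that map_sw_sw by (auto simp: iscx_def)
  from assms(1) obtain f1 f0 g1 g0 h k where 1:
    "f1 \<in> hom Sd ed (src (dcx T)) (src (dcx U))" "f0 \<in> hom Sd ed (tgt (dcx T)) (tgt (dcx U))"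
    "g1 \<in> hom Sd ed (src (dcx U)) (src (dcx T))" "g0 \<in> hom Sd ed (tgt (dcx U)) (tgt (dcx T))"
    "h \<in> hom Sd ed (tgt (dcx T)) (src (dcx T))" "k \<in> hom Sd ed (tgt (dcx U)) (src (dcx U))"
    and eq1: "dif (dcx U) * f1 = f0 * dif (dcx T)" "dif (dcx T) * g1 = g0 * dif (dcx U)"
    "g1 * f1 = obj ed (src (dcx T)) + h * dif (dcx T)" "g0 * f0 = obj ed (tgt (dcx T)) + dif (dcx T) * h"
    "f1 * g1 = obj ed (src (dcx U)) + k * dif (dcx U)" "f0 * g0 = obj ed (tgt (dcx U)) + dif (dcx U) * k" by (rule D.isoE)
  note E = arg_cong[OF eq1(1), of Th] arg_cong[OF eq1(2), of Th] arg_cong[OF eq1(3), of Th]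
    arg_cong[OF eq1(4), of Th] arg_cong[OF eq1(5), of Th] arg_cong[OF eq1(6), of Th]
  show ?thesis
    by (rule isoI[of "Th g0" _ _ "Th g1" "Th f0" "Th f1" "Th h" "Th k"])
       (use 1 E in \<open>simp_all add: Th_homD Th_mul Th_Th Th_add Th_ob[symmetric]\<close>)
qed

lemma dcx_ind: "ind S e T \<Longrightarrow> ind Sd ed (dcx T)"
proof -
  assume T: "ind S e T"
  then have cx: "iscx S e T" by (simp add: ind_def)
  have z: "iso Sd ed (dcx U) zcx \<longleftrightarrow> iso S e U zcx" if "iscx S e U" for U
    using dcx_iso[of U zcx] undual_iso[of U zcx] that iscx_zcx by auto
  show ?thesis unfolding ind_def
  proof (intro conjI allI impI)
    show "iscx Sd ed (dcx T)" using dcx_cx[OF cx] .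
    show "\<not> iso Sd ed (dcx T) zcx" using z[OF cx] T by (simp add: ind_def)
    fix U V assume UV: "iscx Sd ed U \<and> iscx Sd ed V \<and> iso Sd ed (dcx T) (dsm ed U V)"
    obtain U' where U': "iscx S e U'" "U = dcx U'" using undual_cx UV by blast
    obtain V' where V': "iscx S e V'" "V = dcx V'" using undual_cx UV by blast
    have "iso Sd ed (dcx T) (dcx (dsm e U' V'))" using UV U' V' by (simp add: dcx_dsm)
    then have "iso S e T (dsm e U' V')" using undual_iso cx iscx_dsm U'(1) V'(1) by blast
    then show "iso Sd ed U zcx \<or> iso Sd ed V zcx"
      using T U' V' z unfolding ind_def by blast
  qed
qed

lemma dcx_presil: "presil S e D \<Longrightarrow> presil Sd ed (dcx D)"
  unfolding presil_def
proof
  fix g assume D: "\<forall>g\<in>hom S e (src D) (tgt D). \<exists>a\<in>hom S e (src D) (src D). \<exists>b\<in>hom S e (tgt D) (tgt D). g = dif D * a + b * dif D"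
    and "g \<in> hom Sd ed (src (dcx D)) (tgt (dcx D))"
  then have "Th g \<in> hom S e (src D) (tgt D)" by (simp add: Th_homD)
  with D obtain a b where a: "a \<in> hom S e (src D) (src D)" and b: "b \<in> hom S e (tgt D) (tgt D)"
    and "Th g = dif D * a + b * dif D" by blast
  then have "Th (Th g) = dif (dcx D) * Th b + Th a * dif (dcx D)" by (simp add: Th_add Th_mul add.commute)
  then show "\<exists>a\<in>hom Sd ed (src (dcx D)) (src (dcx D)). \<exists>b\<in>hom Sd ed (tgt (dcx D)) (tgt (dcx D)).
      g = dif (dcx D) * a + b * dif (dcx D)"
    using Th_hom[OF a] Th_hom[OF b] unfolding Th_Th by auto
qed

lemma dcx_family: "family S e Ts \<Longrightarrow> family Sd ed (map dcx Ts)"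
proof -
  assume F: "family S e Ts"
  have "\<not> iso Sd ed (dcx (Ts ! i)) (dcx (Ts ! j))" if "i < length Ts" "j < length Ts" "i \<noteq> j" for i j
    using undual_iso[of "Ts ! i" "Ts ! j"] family_cx[OF F] that F by (auto simp: family_def)
  then show ?thesis using F dcx_ind dcx_presil[of "dsms e Ts"] by (simp add: family_def dcx_dsms)
qed

lemma dcx_cone:
  assumes "family S e Ts"
  shows "gcone (set (map gv (map dcx Ts))) = dlt ` gcone (set (map gv Ts))"
proof -
  have "set (map gv (map dcx Ts)) = dlt ` set (map gv Ts)"
    using family_cx[OF assms] dcx_gv by (auto simp: image_image)
  then show ?thesis by (simp add: gcone_dlt del: set_map)
qed

lemma fan_subset: "(`) dlt ` fan S e \<subseteq> fan Sd ed"
proof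
  fix C assume "C \<in> (`) dlt ` fan S e"
  then obtain Ts where Ts: "C = dlt ` gcone (set (map gv Ts))" "family S e Ts" by (auto simp: fan_def)
  then show "C \<in> fan Sd ed" using dcx_cone[OF Ts(2)] dcx_family[OF Ts(2)] unfolding fan_def
    by (intro CollectI exI[of _ "map dcx Ts"]) (simp only:)
qed

lemma dual_dual: "dual Sd ed \<theta>" "dual.Sd Sd \<theta> = S" "dual.ed ed \<theta> = e"
proof -
  show D: "dual Sd ed \<theta>"
    by (intro dual.intro dual_axioms.intro dual_idem_ring) (auto simp: th_add th_mul th_th ed_def sw_def)
  interpret D: dual Sd ed \<theta> by (rule D)
  show "D.Sd = S" by (subst D.Sd_def) (simp add: Sd_def image_image th_th)
  show "D.ed = e"
  proof
    fix i show "D.ed i = e i" using conv[of i] by (simp add: D.ed_def ed_def sw_def th_th)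
  qed
qed

text \<open>The other inclusion is the first one for the opposite algebra, since dualising twice
  gives back \<open>S\<close> and \<open>e\<close>.\<close>

lemma fan_dual: "fan Sd ed = (`) dlt ` fan S e"
proof
  interpret D: dual Sd ed \<theta> by (rule dual_dual)
  have "(`) dlt ` fan Sd ed \<subseteq> fan S e" using D.fan_subset unfolding dual_dual(2,3) .
  then have "(`) dlt ` (`) dlt ` fan Sd ed \<subseteq> (`) dlt ` fan S e" by (rule image_mono)
  then show "fan Sd ed \<subseteq> (`) dlt ` fan S e" by (simp add: image_image)
qed (rule fan_subset)

end

section \<open>Duality for triangular algebras\<close>

locale dual_tri2 = tri2 S e sc \<phi> + dual S e \<theta>
  for S :: "'r::ring set" and e and sc :: "'k::field \<Rightarrow> 'r \<Rightarrow> 'r" and \<phi> \<theta> +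
  assumes th_sc: "\<theta> (sc c a) = sc c (\<theta> a)"
begin

definition "\<phi>d i a = \<phi> (sw i) (\<theta> a)"

lemma radl_d: "radl Sd \<phi>d = \<theta> ` radl S \<phi>"
  unfolding radl_def \<phi>d_def Sd_def by (force simp: th_th)

text \<open>\<open>pw\<close> grows on the left, while an anti-automorphism turns this into growth
  on the right.\<close>

lemma pw_mono: "y \<in> pw J (e 1 + e 2) n \<Longrightarrow> j \<in> J \<Longrightarrow> y * j \<in> pw J (e 1 + e 2) (Suc n)"
proof (induction n arbitrary: y)
  case 0
  then show ?case using unit_l[of j] unit_r[of j] by (auto simp: J_S intro!: exI[of _ j])
next
  case (Suc n)
  then obtain j' y' where y: "y = j' * y'" "j' \<in> J" "y' \<in> pw J (e 1 + e 2) n" by auto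
  have "y' * j \<in> pw J (e 1 + e 2) (Suc n)" using Suc y by blast
  then have "j' * (y' * j) \<in> pw J (e 1 + e 2) (Suc (Suc n))"
    using y(2) unfolding pw.simps(2)[of _ _ "Suc n"] by blast
  then show ?case by (simp add: y(1) mult.assoc)
qed

lemma pw_dual: "y \<in> pw (radl Sd \<phi>d) (ed 1 + ed 2) n \<Longrightarrow> \<theta> y \<in> pw J (e 1 + e 2) n"
proof (induction n arbitrary: y)
  case 0 then show ?case by (simp add: ed_def th_add th_th add.commute)
next
  case (Suc n)
  then obtain j y' where y: "y = j * y'" "j \<in> radl Sd \<phi>d" "y' \<in> pw (radl Sd \<phi>d) (ed 1 + ed 2) n" by auto
  obtain j' where "j' \<in> J" "j = \<theta> j'" using y(2) unfolding radl_d by blast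
  then show ?case using pw_mono[OF Suc.IH[OF y(3)]] y(1) by (simp add: th_mul th_th del: pw.simps)
qed

lemma dual_tri2: "tri2 Sd ed sc \<phi>d"
proof -
  interpret D: idem_ring Sd ed by (rule dual_idem_ring)
  obtain m where m: "pw J (e 1 + e 2) m \<subseteq> {0}" using nil by blast
  have "pw (radl Sd \<phi>d) (ed 1 + ed 2) m \<subseteq> {0}"
  proof
    fix y assume "y \<in> pw (radl Sd \<phi>d) (ed 1 + ed 2) m"
    then have "\<theta> y = 0" using pw_dual m by blast
    then show "y \<in> {0}" using th_th[of y] by simp
  qed
  then have n: "\<exists>m. pw (radl Sd \<phi>d) (ed 1 + ed 2) m \<subseteq> {0}" by blast
  have 1: "e 1 \<in> S" "e 2 \<in> S" by (rule eS)+
  show ?thesis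
  proof
    fix c a b
    show "sc c (a * b) = sc c a * b" "sc c (a * b) = a * sc c b" by (rule sc_l, rule sc_r)
  next
    fix a c assume a: "a \<in> Sd"
    then show "sc c a \<in> Sd" by (simp add: Sd_iff th_sc Ssc)
    have "\<theta> ((ed 1 + ed 2) * a) = \<theta> a" "\<theta> (a * (ed 1 + ed 2)) = \<theta> a"
      using a unit_l[of "\<theta> a"] unit_r[of "\<theta> a"] by (simp_all add: Sd_iff th_mul th_add ed_def th_th add.commute)
    then show "(ed 1 + ed 2) * a = a" "a * (ed 1 + ed 2) = a" by (metis th_th)+
    have "\<theta> (ed 2 * a * ed 1) = 0" using tri[of "\<theta> a"] a by (simp add: th_mul ed_def th_th Sd_iff mult.assoc)
    then show "ed 2 * a * ed 1 = 0" by (metis th_th th_0)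
  next
    show "ed 1 * ed 2 = 0" "ed 2 * ed 1 = 0" using orth by (simp_all add: ed_def th_mul[symmetric])
  next
    fix i a b assume i: "i \<in> {1, 2::nat}" and a: "a \<in> Sd"
    show "\<phi>d i (sc c a) = c * \<phi>d i a" for c using a by (simp add: \<phi>d_def th_sc phi_sc[OF sw_12] Sd_iff)
    assume b: "b \<in> Sd"
    show "\<phi>d i (a + b) = \<phi>d i a + \<phi>d i b" "\<phi>d i (a * b) = \<phi>d i a * \<phi>d i b"
      using a b by (simp_all add: \<phi>d_def th_add th_mul phi_add[OF sw_12] phi_mul[OF sw_12] Sd_iff mult.commute)
  next
    fix i j assume "i \<in> {1, 2::nat}" "j \<in> {1, 2::nat}"
    then show "\<phi>d i (ed j) = (if i = j then 1 else 0)" by (auto simp: \<phi>d_def ed_def th_th phi_e)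
  next
    show "\<exists>m. pw (radl Sd \<phi>d) (ed 1 + ed 2) m \<subseteq> {0}" by (rule n)
  qed
qed

end

locale dual_tri = tri_alg S e sc \<phi> x \<psi> + dual_tri2 S e sc \<phi> \<theta>
  for S :: "'r::ring set" and e and sc :: "'k::field \<Rightarrow> 'r \<Rightarrow> 'r" and \<phi> x \<psi> \<theta>
begin

definition "xd = \<theta> x"
definition "\<psi>d a = \<psi> (\<theta> a)"

lemma dual_tri_alg: "tri_alg Sd ed sc \<phi>d xd \<psi>d"
proof -
  interpret D: tri2 Sd ed sc \<phi>d by (rule dual_tri2)
  show ?thesis
  proof
    show "xd \<in> Sd" "ed 1 * xd = xd" "xd * ed 2 = xd" "\<psi>d xd = 1"
      using xX psi_x by (simp_all add: xd_def th_S ed_def th_mul[symmetric] \<psi>d_def th_th)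
  next
    fix a b assume ab: "a \<in> Sd" "b \<in> Sd"
    then show "\<psi>d (a + b) = \<psi>d a + \<psi>d b" by (simp add: \<psi>d_def th_add psi_add Sd_iff)
    show "\<psi>d (a * b) = \<phi>d 1 a * \<psi>d b + \<psi>d a * \<phi>d 2 b"
      using ab by (simp add: \<psi>d_def \<phi>d_def th_mul psi_mul Sd_iff mult.commute add.commute)
  next
    fix a c assume "a \<in> Sd"
    then show "\<psi>d (sc c a) = c * \<psi>d a" by (simp add: \<psi>d_def th_sc psi_sc Sd_iff)
  next
    fix i assume "i \<in> {1, 2::nat}"
    then show "\<psi>d (ed i) = 0" by (simp add: \<psi>d_def ed_def th_th psi_e[OF sw_12])
  qed
qed

text \<open>Transposing the residue of the differential turns a right inverse into a left inverse,
  and dualising respects minimality and the fourth quadrant.\<close>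

lemma RC_dual: "RC = (`) dlt ` tri_alg.LC Sd ed \<phi>d \<psi>d"
proof -
  interpret D: tri_alg Sd ed sc \<phi>d xd \<psi>d by (rule dual_tri_alg)
  have m: "D.minl (dcx T) \<longleftrightarrow> minl T" if "iscx S e T" for T
  proof -
    have "Th (dif T) \<in> mats (radl Sd \<phi>d) \<longleftrightarrow> dif T \<in> mats J"
    proof -
      have "\<theta> a \<in> \<theta> ` J \<longleftrightarrow> a \<in> J" for a by (metis image_iff th_th)
      then show ?thesis unfolding radl_d mats_def by (auto simp: ent_Th)
    qed
    then show ?thesis using that dcx_cx by (simp add: minl_def D.minl_def)
  qed
  have P: "D.\<Psi> (Th M) = tpose (\<Psi> M)" for M
    by (rule fsm_eqI) (simp add: ent_fmap D.psi_0 psi_0 ent_Th \<psi>d_def th_th)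
  have li: "D.linv (dcx T) \<longleftrightarrow> rinv T" for T
  proof
    assume "D.linv (dcx T)"
    then obtain Q where "Q * tpose (\<Psi> (dif T)) = un (length (tgt T))" "Q * un (length (src T)) = Q" "un (length (tgt T)) * Q = Q"
      unfolding D.linv_def by (auto simp: P)
    then have "tpose (Q * tpose (\<Psi> (dif T))) = tpose (un (length (tgt T)))" "tpose (Q * un (length (src T))) = tpose Q"
      "tpose (un (length (tgt T)) * Q) = tpose Q" by simp_all
    then show "rinv T" unfolding rinv_def by (intro exI[of _ "tpose Q"]) (simp add: tpose_times)
  next
    assume "rinv T"
    then obtain Q where "\<Psi> (dif T) * Q = un (length (tgt T))" "Q * un (length (tgt T)) = Q" "un (length (src T)) * Q = Q"
      unfolding rinv_def by blast
    then have "tpose (\<Psi> (dif T) * Q) = tpose (un (length (tgt T)))" "tpose (Q * un (length (tgt T))) = tpose Q"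
      "tpose (un (length (src T)) * Q) = tpose Q" by simp_all
    then show "D.linv (dcx T)" unfolding D.linv_def by (intro exI[of _ "tpose Q"]) (simp add: tpose_times P)
  qed
  have lr: "D.LFT (dcx T) \<longleftrightarrow> RGT T" if cx: "iscx S e T" for T
  proof -
    have q: "D.quad (dcx T) \<longleftrightarrow> quad T" using cx by (auto simp: D.quad_def quad_def sw_def iscx_def split: if_splits)
    have "2 \<in> set (src (dcx T)) \<longleftrightarrow> 1 \<in> set (tgt T)" "1 \<in> set (tgt (dcx T)) \<longleftrightarrow> 2 \<in> set (src T)"
      using cx by (auto simp: sw_def iscx_def image_iff split: if_splits)
    then show ?thesis unfolding D.LFT_def RGT_def li q by blast
  qed
  have fwd: "dlt ` C \<in> D.LC" if C: "C \<in> RC" for C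
  proof -
    from C obtain Ts where Ts: "C = gcone (set (map gv Ts))" and F: "family S e Ts" "\<forall>T\<in>set Ts. minl T"
      and R: "RGT (dsms e Ts)" unfolding RC_def by blast
    have "D.LFT (dsms ed (map dcx Ts))" using R lr iscx_dsms family_cx[OF F(1)] by (simp add: dcx_dsms[symmetric])
    moreover have "\<forall>T\<in>set (map dcx Ts). D.minl T" using F m family_cx[OF F(1)] by auto
    moreover note dcx_family[OF F(1)] dcx_cone[OF F(1)]
    ultimately show ?thesis unfolding D.LC_def Ts mem_Collect_eq by (intro exI[of _ "map dcx Ts"]) (simp only: simp_thms)
  qed
  have bwd: "dlt ` C \<in> RC" if C: "C \<in> D.LC" for C
  proof -
    from C obtain Ts where Ts: "C = gcone (set (map gv Ts))" and F: "family Sd ed Ts" "\<forall>T\<in>set Ts. D.minl T"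
      and R: "D.LFT (dsms ed Ts)" unfolding D.LC_def by blast
    define u where "u T = (SOME U. iscx S e U \<and> T = dcx U)" for T
    have u: "iscx S e (u T) \<and> dcx (u T) = T" if "T \<in> set Ts" for T
      using someI_ex[OF undual_cx[OF D.family_cx[OF F(1) that]]] unfolding u_def by simp
    define Us where "Us = map u Ts"
    have TU: "map dcx Us = Ts" unfolding Us_def using u by (simp add: map_idI)
    have cU: "iscx S e U" if "U \<in> set Us" for U using u that by (auto simp: Us_def)
    interpret DD: dual Sd ed \<theta> by (rule dual_dual)
    have dcxdcx: "DD.dcx (dcx U) = U" if "iscx S e U" for U
    proof (rule cx_eqI)
      show "dif (DD.dcx (dcx U)) = dif U"
        by (rule fsm_eqI) (simp add: DD.ent_Th ent_Th th_th)
    qed (use that map_sw_sw in \<open>auto simp: iscx_def\<close>)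
    have "map DD.dcx Ts = Us" unfolding TU[symmetric] using dcxdcx cU by (simp add: map_idI)
    then have FU: "family S e Us" using DD.dcx_family[OF F(1)] unfolding dual_dual(2,3) by simp
    have "RGT (dsms e Us)" using R lr[of "dsms e Us"] iscx_dsms cU by (simp add: dcx_dsms TU)
    moreover have "\<forall>U\<in>set Us. minl U" using F(2) m cU TU by (metis image_eqI set_map)
    moreover have "dlt ` C = gcone (set (map gv Us))"
      unfolding Ts using dcx_cone[OF FU] unfolding TU by (simp add: image_image)
    ultimately show ?thesis using FU unfolding RC_def by blast
  qed
  show ?thesis
  proof
    show "RC \<subseteq> (`) dlt ` D.LC"
    proof
      fix C assume "C \<in> RC"
      then have "dlt ` C \<in> D.LC" "C = dlt ` dlt ` C" using fwd by (simp_all add: image_image)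
      then show "C \<in> (`) dlt ` D.LC" by blast
    qed
    show "(`) dlt ` D.LC \<subseteq> RC" using bwd by blast
  qed
qed

end

section \<open>Fibre products\<close>

text \<open>The projections \<open>p\<close>, \<open>p'\<close> and the pairing \<open>pr\<close>
  are kept abstract so that the results apply to a product and also to the product with its factors
  exchanged.\<close>

locale fprod = L: tri_alg S e sc \<phi> x \<psi> + M: tri_alg S' e' sc' \<phi>' x' \<psi>' + vG: vector_space scG
  for S :: "'r::ring set" and e and sc :: "'k::field \<Rightarrow> 'r \<Rightarrow> 'r" and \<phi> x \<psi>
    and S' :: "'s::ring set" and e' and sc' :: "'k \<Rightarrow> 's \<Rightarrow> 's" and \<phi>' x' \<psi>'
    and scG :: "'k \<Rightarrow> 'g::ring \<Rightarrow> 'g" +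
  fixes SG :: "'g set" and eG :: "nat \<Rightarrow> 'g" and p :: "'g \<Rightarrow> 'r" and p' :: "'g \<Rightarrow> 's" and pr :: "'r \<Rightarrow> 's \<Rightarrow> 'g"
  assumes p_add: "p (a + b) = p a + p b" "p' (a + b) = p' a + p' b"
    and p_mul: "p (a * b) = p a * p b" "p' (a * b) = p' a * p' b"
    and p_pr: "p (pr u v) = u" "p' (pr u v) = v" and p_inj: "p a = p b \<Longrightarrow> p' a = p' b \<Longrightarrow> a = b"
    and p_e: "p (eG i) = e i" "p' (eG i) = e' i"
    and p_sc: "p (scG c a) = sc c (p a)" "p' (scG c a) = sc' c (p' a)"
    and SG: "SG = {g. p g \<in> S \<and> p' g \<in> S' \<and> \<phi> 1 (p g) = \<phi>' 1 (p' g) \<and> \<phi> 2 (p g) = \<phi>' 2 (p' g) \<and> \<psi> (p g) = \<psi>' (p' g)}"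
    and conv: "i \<noteq> 1 \<Longrightarrow> e i = e 2" "i \<noteq> 1 \<Longrightarrow> e' i = e' 2"
begin

lemma p_0: "p 0 = 0" "p' 0 = 0"
proof -
  have h: "p 0 + p 0 = p 0 + 0" "p' 0 + p' 0 = p' 0 + 0" using p_add[of 0 0] by simp_all
  show "p 0 = 0" "p' 0 = 0" by (rule add_left_imp_eq[OF h(1)], rule add_left_imp_eq[OF h(2)])
qed

lemma p_neg: "p (- a) = - p a" "p' (- a) = - p' a"
proof -
  have "p (- a) + p a = 0" "p' (- a) + p' a = 0" using p_add[of "- a" a] by (simp_all add: p_0)
  then show "p (- a) = - p a" "p' (- a) = - p' a" by (simp_all add: eq_neg_iff_add_eq_0)
qed

lemma psi_neg: "a \<in> S \<Longrightarrow> \<psi> (- a) = - \<psi> a"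
  using L.psi_add[of a "- a"] L.Sneg[of a] L.psi_0 by (simp add: eq_neg_iff_add_eq_0 add.commute)

lemma psi_neg': "a \<in> S' \<Longrightarrow> \<psi>' (- a) = - \<psi>' a"
  using M.psi_add[of a "- a"] M.Sneg[of a] M.psi_0 by (simp add: eq_neg_iff_add_eq_0 add.commute)

lemma SGD: "g \<in> SG \<Longrightarrow> p g \<in> S" "g \<in> SG \<Longrightarrow> p' g \<in> S'"
  and SG_phi: "g \<in> SG \<Longrightarrow> i \<in> {1, 2} \<Longrightarrow> \<phi>' i (p' g) = \<phi> i (p g)" and SG_psi: "g \<in> SG \<Longrightarrow> \<psi>' (p' g) = \<psi> (p g)"
  by (auto simp: SG)

lemma SGI: "p g \<in> S \<Longrightarrow> p' g \<in> S' \<Longrightarrow> (\<And>i. i \<in> {1, 2} \<Longrightarrow> \<phi> i (p g) = \<phi>' i (p' g)) \<Longrightarrow> \<psi> (p g) = \<psi>' (p' g) \<Longrightarrow> g \<in> SG"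
  by (simp add: SG)

lemma eG_SG: "eG i \<in> SG"
proof (rule SGI)
  have "\<exists>j\<in>{1, 2}. e i = e j \<and> e' i = e' j" using conv[of i] by (cases "i = 1") auto
  then obtain j where j: "j \<in> {1, 2}" "e i = e j" "e' i = e' j" by blast
  show "\<phi> k (p (eG i)) = \<phi>' k (p' (eG i))" if k: "k \<in> {1, 2}" for k
    unfolding p_e j(2,3) by (simp only: L.phi_e[OF k j(1)] M.phi_e[OF k j(1)])
  show "\<psi> (p (eG i)) = \<psi>' (p' (eG i))" unfolding p_e j(2,3) by (simp only: L.psi_e[OF j(1)] M.psi_e[OF j(1)])
qed (simp_all add: p_e L.eS M.eS)

lemma pw_zero: "pw (M.J) (e' 1 + e' 2) m \<subseteq> {0} \<Longrightarrow> pw (M.J) (e' 1 + e' 2) (n + m) \<subseteq> {0}"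
  by (induction n) auto

lemma pw_zero': "pw (L.J) (e 1 + e 2) m \<subseteq> {0} \<Longrightarrow> pw (L.J) (e 1 + e 2) (n + m) \<subseteq> {0}"
  by (induction n) auto

lemma fibre_tri_alg: "tri_alg SG eG scG (\<lambda>i g. \<phi> i (p g)) (pr x x') (\<lambda>g. \<psi> (p g))"
proof -
  let ?J = "radl SG (\<lambda>i g. \<phi> i (p g))"
  have pw: "p y \<in> pw L.J (e 1 + e 2) n \<and> p' y \<in> pw M.J (e' 1 + e' 2) n" if "y \<in> pw ?J (eG 1 + eG 2) n" for y n
    using that
  proof (induction n arbitrary: y)
    case 0 then show ?case by (simp add: p_add p_e)
  next
    case (Suc n)
    then obtain j y' where y: "y = j * y'" "j \<in> ?J" "y' \<in> pw ?J (eG 1 + eG 2) n" by auto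
    have "p j \<in> L.J" "p' j \<in> M.J" using y(2) SGD[of j] SG_phi[of j] by (auto simp: radl_def)
    then show ?case using Suc.IH[OF y(3)] by (auto simp: y(1) p_mul)
  qed
  obtain m where m1: "pw L.J (e 1 + e 2) m \<subseteq> {0}" using L.nil by (elim exE)
  obtain m' where m2: "pw M.J (e' 1 + e' 2) m' \<subseteq> {0}" using M.nil by (elim exE)
  have "pw ?J (eG 1 + eG 2) (m + m') \<subseteq> {0}"
  proof
    fix y assume "y \<in> pw ?J (eG 1 + eG 2) (m + m')"
    then have "p y = 0" "p' y = 0" using pw[of y "m + m'"] pw_zero'[OF m1, of m'] pw_zero[OF m2, of m]
      by (auto simp: add.commute)
    then show "y \<in> {0}" using p_inj[of y 0] by (simp add: p_0)
  qed
  then have nil: "\<exists>m. pw ?J (eG 1 + eG 2) m \<subseteq> {0}" by blast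
  show ?thesis
  proof
    show "0 \<in> SG" by (rule SGI) (simp_all add: p_0 L.S0 M.S0 L.phi_0 M.phi_0 L.psi_0 M.psi_0 del: insert_iff)
    fix i show "eG i \<in> SG" by (rule eG_SG)
    show "eG i * eG i = eG i" by (rule p_inj) (simp_all add: p_mul p_e L.ee M.ee)
  next
    fix a b assume ab: "a \<in> SG" "b \<in> SG"
    note f = SGD[OF ab(1)] SGD[OF ab(2)] SG_phi[OF ab(1)] SG_phi[OF ab(2)] SG_psi[OF ab(1)] SG_psi[OF ab(2)]
    show "a + b \<in> SG" by (rule SGI) (use f in \<open>simp_all add: p_add L.Sadd M.Sadd L.phi_add M.phi_add L.psi_add M.psi_add del: insert_iff\<close>)
    show "a * b \<in> SG" by (rule SGI) (use f in \<open>simp_all add: p_mul L.Smul M.Smul L.phi_mul M.phi_mul L.psi_mul M.psi_mul del: insert_iff\<close>, simp)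
    show "\<psi> (p (a + b)) = \<psi> (p a) + \<psi> (p b)" using f by (simp add: p_add L.psi_add)
    show "\<psi> (p (a * b)) = \<phi> 1 (p a) * \<psi> (p b) + \<psi> (p a) * \<phi> 2 (p b)" using f(1,3) L.psi_mul by (simp only: p_mul)
    fix i assume i: "i \<in> {1, 2::nat}"
    show "\<phi> i (p (a + b)) = \<phi> i (p a) + \<phi> i (p b)" "\<phi> i (p (a * b)) = \<phi> i (p a) * \<phi> i (p b)"
      using f i by (simp_all add: p_add p_mul L.phi_add L.phi_mul del: insert_iff)
  next
    fix a c assume a: "a \<in> SG"
    note f = SGD[OF a] SG_phi[OF a] SG_psi[OF a]
    show "- a \<in> SG" by (rule SGI) (use f in \<open>simp_all add: p_neg L.Sneg M.Sneg L.phi_uminus M.phi_uminus psi_neg psi_neg' del: insert_iff\<close>)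
    show "scG c a \<in> SG" by (rule SGI) (use f in \<open>simp_all add: p_sc L.Ssc M.Ssc L.phi_sc M.phi_sc L.psi_sc M.psi_sc del: insert_iff\<close>)
    show "(eG 1 + eG 2) * a = a" "a * (eG 1 + eG 2) = a"
      by (rule p_inj; use f L.unit_l[of "p a"] L.unit_r[of "p a"] M.unit_l[of "p' a"] M.unit_r[of "p' a"] in \<open>simp add: p_mul p_add p_e\<close>)+
    show "eG 2 * a * eG 1 = 0"
      by (rule p_inj) (use f L.tri[of "p a"] M.tri[of "p' a"] in \<open>simp_all add: p_mul p_e p_0\<close>)
    show "\<psi> (p (scG c a)) = c * \<psi> (p a)" using f by (simp add: p_sc L.psi_sc)
    fix i assume i: "i \<in> {1, 2::nat}"
    show "\<phi> i (p (scG c a)) = c * \<phi> i (p a)" using f i by (simp add: p_sc L.phi_sc del: insert_iff)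
  next
    fix c a b
    show "scG c (a * b) = scG c a * b" "scG c (a * b) = a * scG c b"
      by (rule p_inj; simp only: p_sc p_mul L.sc_l M.sc_l)
        (rule p_inj; simp only: p_sc p_mul L.sc_r M.sc_r)
  next
    show "eG 1 * eG 2 = 0" "eG 2 * eG 1 = 0"
      by (rule p_inj; use L.orth M.orth in \<open>simp add: p_mul p_e p_0\<close>)+
  next
    fix i j assume "i \<in> {1, 2::nat}" "j \<in> {1, 2::nat}"
    then show "\<phi> i (p (eG j)) = (if i = j then 1 else 0)" by (simp add: p_e L.phi_e del: insert_iff)
  next
    show "\<exists>m. pw ?J (eG 1 + eG 2) m \<subseteq> {0}" by (rule nil)
  next
    show "pr x x' \<in> SG"
    proof (rule SGI)
      show "\<phi> i (p (pr x x')) = \<phi>' i (p' (pr x x'))" if i: "i \<in> {1, 2}" for i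
      proof -
        have "\<phi> 1 (x * e 2) = 0" "\<phi> 2 (e 1 * x) = 0" "\<phi>' 1 (x' * e' 2) = 0" "\<phi>' 2 (e' 1 * x') = 0"
          using L.xX(1) M.xX(1) by (simp_all add: L.phi_mul L.eS L.phi_e M.phi_mul M.eS M.phi_e)
        then show ?thesis using i L.xX M.xX by (auto simp: p_pr)
      qed
    qed (use L.xX M.xX L.psi_x M.psi_x in \<open>simp_all add: p_pr\<close>)
    show "eG 1 * pr x x' = pr x x'" "pr x x' * eG 2 = pr x x'"
      by (rule p_inj; use L.xX M.xX in \<open>simp add: p_mul p_e p_pr\<close>)+
    show "\<psi> (p (pr x x')) = 1" by (simp add: p_pr L.psi_x)
  next
    fix i assume "i \<in> {1, 2::nat}"
    then show "\<psi> (p (eG i)) = 0" by (simp add: p_e L.psi_e del: insert_iff)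
  qed
qed

text \<open>The second component runs through the span of \<open>e' 1\<close>, \<open>e' 2\<close>
  and \<open>x'\<close>, a copy of the path algebra of \<open>A\<^sub>2\<close> in the second
  factor; it is the element there with the same three residues as \<open>r\<close>.\<close>

definition sec :: "'r \<Rightarrow> 'g" where
  "sec r = pr r (sc' (\<phi> 1 r) (e' 1) + sc' (\<phi> 2 r) (e' 2) + sc' (\<psi> r) x')"

lemma M_products:
  "x' * e' 1 = 0" "e' 2 * x' = 0" "x' * x' = 0"
proof -
  have "x' * e' 1 = x' * e' 2 * e' 1" using M.xX by simp
  then show 1: "x' * e' 1 = 0" using M.orth by (simp add: mult.assoc)
  have "e' 2 * x' = e' 2 * (e' 1 * x')" using M.xX by simp
  then show "e' 2 * x' = 0" using M.orth by (simp add: mult.assoc[symmetric])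
  have "x' * x' = x' * (e' 1 * x')" using M.xX by simp
  then show "x' * x' = 0" using 1 by (simp add: mult.assoc[symmetric])
qed

lemma phi_x: "i \<in> {1, 2} \<Longrightarrow> \<phi>' i x' = 0"
proof -
  have "\<phi>' 1 (x' * e' 2) = 0" "\<phi>' 2 (e' 1 * x') = 0"
    using M.xX(1) by (simp_all add: M.phi_mul M.eS M.phi_e)
  then show "i \<in> {1, 2} \<Longrightarrow> \<phi>' i x' = 0" using M.xX by auto
qed

lemma sec_SG: "r \<in> S \<Longrightarrow> sec r \<in> SG"
proof (rule SGI)
  assume r: "r \<in> S"
  have m: "sc' c (e' i) \<in> S'" "sc' c x' \<in> S'" for c i using M.Ssc M.eS M.xX(1) by blast+
  show "p (sec r) \<in> S" "p' (sec r) \<in> S'" using r m by (simp_all add: sec_def p_pr M.Sadd)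
  show "\<phi> i (p (sec r)) = \<phi>' i (p' (sec r))" if i: "i \<in> {1, 2}" for i
    using i m M.xX(1) phi_x[OF i]
    by (simp add: sec_def p_pr M.phi_add M.Sadd M.phi_sc M.eS M.phi_e del: insert_iff)
      (use i M.phi_e[of 1 1] M.phi_e[of 1 2] M.phi_e[of 2 1] M.phi_e[of 2 2] in auto)
  show "\<psi> (p (sec r)) = \<psi>' (p' (sec r))"
    using m M.xX(1) by (simp add: sec_def p_pr M.psi_add M.Sadd M.psi_sc M.eS M.psi_e M.psi_x)
qed

text \<open>The hypothesis \<open>gen\<close> lets \<open>x'\<close> generate from the left, dual to
  \<open>X = x B\<close>. It is what makes the relevant kernel elements left multiples of
  \<open>y\<close>.\<close>

lemma fibre_fib:
  assumes G: "tri_alg SG eG scG \<phi>G y \<psi>G"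
    and agree: "\<And>i g. i \<in> {1, 2} \<Longrightarrow> g \<in> SG \<Longrightarrow> \<phi>G i g = \<phi> i (p g)" "\<And>g. g \<in> SG \<Longrightarrow> \<psi>G g = \<psi> (p g)"
    and y: "p y = x" "p' y = x'"
    and gen: "\<And>t. t \<in> S' \<Longrightarrow> e' 1 * t = t \<Longrightarrow> t * e' 2 = t \<Longrightarrow> \<exists>a\<in>S'. e' 1 * a = a \<and> a * e' 1 = a \<and> t = a * x'"
  shows "fib SG eG scG \<phi>G y \<psi>G S e sc \<phi> x \<psi> p sec"
proof -
  interpret G: tri_alg SG eG scG \<phi>G y \<psi>G by (rule G)
  note sd = M.scale_right_distrib M.scale_left_distrib M.sc_l[symmetric] M.sc_r[symmetric]
  show ?thesis
  proof
    fix g h assume "g \<in> SG" then show "p g \<in> S" by (rule SGD)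
    show "p (g + h) = p g + p h" "p (g * h) = p g * p h" by (rule p_add, rule p_mul)
  next
    fix i
    show "p (eG i) = e i" by (rule p_e)
    have "\<exists>j\<in>{1, 2}. e i = e j \<and> e' i = e' j" using conv[of i] by (cases "i = 1") auto
    then obtain j where j: "j \<in> {1, 2}" "e i = e j" "e' i = e' j" by blast
    have "p' (sec (e i)) = e' j"
      using j(1) L.phi_e[of 1 j] L.phi_e[of 2 j] L.psi_e[OF j(1)] by (auto simp: sec_def p_pr j(2))
    then show "sec (e i) = eG i" by (intro p_inj) (simp_all add: p_e j(3)[symmetric], simp add: sec_def p_pr)
  next
    fix r t assume r: "r \<in> S"
    show "sec r \<in> SG" by (rule sec_SG[OF r])
    show "p (sec r) = r" by (simp add: sec_def p_pr)
    assume t: "t \<in> S"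
    show "sec (r + t) = sec r + sec t"
      by (rule p_inj) (use r t in \<open>simp_all add: sec_def p_pr p_add L.phi_add L.psi_add sd algebra_simps\<close>)
    show "sec (r * t) = sec r * sec t"
    proof (rule p_inj)
      show "p' (sec (r * t)) = p' (sec r * sec t)"
        using M.ee[of 1] M.ee[of 2] M.orth M.xX M_products r t
        by (simp add: sec_def p_pr p_mul L.phi_mul L.psi_mul distrib_left distrib_right sd) (simp add: add.assoc add.left_commute mult.commute)
    qed (simp add: sec_def p_pr p_mul)
  next
    fix i :: nat and g assume "i \<in> {1, 2}" "g \<in> SG" then show "\<phi>G i g = \<phi> i (p g)" by (rule agree)
  next
    fix g assume "g \<in> SG" then show "\<psi>G g = \<psi> (p g)" by (rule agree)
  next
    fix \<kappa> assume k: "\<kappa> \<in> SG" "eG 1 * \<kappa> = \<kappa>" "\<kappa> * eG 2 = \<kappa>" "p \<kappa> = 0"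
    have "p' (eG 1 * \<kappa>) = p' \<kappa>" "p' (\<kappa> * eG 2) = p' \<kappa>" using k by simp_all
    then obtain a where a: "a \<in> S'" "e' 1 * a = a" "a * e' 1 = a" "p' \<kappa> = a * x'"
      using gen[OF SGD(2)[OF k(1)]] by (auto simp: p_mul p_e)
    \<comment> \<open>Since \<open>p \<kappa>\<close> is zero, the residues of the coefficient
      \<open>a\<close> all vanish, so \<open>pr 0 a\<close> belongs to the fibre product.\<close>
    have "\<psi>' (p' \<kappa>) = 0" using SG_psi[OF k(1)] k(4) L.psi_0 by simp
    then have "\<phi>' 1 a = 0" using M.psi_mul[OF a(1) M.xX(1)] phi_x[of 2] by (simp add: a(4) M.psi_x)
    moreover have "\<phi>' 2 a = 0" using M.phi_mul[of 2 a "e' 1"] a M.eS M.phi_e[of 2 1] by simp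
    moreover have "\<psi>' a = 0" using M.psi_mul[OF a(1) M.eS, of 1] a M.psi_e[of 1] M.phi_e[of 2 1] by simp
    ultimately have n: "pr 0 a \<in> SG" using a(1) by (intro SGI) (auto simp: p_pr L.S0 L.phi_0 L.psi_0)
    have "eG 1 * pr 0 a = pr 0 a" "pr 0 a * eG 1 = pr 0 a"
      by (rule p_inj; use a in \<open>simp add: p_mul p_e p_pr\<close>)+
    moreover have "\<kappa> = pr 0 a * y" by (rule p_inj) (simp_all add: p_mul p_pr y a(4) k(4))
    ultimately show "\<exists>n\<in>SG. eG 1 * n = n \<and> n * eG 1 = n \<and> p n = 0 \<and> \<kappa> = n * y"
      using n p_pr(1) by blast
  next
    fix n m assume n: "n \<in> SG" "eG 1 * n = n" "n * eG 1 = n" "p n = 0" and m: "m \<in> S" "e 1 * m = m" "m * e 2 = m"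
    \<comment> \<open>Both characters vanish on \<open>m\<close>, so the second component of
      \<open>sec m\<close> is just \<open>\<psi> m\<close> times \<open>x'\<close>.\<close>
    have "\<phi> 1 m = 0" using L.phi_mul[of 1 m "e 2"] m L.eS L.phi_e[of 1 2] by simp
    moreover have "\<phi> 2 m = 0" using L.phi_mul[of 2 "e 1" m] m L.eS L.phi_e[of 2 1] by simp
    ultimately show "n * sec m = scG (\<psi> m) (n * y)"
      by (intro p_inj) (simp_all add: p_mul p_sc n(4) sec_def p_pr y M.sc_r)
  qed
qed

end

section \<open>Comparison with the carrier-based definitions\<close>

lemma ent_sft_times:
  fixes A :: "'r::ring fsm"
  shows "ent (sft e n ms * A) i j = (if n \<le> i \<and> i < n + length ms then e (ms ! (i - n)) * ent A (i - n) j else 0)"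
proof (cases "n \<le> i \<and> i < n + length ms")
  case True
  then have "ent (colm (\<lambda>j. j + n) (map e ms) * A) ((i - n) + n) j = map e ms ! (i - n) * ent A (i - n) j"
    by (intro ent_colm_times) (auto simp: inj_on_def)
  then show ?thesis using True by (auto simp: sft_def)
next
  case False
  have "i \<notin> (\<lambda>j. j + n) ` {..<length (map e ms)}" using False by auto
  from ent_colm_times_other[OF this] False show ?thesis unfolding sft_def by auto
qed

lemma ent_times_sft':
  fixes A :: "'r::ring fsm"
  shows "ent (A * sft' e n ms) i j = (if n \<le> j \<and> j < n + length ms then ent A i (j - n) * e (ms ! (j - n)) else 0)"
proof -
  have "ent (A * sft' e n ms) i j = (\<Sum>k<length ms. ent A i k * ent (sft' e n ms) k j)"
    by (rule ent_times) (auto simp: sft'_def ent_rowm)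
  also have "\<dots> = (\<Sum>k<length ms. if k = j - n then (if n \<le> j then ent A i (j - n) * e (ms ! (j - n)) else 0) else 0)"
    by (rule sum.cong) (auto simp: sft'_def ent_rowm)
  finally show ?thesis by auto
qed

text \<open>\<open>\<iota>\<close> serves in two roles: as a matrix representation of a given
  algebra, and as the decoding map of a constructed one.\<close>

locale emb = R: ring R for R :: "'a ring" (structure) +
  fixes \<iota> :: "'a \<Rightarrow> 'r::ring" and e1 e2 :: 'a
  assumes inj: "inj_on \<iota> (carrier R)"
    and i_add: "a \<in> carrier R \<Longrightarrow> b \<in> carrier R \<Longrightarrow> \<iota> (a \<oplus> b) = \<iota> a + \<iota> b"
    and i_mul: "a \<in> carrier R \<Longrightarrow> b \<in> carrier R \<Longrightarrow> \<iota> (a \<otimes> b) = \<iota> a * \<iota> b"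
    and e12: "e1 \<in> carrier R" "e2 \<in> carrier R" "e1 \<otimes> e1 = e1" "e2 \<otimes> e2 = e2"
begin

definition S :: "'r set" where "S = \<iota> ` carrier R"
definition e :: "nat \<Rightarrow> 'r" where "e i = \<iota> (idm e1 e2 i)"

lemma i_S: "a \<in> carrier R \<Longrightarrow> \<iota> a \<in> S"
  by (simp add: S_def)

lemma i_0: "\<iota> \<zero> = 0"
proof -
  have "\<iota> \<zero> + \<iota> \<zero> = \<iota> \<zero> + 0" using i_add[of \<zero> \<zero>] by simp
  then show ?thesis by (rule add_left_imp_eq)
qed

lemma i_neg: "a \<in> carrier R \<Longrightarrow> \<iota> (\<ominus> a) = - \<iota> a"
  using i_add[of a "\<ominus> a"] by (simp add: i_0 R.r_neg eq_neg_iff_add_eq_0 add.commute)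

lemma i_minus: "a \<in> carrier R \<Longrightarrow> b \<in> carrier R \<Longrightarrow> \<iota> (a \<ominus> b) = \<iota> a - \<iota> b"
  by (simp add: R.minus_eq i_add i_neg)

lemma i_eq: "a \<in> carrier R \<Longrightarrow> b \<in> carrier R \<Longrightarrow> \<iota> a = \<iota> b \<longleftrightarrow> a = b"
  using inj by (meson inj_onD)

lemma idm_R: "idm e1 e2 i \<in> carrier R" "idm e1 e2 i \<otimes> idm e1 e2 i = idm e1 e2 i"
  using e12 by (simp_all add: idm_def)

lemma i_finsum: "finite A \<Longrightarrow> (\<And>i. i \<in> A \<Longrightarrow> f i \<in> carrier R) \<Longrightarrow> \<iota> (finsum R f A) = (\<Sum>i\<in>A. \<iota> (f i))"
proof (induction A rule: finite_induct)
  case (insert x F)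
  then have "finsum R f F \<in> carrier R" by (intro R.finsum_closed) auto
  moreover have "finsum R f (insert x F) = f x \<oplus> finsum R f F"
    using insert by (intro R.finsum_insert) auto
  ultimately show ?case using insert by (simp add: i_add)
qed (simp add: i_0)

sublocale C: idem_ring S e
proof
  show "0 \<in> S" using i_S[OF R.zero_closed] by (simp add: i_0)
  fix a b assume "a \<in> S" "b \<in> S"
  then obtain a' b' where ab: "a = \<iota> a'" "b = \<iota> b'" "a' \<in> carrier R" "b' \<in> carrier R" by (auto simp: S_def)
  show "a + b \<in> S" unfolding ab(1,2) using i_S[OF R.a_closed[OF ab(3,4)]] ab(3,4) by (simp add: i_add)
  show "a * b \<in> S" unfolding ab(1,2) using i_S[OF R.m_closed[OF ab(3,4)]] ab(3,4) by (simp add: i_mul)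
  show "- a \<in> S" unfolding ab(1) using i_S[OF R.a_inv_closed[OF ab(3)]] ab(3) by (simp add: i_neg)
next
  fix i show "e i \<in> S" unfolding e_def by (rule i_S[OF idm_R(1)])
  show "e i * e i = e i" unfolding e_def using i_mul[OF idm_R(1) idm_R(1), of i i] by (simp add: idm_R(2))
qed

text \<open>A domain closed under \<open>mcomp\<close>, \<open>madd\<close> and \<open>msub\<close>
  on which \<open>mt\<close> is injective; \<open>is_mor\<close> would fix a shape for each
  matrix.\<close>

definition K :: "(nat \<Rightarrow> nat \<Rightarrow> 'a) set" where
  "K = {M. (\<forall>j i. M j i \<in> carrier R) \<and> (\<exists>n. \<forall>j i. n \<le> j \<or> n \<le> i \<longrightarrow> M j i = \<zero>)}"

definition mt :: "(nat \<Rightarrow> nat \<Rightarrow> 'a) \<Rightarrow> 'r fsm" where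
  "mt M = Fsm (\<lambda>j i. \<iota> (M j i))"

definition um :: "'r fsm \<Rightarrow> (nat \<Rightarrow> nat \<Rightarrow> 'a)" where
  "um f = (\<lambda>j i. the_inv_into (carrier R) \<iota> (ent f j i))"

lemma ent_mt: "M \<in> K \<Longrightarrow> ent (mt M) j i = \<iota> (M j i)"
proof -
  assume "M \<in> K"
  then obtain n where "\<forall>j i. n \<le> j \<or> n \<le> i \<longrightarrow> M j i = \<zero>" by (auto simp: K_def)
  then show ?thesis unfolding mt_def by (subst ent_Fsm[of n]) (auto simp: i_0)
qed

lemma K_closed: "M \<in> K \<Longrightarrow> M j i \<in> carrier R"
  by (simp add: K_def)

lemma mt_inj: "M \<in> K \<Longrightarrow> N \<in> K \<Longrightarrow> mt M = mt N \<longleftrightarrow> M = N"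
proof
  assume MN: "M \<in> K" "N \<in> K" "mt M = mt N"
  show "M = N"
  proof (intro ext)
    fix j i
    have "\<iota> (M j i) = \<iota> (N j i)" using MN by (metis ent_mt)
    then show "M j i = N j i" using MN(1,2) by (simp add: i_eq K_closed)
  qed
qed simp

lemma um: "f \<in> mats S \<Longrightarrow> um f \<in> K" "f \<in> mats S \<Longrightarrow> mt (um f) = f"
proof -
  assume f: "f \<in> mats S"
  have c: "the_inv_into (carrier R) \<iota> s \<in> carrier R" "\<iota> (the_inv_into (carrier R) \<iota> s) = s" if "s \<in> S" for s
    using that the_inv_into_into[OF inj, of s "carrier R"] f_the_inv_into_f[OF inj, of s] by (auto simp: S_def)
  obtain n where "\<forall>j i. n \<le> j \<or> n \<le> i \<longrightarrow> ent f j i = 0" using ent_bounded by blast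
  moreover have "the_inv_into (carrier R) \<iota> 0 = \<zero>" using the_inv_into_f_f[OF inj R.zero_closed] by (simp add: i_0)
  ultimately have "\<forall>j i. n \<le> j \<or> n \<le> i \<longrightarrow> um f j i = \<zero>" by (simp add: um_def)
  moreover have "\<forall>j i. um f j i \<in> carrier R" using c f by (simp add: um_def mats_def)
  ultimately show K: "um f \<in> K" unfolding K_def by blast
  show "mt (um f) = f"
  proof (rule fsm_eqI)
    fix i j
    have "ent (mt (um f)) i j = \<iota> (um f i j)" by (rule ent_mt[OF K])
    also have "\<dots> = ent f i j" using c f by (simp add: um_def mats_def)
    finally show "ent (mt (um f)) i j = ent f i j" .
  qed
qed

lemma mor_K: "is_mor R e1 e2 ls ms M \<Longrightarrow> M \<in> K"
proof -
  assume M: "is_mor R e1 e2 ls ms M"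
  have "M j i \<in> carrier R" "length ms \<le> j \<or> length ls \<le> i \<Longrightarrow> M j i = \<zero>" for j i
    using M[unfolded is_mor_def, rule_format, of j i] by (auto split: if_splits)
  then show ?thesis unfolding K_def by (intro CollectI conjI allI exI[of _ "max (length ms) (length ls)"]) auto
qed

lemma mor_hom: "M \<in> K \<Longrightarrow> is_mor R e1 e2 ls ms M \<longleftrightarrow> mt M \<in> hom S e ls ms"
proof
  assume M: "M \<in> K" and m: "is_mor R e1 e2 ls ms M"
  show "mt M \<in> hom S e ls ms"
  proof -
    have z: "M j i = \<zero>" if "length ms \<le> j \<or> length ls \<le> i" for j i
      using m[unfolded is_mor_def, rule_format, of j i] that by (auto split: if_splits)
    have s: "idm e1 e2 (ms ! j) \<otimes> M j i = M j i \<and> M j i \<otimes> idm e1 e2 (ls ! i) = M j i" if "j < length ms" "i < length ls" for j i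
    proof -
      define a where "a = idm e1 e2 (ms ! j)"
      define b where "b = idm e1 e2 (ls ! i)"
      have ab: "a \<in> carrier R" "b \<in> carrier R" "a \<otimes> a = a" "b \<otimes> b = b" "M j i \<in> carrier R"
        using idm_R M by (simp_all add: a_def b_def K_closed)
      have "a \<otimes> M j i \<otimes> b = M j i" using m that unfolding is_mor_def a_def b_def by auto
      then show ?thesis unfolding a_def[symmetric] b_def[symmetric] using ab by (metis R.m_assoc R.m_closed)
    qed
    have h: "\<iota> (idm e1 e2 (ms ! j)) * \<iota> (M j i) = \<iota> (M j i)" if "j < length ms" for j i
    proof (cases "i < length ls")
      case True
      then show ?thesis using s[OF that True] M idm_R(1) by (simp add: i_mul[symmetric] K_closed)
    qed (simp add: z i_0)
    have h': "\<iota> (M j i) * \<iota> (idm e1 e2 (ls ! i)) = \<iota> (M j i)" if "i < length ls" for j i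
    proof (cases "j < length ms")
      case True
      then show ?thesis using s[OF True that] M idm_R(1) by (simp add: i_mul[symmetric] K_closed)
    qed (simp add: z i_0)
    show ?thesis unfolding hom_def obj_def e_def
      by (auto intro!: matsI fsm_eqI simp: ent_diag_times ent_times_diag ent_mt[OF M] h h' z i_0 i_S K_closed[OF M])
  qed
next
  assume M: "M \<in> K" and h: "mt M \<in> hom S e ls ms"
  have e1: "ent (diag (map e ms) * mt M) j i = ent (mt M) j i" "ent (mt M * diag (map e ls)) j i = ent (mt M) j i" for j i
    using h by (simp_all add: hom_def obj_def)
  show "is_mor R e1 e2 ls ms M"
    unfolding is_mor_def
  proof (intro allI)
    fix j i
    show "if j < length ms \<and> i < length ls then M j i \<in> carrier R \<and> idm e1 e2 (ms ! j) \<otimes> M j i \<otimes> idm e1 e2 (ls ! i) = M j i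
      else M j i = \<zero>"
    proof (cases "j < length ms \<and> i < length ls")
      case True
      then have "\<iota> (idm e1 e2 (ms ! j) \<otimes> M j i) = \<iota> (M j i)" "\<iota> (M j i \<otimes> idm e1 e2 (ls ! i)) = \<iota> (M j i)"
        using e1[of j i] M idm_R(1) by (simp_all add: ent_diag_times ent_times_diag ent_mt e_def i_mul K_closed)
      then have "idm e1 e2 (ms ! j) \<otimes> M j i = M j i" "M j i \<otimes> idm e1 e2 (ls ! i) = M j i"
        using M idm_R(1) by (simp_all add: i_eq K_closed)
      then show ?thesis using True M by (simp add: K_closed)
    next
      case False
      then have "\<iota> (M j i) = \<iota> \<zero>"
        using e1[of j i] M by (auto simp: ent_diag_times ent_times_diag ent_mt i_0 split: if_splits)
      then have "M j i = \<zero>" using M by (simp add: i_eq K_closed)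
      then show ?thesis using False by (simp only: if_False)
    qed
  qed
qed

lemma mcomp_K:
  assumes "N \<in> K" "M \<in> K"
  shows "mcomp R n N M \<in> K"
proof -
  obtain n1 where n1: "\<forall>j i. n1 \<le> j \<or> n1 \<le> i \<longrightarrow> N j i = \<zero>" using assms(1) by (auto simp: K_def)
  obtain n2 where n2: "\<forall>j i. n2 \<le> j \<or> n2 \<le> i \<longrightarrow> M j i = \<zero>" using assms(2) by (auto simp: K_def)
  have "mcomp R n N M j i \<in> carrier R" for j i
    using assms unfolding mcomp_def by (auto intro!: R.finsum_closed simp: K_closed)
  moreover have "mcomp R n N M j i = \<zero>" if "max n1 n2 \<le> j \<or> max n1 n2 \<le> i" for j i
  proof -
    have "finsum R (\<lambda>k. N j k \<otimes> M k i) {..<n} = finsum R (\<lambda>k. \<zero>) {..<n}"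
      by (rule R.finsum_cong') (use that n1 n2 assms in \<open>auto simp: K_closed\<close>)
    then show ?thesis by (simp add: mcomp_def)
  qed
  ultimately show ?thesis unfolding K_def by (intro CollectI conjI allI exI[of _ "max n1 n2"]) auto
qed

lemma mt_mcomp:
  assumes "N \<in> K" "M \<in> K" and z: "\<And>k i. n \<le> k \<Longrightarrow> M k i = \<zero>"
  shows "mt (mcomp R n N M) = mt N * mt M"
proof (rule fsm_eqI)
  fix j i
  have "ent (mt (mcomp R n N M)) j i = \<iota> (finsum R (\<lambda>k. N j k \<otimes> M k i) {..<n})"
    by (simp add: ent_mt[OF mcomp_K[OF assms(1,2)]]) (simp add: mcomp_def)
  also have "\<dots> = (\<Sum>k<n. \<iota> (N j k \<otimes> M k i))" by (rule i_finsum) (use assms in \<open>auto simp: K_closed\<close>)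
  also have "\<dots> = (\<Sum>k<n. ent (mt N) j k * ent (mt M) k i)" using assms by (simp add: i_mul K_closed ent_mt)
  also have "\<dots> = ent (mt N * mt M) j i" by (rule ent_times[symmetric]) (use assms z in \<open>simp add: ent_mt i_0\<close>)
  finally show "ent (mt (mcomp R n N M)) j i = ent (mt N * mt M) j i" .
qed

lemma mor_zero: "is_mor R e1 e2 ls ms M \<Longrightarrow> length ms \<le> k \<Longrightarrow> M k i = \<zero>"
  unfolding is_mor_def by (metis linorder_not_le)

lemma mt_mcomp_mor: "is_mor R e1 e2 ls ms M \<Longrightarrow> N \<in> K \<Longrightarrow> mt (mcomp R (length ms) N M) = mt N * mt M"
  by (rule mt_mcomp) (auto simp: mor_K mor_zero)

lemma K_lin: "M \<in> K \<Longrightarrow> N \<in> K \<Longrightarrow> madd R M N \<in> K" "M \<in> K \<Longrightarrow> N \<in> K \<Longrightarrow> msub R M N \<in> K"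
proof -
  assume "M \<in> K" "N \<in> K"
  moreover obtain n1 where "\<forall>j i. n1 \<le> j \<or> n1 \<le> i \<longrightarrow> M j i = \<zero>" using \<open>M \<in> K\<close> by (auto simp: K_def)
  moreover obtain n2 where "\<forall>j i. n2 \<le> j \<or> n2 \<le> i \<longrightarrow> N j i = \<zero>" using \<open>N \<in> K\<close> by (auto simp: K_def)
  ultimately have c: "\<forall>j i. madd R M N j i \<in> carrier R" "\<forall>j i. msub R M N j i \<in> carrier R"
    "\<forall>j i. max n1 n2 \<le> j \<or> max n1 n2 \<le> i \<longrightarrow> madd R M N j i = \<zero>"
    "\<forall>j i. max n1 n2 \<le> j \<or> max n1 n2 \<le> i \<longrightarrow> msub R M N j i = \<zero>"
    by (auto simp: madd_def msub_def K_closed R.minus_eq)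
  then show "madd R M N \<in> K" "msub R M N \<in> K" unfolding K_def by blast+
qed

lemma mt_lin: "M \<in> K \<Longrightarrow> N \<in> K \<Longrightarrow> mt (madd R M N) = mt M + mt N" "M \<in> K \<Longrightarrow> N \<in> K \<Longrightarrow> mt (msub R M N) = mt M - mt N"
  by (rule fsm_eqI, simp add: ent_mt K_lin, simp add: madd_def msub_def i_add i_minus K_closed)+

lemma mid_mt: "mid R e1 e2 ls \<in> K" "mt (mid R e1 e2 ls) = obj e ls"
proof -
  show K: "mid R e1 e2 ls \<in> K" unfolding K_def mid_def using idm_R(1)
    by (intro CollectI conjI allI exI[of _ "length ls"]) auto
  show "mt (mid R e1 e2 ls) = obj e ls"
    by (rule fsm_eqI) (auto simp: ent_mt[OF K], auto simp: mid_def obj_def ent_diag e_def i_0)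
qed

section \<open>Translation of complexes\<close>

definition tr :: "'a cpx \<Rightarrow> 'r cx" where "tr T = Cx (tm1 T) (t0 T) (mt (dd T))"
definition ut :: "'r cx \<Rightarrow> 'a cpx" where "ut T = (src T, tgt T, um (dif T))"

lemma tr_sel [simp]: "src (tr T) = tm1 T" "tgt (tr T) = t0 T" "dif (tr T) = mt (dd T)"
  by (simp_all add: tr_def)

lemma ut_sel [simp]: "tm1 (ut T) = src T" "t0 (ut T) = tgt T" "dd (ut T) = um (dif T)"
  by (simp_all add: ut_def tm1_def t0_def dd_def)

lemma cpx_mor: "is_cpx R e1 e2 T \<Longrightarrow> is_mor R e1 e2 (tm1 T) (t0 T) (dd T)"
  by (simp add: is_cpx_def)

lemma cpx_K: "is_cpx R e1 e2 T \<Longrightarrow> dd T \<in> K"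
  using cpx_mor mor_K by blast

lemma tr_cx: "is_cpx R e1 e2 T \<Longrightarrow> iscx S e (tr T)"
  using cpx_K[of T] mor_hom[of "dd T"] by (simp add: is_cpx_def iscx_def)

lemma ut_cpx: "iscx S e U \<Longrightarrow> is_cpx R e1 e2 (ut U)" "iscx S e U \<Longrightarrow> tr (ut U) = U"
proof -
  assume U: "iscx S e U"
  have m: "dif U \<in> mats S" using C.hom_mats[OF C.iscx_dif[OF U]] .
  show "is_cpx R e1 e2 (ut U)" using U mor_hom[OF um(1)[OF m]] by (simp add: is_cpx_def iscx_def um(2)[OF m])
  show "tr (ut U) = U" by (rule cx_eqI) (simp_all add: um(2)[OF m])
qed

lemma mor_um: "f \<in> hom S e ls ms \<Longrightarrow> is_mor R e1 e2 ls ms (um f)" "f \<in> hom S e ls ms \<Longrightarrow> mt (um f) = f"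
  using mor_hom um C.hom_mats by metis+

lemma iso_tr:
  assumes T: "is_cpx R e1 e2 T" and U: "is_cpx R e1 e2 U"
  shows "cpx_iso R e1 e2 T U \<longleftrightarrow> iso S e (tr T) (tr U)"
proof
  assume "cpx_iso R e1 e2 T U"
  then obtain f1 f0 g1 g0 where c: "chain_map R e1 e2 T U f1 f0" "chain_map R e1 e2 U T g1 g0"
    and n1: "nullhtp R e1 e2 T T (msub R (mcomp R (length (tm1 U)) g1 f1) (mid R e1 e2 (tm1 T)))
                          (msub R (mcomp R (length (t0 U)) g0 f0) (mid R e1 e2 (t0 T)))"
    and n2: "nullhtp R e1 e2 U U (msub R (mcomp R (length (tm1 T)) f1 g1) (mid R e1 e2 (tm1 U)))
                          (msub R (mcomp R (length (t0 T)) f0 g0) (mid R e1 e2 (t0 U)))"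
    unfolding cpx_iso_def by blast
  obtain h where h: "is_mor R e1 e2 (t0 T) (tm1 T) h"
    "msub R (mcomp R (length (tm1 U)) g1 f1) (mid R e1 e2 (tm1 T)) = mcomp R (length (t0 T)) h (dd T)"
    "msub R (mcomp R (length (t0 U)) g0 f0) (mid R e1 e2 (t0 T)) = mcomp R (length (tm1 T)) (dd T) h"
    using n1 unfolding nullhtp_def by blast
  obtain k where k: "is_mor R e1 e2 (t0 U) (tm1 U) k"
    "msub R (mcomp R (length (tm1 T)) f1 g1) (mid R e1 e2 (tm1 U)) = mcomp R (length (t0 U)) k (dd U)"
    "msub R (mcomp R (length (t0 T)) f0 g0) (mid R e1 e2 (t0 U)) = mcomp R (length (tm1 U)) (dd U) k"
    using n2 unfolding nullhtp_def by blast
  have m: "is_mor R e1 e2 (tm1 T) (tm1 U) f1" "is_mor R e1 e2 (t0 T) (t0 U) f0"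
    "is_mor R e1 e2 (tm1 U) (tm1 T) g1" "is_mor R e1 e2 (t0 U) (t0 T) g0"
    and e: "mcomp R (length (tm1 U)) (dd U) f1 = mcomp R (length (t0 T)) f0 (dd T)"
    "mcomp R (length (tm1 T)) (dd T) g1 = mcomp R (length (t0 U)) g0 (dd U)" using c unfolding chain_map_def by blast+
  note mm = m h(1) k(1) cpx_mor[OF T] cpx_mor[OF U]
  note KK = mm[THEN mor_K]
  have H: "mt M \<in> hom S e ls ms" if "is_mor R e1 e2 ls ms M" for M ls ms using mor_hom[OF mor_K[OF that]] that by blast
  note E = arg_cong[OF e(1), of mt] arg_cong[OF e(2), of mt] arg_cong[OF h(2), of mt] arg_cong[OF h(3), of mt]
    arg_cong[OF k(2), of mt] arg_cong[OF k(3), of mt]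
  note E' = E[unfolded mt_lin(2)[OF mcomp_K[OF KK(3,1)] mid_mt(1)] mt_lin(2)[OF mcomp_K[OF KK(4,2)] mid_mt(1)]
     mt_lin(2)[OF mcomp_K[OF KK(1,3)] mid_mt(1)] mt_lin(2)[OF mcomp_K[OF KK(2,4)] mid_mt(1)]
     mt_mcomp_mor[OF mm(1) KK(8)] mt_mcomp_mor[OF mm(7) KK(2)] mt_mcomp_mor[OF mm(3) KK(7)] mt_mcomp_mor[OF mm(8) KK(4)]
     mt_mcomp_mor[OF mm(1) KK(3)] mt_mcomp_mor[OF mm(2) KK(4)] mt_mcomp_mor[OF mm(3) KK(1)] mt_mcomp_mor[OF mm(4) KK(2)]
     mt_mcomp_mor[OF mm(7) KK(5)] mt_mcomp_mor[OF mm(5) KK(7)] mt_mcomp_mor[OF mm(8) KK(6)] mt_mcomp_mor[OF mm(6) KK(8)] mid_mt(2)]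
  show "iso S e (tr T) (tr U)"
    by (rule C.isoI[of "mt f1" _ _ "mt f0" "mt g1" "mt g0" "mt h" "mt k"])
       (use E' H mm in \<open>simp_all add: diff_eq_eq add.commute\<close>)
next
  assume "iso S e (tr T) (tr U)"
  then obtain f1 f0 g1 g0 h k where m: 
    "f1 \<in> hom S e (tm1 T) (tm1 U)" "f0 \<in> hom S e (t0 T) (t0 U)" "g1 \<in> hom S e (tm1 U) (tm1 T)" "g0 \<in> hom S e (t0 U) (t0 T)"
    "h \<in> hom S e (t0 T) (tm1 T)" "k \<in> hom S e (t0 U) (tm1 U)" and eq: "mt (dd U) * f1 = f0 * mt (dd T)" "mt (dd T) * g1 = g0 * mt (dd U)"
    "g1 * f1 = C.ob (tm1 T) + h * mt (dd T)" "g0 * f0 = C.ob (t0 T) + mt (dd T) * h"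
    "f1 * g1 = C.ob (tm1 U) + k * mt (dd U)" "f0 * g0 = C.ob (t0 U) + mt (dd U) * k"
    by (elim C.isoE) (auto simp only: tr_sel)
  note mm = m[THEN mor_um(1)] cpx_mor[OF T] cpx_mor[OF U]
  note KK = mm[THEN mor_K]
  note mtu = m[THEN mor_um(2)]
  note R1 = mt_mcomp_mor[OF mm(1) KK(8)] mt_mcomp_mor[OF mm(7) KK(2)] mt_mcomp_mor[OF mm(3) KK(7)] mt_mcomp_mor[OF mm(8) KK(4)]
     mt_mcomp_mor[OF mm(1) KK(3)] mt_mcomp_mor[OF mm(2) KK(4)] mt_mcomp_mor[OF mm(3) KK(1)] mt_mcomp_mor[OF mm(4) KK(2)]
     mt_mcomp_mor[OF mm(7) KK(5)] mt_mcomp_mor[OF mm(5) KK(7)] mt_mcomp_mor[OF mm(8) KK(6)] mt_mcomp_mor[OF mm(6) KK(8)]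
  have c: "chain_map R e1 e2 T U (um f1) (um f0)" "chain_map R e1 e2 U T (um g1) (um g0)"
    unfolding chain_map_def using mm eq(1,2)
    by (simp_all add: mt_inj[symmetric] mcomp_K KK R1 mtu)
  have n1: "nullhtp R e1 e2 T T (msub R (mcomp R (length (tm1 U)) (um g1) (um f1)) (mid R e1 e2 (tm1 T)))
                          (msub R (mcomp R (length (t0 U)) (um g0) (um f0)) (mid R e1 e2 (t0 T)))"
    unfolding nullhtp_def using mm(5) eq(3,4)
    by (intro exI[of _ "um h"]) (simp add: mt_inj[symmetric] mcomp_K KK K_lin mid_mt mt_lin R1 mtu)
  have n2: "nullhtp R e1 e2 U U (msub R (mcomp R (length (tm1 T)) (um f1) (um g1)) (mid R e1 e2 (tm1 U)))
                          (msub R (mcomp R (length (t0 T)) (um f0) (um g0)) (mid R e1 e2 (t0 U)))"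
    unfolding nullhtp_def using mm(6) eq(5,6)
    by (intro exI[of _ "um k"]) (simp add: mt_inj[symmetric] mcomp_K KK K_lin mid_mt mt_lin R1 mtu)
  show "cpx_iso R e1 e2 T U" unfolding cpx_iso_def using c n1 n2 by blast
qed

lemma tr_zero: "is_cpx R e1 e2 (zero_cpx R)" "tr (zero_cpx R) = zcx"
proof -
  have "(\<lambda>_ _. \<zero>) \<in> K" by (simp add: K_def)
  then show "tr (zero_cpx R) = zcx"
    by (intro cx_eqI fsm_eqI) (simp_all add: zcx_def zero_cpx_def tm1_def t0_def dd_def ent_mt i_0)
  show "is_cpx R e1 e2 (zero_cpx R)" by (simp add: is_cpx_def zero_cpx_def tm1_def t0_def dd_def is_mor_def)
qed

lemma dsum_sel [simp]: "tm1 (dsum R T U) = tm1 T @ tm1 U" "t0 (dsum R T U) = t0 T @ t0 U"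
  by (simp_all add: dsum_def tm1_def t0_def)

lemma dd_dsum: "dd (dsum R T U) j i = (if j < length (t0 T) then (if i < length (tm1 T) then dd T j i else \<zero>)
            else if i < length (tm1 T) then \<zero> else dd U (j - length (t0 T)) (i - length (tm1 T)))"
  by (simp add: dsum_def dd_def)

lemma dsum_cpx: "is_cpx R e1 e2 T \<Longrightarrow> is_cpx R e1 e2 U \<Longrightarrow> is_cpx R e1 e2 (dsum R T U)"
proof -
  assume T: "is_cpx R e1 e2 T" and U: "is_cpx R e1 e2 U"
  have z: "x \<in> carrier R \<Longrightarrow> y \<in> carrier R \<Longrightarrow> x \<otimes> \<zero> \<otimes> y = \<zero>" for x y by simp
  have "is_mor R e1 e2 (tm1 T @ tm1 U) (t0 T @ t0 U) (dd (dsum R T U))"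
    unfolding is_mor_def
  proof (intro allI)
    fix j i
    show "if j < length (t0 T @ t0 U) \<and> i < length (tm1 T @ tm1 U)
       then dd (dsum R T U) j i \<in> carrier R \<and> idm e1 e2 ((t0 T @ t0 U) ! j) \<otimes> dd (dsum R T U) j i \<otimes> idm e1 e2 ((tm1 T @ tm1 U) ! i) = dd (dsum R T U) j i
       else dd (dsum R T U) j i = \<zero>"
      using cpx_mor[OF T, unfolded is_mor_def, rule_format, of j i]
        cpx_mor[OF U, unfolded is_mor_def, rule_format, of "j - length (t0 T)" "i - length (tm1 T)"]
      by (auto simp: dd_dsum nth_append z idm_R split: if_splits)
  qed
  then show ?thesis using T U by (simp add: is_cpx_def)
qed

lemma tr_dsum: "is_cpx R e1 e2 T \<Longrightarrow> is_cpx R e1 e2 U \<Longrightarrow> tr (dsum R T U) = dsm e (tr T) (tr U)"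
proof -
  assume T: "is_cpx R e1 e2 T" and U: "is_cpx R e1 e2 U"
  have zT: "\<not> (j < length (t0 T) \<and> i < length (tm1 T)) \<Longrightarrow> dd T j i = \<zero>" for j i
    using cpx_mor[OF T] unfolding is_mor_def by metis
  have zU: "\<not> (j < length (t0 U) \<and> i < length (tm1 U)) \<Longrightarrow> dd U j i = \<zero>" for j i
    using cpx_mor[OF U] unfolding is_mor_def by metis
  have hU: "mt (dd U) \<in> hom S e (tm1 U) (t0 U)" using C.iscx_dif[OF tr_cx[OF U]] by simp
  have u1: "e (t0 U ! q) * \<iota> (dd U q r) = \<iota> (dd U q r)" if "q < length (t0 U)" for q r
    using arg_cong[OF C.hom_l[OF hU], of "\<lambda>A. ent A q r"] that by (simp add: obj_def ent_diag_times ent_mt cpx_K[OF U])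
  have u2: "\<iota> (dd U q r) * e (tm1 U ! r) = \<iota> (dd U q r)" if "r < length (tm1 U)" for q r
    using arg_cong[OF C.hom_r[OF hU], of "\<lambda>A. ent A q r"] that by (simp add: obj_def ent_times_diag ent_mt cpx_K[OF U])
  have z: "\<iota> (dd U (j - length (t0 T)) (i - length (tm1 T))) = 0"
    if "length (t0 T) + length (t0 U) \<le> j \<or> length (tm1 T) + length (tm1 U) \<le> i" for j i
  proof -
    have "\<not> (j - length (t0 T) < length (t0 U) \<and> i - length (tm1 T) < length (tm1 U))" using that by linarith
    then show ?thesis by (simp add: zU i_0)
  qed
  have "ent (mt (dd (dsum R T U))) j i =
     ent (mt (dd T) + sft e (length (t0 T)) (t0 U) * mt (dd U) * sft' e (length (tm1 T)) (tm1 U)) j i" for j i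
    using u1[of "j - length (t0 T)" "i - length (tm1 T)"] u2[of "i - length (tm1 T)" "j - length (t0 T)"]
    by (simp add: ent_mt cpx_K T U dsum_cpx dd_dsum ent_times_sft' ent_sft_times i_0 zT zU) (auto simp: not_less z)
  then show ?thesis by (intro cx_eqI fsm_eqI) (simp_all add: dsm_def)
qed

lemma tr_dsum_list:
  assumes "\<And>T. T \<in> set Ts \<Longrightarrow> is_cpx R e1 e2 T"
  shows "is_cpx R e1 e2 (dsum_list R Ts)" "tr (dsum_list R Ts) = dsms e (map tr Ts)"
proof -
  have "is_cpx R e1 e2 (dsum_list R Ts) \<and> tr (dsum_list R Ts) = dsms e (map tr Ts)" using assms
    by (induction Ts) (simp_all add: dsum_list_def tr_zero dsum_cpx tr_dsum)
  then show "is_cpx R e1 e2 (dsum_list R Ts)" "tr (dsum_list R Ts) = dsms e (map tr Ts)" by simp_all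
qed

lemma presilting_tr:
  assumes T: "is_cpx R e1 e2 T"
  shows "presilting R e1 e2 T \<longleftrightarrow> presil S e (tr T)"
proof
  assume P: "presilting R e1 e2 T"
  show "presil S e (tr T)" unfolding presil_def tr_sel
  proof
    fix g assume g: "g \<in> hom S e (tm1 T) (t0 T)"
    obtain a b where a: "is_mor R e1 e2 (tm1 T) (tm1 T) a" and b: "is_mor R e1 e2 (t0 T) (t0 T) b" and
      ab: "um g = madd R (mcomp R (length (tm1 T)) (dd T) a) (mcomp R (length (t0 T)) b (dd T))"
      using P mor_um(1)[OF g] unfolding presilting_def by blast
    have "mt (um g) = mt (dd T) * mt a + mt b * mt (dd T)"
      unfolding ab by (simp add: mt_lin mcomp_K mor_K[OF a] mor_K[OF b] cpx_K[OF T]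
          mt_mcomp_mor[OF a] mt_mcomp_mor[OF cpx_mor[OF T]])
    then show "\<exists>a\<in>hom S e (tm1 T) (tm1 T). \<exists>b\<in>hom S e (t0 T) (t0 T). g = mt (dd T) * a + b * mt (dd T)"
      using mor_hom[OF mor_K[OF a]] mor_hom[OF mor_K[OF b]] a b mor_um(2)[OF g] by auto
  qed
next
  assume P: "presil S e (tr T)"
  show "presilting R e1 e2 T" unfolding presilting_def
  proof (intro conjI allI impI T)
    fix g assume g: "is_mor R e1 e2 (tm1 T) (t0 T) g"
    then have "mt g \<in> hom S e (tm1 T) (t0 T)" using mor_hom mor_K by blast
    then obtain a b where a: "a \<in> hom S e (tm1 T) (tm1 T)" and b: "b \<in> hom S e (t0 T) (t0 T)"
      and ab: "mt g = mt (dd T) * a + b * mt (dd T)" using P unfolding presil_def tr_sel by blast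
    note m = mor_um(1)[OF a] mor_um(1)[OF b]
    have "mt g = mt (madd R (mcomp R (length (tm1 T)) (dd T) (um a)) (mcomp R (length (t0 T)) (um b) (dd T)))"
      by (simp add: mt_lin mcomp_K mor_K[OF m(1)] mor_K[OF m(2)] cpx_K[OF T]
          mt_mcomp_mor[OF m(1)] mt_mcomp_mor[OF cpx_mor[OF T]] mor_um(2)[OF a] mor_um(2)[OF b] ab)
    then have "g = madd R (mcomp R (length (tm1 T)) (dd T) (um a)) (mcomp R (length (t0 T)) (um b) (dd T))"
      by (subst (asm) mt_inj) (simp_all add: K_lin mcomp_K mor_K[OF m(1)] mor_K[OF m(2)] cpx_K[OF T] mor_K[OF g])
    then show "\<exists>a b. is_mor R e1 e2 (tm1 T) (tm1 T) a \<and> is_mor R e1 e2 (t0 T) (t0 T) b \<and>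
           g = madd R (mcomp R (length (tm1 T)) (dd T) a) (mcomp R (length (t0 T)) b (dd T))" using m by blast
  qed
qed

lemma indec_tr:
  assumes T: "is_cpx R e1 e2 T"
  shows "indec R e1 e2 T \<longleftrightarrow> ind S e (tr T)"
proof
  assume i: "indec R e1 e2 T"
  show "ind S e (tr T)" unfolding ind_def
  proof (intro conjI allI impI)
    show "iscx S e (tr T)" using tr_cx[OF T] .
    show "\<not> iso S e (tr T) zcx" using i iso_tr[OF T tr_zero(1)] by (simp add: indec_def tr_zero(2))
    fix U V assume UV: "iscx S e U \<and> iscx S e V \<and> iso S e (tr T) (dsm e U V)"
    have c: "is_cpx R e1 e2 (ut U)" "is_cpx R e1 e2 (ut V)" "tr (ut U) = U" "tr (ut V) = V" using ut_cpx UV by blast+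
    have "cpx_iso R e1 e2 T (dsum R (ut U) (ut V))"
      using UV iso_tr[OF T dsum_cpx[OF c(1,2)]] by (simp add: tr_dsum[OF c(1,2)] c(3,4))
    then have "cpx_iso R e1 e2 (ut U) (zero_cpx R) \<or> cpx_iso R e1 e2 (ut V) (zero_cpx R)"
      using i c unfolding indec_def by blast
    then show "iso S e U zcx \<or> iso S e V zcx"
      using iso_tr[OF c(1) tr_zero(1)] iso_tr[OF c(2) tr_zero(1)] by (simp add: c(3,4) tr_zero(2))
  qed
next
  assume i: "ind S e (tr T)"
  show "indec R e1 e2 T" unfolding indec_def
  proof (intro conjI allI impI)
    show "is_cpx R e1 e2 T" by (rule T)
    show "\<not> cpx_iso R e1 e2 T (zero_cpx R)" using i iso_tr[OF T tr_zero(1)] by (simp add: ind_def tr_zero(2))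
    fix U V assume UV: "is_cpx R e1 e2 U \<and> is_cpx R e1 e2 V \<and> cpx_iso R e1 e2 T (dsum R U V)"
    then have "iso S e (tr T) (dsm e (tr U) (tr V))" using iso_tr[OF T dsum_cpx[of U V]] by (simp add: tr_dsum)
    then have "iso S e (tr U) zcx \<or> iso S e (tr V) zcx" using i UV tr_cx unfolding ind_def by blast
    then show "cpx_iso R e1 e2 U (zero_cpx R) \<or> cpx_iso R e1 e2 V (zero_cpx R)"
      using UV iso_tr[OF _ tr_zero(1)] by (simp add: tr_zero(2))
  qed
qed

lemma gvec_tr: "gvec T = gv (tr T)"
  by (simp add: gvec_def gv_def)

theorem gfan_eq_fan: "gfan R e1 e2 = fan S e"
proof
  show "gfan R e1 e2 \<subseteq> fan S e"
  proof
    fix C assume "C \<in> gfan R e1 e2"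
    then obtain Ts where Ts: "C = gcone (set (map gvec Ts))" and i: "\<And>T. T \<in> set Ts \<Longrightarrow> indec R e1 e2 T"
      and n: "\<forall>i<length Ts. \<forall>j<length Ts. i \<noteq> j \<longrightarrow> \<not> cpx_iso R e1 e2 (Ts ! i) (Ts ! j)"
      and p: "presilting R e1 e2 (dsum_list R Ts)" unfolding gfan_def by blast
    have cx: "is_cpx R e1 e2 T" if "T \<in> set Ts" for T using i[OF that] by (simp add: indec_def)
    have "family S e (map tr Ts)" unfolding family_def
      using i indec_tr cx n iso_tr presilting_tr[OF tr_dsum_list(1)[OF cx]] p tr_dsum_list(2)[OF cx] by simp
    moreover have "map gv (map tr Ts) = map gvec Ts" by (simp add: gvec_tr)
    ultimately show "C \<in> fan S e" unfolding fan_def Ts mem_Collect_eq by (intro exI[of _ "map tr Ts"]) (simp only: simp_thms)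
  qed
  show "fan S e \<subseteq> gfan R e1 e2"
  proof
    fix C assume "C \<in> fan S e"
    then obtain Us where Us: "C = gcone (set (map gv Us))" and F: "family S e Us" unfolding fan_def by blast
    have cU: "iscx S e U" if "U \<in> set Us" for U using F that by (simp add: family_def ind_def)
    define Ts where "Ts = map ut Us"
    have cx: "is_cpx R e1 e2 T" if "T \<in> set Ts" for T using that ut_cpx(1)[OF cU] by (auto simp: Ts_def)
    have U: "map tr Ts = Us" using ut_cpx(2)[OF cU] by (simp add: Ts_def map_idI)
    have "indec R e1 e2 T" if "T \<in> set Ts" for T
    proof -
      have "tr T \<in> set Us" unfolding U[symmetric] using that by simp
      then show ?thesis using indec_tr[OF cx[OF that]] F by (simp add: family_def)
    qed
    moreover have "\<not> cpx_iso R e1 e2 (Ts ! i) (Ts ! j)" if ij: "i < length Ts" "j < length Ts" "i \<noteq> j" for i j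
    proof -
      have "tr (Ts ! i) = Us ! i" "tr (Ts ! j) = Us ! j" "length Us = length Ts" using U ij by (metis nth_map, metis nth_map, metis length_map)
      then show ?thesis using iso_tr[OF cx cx, of "Ts ! i" "Ts ! j"] F ij by (simp add: family_def)
    qed
    moreover have "presilting R e1 e2 (dsum_list R Ts)"
      using presilting_tr[OF tr_dsum_list(1)[OF cx]] F tr_dsum_list(2)[OF cx] by (simp add: U family_def)
    moreover have "map gvec Ts = map gv Us" unfolding U[symmetric] by (simp add: gvec_tr)
    ultimately show "C \<in> gfan R e1 e2" unfolding gfan_def Us mem_Collect_eq by (intro exI[of _ Ts]) (simp only: simp_thms, blast)
  qed
qed

end

section \<open>Matrix representations of finite-dimensional algebras\<close>

lemma (in ring) additive_subgroup_intro:
  assumes "I \<subseteq> carrier R" "\<zero> \<in> I" "\<And>a b. a \<in> I \<Longrightarrow> b \<in> I \<Longrightarrow> a \<oplus> b \<in> I" "\<And>a. a \<in> I \<Longrightarrow> \<ominus> a \<in> I"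
  shows "additive_subgroup I R"
  by (intro additive_subgroup.intro subgroup.intro) (use assms in \<open>auto simp: a_inv_def\<close>)

definition fsc :: "'k::field \<Rightarrow> 'k fsm \<Rightarrow> 'k fsm" where
  "fsc c A = fmap (\<lambda>a. c * a) A"

lemma ent_fsc [simp]: "ent (fsc c A) i j = c * ent A i j"
  by (simp add: fsc_def ent_fmap)

interpretation fs: vector_space fsc
  by unfold_locales (auto intro!: fsm_eqI simp: algebra_simps)

lemma fsc_mult: "fsc c (A * B) = fsc c A * B" "fsc c (A * B) = A * fsc c B"
proof -
  obtain n where n: "\<forall>i j. n \<le> i \<or> n \<le> j \<longrightarrow> ent A i j = 0" "\<forall>i j. n \<le> i \<or> n \<le> j \<longrightarrow> ent B i j = 0"
    using common_bound[of A B B] by blast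
  show "fsc c (A * B) = fsc c A * B" "fsc c (A * B) = A * fsc c B"
    by (rule fsm_eqI; use n in \<open>simp add: ent_times[of n] sum_distrib_left mult.assoc mult.left_commute\<close>)+
qed

lemma span_units:
  assumes "\<And>i j. n \<le> i \<or> n \<le> j \<Longrightarrow> ent A i j = 0"
  shows "A \<in> fs.span ((\<lambda>(i, j). single i j 1) ` ({..<n} \<times> {..<n}))"
proof -
  have e: "ent (sum f I) i j = (\<Sum>x\<in>I. ent (f x) i j)" for f :: "nat \<Rightarrow> 'a fsm" and I i j
    by (induction I rule: infinite_finite_induct) simp_all
  have "A = (\<Sum>i<n. \<Sum>j<n. fsc (ent A i j) (single i j 1))"
  proof (rule fsm_eqI)
    fix p q
    have "ent (\<Sum>i<n. \<Sum>j<n. fsc (ent A i j) (single i j 1)) p q = (\<Sum>i<n. \<Sum>j<n. if i = p \<and> j = q then ent A p q else 0)"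
      by (simp add: e ent_single) (intro sum.cong refl, auto)
    also have "\<dots> = (\<Sum>i<n. if i = p then (if q < n then ent A p q else 0) else 0)"
      by (rule sum.cong) auto
    also have "\<dots> = ent A p q" using assms by auto
    finally show "ent A p q = ent (\<Sum>i<n. \<Sum>j<n. fsc (ent A i j) (single i j 1)) p q" by simp
  qed
  moreover have "(\<Sum>i<n. \<Sum>j<n. fsc (ent A i j) (single i j 1)) \<in> fs.span ((\<lambda>(i, j). single i j 1) ` ({..<n} \<times> {..<n}))"
    by (intro fs.span_sum fs.span_scale fs.span_base) auto
  ultimately show ?thesis by simp
qed

locale fdalg = R: ring R for R :: "'a ring" (structure) +
  fixes sm :: "'k::field \<Rightarrow> 'a \<Rightarrow> 'a"
  assumes alg: "is_fd_kalg R sm"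
begin

lemmas alg_laws = alg[unfolded is_fd_kalg_def, THEN conjunct2]
lemmas alg_laws2 = alg_laws[THEN conjunct2, THEN conjunct2]
lemmas alg_laws3 = alg_laws2[THEN conjunct2, THEN conjunct2]

lemmas sm_closed [simp] = alg_laws[THEN conjunct1, rule_format]
lemmas sm_add = alg_laws[THEN conjunct2, THEN conjunct1, rule_format]
lemmas sm_plus = alg_laws2[THEN conjunct1, rule_format]
lemmas sm_times = alg_laws2[THEN conjunct2, THEN conjunct1, rule_format]
lemmas sm_1 = alg_laws3[THEN conjunct1, rule_format]
lemmas sm_l = alg_laws3[THEN conjunct2, THEN conjunct1, rule_format, THEN conjunct1]
lemmas sm_r = alg_laws3[THEN conjunct2, THEN conjunct1, rule_format, THEN conjunct2]
lemmas finite_spanning = alg_laws3[THEN conjunct2, THEN conjunct2]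

lemma sm_0 [simp]: "x \<in> carrier R \<Longrightarrow> sm 0 x = \<zero>"
proof -
  assume x: "x \<in> carrier R"
  have "sm 0 x \<oplus> sm 0 x = sm 0 x" using sm_plus[OF x, of 0 0] by simp
  then show ?thesis using R.add.l_cancel_one[OF sm_closed[OF x] sm_closed[OF x], of 0 0] by simp
qed

lemma sm_zero [simp]: "sm c \<zero> = \<zero>"
proof -
  have "sm c \<zero> \<oplus> sm c \<zero> = sm c \<zero>" using sm_add[of \<zero> \<zero> c] by simp
  then show ?thesis using R.add.l_cancel_one[OF sm_closed[OF R.zero_closed] sm_closed[OF R.zero_closed], of c c] by simp
qed

primrec comb :: "nat \<Rightarrow> (nat \<Rightarrow> 'a) \<Rightarrow> (nat \<Rightarrow> 'k) \<Rightarrow> 'a" where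
  "comb 0 b c = \<zero>"
| "comb (Suc n) b c = sm (c n) (b n) \<oplus> comb n b c"

lemma comb_closed: "(\<And>i. i < n \<Longrightarrow> b i \<in> carrier R) \<Longrightarrow> comb n b c \<in> carrier R"
  by (induction n) auto

lemma comb_cong: "(\<And>i. i < n \<Longrightarrow> b i = b' i \<and> c i = c' i) \<Longrightarrow> comb n b c = comb n b' c'"
  by (induction n) auto

lemma comb_lin: "(\<And>i. i < n \<Longrightarrow> b i \<in> carrier R) \<Longrightarrow>
   comb n b (\<lambda>i. c i + k * d i) = comb n b c \<oplus> sm k (comb n b d)"
proof (induction n)
  case (Suc n)
  have cl: "b n \<in> carrier R" "comb n b c \<in> carrier R" "comb n b d \<in> carrier R"
    using Suc.prems by (auto intro: comb_closed)
  then show ?case using Suc by (simp add: sm_plus sm_times sm_add R.a_ac)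
qed simp

lemma comb_finsum: "(\<And>i. i < n \<Longrightarrow> b i \<in> carrier R) \<Longrightarrow> comb n b c = finsum R (\<lambda>i. sm (c i) (b i)) {..<n}"
proof (induction n)
  case (Suc n)
  have "finsum R (\<lambda>i. sm (c i) (b i)) (insert n {..<n}) = sm (c n) (b n) \<oplus> finsum R (\<lambda>i. sm (c i) (b i)) {..<n}"
    by (rule R.finsum_insert) (use Suc.prems in auto)
  then show ?case using Suc by (simp add: lessThan_Suc)
qed simp

lemma comb_drop:
  assumes "\<And>i. i < Suc n \<Longrightarrow> b i \<in> carrier R" "j \<le> n" "c j = 0"
  shows "comb (Suc n) b c = comb n (\<lambda>i. b (if i < j then i else Suc i)) (\<lambda>i. c (if i < j then i else Suc i))"
  using assms
proof (induction n)
  case (Suc n)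
  show ?case
  proof (cases "j = Suc n")
    case True
    then have "comb (Suc (Suc n)) b c = comb (Suc n) b c"
      using Suc.prems(1)[of "Suc n"] Suc.prems(3) comb_closed[of "Suc n" b c] Suc.prems(1) by simp
    also have "\<dots> = comb (Suc n) (\<lambda>i. b (if i < j then i else Suc i)) (\<lambda>i. c (if i < j then i else Suc i))"
      by (rule comb_cong) (use True in auto)
    finally show ?thesis .
  next
    case False
    then show ?thesis using Suc.IH[OF _ _ Suc.prems(3)] Suc.prems by simp
  qed
qed auto

definition spans :: "nat \<Rightarrow> (nat \<Rightarrow> 'a) \<Rightarrow> bool" where
  "spans n b \<longleftrightarrow> (\<forall>i<n. b i \<in> carrier R) \<and> (\<forall>x\<in>carrier R. \<exists>c. x = comb n b c)"

lemma spans_exists: "\<exists>n b. spans n b"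
proof -
  obtain B where B: "finite B" "B \<subseteq> carrier R" "\<forall>x\<in>carrier R. \<exists>c. x = finsum R (\<lambda>b. sm (c b) b) B"
    using finite_spanning by (elim exE conjE)
  obtain h where h: "bij_betw h {0..<card B} B" using ex_bij_betw_nat_finite[OF B(1)] by blast
  then have hB: "h ` {..<card B} = B" "inj_on h {..<card B}" by (auto simp: bij_betw_def lessThan_atLeast0)
  then have hc: "h i \<in> carrier R" if "i < card B" for i using B(2) that by blast
  have "\<exists>c. x = comb (card B) h c" if x: "x \<in> carrier R" for x
  proof -
    obtain c where c: "x = finsum R (\<lambda>b. sm (c b) b) (h ` {..<card B})" using B(3) x hB by auto
    also have "\<dots> = finsum R (\<lambda>i. sm (c (h i)) (h i)) {..<card B}"
      by (rule R.finsum_reindex) (use hc hB B(2) in auto)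
    also have "\<dots> = comb (card B) h (\<lambda>i. c (h i))" by (rule comb_finsum[symmetric]) (rule hc)
    finally show ?thesis by blast
  qed
  then show ?thesis using hc unfolding spans_def by blast
qed

lemma basis_exists: "\<exists>n b. spans n b \<and> (\<forall>c. comb n b c = \<zero> \<longrightarrow> (\<forall>i<n. c i = 0))"
proof -
  define N where "N = (LEAST n. \<exists>b. spans n b)"
  obtain b where b: "spans N b" unfolding N_def using LeastI_ex[OF spans_exists] by blast
  have "c j = 0" if c: "comb N b c = \<zero>" and j: "j < N" for c j
  proof (rule ccontr)
    assume nz: "c j \<noteq> 0"
    obtain n where n: "N = Suc n" using j by (cases N) auto
    have bc: "i < Suc n \<Longrightarrow> b i \<in> carrier R" for i using b n by (simp add: spans_def)
    define b' where "b' i = b (if i < j then i else Suc i)" for i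
    have "spans n b'" unfolding spans_def
    proof (intro conjI allI impI ballI)
      show "b' i \<in> carrier R" if "i < n" for i using bc that by (simp add: b'_def)
      fix x assume "x \<in> carrier R"
      then obtain d where d: "x = comb N b d" using b by (auto simp: spans_def)
      \<comment> \<open>The relation \<open>c\<close> is subtracted with the factor that makes the
        coefficient at \<open>j\<close> vanish.\<close>
      define d' where "d' = (\<lambda>i. d i + (- d j / c j) * c i)"
      have "comb N b d' = x \<oplus> sm (- d j / c j) \<zero>"
        unfolding d'_def n by (subst comb_lin[OF bc]) (use c d n in simp_all)
      then have "x = comb (Suc n) b d'" using \<open>x \<in> carrier R\<close> n by simp
      also have "\<dots> = comb n b' (\<lambda>i. d' (if i < j then i else Suc i))"
        unfolding b'_def by (rule comb_drop[OF bc]) (use j n nz in \<open>auto simp: d'_def\<close>)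
      finally show "\<exists>c. x = comb n b' c" by blast
    qed
    then have "N \<le> n" unfolding N_def by (intro Least_le) blast
    then show False using n by simp
  qed
  then show ?thesis using b by blast
qed

text \<open>The left regular representation in coordinates: column \<open>j\<close> of
  \<open>\<iota> x\<close> holds the coordinates of \<open>x \<otimes> b j\<close>. It is faithful
  because \<open>x\<close> is recovered as its product with the unit.\<close>

lemma representation:
  "\<exists>(\<iota> :: 'a \<Rightarrow> 'k fsm) n. inj_on \<iota> (carrier R)
     \<and> (\<forall>x\<in>carrier R. \<forall>y\<in>carrier R. \<iota> (x \<oplus> y) = \<iota> x + \<iota> y \<and> \<iota> (x \<otimes> y) = \<iota> x * \<iota> y)
     \<and> (\<forall>c. \<forall>x\<in>carrier R. \<iota> (sm c x) = fsc c (\<iota> x))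
     \<and> (\<forall>x. \<forall>i j. n \<le> i \<or> n \<le> j \<longrightarrow> ent (\<iota> x) i j = 0)"
proof -
  obtain n b where sp: "spans n b" and ind: "\<And>c i. comb n b c = \<zero> \<Longrightarrow> i < n \<Longrightarrow> c i = 0" using basis_exists by blast
  have bc: "i < n \<Longrightarrow> b i \<in> carrier R" for i using sp by (simp add: spans_def)
  define co where "co x = (SOME c. x = comb n b c)" for x
  have co: "comb n b (co x) = x" if "x \<in> carrier R" for x
    using someI_ex[of "\<lambda>c. x = comb n b c"] sp that unfolding co_def spans_def by metis
  have uniq: "c i = d i" if "comb n b c = comb n b d" "i < n" for c d i
  proof -
    have "comb n b (\<lambda>i. c i + (-1) * d i) = comb n b c \<oplus> sm (-1) (comb n b c)"
      by (subst comb_lin[OF bc]) (use that in simp_all)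
    also have "\<dots> = sm 1 (comb n b c) \<oplus> sm (-1) (comb n b c)" using comb_closed[of n b, OF bc] by (simp add: sm_1)
    also have "\<dots> = \<zero>" using comb_closed[of n b, OF bc] by (subst sm_plus[symmetric]) simp_all
    finally show ?thesis using ind[OF _ that(2)] by fastforce
  qed
  have co_lin: "co (x \<oplus> sm k y) i = co x i + k * co y i" if "x \<in> carrier R" "y \<in> carrier R" "i < n" for x y k i
  proof (rule uniq[OF _ that(3), of _ "\<lambda>i. co x i + k * co y i"])
    show "comb n b (co (x \<oplus> sm k y)) = comb n b (\<lambda>i. co x i + k * co y i)"
      using that by (simp add: comb_lin[OF bc] co)
  qed
  have co_add: "co (x \<oplus> y) i = co x i + co y i" if "x \<in> carrier R" "y \<in> carrier R" "i < n" for x y i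
    using co_lin[OF that, of 1] that by (simp add: sm_1)
  have co_0: "co \<zero> i = 0" if "i < n" for i
  proof -
    have "co \<zero> i + co \<zero> i = co \<zero> i + 0" using co_add[of \<zero> \<zero> i] that by simp
    then show ?thesis by (rule add_left_imp_eq)
  qed
  have co_sm: "co (sm k y) i = k * co y i" if "y \<in> carrier R" "i < n" for y k i
    using co_lin[of \<zero> y i k] that co_0 by simp
  define \<iota> where "\<iota> x = Fsm (\<lambda>i j. if i < n \<and> j < n then co (x \<otimes> b j) i else 0)" for x
  have ei: "ent (\<iota> x) i j = (if i < n \<and> j < n then co (x \<otimes> b j) i else 0)" for x i j
    unfolding \<iota>_def by (subst ent_Fsm[of n]) auto
  have dist: "x \<otimes> comb m b c \<in> carrier R \<and> (i < n \<longrightarrow> co (x \<otimes> comb m b c) i = (\<Sum>k<m. c k * co (x \<otimes> b k) i))"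
    if x: "x \<in> carrier R" and m: "m \<le> n" for x m c i
    using m
  proof (induction m)
    case 0 then show ?case using x co_0 by simp
  next
    case (Suc m)
    have bm: "b m \<in> carrier R" "comb m b c \<in> carrier R" using bc Suc.prems by (auto intro: comb_closed)
    have "x \<otimes> comb (Suc m) b c = sm (c m) (x \<otimes> b m) \<oplus> x \<otimes> comb m b c"
      using x bm by (simp add: R.r_distr sm_r)
    then show ?case using Suc x bm by (simp add: co_add co_sm)
  qed
  have "\<iota> (x \<otimes> y) = \<iota> x * \<iota> y" if xy: "x \<in> carrier R" "y \<in> carrier R" for x y
  proof (rule fsm_eqI)
    fix i j
    show "ent (\<iota> (x \<otimes> y)) i j = ent (\<iota> x * \<iota> y) i j"
    proof (cases "i < n \<and> j < n")
      case True
      have "x \<otimes> y \<otimes> b j = x \<otimes> comb n b (co (y \<otimes> b j))" using xy bc True by (simp add: R.m_assoc co)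
      then have "ent (\<iota> (x \<otimes> y)) i j = (\<Sum>k<n. co (y \<otimes> b j) k * co (x \<otimes> b k) i)" using True dist[OF xy(1), of n] by (simp add: ei)
      also have "\<dots> = (\<Sum>k<n. ent (\<iota> x) i k * ent (\<iota> y) k j)" using True by (intro sum.cong) (auto simp: ei)
      also have "\<dots> = ent (\<iota> x * \<iota> y) i j" by (rule ent_times[symmetric]) (simp add: ei)
      finally show ?thesis .
    next
      case False
      have "ent (\<iota> x * \<iota> y) i j = (\<Sum>k<n. ent (\<iota> x) i k * ent (\<iota> y) k j)" by (rule ent_times) (simp add: ei)
      also have "\<dots> = 0" by (rule sum.neutral) (use False in \<open>auto simp: ei\<close>)
      finally show ?thesis using False by (simp only: ei if_False)
    qed
  qed
  moreover have "\<iota> (x \<oplus> y) = \<iota> x + \<iota> y" if "x \<in> carrier R" "y \<in> carrier R" for x y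
    using that bc by (intro fsm_eqI) (simp add: ei R.l_distr co_add)
  moreover have "\<iota> (sm c x) = fsc c (\<iota> x)" if "x \<in> carrier R" for c x
    using that bc by (intro fsm_eqI) (simp add: ei sm_l[symmetric] co_sm)
  moreover have "inj_on \<iota> (carrier R)"
  proof (rule inj_onI)
    fix x y assume xy: "x \<in> carrier R" "y \<in> carrier R" "\<iota> x = \<iota> y"
    have xb: "x \<otimes> b j = y \<otimes> b j" if j: "j < n" for j
    proof -
      have "co (x \<otimes> b j) i = co (y \<otimes> b j) i" if "i < n" for i
        using arg_cong[OF xy(3), of "\<lambda>A. ent A i j"] that j by (simp add: ei)
      then have "comb n b (co (x \<otimes> b j)) = comb n b (co (y \<otimes> b j))" by (intro comb_cong) simp
      then show ?thesis using xy bc j by (simp add: co)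
    qed
    have "x \<otimes> comb m b c = y \<otimes> comb m b c" if "m \<le> n" for m c using that
    proof (induction m)
      case (Suc m)
      have "b m \<in> carrier R" "comb m b c \<in> carrier R" using bc Suc.prems by (auto intro: comb_closed)
      then show ?case using Suc xy xb[of m] by (simp add: R.r_distr sm_r[symmetric])
    qed (use xy in simp)
    from this[of n "co \<one>"] show "x = y" using xy by (simp add: co)
  qed
  ultimately show ?thesis by (intro exI[of _ \<iota>] exI[of _ n]) (auto simp: ei)
qed

end

section \<open>The Jacobson radical of an elementary algebra\<close>

lemma pw_closed: "u \<in> S \<Longrightarrow> J \<subseteq> S \<Longrightarrow> (\<And>a b. a \<in> S \<Longrightarrow> b \<in> S \<Longrightarrow> a * b \<in> S) \<Longrightarrow> pw J u n \<subseteq> S"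
  by (induction n) auto

lemma (in vector_space) dim_less:
  assumes V: "subspace V" "V \<subseteq> span B" "finite B" and W: "subspace W" "W \<subseteq> V" "W \<noteq> V"
  shows "dim W < dim V"
proof -
  obtain v where v: "v \<in> V" "v \<notin> W" using W by blast
  obtain B0 where B0: "B0 \<subseteq> W" "independent B0" "W \<subseteq> span B0" "card B0 = dim W" using basis_exists[of W] by metis
  have "span B0 \<subseteq> W" using B0(1) W(1) by (simp add: span_minimal)
  then have "v \<notin> span B0" using v by blast
  then have i: "independent (insert v B0)" using B0(2) by (rule independent_insertI)
  have "insert v B0 \<subseteq> V" using v B0(1) W(2) by blast
  then obtain B1 where B1: "insert v B0 \<subseteq> B1" "B1 \<subseteq> V" "independent B1" "V \<subseteq> span B1"
    using maximal_independent_subset_extend[OF _ i] by blast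
  have f: "finite B1" using independent_span_bound[OF V(3) B1(3)] B1(2) V(2) by blast
  have "card B1 = dim V" using B1 by (intro dim_unique[symmetric]) auto
  moreover have "card (insert v B0) \<le> card B1" using B1(1) f by (simp add: card_mono)
  moreover have "v \<notin> B0" "finite B0" using v B0(1) B1(1) f by (auto intro: finite_subset)
  ultimately show ?thesis using B0(4) by simp
qed

locale embalg = emb R \<iota> e1 e2 + fdalg R sm
  for R :: "'a ring" (structure) and \<iota> :: "'a \<Rightarrow> 'k::field fsm" and e1 e2 and sm :: "'k \<Rightarrow> 'a \<Rightarrow> 'a" +
  fixes n :: nat
  assumes i_sm: "a \<in> carrier R \<Longrightarrow> \<iota> (sm c a) = fsc c (\<iota> a)"
    and bound: "n \<le> i \<or> n \<le> j \<Longrightarrow> ent (\<iota> a) i j = 0"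
begin

definition units :: "'k fsm set" where "units = (\<lambda>(i, j). single i j 1) ` ({..<n} \<times> {..<n})"

lemma S_span: "S \<subseteq> fs.span units" "finite units"
  using span_units[of n] bound by (auto simp: S_def units_def)

lemma S_sub: "fs.subspace S"
proof (rule fs.subspaceI)
  show "0 \<in> S" by (rule C.S0)
  fix c a b assume "a \<in> S"
  then show "fsc c a \<in> S" by (auto simp: S_def i_sm[symmetric])
  assume "b \<in> S" with \<open>a \<in> S\<close> show "a + b \<in> S" by (rule C.Sadd)
qed

text \<open>Right submodules of the regular module, as subspaces, so that dimensions can be
  compared.\<close>

definition good :: "'k fsm set \<Rightarrow> bool" where
  "good V \<longleftrightarrow> fs.subspace V \<and> V \<subseteq> S \<and> (\<forall>v\<in>V. \<forall>s\<in>S. v * s \<in> V)"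

lemma good_dim: "good V \<Longrightarrow> good W \<Longrightarrow> W \<subseteq> V \<Longrightarrow> W \<noteq> V \<Longrightarrow> fs.dim W < fs.dim V"
  using fs.dim_less[of V units W] S_span by (auto simp: good_def)

text \<open>A proper submodule \<open>W\<close> of largest dimension is maximal, so \<open>V\<close>
  modulo \<open>W\<close> is simple. The radical kills simple modules, since the elements sending a
  vector outside \<open>W\<close> into \<open>W\<close> form a maximal right ideal.\<close>

lemma good_radical:
  assumes V: "good V" "V \<noteq> {0}"
  shows "\<exists>W. good W \<and> W \<subseteq> V \<and> W \<noteq> V \<and> (\<forall>v\<in>V. \<forall>j\<in>\<iota> ` jacobson_radical R. v * j \<in> W)"
proof -
  let ?P = "\<lambda>W. good W \<and> W \<subseteq> V \<and> W \<noteq> V"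
  have "good {0}" using C.S0 by (auto simp: good_def fs.subspace_0 fs.subspace_def)
  then have "?P {0}" using V fs.subspace_0[of V] by (auto simp: good_def)
  moreover have "\<forall>W. ?P W \<longrightarrow> fs.dim W < fs.dim V" using good_dim[OF V(1)] by blast
  ultimately have "\<exists>W. ?P W \<and> (\<forall>W'. ?P W' \<longrightarrow> fs.dim W' \<le> fs.dim W)"
    by (rule ex_has_greatest_nat)
  then obtain W where WW: "?P W \<and> (\<forall>W'. ?P W' \<longrightarrow> fs.dim W' \<le> fs.dim W)" ..
  then have W: "?P W" and max: "\<And>W'. ?P W' \<Longrightarrow> fs.dim W' \<le> fs.dim W" by blast+
  have gV: "fs.subspace V" "V \<subseteq> S" "\<And>v s. v \<in> V \<Longrightarrow> s \<in> S \<Longrightarrow> v * s \<in> V" using V(1) by (auto simp: good_def)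
  have gW: "fs.subspace W" "W \<subseteq> S" "\<And>v s. v \<in> W \<Longrightarrow> s \<in> S \<Longrightarrow> v * s \<in> W" using W by (auto simp: good_def)
  have "v * \<iota> x \<in> W" if v: "v \<in> V" and x: "x \<in> jacobson_radical R" for v x
  proof (cases "v \<in> W")
    case True
    then show ?thesis using gW(3) x i_S by (simp add: jacobson_radical_def)
  next
    case False
    have vS: "v \<in> S" using v gV by blast
    have v1: "v * \<iota> \<one> = v" using vS by (auto simp: S_def i_mul[symmetric])
    define I where "I = {a \<in> carrier R. v * \<iota> a \<in> W}"
    have I: "right_ideal R I" unfolding right_ideal_def
    proof (intro conjI ballI R.additive_subgroup_intro)
      show "I \<subseteq> carrier R" "\<zero> \<in> I" using fs.subspace_0[OF gW(1)] by (auto simp: I_def i_0)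
      fix a assume a: "a \<in> I"
      show "\<ominus> a \<in> I" using a fs.subspace_neg[OF gW(1)] by (auto simp: I_def i_neg)
      show "a \<oplus> b \<in> I" if "b \<in> I" for b using a that fs.subspace_add[OF gW(1)] by (auto simp: I_def i_add distrib_left)
      show "a \<otimes> b \<in> I" if "b \<in> carrier R" for b
        using a that gW(3)[of "v * \<iota> a" "\<iota> b"] i_S by (auto simp: I_def i_mul mult.assoc)
    qed
    have nI: "I \<noteq> carrier R"
    proof
      assume "I = carrier R"
      then have "\<one> \<in> I" by simp
      then show False using False v1 by (simp add: I_def)
    qed
    have "maximal_right_ideal R I" unfolding maximal_right_ideal_def
    proof (intro conjI allI impI I nI)
      fix I' assume I': "right_ideal R I' \<and> I \<subseteq> I' \<and> I' \<noteq> carrier R"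
      then interpret A: additive_subgroup I' R by (simp add: right_ideal_def)
      have sub: "I' \<subseteq> carrier R" using A.a_subset .
      have rI: "a \<otimes> b \<in> I'" if "a \<in> I'" "b \<in> carrier R" for a b using I' that by (simp add: right_ideal_def)
      \<comment> \<open>A right ideal \<open>I'\<close> above \<open>I\<close> gives a submodule
        \<open>V'\<close> between \<open>W\<close> and \<open>V\<close>. It is not all of
        \<open>V\<close>, because \<open>v = w + v * \<iota> a\<close> would put
        \<open>\<one> \<ominus> a\<close> into \<open>I\<close> and hence the unit into
        \<open>I'\<close>.\<close>
      define V' where "V' = {w + v * \<iota> a | w a. w \<in> W \<and> a \<in> I'}"
      have "good V'" unfolding good_def
      proof (intro conjI ballI fs.subspaceI)
        show "0 \<in> V'" unfolding V'_def using fs.subspace_0[OF gW(1)] A.zero_closed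
          by (intro CollectI exI[of _ 0] exI[of _ "\<zero>"]) (simp add: i_0)
        show "V' \<subseteq> S" unfolding V'_def using gW(2) vS sub i_S by (auto intro!: C.Sadd C.Smul)
        fix y assume "y \<in> V'"
        then obtain w a where y: "y = w + v * \<iota> a" "w \<in> W" "a \<in> I'" by (auto simp: V'_def)
        show "y + y' \<in> V'" if yV: "y' \<in> V'" for y'
        proof -
          obtain w' a' where y': "y' = w' + v * \<iota> a'" "w' \<in> W" "a' \<in> I'" using yV by (auto simp: V'_def)
          have "y + y' = (w + w') + v * \<iota> (a \<oplus> a')" using y y' sub by (auto simp: i_add distrib_left add_ac subset_iff)
          then show ?thesis unfolding V'_def using fs.subspace_add[OF gW(1) y(2) y'(2)] A.a_closed[OF y(3) y'(3)] by blast
        qed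
        show "fsc c y \<in> V'" for c
        proof -
          have ac: "a \<in> carrier R" using y(3) sub by blast
          have "sm c a = a \<otimes> sm c \<one>" using sm_r[OF ac R.one_closed, of c] ac by simp
          then have "sm c a \<in> I'" using rI[OF y(3)] by simp
          moreover have "fsc c y = fsc c w + v * \<iota> (sm c a)"
            unfolding y(1) using ac by (simp add: fs.scale_right_distrib fsc_mult(2) i_sm)
          ultimately show ?thesis unfolding V'_def using fs.subspace_scale[OF gW(1) y(2)] by blast
        qed
        show "y * s \<in> V'" if s: "s \<in> S" for s
        proof -
          obtain b where b: "s = \<iota> b" "b \<in> carrier R" using s by (auto simp: S_def)
          have "y * s = w * s + v * \<iota> (a \<otimes> b)" using y sub b by (auto simp: i_mul distrib_right mult.assoc subset_iff)
          then show ?thesis unfolding V'_def using gW(3)[OF y(2) s] rI[OF y(3) b(2)] by blast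
        qed
      qed
      moreover have WV': "W \<subseteq> V'" unfolding V'_def using A.zero_closed by (auto intro!: exI[of _ "\<zero>"] simp: i_0)
      moreover have "V' \<subseteq> V" unfolding V'_def using W v gV sub i_S by (auto intro!: fs.subspace_add[OF gV(1)])
      moreover have "V' \<noteq> V"
      proof
        assume "V' = V"
        then obtain w a where wa: "v = w + v * \<iota> a" "w \<in> W" "a \<in> I'" using v by (auto simp: V'_def)
        have ac: "a \<in> carrier R" using wa(3) sub by blast
        have "v * \<iota> (\<one> \<ominus> a) = w" using wa(1) ac v1 by (simp add: i_minus right_diff_distrib) (metis add_diff_cancel_right')
        then have "\<one> \<ominus> a \<in> I'" using I' wa(2) ac by (auto simp: I_def)
        then have "(\<one> \<ominus> a) \<oplus> a \<in> I'" using wa(3) by (rule A.a_closed)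
        then have one: "\<one> \<in> I'" using ac by (simp add: R.minus_eq R.a_assoc R.l_neg)
        have "carrier R \<subseteq> I'" using rI[OF one] by auto
        then show False using I' sub by blast
      qed
      ultimately have "V' = W" using max[of V'] good_dim[of V' W] W by fastforce
      show "I' = I"
      proof
        show "I' \<subseteq> I"
        proof
          fix a assume a: "a \<in> I'"
          have "0 + v * \<iota> a \<in> V'" unfolding V'_def using a fs.subspace_0[OF gW(1)] by blast
          then show "a \<in> I" using \<open>V' = W\<close> a sub by (auto simp: I_def)
        qed
      qed (use I' in blast)
    qed
    then have "x \<in> I" using x by (simp add: jacobson_radical_def)
    then show ?thesis by (simp add: I_def)
  qed
  then show ?thesis using W by blast
qed

text \<open>Multiplication by a radical element leads into a submodule of smaller dimension, so by
  induction long products kill the regular module; applied to the unit, they vanish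
  themselves.\<close>

lemma jacobson_nilpotent:
  assumes u: "u = \<iota> \<one>"
  shows "\<exists>m. pw (\<iota> ` jacobson_radical R) u m \<subseteq> {0}"
proof -
  let ?J = "\<iota> ` jacobson_radical R"
  have "good V \<Longrightarrow> \<exists>m. \<forall>v\<in>V. \<forall>y\<in>pw ?J u m. v * y = 0" for V
  proof (induction "fs.dim V" arbitrary: V rule: less_induct)
    case less
    show ?case
    proof (cases "V = {0}")
      case True then show ?thesis by auto
    next
      case False
      then obtain W where W: "good W" "W \<subseteq> V" "W \<noteq> V" "\<forall>v\<in>V. \<forall>j\<in>?J. v * j \<in> W"
        using good_radical[OF less.prems] by blast
      from less.hyps[OF good_dim[OF less.prems W(1-3)] W(1)] obtain m where m: "\<forall>v\<in>W. \<forall>y\<in>pw ?J u m. v * y = 0" by blast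
      have "v * y = 0" if v: "v \<in> V" and y: "y \<in> pw ?J u (Suc m)" for v y
      proof -
        obtain j y' where j: "y = j * y'" "j \<in> ?J" "y' \<in> pw ?J u m" using y unfolding pw.simps by blast
        have "v * j * y' = 0" using m W(4) v j(2,3) by blast
        then show ?thesis by (simp add: j(1) mult.assoc)
      qed
      then show ?thesis by blast
    qed
  qed
  moreover have "good S" using S_sub C.Smul by (auto simp: good_def)
  ultimately obtain m where m: "\<forall>v\<in>S. \<forall>y\<in>pw ?J u m. v * y = 0" by blast
  have uS: "u \<in> S" using u i_S by simp
  have "?J \<subseteq> S" using i_S by (auto simp: jacobson_radical_def)
  then have pS: "pw ?J u m \<subseteq> S" using uS C.Smul by (intro pw_closed) auto
  have "y = 0" if y: "y \<in> pw ?J u m" for y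
  proof -
    have "u * y = y" using y pS u by (auto simp: S_def i_mul[symmetric])
    then show ?thesis using m uS y by metis
  qed
  then show ?thesis by blast
qed

text \<open>The images of \<open>e1\<close> and \<open>e2\<close> in the product of two fields are
  complementary idempotents. Neither is zero, since a nilpotent radical contains no nonzero
  idempotent, so they are the two coordinate idempotents, and the characters are numbered to
  match.\<close>

lemma tri2_exists:
  assumes el: "elementary_rank2 R sm" and prim: "complete_prim_orth2 R e1 e2" and tri: "\<forall>x\<in>carrier R. e2 \<otimes> x \<otimes> e1 = \<zero>"
  shows "\<exists>\<phi>. tri2 S e fsc \<phi>"
proof -
  from el[unfolded elementary_rank2_def] obtain p :: "'a \<Rightarrow> 'k \<times> 'k" where p0: "p ` carrier R = UNIV"
    "\<forall>x\<in>carrier R. \<forall>y\<in>carrier R. p (x \<oplus> y) = (fst (p x) + fst (p y), snd (p x) + snd (p y))"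
    "\<forall>x\<in>carrier R. \<forall>y\<in>carrier R. p (x \<otimes> y) = (fst (p x) * fst (p y), snd (p x) * snd (p y))"
    "p \<one> = (1, 1)" "\<forall>c. \<forall>x\<in>carrier R. p (sm c x) = (c * fst (p x), c * snd (p x))"
    "{x \<in> carrier R. p x = (0, 0)} = jacobson_radical R"
    by (elim exE conjE)
  note p = p0(2)[rule_format] p0(3)[rule_format] p0(4) p0(5)[rule_format] p0(6)
  have P: "e1 \<oplus> e2 = \<one>" "e1 \<otimes> e2 = \<zero>" "e2 \<otimes> e1 = \<zero>" "e1 \<noteq> \<zero>" "e2 \<noteq> \<zero>"
    using prim by (auto simp: complete_prim_orth2_def primitive_idem_def)
  obtain m where m: "pw (\<iota> ` jacobson_radical R) (\<iota> \<one>) m \<subseteq> {0}" using jacobson_nilpotent by blast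
  have nz: "p x \<noteq> (0, 0)" if x: "x \<in> carrier R" "x \<otimes> x = x" "x \<noteq> \<zero>" for x
  proof
    assume "p x = (0, 0)"
    then have xJ: "x \<in> jacobson_radical R" using p(5) x by blast
    have xx: "\<iota> x * \<iota> x = \<iota> x" using x by (simp add: i_mul[symmetric])
    have "\<iota> x \<in> pw (\<iota> ` jacobson_radical R) (\<iota> \<one>) (Suc k)" for k
    proof (induction k)
      case 0
      have "\<iota> x = \<iota> x * \<iota> \<one>" using x by (simp add: i_mul[symmetric])
      then show ?case using xJ by auto
    next
      case (Suc k)
      then have "\<iota> x * \<iota> x \<in> pw (\<iota> ` jacobson_radical R) (\<iota> \<one>) (Suc (Suc k))"
        using xJ unfolding pw.simps(2)[of _ _ "Suc k"] by blast
      then show ?case by (simp only: xx)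
    qed
    moreover have "pw (\<iota> ` jacobson_radical R) (\<iota> \<one>) (Suc m) \<subseteq> {0}" using m by auto
    ultimately have "\<iota> x \<in> {0}" by (meson subsetD)
    then have "\<iota> x = \<iota> \<zero>" by (simp add: i_0)
    then show False using x by (simp add: i_eq)
  qed
  obtain a b where ab: "p e1 = (a, b)" by (cases "p e1")
  obtain a' b' where ab': "p e2 = (a', b')" by (cases "p e2")
  have i1: "a * a = a" "b * b = b" "a' * a' = a'" "b' * b' = b'" using p(2)[of e1 e1] p(2)[of e2 e2] e12 ab ab' by auto
  have i2: "a + a' = 1" "b + b' = 1" using p(1)[of e1 e2] p(3) P(1) e12 ab ab' by auto
  have i3: "(a, b) \<noteq> (0, 0)" "(a', b') \<noteq> (0, 0)" using nz[of e1] nz[of e2] e12 P ab ab' by auto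
  have "(a = 1 \<and> b = 0 \<and> a' = 0 \<and> b' = 1) \<or> (a = 0 \<and> b = 1 \<and> a' = 1 \<and> b' = 0)"
  proof -
    have "a = 0 \<or> a = 1" "b = 0 \<or> b = 1" using i1(1,2) by (simp_all add: mult_cancel_left1)
    moreover have "a' = 1 - a" "b' = 1 - b" using i2 by (simp_all add: eq_diff_eq add.commute)
    ultimately show ?thesis using i3 by auto
  qed
  then have "\<exists>f g :: 'k \<times> 'k \<Rightarrow> 'k. ((f = fst \<and> g = snd) \<or> (f = snd \<and> g = fst)) \<and>
    f (p e1) = 1 \<and> g (p e1) = 0 \<and> f (p e2) = 0 \<and> g (p e2) = 1"
  proof
    assume "a = 1 \<and> b = 0 \<and> a' = 0 \<and> b' = 1"
    then show ?thesis using ab ab' by (intro exI[of _ fst] exI[of _ snd]) simp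
  next
    assume "a = 0 \<and> b = 1 \<and> a' = 1 \<and> b' = 0"
    then show ?thesis using ab ab' by (intro exI[of _ snd] exI[of _ fst]) simp
  qed
  then obtain f g :: "'k \<times> 'k \<Rightarrow> 'k" where fg: "(f = fst \<and> g = snd) \<or> (f = snd \<and> g = fst)"
    "f (p e1) = 1" "g (p e1) = 0" "f (p e2) = 0" "g (p e2) = 1" by (elim exE conjE)
  define \<kappa> where "\<kappa> = the_inv_into (carrier R) \<iota>"
  have k: "\<kappa> (\<iota> x) = x" if "x \<in> carrier R" for x using the_inv_into_f_f[OF inj that] by (simp add: \<kappa>_def)
  define \<phi> where "\<phi> i s = (if i = (1::nat) then f (p (\<kappa> s)) else g (p (\<kappa> s)))" for i s
  have ph: "\<phi> i (\<iota> x) = (if i = 1 then f (p x) else g (p x))" if "x \<in> carrier R" for i x using that by (simp add: \<phi>_def k)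
  have rad: "radl S \<phi> = \<iota> ` jacobson_radical R"
  proof -
    have "\<phi> 1 (\<iota> x) = 0 \<and> \<phi> 2 (\<iota> x) = 0 \<longleftrightarrow> x \<in> jacobson_radical R" if "x \<in> carrier R" for x
      using that fg(1) ph[OF that] p(5) by (auto simp: prod_eq_iff)
    moreover have "jacobson_radical R \<subseteq> carrier R" by (auto simp: jacobson_radical_def)
    ultimately show ?thesis unfolding radl_def S_def by blast
  qed
  have e: "e 1 = \<iota> e1" "e 2 = \<iota> e2" "e (Suc 0) = \<iota> e1" by (simp_all add: e_def idm_def)
  have sum: "e 1 + e 2 = \<iota> \<one>" using P(1) e12 by (simp add: e i_add[symmetric])
  have "tri2 S e fsc \<phi>"
  proof
    show "fsc c (x * y) = fsc c x * y" "fsc c (x * y) = x * fsc c y" for c x y by (rule fsc_mult)+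
    show "fsc c x \<in> S" if "x \<in> S" for c x using fs.subspace_scale[OF S_sub that] .
    show "(e 1 + e 2) * x = x" "x * (e 1 + e 2) = x" if "x \<in> S" for x
      unfolding sum using that by (auto simp: S_def i_mul[symmetric])
    show "e 1 * e 2 = 0" "e 2 * e 1 = 0" using P e12 by (simp_all add: e i_mul[symmetric] i_0)
    show "\<exists>m. pw (radl S \<phi>) (e 1 + e 2) m \<subseteq> {0}" unfolding rad sum using m by blast
    show "e 2 * s * e 1 = 0" if sS: "s \<in> S" for s
    proof -
      obtain x where x: "s = \<iota> x" "x \<in> carrier R" using sS by (auto simp: S_def)
      have "\<iota> (e2 \<otimes> x \<otimes> e1) = e 2 * s * e 1" using x e12 by (simp add: e i_mul)
      then show ?thesis using tri x(2) i_0 by simp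
    qed
    fix i :: nat assume i: "i \<in> {1, 2}"
    show "\<phi> i (e j) = (if i = j then 1 else 0)" if "j \<in> {1, 2}" for j
      using i that fg e12 ph[of e1 i] ph[of e2 i] by (auto simp: e)
    fix x assume "x \<in> S"
    then obtain x' where x: "x = \<iota> x'" "x' \<in> carrier R" by (auto simp: S_def)
    show "\<phi> i (fsc c x) = c * \<phi> i x" for c
      using fg(1) x ph[OF x(2), of i] ph[OF sm_closed[OF x(2)], of i c] p(4)[OF x(2), of c] by (auto simp: i_sm)
    fix y assume "y \<in> S"
    then obtain y' where y: "y = \<iota> y'" "y' \<in> carrier R" by (auto simp: S_def)
    show "\<phi> i (x + y) = \<phi> i x + \<phi> i y" "\<phi> i (x * y) = \<phi> i x * \<phi> i y"
      using fg(1) x y p(1)[OF x(2) y(2)] p(2)[OF x(2) y(2)] ph[OF x(2), of i] ph[OF y(2), of i]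
        ph[OF R.a_closed[OF x(2) y(2)], of i] ph[OF R.m_closed[OF x(2) y(2)], of i]
      by (auto simp: i_add i_mul)
  qed
  then show ?thesis by blast
qed

end

text \<open>The bound \<open>n\<close> on the size of the matrices is recorded because the finite
  dimension of the glued algebra is read off from it.\<close>

lemma matrix_model:
  fixes L :: "'a ring" and sm :: "'k::field \<Rightarrow> 'a \<Rightarrow> 'a"
  assumes alg: "is_fd_kalg L sm" and el: "elementary_rank2 L sm" and prim: "complete_prim_orth2 L e1 e2"
    and tri: "\<forall>x\<in>carrier L. e2 \<otimes>\<^bsub>L\<^esub> x \<otimes>\<^bsub>L\<^esub> e1 = \<zero>\<^bsub>L\<^esub>"
  shows "\<exists>S e \<phi> n. tri2 S e (fsc :: 'k \<Rightarrow> _) \<phi> \<and> gfan L e1 e2 = fan S e \<and> (\<forall>i. i \<noteq> 1 \<longrightarrow> e i = e 2)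
     \<and> (\<forall>s\<in>S. \<forall>i j. n \<le> i \<or> n \<le> j \<longrightarrow> ent s i j = 0)"
proof -
  have "ring L" using alg by (simp add: is_fd_kalg_def)
  then interpret A: fdalg L sm using alg by (intro fdalg.intro fdalg_axioms.intro)
  obtain \<iota> :: "'a \<Rightarrow> 'k fsm" and n where i: "inj_on \<iota> (carrier L)"
     "\<forall>x\<in>carrier L. \<forall>y\<in>carrier L. \<iota> (x \<oplus>\<^bsub>L\<^esub> y) = \<iota> x + \<iota> y \<and> \<iota> (x \<otimes>\<^bsub>L\<^esub> y) = \<iota> x * \<iota> y"
     "\<forall>c. \<forall>x\<in>carrier L. \<iota> (sm c x) = fsc c (\<iota> x)" "\<forall>x. \<forall>i j. n \<le> i \<or> n \<le> j \<longrightarrow> ent (\<iota> x) i j = 0"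
    using A.representation by blast
  have e: "e1 \<in> carrier L" "e2 \<in> carrier L" "e1 \<otimes>\<^bsub>L\<^esub> e1 = e1" "e2 \<otimes>\<^bsub>L\<^esub> e2 = e2"
    using prim by (auto simp: complete_prim_orth2_def primitive_idem_def idempotent_el_def)
  interpret E: embalg L \<iota> e1 e2 sm n
    by unfold_locales (use i e in auto)
  obtain \<phi> where "tri2 E.S E.e fsc \<phi>" using E.tri2_exists[OF el prim tri] by blast
  moreover have "\<forall>i. i \<noteq> 1 \<longrightarrow> E.e i = E.e 2" by (simp add: E.e_def idm_def)
  moreover have "\<forall>s\<in>E.S. \<forall>i j. n \<le> i \<or> n \<le> j \<longrightarrow> ent s i j = 0" using i(4) by (auto simp: E.S_def)
  ultimately show ?thesis using E.gfan_eq_fan by blast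
qed

section \<open>Carrier models of elementary algebras\<close>

context elem2
begin

text \<open>The truncated geometric series: adding the error \<open>y\<close> to \<open>w\<close>
  changes the error to \<open>j * y\<close>.\<close>

lemma one_minus_J_inverse:
  assumes j: "j \<in> J"
  shows "\<exists>w\<in>S. (e 1 + e 2 - j) * w = e 1 + e 2"
proof -
  obtain m where m: "pw J (e 1 + e 2) m \<subseteq> {0}" using nil by (elim exE)
  have uS: "e 1 + e 2 \<in> S" using eS Sadd by simp
  have pS: "y \<in> S" if "y \<in> pw J (e 1 + e 2) k" for k y
    using pw_closed[of "e 1 + e 2" S J k] uS Smul J_S that by blast
  have "\<exists>w\<in>S. \<exists>y\<in>pw J (e 1 + e 2) k. (e 1 + e 2 - j) * w = e 1 + e 2 - y" for k
  proof (induction k)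
    case 0 show ?case by (rule bexI[of _ 0]) (auto simp: S0)
  next
    case (Suc k)
    then obtain w y where wy: "w \<in> S" "y \<in> pw J (e 1 + e 2) k" "(e 1 + e 2 - j) * w = e 1 + e 2 - y" by blast
    have "(e 1 + e 2 - j) * y = y - j * y" using unit_l[OF pS[OF wy(2)]] by (simp add: left_diff_distrib)
    then have "(e 1 + e 2 - j) * (w + y) = e 1 + e 2 - j * y" using wy(3) by (simp add: distrib_left)
    moreover have "j * y \<in> pw J (e 1 + e 2) (Suc k)" using j wy(2) by auto
    ultimately show ?case using Sadd[OF wy(1) pS[OF wy(2)]] by blast
  qed
  then obtain w y where wy: "w \<in> S" "y \<in> pw J (e 1 + e 2) m" "(e 1 + e 2 - j) * w = e 1 + e 2 - y" by blast
  then have "y = 0" using m by blast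
  then show ?thesis using wy(1,3) by auto
qed

text \<open>The structure is transported along \<open>enc\<close> to a ring record. Its Jacobson
  radical is the common kernel of the characters: subtracting such an element from the unit gives an
  invertible element, and each character has a maximal right ideal as kernel.\<close>

lemma carrier_model:
  fixes enc :: "'r \<Rightarrow> 'c"
  assumes enc: "inj enc" and Bf: "finite Bf" "S \<subseteq> span Bf" and conv: "\<And>i. i \<noteq> 1 \<Longrightarrow> e i = e 2"
  shows "\<exists>(G :: 'c ring) smG g1 g2. is_fd_kalg G (smG :: 'k \<Rightarrow> 'c \<Rightarrow> 'c) \<and> elementary_rank2 G smG
    \<and> complete_prim_orth2 G g1 g2 \<and> gfan G g1 g2 = fan S e"
proof -
  define dec where "dec = inv_into UNIV enc"
  have de [simp]: "dec (enc s) = s" for s using enc by (simp add: dec_def)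
  define G :: "'c ring" where "G = \<lparr>carrier = enc ` S, mult = (\<lambda>a b. enc (dec a * dec b)), one = enc (e 1 + e 2),
     zero = enc 0, add = (\<lambda>a b. enc (dec a + dec b))\<rparr>"
  have G [simp]: "carrier G = enc ` S" "a \<otimes>\<^bsub>G\<^esub> b = enc (dec a * dec b)" "\<one>\<^bsub>G\<^esub> = enc (e 1 + e 2)"
    "\<zero>\<^bsub>G\<^esub> = enc 0" "a \<oplus>\<^bsub>G\<^esub> b = enc (dec a + dec b)" for a b by (simp_all add: G_def)
  have uS: "e 1 + e 2 \<in> S" using eS Sadd by simp
  have "ring G"
  proof (rule ringI)
    show "abelian_group G"
    proof (rule abelian_groupI)
      fix a assume "a \<in> carrier G"
      then obtain s where s: "a = enc s" "s \<in> S" by auto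
      show "\<exists>b\<in>carrier G. b \<oplus>\<^bsub>G\<^esub> a = \<zero>\<^bsub>G\<^esub>" using s Sneg[OF s(2)] by (intro bexI[of _ "enc (- s)"]) simp_all
    qed (auto simp: S0 Sadd algebra_simps)
    show "monoid G" by (rule monoidI) (use uS unit_l unit_r in \<open>auto simp: Smul mult.assoc\<close>)
  qed (auto simp: distrib_left distrib_right)
  then interpret RG: ring G .
  interpret E: emb G dec "enc (e 1)" "enc (e 2)"
    by unfold_locales (auto simp: inj_on_def eS ee)
  have ES: "E.S = S" by (simp add: E.S_def image_image)
  have Ee: "E.e = e"
  proof
    fix i show "E.e i = e i" unfolding E.e_def idm_def using conv[of i] by simp
  qed
  have fan: "gfan G (enc (e 1)) (enc (e 2)) = fan S e" using E.gfan_eq_fan unfolding ES Ee .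
  define smG where "smG c a = enc (sc c (dec a))" for c a
  have spanning: "\<exists>B. finite B \<and> B \<subseteq> carrier G \<and> (\<forall>x\<in>carrier G. \<exists>c. x = finsum G (\<lambda>b. smG (c b) b) B)"
  proof -
    obtain B0 where B0: "B0 \<subseteq> S" "independent B0" "S \<subseteq> span B0" using maximal_independent_subset[of S] by metis
    have f: "finite B0" using independent_span_bound[OF Bf(1) B0(2)] B0(1) Bf(2) by blast
    have "\<exists>c. x = finsum G (\<lambda>b. smG (c b) b) (enc ` B0)" if x: "x \<in> carrier G" for x
    proof -
      obtain s where s: "x = enc s" "s \<in> S" using x by auto
      have "s \<in> range (\<lambda>u. \<Sum>v\<in>B0. sc (u v) v)" using B0(3) s(2) span_finite[OF f] by blast
      then obtain c where c: "s = (\<Sum>v\<in>B0. sc (c v) v)" by blast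
      have cl: "smG (c (dec b)) b \<in> carrier G" if "b \<in> enc ` B0" for b
        using that B0(1) Ssc by (auto simp: smG_def)
      have "dec (finsum G (\<lambda>b. smG (c (dec b)) b) (enc ` B0)) = (\<Sum>b\<in>enc ` B0. dec (smG (c (dec b)) b))"
        by (rule E.i_finsum) (use f cl in auto)
      also have "\<dots> = s" unfolding c by (subst sum.reindex) (use enc in \<open>auto simp: smG_def intro: inj_on_subset\<close>)
      finally have "dec (finsum G (\<lambda>b. smG (c (dec b)) b) (enc ` B0)) = dec x" by (simp add: s(1))
      moreover have "finsum G (\<lambda>b. smG (c (dec b)) b) (enc ` B0) \<in> carrier G"
        by (rule RG.finsum_closed) (use cl in blast)
      ultimately have "finsum G (\<lambda>b. smG (c (dec b)) b) (enc ` B0) = x" using E.i_eq[OF _ x] by blast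
      then show ?thesis by (intro exI[of _ "\<lambda>b. c (dec b)"]) (rule sym)
    qed
    then show ?thesis using f B0(1) by (intro exI[of _ "enc ` B0"]) auto
  qed
  have "is_fd_kalg G smG" unfolding is_fd_kalg_def
  proof (intro conjI allI impI)
    show "ring G" by (rule \<open>ring G\<close>)
    show "\<exists>B. finite B \<and> B \<subseteq> carrier G \<and> (\<forall>x\<in>carrier G. \<exists>c. x = finsum G (\<lambda>b. smG (c b) b) B)" by (rule spanning)
    fix c x y
    show "smG c (x \<otimes>\<^bsub>G\<^esub> y) = smG c x \<otimes>\<^bsub>G\<^esub> y" by (simp add: smG_def sc_l)
    show "smG c (x \<otimes>\<^bsub>G\<^esub> y) = x \<otimes>\<^bsub>G\<^esub> smG c y" by (simp add: smG_def sc_r)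
  qed (auto simp: smG_def Ssc scale_right_distrib scale_left_distrib)
  moreover have "elementary_rank2 G smG" unfolding elementary_rank2_def
  proof (intro exI[of _ "\<lambda>a. (\<phi> 1 (dec a), \<phi> 2 (dec a))"] conjI)
    show "(\<lambda>a. (\<phi> 1 (dec a), \<phi> 2 (dec a))) ` carrier G = UNIV"
    proof (intro equalityI subsetI)
      fix ab :: "'k \<times> 'k" 
      define s where "s = sc (fst ab) (e 1) + sc (snd ab) (e 2)"
      have sS: "s \<in> S" by (simp add: s_def Sadd Ssc eS)
      have "\<phi> i s = fst ab * \<phi> i (e 1) + snd ab * \<phi> i (e 2)" if "i \<in> {1, 2}" for i
        using that by (simp only: s_def phi_add[OF that Ssc[OF eS] Ssc[OF eS]] phi_sc[OF that eS])
      from this[of 1] this[of 2] have "\<phi> 1 s = fst ab" "\<phi> 2 s = snd ab"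
        using phi_e[of 1 1] phi_e[of 1 2] phi_e[of 2 1] phi_e[of 2 2] by auto
      then have "(\<phi> 1 (dec (enc s)), \<phi> 2 (dec (enc s))) = ab" by (simp add: prod_eq_iff)
      then show "ab \<in> (\<lambda>a. (\<phi> 1 (dec a), \<phi> 2 (dec a))) ` carrier G" using sS by force
    qed simp
    show "{x \<in> carrier G. (\<phi> 1 (dec x), \<phi> 2 (dec x)) = (0, 0)} = jacobson_radical G"
    proof (intro equalityI subsetI)
      fix x assume "x \<in> {x \<in> carrier G. (\<phi> 1 (dec x), \<phi> 2 (dec x)) = (0, 0)}"
      then obtain s where s: "x = enc s" "s \<in> J" by (auto simp: radl_def)
      have xG: "x \<in> carrier G" using s J_S by simp
      have "x \<in> I" if I: "maximal_right_ideal G I" for I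
      proof (rule ccontr)
        assume nx: "x \<notin> I"
        have rI: "right_ideal G I" and nI: "I \<noteq> carrier G" using I by (simp_all add: maximal_right_ideal_def)
        then interpret A: additive_subgroup I G by (simp add: right_ideal_def)
        have ri: "\<And>a b. a \<in> I \<Longrightarrow> b \<in> carrier G \<Longrightarrow> a \<otimes>\<^bsub>G\<^esub> b \<in> I" using rI unfolding right_ideal_def by blast
        have sub: "I \<subseteq> carrier G" using A.a_subset .
        \<comment> \<open>If \<open>x\<close> is outside the maximal right ideal \<open>I\<close>,
          then \<open>I\<close> and \<open>x\<close> generate everything, so \<open>I\<close>
          contains the unit minus a radical element, which is invertible.\<close>
        define I' where "I' = {i \<oplus>\<^bsub>G\<^esub> x \<otimes>\<^bsub>G\<^esub> g | i g. i \<in> I \<and> g \<in> carrier G}"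
        have I'I: "i \<oplus>\<^bsub>G\<^esub> x \<otimes>\<^bsub>G\<^esub> g \<in> I'" if "i \<in> I" "g \<in> carrier G" for i g unfolding I'_def using that by blast
        have "right_ideal G I'" unfolding right_ideal_def
        proof (intro conjI ballI RG.additive_subgroup_intro)
          show "I' \<subseteq> carrier G"
          proof
            fix a assume "a \<in> I'"
            then obtain i g where a: "a = i \<oplus>\<^bsub>G\<^esub> x \<otimes>\<^bsub>G\<^esub> g" "i \<in> I" "g \<in> carrier G" unfolding I'_def by blast
            show "a \<in> carrier G" unfolding a(1) using RG.a_closed[OF subsetD[OF sub a(2)] RG.m_closed[OF xG a(3)]] .
          qed
          show "\<zero>\<^bsub>G\<^esub> \<in> I'" using I'I[OF A.zero_closed RG.zero_closed] xG RG.r_null[OF xG] RG.r_zero[OF RG.zero_closed] by (simp only:)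
          fix a assume "a \<in> I'"
          then obtain i g where a: "a = i \<oplus>\<^bsub>G\<^esub> x \<otimes>\<^bsub>G\<^esub> g" "i \<in> I" "g \<in> carrier G" unfolding I'_def by blast
          have iG: "i \<in> carrier G" using a sub by blast
          show "\<ominus>\<^bsub>G\<^esub> a \<in> I'"
          proof -
            have "\<ominus>\<^bsub>G\<^esub> a = \<ominus>\<^bsub>G\<^esub> i \<oplus>\<^bsub>G\<^esub> x \<otimes>\<^bsub>G\<^esub> (\<ominus>\<^bsub>G\<^esub> g)"
              unfolding a(1) using RG.minus_add[OF iG RG.m_closed[OF xG a(3)]] RG.r_minus[OF xG a(3)] by (simp only:)
            then show ?thesis using I'I[OF A.a_inv_closed[OF a(2)] RG.a_inv_closed[OF a(3)]] by (simp only:)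
          qed
          show "a \<oplus>\<^bsub>G\<^esub> b \<in> I'" if bI: "b \<in> I'" for b
          proof -
            obtain i' g' where b: "b = i' \<oplus>\<^bsub>G\<^esub> x \<otimes>\<^bsub>G\<^esub> g'" "i' \<in> I" "g' \<in> carrier G" using bI unfolding I'_def by blast
            have "a \<oplus>\<^bsub>G\<^esub> b = (i \<oplus>\<^bsub>G\<^esub> i') \<oplus>\<^bsub>G\<^esub> x \<otimes>\<^bsub>G\<^esub> (g \<oplus>\<^bsub>G\<^esub> g')"
              unfolding a(1) b(1) by (simp add: distrib_left add_ac)
            then show ?thesis using I'I[OF A.a_closed[OF a(2) b(2)] RG.a_closed[OF a(3) b(3)]] by (simp only:)
          qed
          show "a \<otimes>\<^bsub>G\<^esub> b \<in> I'" if b: "b \<in> carrier G" for b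
          proof -
            have "a \<otimes>\<^bsub>G\<^esub> b = i \<otimes>\<^bsub>G\<^esub> b \<oplus>\<^bsub>G\<^esub> x \<otimes>\<^bsub>G\<^esub> (g \<otimes>\<^bsub>G\<^esub> b)"
              unfolding a(1) by (simp add: distrib_right mult.assoc)
            then show ?thesis using I'I[OF ri[OF a(2) b] RG.m_closed[OF a(3) b]] by (simp only:)
          qed
        qed
        moreover have "I \<subseteq> I'"
        proof
          fix i assume i: "i \<in> I"
          then have "i \<in> carrier G" using sub by blast
          then show "i \<in> I'" using I'I[OF i RG.zero_closed] RG.r_null[OF xG] RG.r_zero by (simp only:)
        qed
        moreover have "x \<in> I'"
          using I'I[OF A.zero_closed RG.one_closed] RG.r_one[OF xG] RG.l_zero[OF xG] by (simp only:)
        ultimately have "I' = carrier G" using I nx unfolding maximal_right_ideal_def by blast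
        then have "\<one>\<^bsub>G\<^esub> \<in> I'" by (simp only: RG.one_closed)
        then obtain i g where ig: "\<one>\<^bsub>G\<^esub> = i \<oplus>\<^bsub>G\<^esub> x \<otimes>\<^bsub>G\<^esub> g" "i \<in> I" "g \<in> carrier G" unfolding I'_def by blast
        obtain t where t: "g = enc t" "t \<in> S" using ig(3) by auto
        have jJ: "s * t \<in> J" using J_ideal(2)[OF s(2) t(2)] .
        have "dec \<one>\<^bsub>G\<^esub> = dec (i \<oplus>\<^bsub>G\<^esub> x \<otimes>\<^bsub>G\<^esub> g)" using ig(1) by (simp only:)
        then have di: "dec i = e 1 + e 2 - s * t" by (simp add: s t)
        obtain w where w: "w \<in> S" "(e 1 + e 2 - s * t) * w = e 1 + e 2" using one_minus_J_inverse[OF jJ] by blast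
        have "i \<otimes>\<^bsub>G\<^esub> enc w \<in> I" by (rule ri[OF ig(2)]) (simp add: w)
        then have one: "\<one>\<^bsub>G\<^esub> \<in> I" using w(2) by (simp add: di)
        have "carrier G \<subseteq> I"
        proof
          fix a assume a: "a \<in> carrier G"
          show "a \<in> I" using ri[OF one a] RG.l_one[OF a] by (simp only:)
        qed
        then show False using nI sub by blast
      qed
      then show "x \<in> jacobson_radical G" using xG by (simp add: jacobson_radical_def)
    next
      fix x assume x: "x \<in> jacobson_radical G"
      have xG: "x \<in> carrier G" using x by (simp add: jacobson_radical_def)
      have "\<phi> i (dec x) = 0" if i: "i \<in> {1, 2}" for i
      proof -
        define I where "I = enc ` {s \<in> S. \<phi> i s = 0}"
        have neg: "\<ominus>\<^bsub>G\<^esub> (enc s) = enc (- s)" if "s \<in> S" for s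
        proof -
          have "enc (- s) \<oplus>\<^bsub>G\<^esub> enc s = \<zero>\<^bsub>G\<^esub>" by simp
          then show ?thesis using that Sneg[OF that] RG.minus_equality by auto
        qed
        have rI: "right_ideal G I" unfolding right_ideal_def
          by (intro conjI ballI RG.additive_subgroup_intro)
            (use i in \<open>auto simp: I_def S0 phi_0 Sadd phi_add neg Sneg phi_uminus Smul phi_mul\<close>)
        have "maximal_right_ideal G I" unfolding maximal_right_ideal_def
        proof (intro conjI allI impI rI)
          have "\<phi> i (e i) = 1" using i by (simp add: phi_e)
          then have "enc (e i) \<notin> I" using enc by (auto simp: I_def inj_eq)
          then show "I \<noteq> carrier G" using eS by auto
          fix I' assume I': "right_ideal G I' \<and> I \<subseteq> I' \<and> I' \<noteq> carrier G"
          then interpret A: additive_subgroup I' G by (simp add: right_ideal_def)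
          have ri: "\<And>a b. a \<in> I' \<Longrightarrow> b \<in> carrier G \<Longrightarrow> a \<otimes>\<^bsub>G\<^esub> b \<in> I'" using I' unfolding right_ideal_def by blast
          have sub: "I' \<subseteq> carrier G" using A.a_subset .
          show "I' = I"
          proof (rule ccontr)
            assume "I' \<noteq> I"
            then obtain g where g: "enc g \<in> I'" "enc g \<notin> I" "g \<in> S" using I' sub by auto
            then have gn: "\<phi> i g \<noteq> 0" by (auto simp: I_def)
            have "enc a \<in> I'" if a: "a \<in> S" for a
            proof -
              \<comment> \<open>\<open>g * q\<close> agrees with \<open>a\<close> under
                \<open>\<phi> i\<close>, so the difference lies in \<open>I\<close>.\<close>
              define q where "q = sc (\<phi> i a / \<phi> i g) (e 1 + e 2)"
              have qS: "q \<in> S" using uS Ssc by (simp add: q_def)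
              have "\<phi> i (e 1 + e 2) = 1" using i phi_add[OF i eS eS, of 1 2] by (auto simp: phi_e)
              then have "\<phi> i (g * q) = \<phi> i a" using gn i uS g(3) qS by (simp add: phi_mul) (simp add: q_def phi_sc)
              then have "enc (a - g * q) \<in> I" using i a g(3) qS by (auto simp: I_def Sdiff Smul phi_diff)
              then have m: "enc (a - g * q) \<in> I'" using I' by blast
              have "enc g \<otimes>\<^bsub>G\<^esub> enc q \<in> I'" by (rule ri[OF g(1)]) (simp add: qS)
              from A.a_closed[OF m this] show ?thesis by simp
            qed
            then show False using I' sub by auto
          qed
        qed
        then have "x \<in> I" using x by (simp add: jacobson_radical_def)
        then show ?thesis by (auto simp: I_def)
      qed
      from this[of 1] this[of 2] show "x \<in> {x \<in> carrier G. (\<phi> 1 (dec x), \<phi> 2 (dec x)) = (0, 0)}" using xG by simp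
    qed
    show "(\<phi> 1 (dec \<one>\<^bsub>G\<^esub>), \<phi> 2 (dec \<one>\<^bsub>G\<^esub>)) = (1, 1)"
      using phi_add[of 1, OF _ eS eS, of 1 2] phi_add[of 2, OF _ eS eS, of 1 2]
        phi_e[of 1 1] phi_e[of 1 2] phi_e[of 2 1] phi_e[of 2 2] by simp
  qed (auto simp: phi_add phi_mul smG_def phi_sc)
  moreover have "complete_prim_orth2 G (enc (e 1)) (enc (e 2))" unfolding complete_prim_orth2_def
  proof (intro conjI)
    have "primitive_idem G (enc (e i))" if i: "i \<in> {1, 2}" for i
      unfolding primitive_idem_def
    proof (intro conjI allI impI)
      show "idempotent_el G (enc (e i))" by (simp add: idempotent_el_def eS ee)
      have "e i \<noteq> 0" using phi_e[OF i i] phi_0[OF i] by auto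
      then show "enc (e i) \<noteq> \<zero>\<^bsub>G\<^esub>" using enc by (simp add: inj_eq)
      fix f g assume fg: "idempotent_el G f \<and> idempotent_el G g \<and> f \<otimes>\<^bsub>G\<^esub> g = \<zero>\<^bsub>G\<^esub> \<and> g \<otimes>\<^bsub>G\<^esub> f = \<zero>\<^bsub>G\<^esub>
        \<and> f \<oplus>\<^bsub>G\<^esub> g = enc (e i)"
      then obtain s t where st: "f = enc s" "g = enc t" "s \<in> S" "t \<in> S" by (auto simp: idempotent_el_def)
      have q: "s * s = s" "t * t = t" "s + t = e i" using fg enc by (auto simp: st idempotent_el_def inj_eq)
      have two: "\<phi> k s = 0 \<or> \<phi> k s = 1" "\<phi> k t = 0 \<or> \<phi> k t = 1" "\<phi> k s + \<phi> k t = (if k = i then 1 else 0)"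
        "\<phi> k s * \<phi> k t = 0" if k: "k \<in> {1, 2}" for k
      proof -
        have "\<phi> k s * \<phi> k s = \<phi> k s" "\<phi> k t * \<phi> k t = \<phi> k t" using q k st by (metis phi_mul)+
        then show "\<phi> k s = 0 \<or> \<phi> k s = 1" "\<phi> k t = 0 \<or> \<phi> k t = 1" by auto
        show "\<phi> k s + \<phi> k t = (if k = i then 1 else 0)" using phi_add[OF k st(3,4)] q(3) phi_e[OF k i] by simp
        have "s * t = 0" using fg enc by (auto simp: st inj_eq)
        then show "\<phi> k s * \<phi> k t = 0" using phi_mul[OF k st(3,4)] phi_0[OF k] by simp
      qed
      \<comment> \<open>Under each character the values of \<open>s\<close> and \<open>t\<close>
        have product zero and sum the value of \<open>e i\<close>; so one of the two idempotents has
        only zero values and vanishes by nilpotency.\<close>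
      have "s \<in> J \<or> t \<in> J"
      proof -
        have o: "\<phi> k s = 0 \<and> \<phi> k t = 0" if "k \<in> {1, 2}" "k \<noteq> i" for k
        proof -
          have "\<phi> k s + \<phi> k t = 0" "\<phi> k s * \<phi> k t = 0" using two(3,4)[OF that(1)] that(2) by simp_all
          then show ?thesis by auto
        qed
        have "\<phi> i s = 0 \<or> \<phi> i t = 0" using two(4)[OF i] by simp
        then show ?thesis using o[of 1] o[of 2] i st(3,4) by (auto simp: radl_def)
      qed
      then have "s = 0 \<or> t = 0" using idem_J q by blast
      then show "f = \<zero>\<^bsub>G\<^esub> \<or> g = \<zero>\<^bsub>G\<^esub>" by (auto simp: st)
    qed
    then show "primitive_idem G (enc (e 1))" "primitive_idem G (enc (e 2))" by simp_all
  qed (use orth in simp_all)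
  ultimately show ?thesis using fan by blast
qed

end

section \<open>The gluing theorem\<close>

instantiation prod :: (times, times) times
begin
definition "a * b = (fst a * fst b, snd a * snd b)"
instance ..
end

instance prod :: (ring, ring) ring
  by standard (auto simp: times_prod_def algebra_simps prod_eq_iff)

lemma fst_snd_times [simp]: "fst (a * b) = fst a * fst b" "snd (a * b) = snd a * snd b"
  by (simp_all add: times_prod_def)

definition psc :: "'k::field \<Rightarrow> 'k fsm \<times> 'k fsm \<Rightarrow> 'k fsm \<times> 'k fsm" where
  "psc c g = (fsc c (fst g), fsc c (snd g))"

interpretation ps: vector_space psc
  by unfold_locales (simp_all add: psc_def fs.scale_right_distrib fs.scale_left_distrib prod_eq_iff)

definition ptp :: "'k::field fsm \<times> 'k fsm \<Rightarrow> 'k fsm \<times> 'k fsm" where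
  "ptp g = (tpose (fst g), tpose (snd g))"

lemma tpose_add: "tpose (A + B) = tpose A + tpose (B :: 'k::field fsm)"
  by (rule fsm_eqI) simp

lemma tpose_fsc: "tpose (fsc c A) = fsc c (tpose A)"
  by (rule fsm_eqI) simp

text \<open>Codes a pair of finitely supported matrices as one sequence of scalars, because the
  glued algebra has to live on the type \<open>nat \<Rightarrow> 'k\<close>. The tag
  \<open>t\<close> tells the components apart.\<close>

definition penc :: "'k::field fsm \<times> 'k fsm \<Rightarrow> nat \<Rightarrow> 'k" where
  "penc g n = (let (t, m) = prod_decode n; (i, j) = prod_decode m
     in if t = 0 then ent (fst g) i j else ent (snd g) i j)"

lemma inj_penc: "inj (penc :: 'k::field fsm \<times> 'k fsm \<Rightarrow> nat \<Rightarrow> 'k)"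
proof (rule injI)
  fix g h :: "'k fsm \<times> 'k fsm" assume eq: "penc g = penc h"
  have "penc g (prod_encode (t, prod_encode (i, j))) = penc h (prod_encode (t, prod_encode (i, j)))" for t i j
    using eq by simp
  from this[of 0] this[of 1] show "g = h"
    by (auto simp: penc_def prod_eq_iff intro!: fsm_eqI)
qed

lemma span_pair:
  assumes "A \<in> fs.span U" "B \<in> fs.span U"
  shows "(A, B) \<in> ps.span ((\<lambda>a. (a, 0)) ` U \<union> (\<lambda>a. (0, a)) ` U)"
proof -
  let ?W = "(\<lambda>a. (a, 0)) ` U \<union> (\<lambda>a. (0, a)) ` U"
  have 1: "(A, 0) \<in> ps.span ?W" using assms(1)
  proof (induction rule: fs.span_induct_alt)
    case base show ?case using ps.span_zero by (simp add: zero_prod_def)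
  next
    case (step c x y)
    have "(x, 0) \<in> ?W" using step by blast
    then have "psc c (x, 0) + (y, 0) \<in> ps.span ?W"
      using step by (intro ps.span_add[OF ps.span_scale[OF ps.span_base]])
    moreover have "psc c (x, 0) + (y, 0) = (fsc c x + y, 0)" by (simp add: psc_def)
    ultimately show ?case by (simp only:)
  qed
  have 2: "(0, B) \<in> ps.span ?W" using assms(2)
  proof (induction rule: fs.span_induct_alt)
    case base show ?case using ps.span_zero by (simp add: zero_prod_def)
  next
    case (step c x y)
    have "(0, x) \<in> ?W" using step by blast
    then have "psc c (0, x) + (0, y) \<in> ps.span ?W"
      using step by (intro ps.span_add[OF ps.span_scale[OF ps.span_base]])
    moreover have "psc c (0, x) + (0, y) = (0, fsc c x + y)" by (simp add: psc_def)
    ultimately show ?case by (simp only:)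
  qed
  from ps.span_add[OF 1 2] show ?thesis by simp
qed

lemma cones2_Un: "cones2 (K \<union> K') = cones2 K \<union> cones2 K'"
  by (auto simp: cones2_def)

lemma dlt_sigma: "dlt ` gcone {(1, -1), (1, 0)} = gcone {(0, -1), (1, -1)}"
  unfolding gcone_dlt[symmetric] by (simp add: dlt_def insert_commute)

theorem theorem6p3:
  fixes L :: "'a ring" and smL :: "'k::field \<Rightarrow> 'a \<Rightarrow> 'a" and e1 e2 :: 'a
    and L' :: "'b ring" and smL' :: "'k \<Rightarrow> 'b \<Rightarrow> 'b" and e1' e2' :: 'b
  assumes "is_fd_kalg L smL" and "elementary_rank2 L smL" and "complete_prim_orth2 L e1 e2"
    and "\<forall>x\<in>carrier L. e2 \<otimes>\<^bsub>L\<^esub> x \<otimes>\<^bsub>L\<^esub> e1 = \<zero>\<^bsub>L\<^esub>"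
    and "is_fd_kalg L' smL'" and "elementary_rank2 L' smL'" and "complete_prim_orth2 L' e1' e2'"
    and "\<forall>x\<in>carrier L'. e2' \<otimes>\<^bsub>L'\<^esub> x \<otimes>\<^bsub>L'\<^esub> e1' = \<zero>\<^bsub>L'\<^esub>"
    and "gcone {(0, -1), (1, -1)} \<in> gfan L e1 e2"
    and "gcone {(1, -1), (1, 0)} \<in> gfan L' e1' e2'"
  shows "\<exists>(G :: (nat \<Rightarrow> 'k) ring) (smG :: 'k \<Rightarrow> (nat \<Rightarrow> 'k) \<Rightarrow> (nat \<Rightarrow> 'k)) g1 g2.
           is_fd_kalg G smG \<and> elementary_rank2 G smG \<and> complete_prim_orth2 G g1 g2 \<and>
           cones2 (gfan G g1 g2) =
             (cones2 (gfan L e1 e2) - {gcone {(0, -1), (1, -1)}}) \<union>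
             (cones2 (gfan L' e1' e2') - {gcone {(1, -1), (1, 0)}})"
proof -
  obtain S e \<phi> n where L0: "tri2 S e (fsc :: 'k \<Rightarrow> _) \<phi>" "gfan L e1 e2 = fan S e" "\<forall>i. i \<noteq> 1 \<longrightarrow> e i = e 2"
    "\<forall>s\<in>S. \<forall>i j. n \<le> i \<or> n \<le> j \<longrightarrow> ent s i j = 0"
    using matrix_model[OF assms(1-4)] by (elim exE conjE)
  obtain S' e' \<phi>' n' where M0: "tri2 S' e' (fsc :: 'k \<Rightarrow> _) \<phi>'" "gfan L' e1' e2' = fan S' e'" "\<forall>i. i \<noteq> 1 \<longrightarrow> e' i = e' 2"
    "\<forall>s\<in>S'. \<forall>i j. n' \<le> i \<or> n' \<le> j \<longrightarrow> ent s i j = 0"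
    using matrix_model[OF assms(5-8)] by (elim exE conjE)
  let ?\<sigma> = "gcone {(0, -1), (1, -1)} :: (real \<times> real) set"
  let ?\<sigma>' = "gcone {(1, -1), (1, 0)} :: (real \<times> real) set"
  interpret LT: tri2 S e fsc \<phi> by (rule L0(1))
  obtain x where x0: "x \<in> LT.X" "x \<noteq> 0" "\<forall>s\<in>LT.X. \<exists>b\<in>LT.B. s = x * b"
    using LT.sigma_generator[OF assms(9)[unfolded L0(2)]] by (elim bexE conjE)
  note x = x0(1,2) x0(3)[rule_format]
  obtain \<psi> where "tri_alg S e fsc \<phi> x \<psi>" using LT.tri_alg_of_generator[OF x] by blast
  then interpret L: tri_gen S e fsc \<phi> x \<psi>
    by (intro tri_gen.intro tri_gen_axioms.intro x(3))
  interpret MT: tri2 S' e' fsc \<phi>' by (rule M0(1))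
  \<comment> \<open>The second algebra is replaced by its opposite, where \<open>?\<sigma>'\<close>
    becomes \<open>?\<sigma>\<close> and the construction of a generator and of its residue map
    applies again.\<close>
  interpret D: dual_tri2 S' e' fsc \<phi>' tpose
    by unfold_locales (rule tpose_add tpose_times tpose_tpose tpose_fsc M0(3)[rule_format] | assumption)+
  interpret MD: tri2 D.Sd D.ed fsc D.\<phi>d by (rule D.dual_tri2)
  have "?\<sigma> \<in> fan D.Sd D.ed" unfolding D.fan_dual dlt_sigma[symmetric] using assms(10) unfolding M0(2) by blast
  from MD.sigma_generator[OF this]
  obtain xM where xM0: "xM \<in> MD.X" "xM \<noteq> 0" "\<forall>s\<in>MD.X. \<exists>b\<in>MD.B. s = xM * b"
    by (elim bexE conjE)
  note xM = xM0(1,2) xM0(3)[rule_format]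
  obtain \<psi>M where "tri_alg D.Sd D.ed fsc D.\<phi>d xM \<psi>M" using MD.tri_alg_of_generator[OF xM] by blast
  then interpret M: tri_gen D.Sd D.ed fsc D.\<phi>d xM \<psi>M
    by (intro tri_gen.intro tri_gen_axioms.intro xM(3))
  have convM: "i \<noteq> 1 \<Longrightarrow> D.ed i = D.ed 2" for i
    using dual.conv[OF D.dual_dual(1)] .
  \<comment> \<open>Dualising back returns the second algebra itself, now with a residue map and an
    element that generates from the left.\<close>
  interpret DM: dual_tri D.Sd D.ed fsc D.\<phi>d xM \<psi>M tpose
    by unfold_locales (rule tpose_add tpose_times tpose_tpose tpose_fsc convM | assumption)+
  interpret DL: dual_tri S e fsc \<phi> x \<psi> tpose
    by unfold_locales (rule tpose_add tpose_times tpose_tpose tpose_fsc L0(3)[rule_format] | assumption)+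
  interpret DLt: tri_alg DL.Sd DL.ed fsc DL.\<phi>d DL.xd DL.\<psi>d by (rule DL.dual_tri_alg)
  interpret DMt: tri_alg DM.Sd DM.ed fsc DM.\<phi>d DM.xd DM.\<psi>d by (rule DM.dual_tri_alg)
  have convDM: "i \<noteq> 1 \<Longrightarrow> DM.ed i = DM.ed 2" for i using dual.conv[OF DM.dual_dual(1)] .
  have convDL: "i \<noteq> 1 \<Longrightarrow> DL.ed i = DL.ed 2" for i using dual.conv[OF DL.dual_dual(1)] .
  define SG where "SG = {g. fst g \<in> S \<and> snd g \<in> DM.Sd \<and> \<phi> 1 (fst g) = DM.\<phi>d 1 (snd g) \<and> \<phi> 2 (fst g) = DM.\<phi>d 2 (snd g)
     \<and> \<psi> (fst g) = DM.\<psi>d (snd g)}"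
  define eG where "eG i = (e i, DM.ed i)" for i
  interpret P1: fprod S e fsc \<phi> x \<psi> DM.Sd DM.ed fsc DM.\<phi>d DM.xd DM.\<psi>d psc SG eG fst snd Pair
    by unfold_locales (rule L0(3)[rule_format] convDM, assumption | simp add: psc_def eG_def SG_def prod_eq_iff)+
  define \<phi>G where "\<phi>G i g = \<phi> i (fst g)" for i and g :: "'k fsm \<times> 'k fsm"
  define \<psi>G where "\<psi>G g = \<psi> (fst g)" for g :: "'k fsm \<times> 'k fsm"
  have GT: "tri_alg SG eG psc \<phi>G (x, DM.xd) \<psi>G"
    using P1.fibre_tri_alg unfolding \<phi>G_def[abs_def] \<psi>G_def[abs_def] .
  have convG: "i \<noteq> 1 \<Longrightarrow> eG i = eG 2" for i
    unfolding eG_def prod.inject using L0(3)[rule_format, of i] convDM[of i] by blast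
  interpret G: tri_alg SG eG psc \<phi>G "(x, DM.xd)" \<psi>G by (rule GT)
  interpret F1: fib SG eG psc \<phi>G "(x, DM.xd)" \<psi>G S e fsc \<phi> x \<psi> fst P1.sec
  proof (rule P1.fibre_fib[OF GT])
    \<comment> \<open>Transposition turns the right generator \<open>xM\<close> of the opposite
      algebra into a left generator.\<close>
    fix t assume t: "t \<in> DM.Sd" "DM.ed 1 * t = t" "t * DM.ed 2 = t"
    have "tpose (DM.ed 1 * t) = tpose t" "tpose (t * DM.ed 2) = tpose t" using t by simp_all
    then have "tpose t \<in> MD.X" using t(1) by (simp add: MD.X_def DM.Sd_iff tpose_times DM.ed_def)
    then obtain b where b: "b \<in> MD.B" "tpose t = xM * b" using xM(3) by blast
    have "t = tpose b * DM.xd" using arg_cong[OF b(2), of tpose] by (simp add: tpose_times DM.xd_def)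
    moreover have "tpose b \<in> DM.Sd" "DM.ed 1 * tpose b = tpose b" "tpose b * DM.ed 1 = tpose b"
      using b(1) by (simp_all add: MD.B_def DM.th_S DM.ed_def tpose_times[symmetric])
    ultimately show "\<exists>a\<in>DM.Sd. DM.ed 1 * a = a \<and> a * DM.ed 1 = a \<and> t = a * DM.xd" by blast
  qed (simp_all add: \<phi>G_def \<psi>G_def)
  interpret DG: dual_tri SG eG psc \<phi>G "(x, DM.xd)" \<psi>G ptp
    by unfold_locales (rule convG, assumption | simp add: ptp_def psc_def prod_eq_iff tpose_add tpose_times tpose_fsc)+
  have Dst: "tpose t \<in> DM.Sd \<longleftrightarrow> t \<in> D.Sd" for t using DM.th_S .
  have DLst: "t \<in> DL.Sd \<longleftrightarrow> tpose t \<in> S" for t using DL.Sd_iff .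
  \<comment> \<open>The opposite of the glued algebra is the fibre product of the opposite algebras,
    read with its factors in the other order.\<close>
  have SGd: "DG.Sd = {g. snd g \<in> D.Sd \<and> fst g \<in> DL.Sd \<and> D.\<phi>d 1 (snd g) = DL.\<phi>d 1 (fst g)
     \<and> D.\<phi>d 2 (snd g) = DL.\<phi>d 2 (fst g) \<and> \<psi>M (snd g) = DL.\<psi>d (fst g)}"
  proof (rule Set.set_eqI)
    fix g
    have "g \<in> DG.Sd \<longleftrightarrow> ptp g \<in> SG" by (rule DG.Sd_iff)
    also have "\<dots> \<longleftrightarrow> snd g \<in> D.Sd \<and> fst g \<in> DL.Sd \<and> D.\<phi>d 1 (snd g) = DL.\<phi>d 1 (fst g)
     \<and> D.\<phi>d 2 (snd g) = DL.\<phi>d 2 (fst g) \<and> \<psi>M (snd g) = DL.\<psi>d (fst g)"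
      by (auto simp: SG_def ptp_def Dst DLst DM.\<phi>d_def DL.\<phi>d_def DM.\<psi>d_def DL.\<psi>d_def)
    finally show "g \<in> DG.Sd \<longleftrightarrow> g \<in> {g. snd g \<in> D.Sd \<and> fst g \<in> DL.Sd \<and> D.\<phi>d 1 (snd g) = DL.\<phi>d 1 (fst g)
     \<and> D.\<phi>d 2 (snd g) = DL.\<phi>d 2 (fst g) \<and> \<psi>M (snd g) = DL.\<psi>d (fst g)}" by simp
  qed
  have eGd: "snd (DG.ed i) = D.ed i" "fst (DG.ed i) = DL.ed i" for i
  proof -
    show "fst (DG.ed i) = DL.ed i" by (simp add: DG.ed_def ptp_def eG_def DL.ed_def)
    have "D.ed (sw (sw i)) = D.ed i" using convM[of i] by (cases "i = 1") (simp_all add: sw_def)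
    then show "snd (DG.ed i) = D.ed i" by (simp add: DG.ed_def ptp_def eG_def DM.ed_def)
  qed
  interpret P2: fprod D.Sd D.ed fsc D.\<phi>d xM \<psi>M DL.Sd DL.ed fsc DL.\<phi>d DL.xd DL.\<psi>d psc DG.Sd DG.ed snd fst "\<lambda>u v. (v, u)"
    by unfold_locales (rule convM convDL, assumption | simp add: psc_def prod_eq_iff SGd eGd)+
  interpret F2: fib DG.Sd DG.ed psc DG.\<phi>d DG.xd DG.\<psi>d D.Sd D.ed fsc D.\<phi>d xM \<psi>M snd P2.sec
  proof (rule P2.fibre_fib[OF DG.dual_tri_alg])
    fix t assume t: "t \<in> DL.Sd" "DL.ed 1 * t = t" "t * DL.ed 2 = t"
    have "tpose (DL.ed 1 * t) = tpose t" "tpose (t * DL.ed 2) = tpose t" using t by simp_all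
    then have "tpose t \<in> LT.X" using t(1) by (simp add: LT.X_def DLst tpose_times DL.ed_def)
    then obtain b where b: "b \<in> LT.B" "tpose t = x * b" using x(3) by blast
    have "t = tpose b * DL.xd" using arg_cong[OF b(2), of tpose] by (simp add: tpose_times DL.xd_def)
    moreover have "tpose b \<in> DL.Sd" "DL.ed 1 * tpose b = tpose b" "tpose b * DL.ed 1 = tpose b"
      using b(1) by (simp_all add: LT.B_def DL.th_S DL.ed_def tpose_times[symmetric])
    ultimately show "\<exists>a\<in>DL.Sd. DL.ed 1 * a = a \<and> a * DL.ed 1 = a \<and> t = a * DL.xd" by blast
  next
    fix i :: nat and g assume i: "i \<in> {1, 2}" and g: "g \<in> DG.Sd"
    have "DG.\<phi>d i g = DL.\<phi>d i (fst g)" by (simp add: DG.\<phi>d_def \<phi>G_def ptp_def DL.\<phi>d_def)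
    also have "\<dots> = D.\<phi>d i (snd g)" using i g by (auto simp: SGd)
    finally show "DG.\<phi>d i g = D.\<phi>d i (snd g)" .
  next
    fix g assume g: "g \<in> DG.Sd"
    have "DG.\<psi>d g = DL.\<psi>d (fst g)" by (simp add: DG.\<psi>d_def \<psi>G_def ptp_def DL.\<psi>d_def)
    also have "\<dots> = \<psi>M (snd g)" using g by (simp add: SGd)
    finally show "DG.\<psi>d g = \<psi>M (snd g)" .
  next
    show "snd DG.xd = xM" "fst DG.xd = DL.xd"
      unfolding DG.xd_def by (simp_all add: ptp_def DM.xd_def DL.xd_def)
  qed
  have left: "cones2 G.LC = cones2 (fan S e) - {?\<sigma>}" unfolding F1.LC_eq by (rule L.cones2_LC)
  \<comment> \<open>The right cones of the glued algebra are dual to the left cones of its opposite,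
    which are those of the opposite of the second algebra.\<close>
  have "cones2 G.RC = (`) dlt ` (cones2 (fan D.Sd D.ed) - {?\<sigma>})"
    unfolding DG.RC_dual F2.LC_eq cones2_dlt by (simp only: M.cones2_LC)
  also have "cones2 (fan D.Sd D.ed) = (`) dlt ` cones2 (fan S' e')" unfolding D.fan_dual by (rule cones2_dlt)
  also have "(`) dlt ` ((`) dlt ` cones2 (fan S' e') - {?\<sigma>}) = cones2 (fan S' e') - {?\<sigma>'}"
  proof -
    have inv: "dlt ` dlt ` C = C" for C by (simp add: image_image)
    have injd: "inj ((`) dlt)" by (metis inv injI)
    have "(`) dlt ` ((`) dlt ` cones2 (fan S' e') - {?\<sigma>}) = (`) dlt ` ((`) dlt ` (cones2 (fan S' e') - {?\<sigma>'}))"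
      unfolding image_set_diff[OF injd] by (simp add: dlt_sigma)
    also have "\<dots> = cones2 (fan S' e') - {?\<sigma>'}" by (simp add: image_image inv)
    finally show ?thesis .
  qed
  finally have right: "cones2 G.RC = cones2 (fan S' e') - {?\<sigma>'}" .
  have total: "cones2 (fan SG eG) = (cones2 (fan S e) - {?\<sigma>}) \<union> (cones2 (fan S' e') - {?\<sigma>'})"
    unfolding G.fan_LC_RC cones2_Un left right ..
  \<comment> \<open>All matrices that occur have size at most \<open>N\<close>, so the pairs lie in
    a finite-dimensional space.\<close>
  define N where "N = max n n'"
  define U where "U = (\<lambda>(i, j). single i j (1 :: 'k)) ` ({..<N} \<times> {..<N})"
  have "SG \<subseteq> ps.span ((\<lambda>a. (a, 0)) ` U \<union> (\<lambda>a. (0, a)) ` U)"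
  proof
    fix g assume g: "g \<in> SG"
    have "fst g \<in> fs.span U" unfolding U_def
      by (rule span_units) (use g L0(4) in \<open>auto simp: SG_def N_def\<close>)
    moreover have "DM.Sd = S'" using D.dual_dual(2) by (simp add: DM.Sd_def D.Sd_def image_image)
    then have "snd g \<in> fs.span U" unfolding U_def
      by (intro span_units) (use g M0(4) in \<open>auto simp: SG_def N_def\<close>)
    ultimately show "g \<in> ps.span ((\<lambda>a. (a, 0)) ` U \<union> (\<lambda>a. (0, a)) ` U)"
      using span_pair[of "fst g" U "snd g"] by simp
  qed
  moreover have "finite ((\<lambda>a. (a, 0)) ` U \<union> (\<lambda>a. (0 :: 'k fsm, a)) ` U)" by (simp add: U_def)
  ultimately obtain G :: "(nat \<Rightarrow> 'k) ring" and smG :: "'k \<Rightarrow> (nat \<Rightarrow> 'k) \<Rightarrow> (nat \<Rightarrow> 'k)" and g1 g2 where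
    "is_fd_kalg G smG" "elementary_rank2 G smG" "complete_prim_orth2 G g1 g2" "gfan G g1 g2 = fan SG eG"
    using G.carrier_model[OF inj_penc _ _ convG] by (metis (no_types, lifting))
  then show ?thesis using total unfolding L0(2) M0(2) by metis
qed

end
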